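(* Let $n\geq 2$ be an integer and let $\mathbb S^n\subset\mathbb R^{n+1}$ be the unit sphere. There is a compact set $Z\subset\mathbb R^{n+1}$ such that $\pi_k^{\mathrm{Lip}}(Z)=0$ for all $k\geq 0$, and the Lipschitz mappings $\mathrm{Lip}(\mathbb S^n,Z)$ are not dense in $W^{1,n}(\mathbb S^n,Z)$.
   Context: For a pointed metric space $(Z,z_0)$, the Lipschitz homotopy group $\pi_k^{\mathrm{Lip}}(Z,z_0)$ is defined exactly as the classical homotopy group (homotopy classes of maps $(Q^k,\partial Q^k)\to(Z,z_0)$, $Q^k=[0,1]^k$), except that both maps and homotopies are required to be Lipschitz (with no control on the Lipschitz constant of the homotopy). $\pi_0^{\mathrm{Lip}}(Z)$ is the set of Lipschitz-path-connected components (components in which any two points can be joined by a rectifiable curve), and $\pi_0^{\mathrm{Lip}}(Z)=0$ means $Z$ is rectifiably connected; $\pi_k^{\mathrm{Lip}}(Z)=0$ for $k\ge1$ means this holds for every base point. For compact $Z\subset\mathbb R^{n+1}$, $W^{1,n}(\mathbb S^n,Z)=\{u\in W^{1,n}(\mathbb S^n,\mathbb R^{n+1}): u(x)\in Z\text{ a.e.}\}$ with the metric of the $W^{1,n}(\mathbb S^n,\mathbb R^{n+1})$ norm. *)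

theory Defs
  imports "HOL-Analysis.Analysis"
begin

definition cube :: "nat \<Rightarrow> (nat \<Rightarrow> real) set" where
  "cube k = {x. (\<forall>i<k. 0 \<le> x i \<and> x i \<le> 1) \<and> (\<forall>i\<ge>k. x i = 0)}"

definition cube_boundary :: "nat \<Rightarrow> (nat \<Rightarrow> real) set" where
  "cube_boundary k = {x \<in> cube k. \<exists>i<k. x i = 0 \<or> x i = 1}"

definition cdist :: "nat \<Rightarrow> (nat \<Rightarrow> real) \<Rightarrow> (nat \<Rightarrow> real) \<Rightarrow> real" where
  "cdist k x y = sqrt (\<Sum>i<k. (x i - y i)\<^sup>2)"

definition cube_lipschitz :: "nat \<Rightarrow> (nat \<Rightarrow> real) set \<Rightarrow> ((nat \<Rightarrow> real) \<Rightarrow> 'a::metric_space) \<Rightarrow> bool" where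
  "cube_lipschitz k S f \<longleftrightarrow> (\<exists>L. \<forall>x\<in>S. \<forall>y\<in>S. dist (f x) (f y) \<le> L * cdist k x y)"

definition lip_pi0_trivial :: "'a::metric_space set \<Rightarrow> bool" where
  "lip_pi0_trivial Z \<longleftrightarrow> Z \<noteq> {} \<and>
     (\<forall>x\<in>Z. \<forall>y\<in>Z. \<exists>\<gamma>::real \<Rightarrow> 'a. (\<exists>L. L-lipschitz_on {0..1} \<gamma>) \<and>
        \<gamma> ` {0..1} \<subseteq> Z \<and> \<gamma> 0 = x \<and> \<gamma> 1 = y)"

text \<open>pi_k^Lip(Z,z0) = 0 for k >= 1 and every base point z0: every Lipschitz map
  (Q^k, boundary) -> (Z, z0) is Lipschitz homotopic rel boundary to the constant map.
  The homotopy is a map on Q^(k+1), the last coordinate (index k) being time.\<close>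
definition lip_pik_trivial :: "nat \<Rightarrow> 'a::metric_space set \<Rightarrow> bool" where
  "lip_pik_trivial k Z \<longleftrightarrow>
     (\<forall>z0\<in>Z. \<forall>f. cube_lipschitz k (cube k) f \<and> f ` cube k \<subseteq> Z \<and>
        (\<forall>x\<in>cube_boundary k. f x = z0) \<longrightarrow>
        (\<exists>H. cube_lipschitz (Suc k) (cube (Suc k)) H \<and> H ` cube (Suc k) \<subseteq> Z \<and>
           (\<forall>x\<in>cube k. H x = f x) \<and>
           (\<forall>x\<in>cube k. H (x(k := 1)) = z0) \<and>
           (\<forall>x\<in>cube_boundary k. \<forall>t\<in>{0..1}. H (x(k := t)) = z0)))"

definition partial :: "'a::euclidean_space \<Rightarrow> ('a \<Rightarrow> real) \<Rightarrow> 'a \<Rightarrow> real" where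
  "partial b f x = frechet_derivative f (at x) b"

fun iter_partial :: "'a::euclidean_space list \<Rightarrow> ('a \<Rightarrow> real) \<Rightarrow> 'a \<Rightarrow> real" where
  "iter_partial [] f = f"
| "iter_partial (b # bs) f = partial b (iter_partial bs f)"

definition smooth_fun :: "('a::euclidean_space \<Rightarrow> real) \<Rightarrow> bool" where
  "smooth_fun f \<longleftrightarrow> (\<forall>bs. \<forall>x. iter_partial bs f differentiable (at x))"

definition test_function :: "'a::euclidean_space set \<Rightarrow> ('a \<Rightarrow> real) \<Rightarrow> bool" where
  "test_function \<Omega> \<phi> \<longleftrightarrow> smooth_fun \<phi> \<and>
     (\<exists>K. compact K \<and> K \<subseteq> \<Omega> \<and> (\<forall>x. x \<notin> K \<longrightarrow> \<phi> x = 0))"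

definition Lp_on :: "real \<Rightarrow> 'a::euclidean_space set \<Rightarrow> ('a \<Rightarrow> 'b::euclidean_space) \<Rightarrow> bool" where
  "Lp_on p \<Omega> U \<longleftrightarrow> U \<in> borel_measurable (lebesgue_on \<Omega>) \<and>
     integrable (lebesgue_on \<Omega>) (\<lambda>x. norm (U x) powr p)"

definition weak_partial :: "'a::euclidean_space set \<Rightarrow> ('a \<Rightarrow> 'b::euclidean_space) \<Rightarrow> 'a \<Rightarrow> ('a \<Rightarrow> 'b) \<Rightarrow> bool" where
  "weak_partial \<Omega> U b g \<longleftrightarrow> (\<forall>\<phi>. test_function \<Omega> \<phi> \<longrightarrow>
     integral\<^sup>L (lebesgue_on \<Omega>) (\<lambda>x. partial b \<phi> x *\<^sub>R U x) =
     - integral\<^sup>L (lebesgue_on \<Omega>) (\<lambda>x. \<phi> x *\<^sub>R g x))"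

definition weak_gradient :: "real \<Rightarrow> 'a::euclidean_space set \<Rightarrow> ('a \<Rightarrow> 'b::euclidean_space) \<Rightarrow> ('a \<Rightarrow> 'a \<Rightarrow> 'b) \<Rightarrow> bool" where
  "weak_gradient p \<Omega> U G \<longleftrightarrow> (\<forall>b\<in>Basis. Lp_on p \<Omega> (G b) \<and> weak_partial \<Omega> U b (G b))"

definition sobolev :: "real \<Rightarrow> 'a::euclidean_space set \<Rightarrow> ('a \<Rightarrow> 'b::euclidean_space) \<Rightarrow> bool" where
  "sobolev p \<Omega> U \<longleftrightarrow> Lp_on p \<Omega> U \<and> (\<exists>G. weak_gradient p \<Omega> U G)"

definition sobolev_norm :: "real \<Rightarrow> 'a::euclidean_space set \<Rightarrow> ('a \<Rightarrow> 'b::euclidean_space) \<Rightarrow> real" where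
  "sobolev_norm p \<Omega> U = (let G = (SOME G. weak_gradient p \<Omega> U G) in
     (integral\<^sup>L (lebesgue_on \<Omega>) (\<lambda>x. norm (U x) powr p) +
      integral\<^sup>L (lebesgue_on \<Omega>) (\<lambda>x. (\<Sum>b\<in>Basis. (norm (G b x))\<^sup>2) powr (p / 2))) powr (1 / p))"

definition annulus :: "'a::euclidean_space set" where
  "annulus = {x. 1 < norm x \<and> norm x < 2}"

definition radial_ext :: "('a::euclidean_space \<Rightarrow> 'b) \<Rightarrow> 'a \<Rightarrow> 'b" where
  "radial_ext u x = u (x /\<^sub>R norm x)"

text \<open>u : S^n -> R^{n+1} (only its values on sphere 0 1 matter) lies in W^{1,p}(S^n, R^{n+1})\<close>
definition sphere_sobolev :: "real \<Rightarrow> ('a::euclidean_space \<Rightarrow> 'a) \<Rightarrow> bool" where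
  "sphere_sobolev p u \<longleftrightarrow> sobolev p annulus (radial_ext u)"

text \<open>W^{1,p}(S^n, Z): additionally u(x) in Z for a.e. x in S^n\<close>
definition sphere_sobolev_into :: "real \<Rightarrow> 'a::euclidean_space set \<Rightarrow> ('a \<Rightarrow> 'a) \<Rightarrow> bool" where
  "sphere_sobolev_into p Z u \<longleftrightarrow> sphere_sobolev p u \<and>
     (AE x in lebesgue_on annulus. radial_ext u x \<in> Z)"

definition sphere_sobolev_dist :: "real \<Rightarrow> ('a::euclidean_space \<Rightarrow> 'a) \<Rightarrow> ('a \<Rightarrow> 'a) \<Rightarrow> real" where
  "sphere_sobolev_dist p u v = sobolev_norm p annulus (\<lambda>x. radial_ext u x - radial_ext v x)"

end

theory Submission
  imports Defs
begin

text \<open>Let the unit sphere have poles \<open>\<plusminus>e\<close> and put \<open>u(x) = x + (sin (ln (1 - ln (1 - h))))\<^sup>2 e\<close> for heights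
  \<open>h = x \<bullet> e \<ge> 0\<close>, and \<open>u(x) = x\<close> for \<open>h \<le> 0\<close>. Because the phase is a double logarithm of the distance to the
  north pole, \<open>u\<close> lies in \<open>W\<^sup>1\<^sup>,\<^sup>n\<close>, but it oscillates infinitely often there. Let \<open>Z\<close> be the image of \<open>u\<close> together with
  the segment from \<open>-e\<close> to \<open>2e\<close>: a sphere with the local structure of the topologist's sine curve at the north pole.

  A Lipschitz map from a cube or a sphere to \<open>Z\<close> cannot follow infinitely many oscillations, so its
  image avoids a neighbourhood of the end of the oscillating sheet. What is left of \<open>Z\<close> is bilipschitz to a disc with
  a segment attached to its centre, a Lipschitz retract of a convex set. Hence all
  Lipschitz homotopy groups of \<open>Z\<close> vanish.

  For the same reason a Lipschitz map \<open>v\<close> from the sphere to \<open>Z\<close> has degree zero over the southern cap. Here the degree is the integral of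
  \<open>\<eta>(v)\<close> times the Jacobian determinant of the horizontal part of \<open>v\<close> and of the radial direction, where \<open>\<eta>\<close> is a bump near
  \<open>-e\<close>; it vanishes since the determinant is a null Lagrangian. For \<open>u\<close> itself, the identity
  near \<open>-e\<close>, the integral is not zero. Since the horizontal part of \<open>u\<close> is Lipschitz, this
  integral is continuous at \<open>u\<close> with respect to the \<open>W\<^sup>1\<^sup>,\<^sup>n\<close> distance, so \<open>u\<close> is not a limit of such \<open>v\<close>.\<close>

section \<open>Directional derivatives of Lipschitz functions\<close>

text \<open>The phase must be unbounded and yet have its gradient in L^n. Near the pole
  \<open>1 - h\<close> is of order r^2, where r is the distance to the pole, so a single logarithm
  has a gradient of order 1/r and just fails; the iterated one has gradient of order 1/(r |ln r|),
  whose n-th power is integrable in n dimensions because n > 1. Only the vertical component of u is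
  singular. This shapes the degree: only horizontal components are differentiated, and the vertical
  one enters through the weight \<eta> alone. Since the Sobolev norm is taken of the radial
  extension to an annulus, the n-form on the sphere becomes a determinant of size n + 1 whose extra
  row is the radial direction. The weighted determinant must remain a Jacobian for the null
  Lagrangian argument. So the horizontal factors of \<eta> are derivatives of functions of one
  coordinate each, and its vertical factor is arranged to be 1 wherever it could matter. The
  competitors v are merely Lipschitz. Hence the degree rests on Rademacher's theorem and on the
  change of variables for Lipschitz perturbations of the identity.\<close>

lemma right_increasing_imp_le:
  fixes G :: "real \<Rightarrow> real"
  assumes cont: "continuous_on {a..b} G" and "a \<le> b"
    and inc: "\<And>t \<delta>. a \<le> t \<Longrightarrow> t < b \<Longrightarrow> \<delta> > 0 \<Longrightarrow> \<exists>h. 0 < h \<and> h < \<delta> \<and> G t \<le> G (t + h)"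
  shows "G a \<le> G b"
proof -
  define T where "T = {a..b} \<inter> {t. G a \<le> G t}"
  have clT: "closed T"
    unfolding T_def using continuous_on_closed_Collect_le[OF continuous_on_const cont closed_atLeastAtMost]
    by (simp add: Int_def)
  have aT: "a \<in> T" using \<open>a \<le> b\<close> by (simp add: T_def)
  have bdd: "bdd_above T" by (rule bdd_aboveI[of _ b]) (auto simp: T_def)
  have sT: "Sup T \<in> T" using closed_contains_Sup[OF _ bdd clT] aT by blast
  show ?thesis
  proof (cases "Sup T = b")
    case True
    with sT show ?thesis by (simp add: T_def)
  next
    case False
    then have "Sup T < b" "a \<le> Sup T" using sT by (auto simp: T_def)
    then obtain h where h: "0 < h" "h < b - Sup T" "G (Sup T) \<le> G (Sup T + h)"
      using inc[of "Sup T" "b - Sup T"] by auto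
    then have "Sup T + h \<in> T" using sT by (auto simp: T_def)
    then have "Sup T + h \<le> Sup T" using bdd by (rule cSup_upper)
    with h show ?thesis by simp
  qed
qed

text \<open>A point of \<open>K\<close> admits arbitrarily short steps of slope at most
  \<open>p\<close>; near a point off the closed set \<open>K\<close> the measure of \<open>K\<close>
  does not grow and the slope is at most \<open>L\<close>. So
  \<open>L * t - (L - p) * m t - f t\<close> does not fall along suitable small steps, and the
  continuity argument above applies.\<close>

lemma lipschitz_increment_bound:
  fixes f :: "real \<Rightarrow> real"
  assumes lip: "L-lipschitz_on UNIV f" and K: "compact K" and pL: "p \<le> L"
    and slope: "\<And>t \<delta>. t \<in> K \<Longrightarrow> \<delta> > 0 \<Longrightarrow> \<exists>h. 0 < h \<and> h < \<delta> \<and> f (t + h) - f t \<le> p * h"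
    and ab: "a \<le> b"
  shows "f b - f a \<le> L * (b - a) - (L - p) * measure lborel (K \<inter> {a..b})"
proof -
  define m where "m t = measure lborel (K \<inter> {a..t})" for t
  have Kb: "closed K" "K \<in> sets borel" using K by (auto simp: compact_imp_closed borel_compact)
  have fin: "emeasure lborel (K \<inter> {x..y}) \<noteq> \<infinity>" for x y
    using emeasure_mono[of "K \<inter> {x..y}" "{x..y}" lborel] Kb
    by (auto simp: top_unique emeasure_lborel_Icc_eq split: if_splits)
  have m_add: "m (t + h) \<le> m t + measure lborel (K \<inter> {t..t+h})" if "a \<le> t" "0 \<le> h" for t h
  proof -
    have "K \<inter> {a..t+h} = (K \<inter> {a..t}) \<union> (K \<inter> {t..t+h})" using that by auto
    then have "m (t+h) = measure lborel ((K \<inter> {a..t}) \<union> (K \<inter> {t..t+h}))"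
      by (simp only: m_def)
    also have "\<dots> \<le> measure lborel (K \<inter> {a..t}) + measure lborel (K \<inter> {t..t+h})"
      using Kb by (intro measure_Un_le) auto
    finally show ?thesis by (simp add: m_def)
  qed
  have m_mono: "m t \<le> m s" if "t \<le> s" for t s
    unfolding m_def using Kb that fin by (intro measure_mono_fmeasurable) (auto simp: fmeasurable_def less_top)
  have small: "measure lborel (K \<inter> {t..t+h}) \<le> h" if "0 \<le> h" for t h
  proof -
    have "measure lborel (K \<inter> {t..t+h}) \<le> measure lborel {t..t+h}"
      using Kb by (intro measure_mono_fmeasurable) (auto simp: fmeasurable_def emeasure_lborel_Icc_eq)
    then show ?thesis using that by simp
  qed
  have m_lip: "\<bar>m t - m s\<bar> \<le> \<bar>t - s\<bar>" if "a \<le> t" "a \<le> s" for t s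
    using that m_add[of t "s - t"] m_add[of s "t - s"] small[of "s-t" t] small[of "t-s" s]
      m_mono[of t s] m_mono[of s t] by (cases "t \<le> s") auto
  have m_cont: "continuous_on {a..b} m"
    unfolding continuous_on_iff dist_real_def using m_lip by (metis atLeastAtMost_iff le_less_trans)
  define G where "G t = L * t - (L - p) * m t - f t" for t
  have f_cont: "continuous_on {a..b} f" using lipschitz_on_continuous_on[OF lip] continuous_on_subset by blast
  have fL: "f (t + h) - f t \<le> L * h" if "0 \<le> h" for t h
    using lipschitz_onD[OF lip, of "t+h" t] that by (simp add: dist_real_def)
  have "G a \<le> G b"
  proof (rule right_increasing_imp_le[where G=G and a=a and b=b])
    show "continuous_on {a..b} G" unfolding G_def by (intro continuous_intros m_cont f_cont)
    show "a \<le> b" by fact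
    fix t \<delta> :: real assume t: "a \<le> t" "t < b" "\<delta> > 0"
    show "\<exists>h. 0 < h \<and> h < \<delta> \<and> G t \<le> G (t + h)"
    proof (cases "t \<in> K")
      case True
      obtain h where h: "0 < h" "h < \<delta>" "f (t + h) - f t \<le> p * h" using slope[OF True t(3)] by auto
      have "m (t+h) - m t \<le> h" using m_add[of t h] small[of h t] h t by simp
      then have "(L - p) * (m (t+h) - m t) \<le> (L - p) * h" using pL by (intro mult_left_mono) auto
      then have "G t \<le> G (t + h)" using h unfolding G_def by (simp add: algebra_simps)
      with h show ?thesis by blast
    next
      case False
      then obtain e where e: "e > 0" "ball t e \<subseteq> - K"
        using Kb(1) open_contains_ball[of "-K"] by auto
      define h where "h = min (\<delta>/2) (e/2)"
      have h: "0 < h" "h < \<delta>" "h < e" using e t by (auto simp: h_def)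
      have "K \<inter> {t..t+h} = {}" using e(2) h by (auto simp: subset_eq dist_real_def)
      then have "m (t + h) - m t \<le> 0" using m_add[of t h] t h by simp
      then have "(L - p) * (m (t+h) - m t) \<le> 0" using pL by (intro mult_nonneg_nonpos) auto
      then have "G t \<le> G (t + h)" using fL[of h t] h unfolding G_def by (simp add: algebra_simps)
      with h show ?thesis by blast
    qed
  qed
  moreover have "m a = 0"
  proof -
    have "m (a + 0) \<le> 0" using small[of 0 a] by (simp add: m_def)
    then show ?thesis by (simp add: m_def measure_nonneg antisym)
  qed
  ultimately show ?thesis by (simp add: G_def m_def algebra_simps)
qed

text \<open>The principle is that a set of positive measure nearly fills some interval.
  \<open>K\<close> is enclosed in an open \<open>U\<close> of almost the same measure and cut by a
  grid so fine that the cells meeting \<open>K\<close> lie in \<open>U\<close>; adding up the cells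
  bounds the measure of \<open>K\<close> by \<open>c\<close> times that of \<open>U\<close>.\<close>

lemma compact_sparse_imp_null:
  fixes K :: "real set"
  assumes K: "compact K" and c: "0 \<le> c" "c < 1"
    and sparse: "\<And>a b. a \<le> b \<Longrightarrow> measure lborel (K \<inter> {a..b}) \<le> c * (b - a)"
  shows "measure lborel K = 0"
proof (rule ccontr)
  assume "measure lborel K \<noteq> 0"
  then have pos: "measure lborel K > 0" by (simp add: zero_less_measure_iff)
  \<comment> \<open>The covering will give \<open>2 * \<epsilon> \<le> c * \<epsilon>\<close>, which
    is impossible for \<open>c < 1\<close>.\<close>
  define \<epsilon> where "\<epsilon> = (1 - c) * measure lborel K / 2"
  have \<epsilon>: "\<epsilon> > 0" using pos c by (simp add: \<epsilon>_def)
  have Kb: "K \<in> sets borel" and Kfin: "K \<in> fmeasurable lborel"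
    using K by (auto simp: borel_compact fmeasurable_compact)
  obtain U where U: "open U" "K \<subseteq> U" "emeasure lborel (U - K) < ennreal \<epsilon>"
    using outer_regular_lborel[OF Kb \<epsilon>] by auto
  have UKfin: "U - K \<in> fmeasurable lborel"
    using U Kb less_trans[OF U(3) ennreal_less_top] by (intro fmeasurableI) auto
  have UKm: "measure lborel (U - K) < \<epsilon>"
    using U(3) \<epsilon> UKfin by (simp add: emeasure_eq_measure2 ennreal_less_iff)
  have Ufin: "U \<in> fmeasurable lborel"
  proof -
    have "U = (U - K) \<union> K" using U by auto
    then show ?thesis using UKfin Kfin by (metis fmeasurable.Un)
  qed
  have Um: "measure lborel U \<le> measure lborel K + \<epsilon>"
  proof -
    have "U = (U - K) \<union> K" using U by auto
    then have "measure lborel U \<le> measure lborel (U - K) + measure lborel K"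
      by (metis measure_Un_le UKfin Kfin fmeasurableD)
    with UKm show ?thesis by simp
  qed
  obtain d where d: "d > 0" "(\<Union>x\<in>K. ball x d) \<subseteq> U"
    using compact_subset_open_imp_ball_epsilon_subset[OF K U(1,2)] by metis
  \<comment> \<open>Half-open cells are disjoint, and the length \<open>d/2\<close> keeps every cell
    that meets \<open>K\<close> within distance \<open>d\<close> of a point of \<open>K\<close>,
    hence inside \<open>U\<close>.\<close>
  define I where "I i = {real_of_int i * (d/2)..<real_of_int (i+1) * (d/2)}" for i
  define J where "J = (\<lambda>t. \<lfloor>t / (d/2)\<rfloor>) ` K"
  obtain B where B: "\<And>t. t \<in> K \<Longrightarrow> \<bar>t\<bar> \<le> B" using compact_imp_bounded[OF K] by (auto simp: bounded_iff)
  have "J \<subseteq> {\<lfloor>- B / (d/2)\<rfloor>..\<lfloor>B / (d/2)\<rfloor>}"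
  proof
    fix i assume "i \<in> J"
    then obtain t where t: "t \<in> K" "i = \<lfloor>t / (d/2)\<rfloor>" by (auto simp: J_def)
    have "- B \<le> t" "t \<le> B" using B[OF t(1)] by linarith+
    then have "- B / (d/2) \<le> t / (d/2)" "t / (d/2) \<le> B / (d/2)"
      using d divide_right_mono[of "-B" t "d/2"] divide_right_mono[of t B "d/2"] by linarith+
    then show "i \<in> {\<lfloor>- B / (d/2)\<rfloor>..\<lfloor>B / (d/2)\<rfloor>}"
      unfolding t(2) using floor_mono by auto
  qed
  then have finJ: "finite J" by (rule finite_subset) simp
  have inI: "t \<in> I \<lfloor>t / (d/2)\<rfloor>" for t
  proof -
    have "real_of_int \<lfloor>t / (d/2)\<rfloor> \<le> t / (d/2)" "t / (d/2) < real_of_int (\<lfloor>t / (d/2)\<rfloor> + 1)"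
      using floor_correct[of "t/(d/2)"] by auto
    then show ?thesis
      using d unfolding I_def by (simp only: pos_le_divide_eq pos_divide_less_eq half_gt_zero atLeastLessThan_iff)
  qed
  have disj: "disjoint_family_on I J"
  proof -
    have "i = j" if "t \<in> I i" "t \<in> I j" for t i j
    proof -
      have "\<lfloor>t / (d/2)\<rfloor> = i" "\<lfloor>t / (d/2)\<rfloor> = j"
        using that d unfolding I_def by (auto intro!: floor_unique simp: field_simps)
      then show ?thesis by simp
    qed
    then show ?thesis by (auto simp: disjoint_family_on_def)
  qed
  have IU: "I i \<subseteq> U" if iJ: "i \<in> J" for i
  proof
    fix s assume s: "s \<in> I i"
    obtain t where t: "t \<in> K" "i = \<lfloor>t / (d/2)\<rfloor>" using iJ unfolding J_def by blast
    have "t \<in> I i" using inI t by simp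
    then have "\<bar>s - t\<bar> < d" using s d unfolding I_def by (auto simp: field_simps abs_if)
    then have "s \<in> ball t d" by (simp add: dist_real_def)
    then show "s \<in> U" using d(2) t by blast
  qed
  have mI: "measure lborel (I i) = d/2" for i
    unfolding I_def using d by (simp add: field_simps)
  have Ifin: "I i \<in> fmeasurable lborel" for i
    unfolding I_def using d by (simp add: fmeasurable_def emeasure_lborel_Ico field_simps)
  have KI: "measure lborel (K \<inter> I i) \<le> c * (d/2)" for i
  proof -
    have "measure lborel (K \<inter> I i) \<le> measure lborel (K \<inter> {real_of_int i * (d/2)..real_of_int (i+1) * (d/2)})"
      using Kb Kfin by (intro measure_mono_fmeasurable) (auto simp: I_def intro: fmeasurable_Int_fmeasurable)
    also have "\<dots> \<le> c * (d/2)"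
      using sparse[of "real_of_int i * (d/2)" "real_of_int (i+1) * (d/2)"] d by (simp add: field_simps)
    finally show ?thesis .
  qed
  have "K = (\<Union>i\<in>J. K \<inter> I i)" using inI by (auto simp: J_def)
  then have "measure lborel K = measure lborel (\<Union>i\<in>J. K \<inter> I i)" by simp
  also have "\<dots> \<le> (\<Sum>i\<in>J. measure lborel (K \<inter> I i))"
    using Kb by (intro measure_UNION_le finJ) (auto simp: I_def)
  also have "\<dots> \<le> (\<Sum>i\<in>J. c * measure lborel (I i))" unfolding mI using KI by (intro sum_mono)
  also have "\<dots> = c * (\<Sum>i\<in>J. measure lborel (I i))" by (simp add: sum_distrib_left)
  also have "(\<Sum>i\<in>J. measure lborel (I i)) = measure lborel (\<Union>i\<in>J. I i)"
    using disj Ifin by (intro measure_finite_Union[symmetric] finJ) (auto simp: fmeasurable_def less_top)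
  also have "\<dots> \<le> measure lborel U"
    using IU Ufin by (intro measure_mono_fmeasurable) (auto simp: I_def finJ)
  finally have "measure lborel K \<le> c * (measure lborel K + \<epsilon>)"
    using Um c by (meson mult_left_mono order_trans)
  moreover have "c * \<epsilon> \<le> \<epsilon>" using c \<epsilon> by (simp add: mult_left_le_one_le)
  moreover have "2 * \<epsilon> = measure lborel K - c * measure lborel K"
    by (simp add: \<epsilon>_def field_simps)
  ultimately show False using \<epsilon> unfolding distrib_left by linarith
qed

text \<open>The increment bound is applied to \<open>f\<close> with slope \<open>p\<close> and to
  \<open>- f\<close> with slope \<open>- q\<close>. On addition the increments cancel, and what
  remains says that \<open>K\<close> has density at most
  \<open>2 * L / (2 * L + (q - p)) < 1\<close> in every interval.\<close>

lemma lipschitz_osc_slopes_compact_null: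
  fixes f :: "real \<Rightarrow> real"
  assumes lip: "L-lipschitz_on UNIV f" and K: "compact K" and pq: "p < q"
    and lo: "\<And>t \<delta>. t \<in> K \<Longrightarrow> \<delta> > 0 \<Longrightarrow> \<exists>h. 0 < h \<and> h < \<delta> \<and> f (t + h) - f t \<le> p * h"
    and hi: "\<And>t \<delta>. t \<in> K \<Longrightarrow> \<delta> > 0 \<Longrightarrow> \<exists>h. 0 < h \<and> h < \<delta> \<and> f (t + h) - f t \<ge> q * h"
  shows "measure lborel K = 0"
proof (cases "K = {}")
  case False
  then obtain t where t: "t \<in> K" by auto
  have L: "\<bar>f (t + h) - f t\<bar> \<le> L * h" if "0 \<le> h" for h
    using lipschitz_onD[OF lip, of "t+h" t] that by (simp add: dist_real_def)
  obtain h where h: "0 < h" "f (t+h) - f t \<ge> q * h" using hi[OF t, of 1] by auto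
  then have qL: "q \<le> L" using L[of h] by (smt (verit) mult_le_cancel_right)
  obtain h where h: "0 < h" "f (t+h) - f t \<le> p * h" using lo[OF t, of 1] by auto
  have "- L * h \<le> p * h" using L[of h] h by simp
  then have pL: "- L \<le> p" using h mult_le_cancel_right[of "-L" h p] by auto
  have lip': "L-lipschitz_on UNIV (\<lambda>t. - f t)" using lip by simp
  define c where "c = 2 * L / (2 * L + (q - p))"
  have L0: "L \<ge> 0" "2 * L > 0" using qL pL pq by auto
  show ?thesis
  proof (rule compact_sparse_imp_null[OF K, of c])
    show "0 \<le> c" "c < 1" using L0 pq by (auto simp: c_def)
    fix a b :: real assume ab: "a \<le> b"
    let ?m = "measure lborel (K \<inter> {a..b})"
    have 1: "f b - f a \<le> L * (b - a) - (L - p) * ?m"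
      by (rule lipschitz_increment_bound[OF lip K _ lo ab]) (use pq qL in auto)
    have 2: "- f b - (- f a) \<le> L * (b - a) - (L - (- q)) * ?m"
    proof (rule lipschitz_increment_bound[OF lip' K _ _ ab])
      show "- q \<le> L" using pL pq by simp
      fix t \<delta> :: real assume "t \<in> K" "\<delta> > 0"
      then obtain h where h: "0 < h" "h < \<delta>" "f (t + h) - f t \<ge> q * h" using hi by blast
      then show "\<exists>h>0. h < \<delta> \<and> - f (t + h) - - f t \<le> - q * h" by (intro exI[of _ h]) auto
    qed
    from 1 2 have "(2 * L + (q - p)) * ?m \<le> 2 * L * (b - a)" by (simp add: algebra_simps)
    then show "?m \<le> c * (b - a)" using L0 pq by (simp add: c_def field_simps)
  qed
qed auto

text \<open>Only rational steps \<open>h\<close> are used, so that the set is Borel; by continuity of \<open>f\<close> nothing is lost.\<close>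

definition oscillating :: "('a::real_normed_vector \<Rightarrow> real) \<Rightarrow> 'a \<Rightarrow> real \<Rightarrow> real \<Rightarrow> 'a set" where
  "oscillating f v p q = {x. (\<forall>m::nat. \<exists>h\<in>\<rat> \<inter> {0<..<inverse (Suc m)}. f (x + h *\<^sub>R v) - f x < p * h) \<and>
     (\<forall>m::nat. \<exists>h\<in>\<rat> \<inter> {0<..<inverse (Suc m)}. f (x + h *\<^sub>R v) - f x > q * h)}"

lemma oscillating_borel:
  assumes cont: "continuous_on UNIV f"
  shows "oscillating f v p q \<in> sets borel"
proof -
  have *: "continuous_on UNIV (\<lambda>x. f (x + h *\<^sub>R v) - f x)" for h
    by (intro continuous_intros continuous_on_compose2[OF cont]) auto
  have c: "countable (\<rat> \<inter> {0<..<x})" for x :: real by (simp add: countable_rat)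
  have "{x. f (x + h *\<^sub>R v) - f x < p * h} \<in> sets borel" "{x. f (x + h *\<^sub>R v) - f x > q * h} \<in> sets borel" for h
    by (intro borel_open open_Collect_less * continuous_intros)+
  then have "(\<Inter>m::nat. \<Union>h\<in>\<rat> \<inter> {0<..<inverse (Suc m)}. {x. f (x + h *\<^sub>R v) - f x < p * h}) \<in> sets borel"
    "(\<Inter>m::nat. \<Union>h\<in>\<rat> \<inter> {0<..<inverse (Suc m)}. {x. f (x + h *\<^sub>R v) - f x > q * h}) \<in> sets borel"
    by (intro sets.countable_INT' sets.countable_UN'[OF c]; simp add: image_subset_iff sets.countable_UN'[OF c])+
  then have "(\<Inter>m::nat. \<Union>h\<in>\<rat> \<inter> {0<..<inverse (Suc m)}. {x. f (x + h *\<^sub>R v) - f x < p * h}) \<inter> 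
    (\<Inter>m::nat. \<Union>h\<in>\<rat> \<inter> {0<..<inverse (Suc m)}. {x. f (x + h *\<^sub>R v) - f x > q * h}) \<in> sets borel" by blast
  also have "(\<Inter>m::nat. \<Union>h\<in>\<rat> \<inter> {0<..<inverse (Suc m)}. {x. f (x + h *\<^sub>R v) - f x < p * h}) \<inter> 
    (\<Inter>m::nat. \<Union>h\<in>\<rat> \<inter> {0<..<inverse (Suc m)}. {x. f (x + h *\<^sub>R v) - f x > q * h}) = oscillating f v p q"
    unfolding oscillating_def by (intro set_eqI) auto
  finally show ?thesis .
qed

text \<open>Inner approximation by closed sets, cut down to bounded intervals, reduces the Borel set
  to the compact case.\<close>

lemma oscillating_real_null:
  fixes f :: "real \<Rightarrow> real"
  assumes lip: "L-lipschitz_on UNIV f" and pq: "p < q"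
  shows "oscillating f 1 p q \<in> null_sets lborel"
proof -
  let ?E = "oscillating f 1 p q"
  have cont: "continuous_on UNIV f" using lip lipschitz_on_continuous_on by blast
  have Eb: "?E \<in> sets borel" by (rule oscillating_borel[OF cont])
  have Eb': "?E \<in> sets lebesgue" using Eb by simp
  have small: "emeasure lebesgue ?E \<le> ennreal e" if e: "e > 0" for e :: real
  proof -
    obtain T where T: "closed T" "T \<subseteq> ?E" "emeasure lebesgue (?E - T) < ennreal e"
      using sets_lebesgue_inner_closed[OF Eb' e] by metis
    have "T \<inter> {-real n..real n} \<in> null_sets lborel" for n :: nat
    proof -
      let ?K = "T \<inter> {-real n..real n}"
      have K: "compact ?K" using T by (intro closed_Int_compact) auto
      have "measure lborel ?K = 0"
      proof (rule lipschitz_osc_slopes_compact_null[OF lip K pq])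
        fix t \<delta> :: real assume t: "t \<in> ?K" and "\<delta> > 0"
        obtain m :: nat where m: "inverse (Suc m) < \<delta>" using reals_Archimedean[OF \<open>\<delta> > 0\<close>] by auto
        have E: "t \<in> ?E" using t T(2) by auto
        obtain h where "h \<in> \<rat> \<inter> {0<..<inverse (Suc m)}" "f (t + h *\<^sub>R 1) - f t < p * h"
          using E unfolding oscillating_def by blast
        then show "\<exists>h>0. h < \<delta> \<and> f (t + h) - f t \<le> p * h" using m by (intro exI[of _ h]) auto
        obtain h where "h \<in> \<rat> \<inter> {0<..<inverse (Suc m)}" "f (t + h *\<^sub>R 1) - f t > q * h"
          using E unfolding oscillating_def by blast
        then show "\<exists>h>0. h < \<delta> \<and> f (t + h) - f t \<ge> q * h" using m by (intro exI[of _ h]) auto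
      qed
      then have "emeasure lborel ?K = 0" using fmeasurable_compact[OF K] by (simp add: emeasure_eq_measure2)
      then show ?thesis using borel_compact[OF K] by (simp add: null_sets_def)
    qed
    then have "(\<Union>n::nat. T \<inter> {-real n..real n}) \<in> null_sets lborel" by (rule null_sets_UN)
    also have "(\<Union>n::nat. T \<inter> {-real n..real n}) = T"
    proof -
      have "\<exists>n::nat. t \<in> {-real n..real n}" for t
      proof -
        obtain n :: nat where "\<bar>t\<bar> \<le> real n" using real_arch_simple by blast
        then show ?thesis by (intro exI[of _ n]) auto
      qed
      then show ?thesis by blast
    qed
    finally have "T \<in> null_sets lebesgue" by (simp add: null_sets_completionI)
    then have "emeasure lebesgue ?E = emeasure lebesgue (?E - T)"
      by (rule emeasure_Diff_null_set[OF _ Eb', symmetric])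
    then show ?thesis using T(3) by simp
  qed
  have "emeasure lebesgue ?E \<le> 0"
  proof (rule ennreal_le_epsilon)
    fix e :: real assume "e > 0"
    from small[OF this] show "emeasure lebesgue ?E \<le> 0 + ennreal e" by simp
  qed
  then show ?thesis using Eb by (simp add: null_sets_def)
qed

lemma open_inter_Rats:
  fixes S :: "real set"
  assumes "open S" "S \<noteq> {}"
  shows "\<exists>r\<in>\<rat>. r \<in> S"
proof -
  obtain x e where "e > 0" "ball x e \<subseteq> S" using assms open_contains_ball by (metis ex_in_conv)
  moreover obtain r where "r \<in> \<rat>" "x < r" "r < x + e" using Rats_dense_in_real[of x "x+e"] \<open>e>0\<close> by auto
  ultimately show ?thesis by (intro bexI[of _ r]) (auto simp: subset_eq dist_real_def)
qed

text \<open>The candidate is the lower limit of the quotients, written as the supremum of their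
  eventual lower bounds. If the upper limit were larger, two rationals strictly between would be
  passed on both sides by arbitrarily small steps.\<close>

lemma not_oscillating_imp_right_derivative:
  fixes f :: "'a::real_normed_vector \<Rightarrow> real"
  assumes lip: "L-lipschitz_on UNIV f"
    and no: "\<And>p q. p \<in> \<rat> \<Longrightarrow> q \<in> \<rat> \<Longrightarrow> p < q \<Longrightarrow> x \<notin> oscillating f v p q"
  shows "\<exists>D. ((\<lambda>h. (f (x + h *\<^sub>R v) - f x) / h) \<longlongrightarrow> D) (at_right 0)"
proof -
  define \<phi> where "\<phi> h = (f (x + h *\<^sub>R v) - f x) / h" for h
  have cont: "continuous_on UNIV f" using lip lipschitz_on_continuous_on by blast
  have c: "continuous_on UNIV (\<lambda>h. f (x + h *\<^sub>R v) - f x)"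
    by (intro continuous_intros continuous_on_compose2[OF cont]) auto
  have bnd: "\<bar>\<phi> h\<bar> \<le> L * norm v" if "h > 0" for h
    using lipschitz_onD[OF lip, of "x + h *\<^sub>R v" x] that by (simp add: \<phi>_def dist_real_def dist_norm field_simps)
  define A where "A = {p. \<forall>\<^sub>F h in at_right 0. p \<le> \<phi> h}"
  have ev: "\<forall>\<^sub>F h in at_right (0::real). 0 < h" by (simp add: eventually_at_right_less)
  have A1: "- (L * norm v) \<in> A" unfolding A_def using ev by (auto elim!: eventually_mono dest: bnd simp: abs_le_iff minus_le_iff)
  have A2: "p \<le> L * norm v" if "p \<in> A" for p
  proof -
    have "\<forall>\<^sub>F h in at_right 0. p \<le> \<phi> h \<and> 0 < h" using that ev by (auto simp: A_def eventually_conj)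
    then obtain h where "p \<le> \<phi> h" "0 < h" using eventually_happens[of _ "at_right (0::real)"] by fastforce
    then show ?thesis using bnd[of h] by simp
  qed
  have bdd: "bdd_above A" by (rule bdd_aboveI[of _ "L * norm v"]) (rule A2)
  define D where "D = Sup A"
  have "(\<phi> \<longlongrightarrow> D) (at_right 0)"
  proof (rule order_tendstoI)
    fix a assume "a < D"
    then obtain p where "p \<in> A" "a < p" using less_cSup_iff[of A a] A1 bdd by (auto simp: D_def)
    then show "\<forall>\<^sub>F h in at_right 0. a < \<phi> h" by (auto simp: A_def elim!: eventually_mono)
  next
    fix a assume "D < a"
    show "\<forall>\<^sub>F h in at_right 0. \<phi> h < a"
    proof (rule ccontr)
      assume fr: "\<not> ?thesis"
      obtain q where q: "q \<in> \<rat>" "D < q" "q < a" using Rats_dense_in_real[OF \<open>D < a\<close>] by auto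
      obtain p where p: "p \<in> \<rat>" "D < p" "p < q" using Rats_dense_in_real[OF q(2)] by auto
      have pA: "p \<notin> A" using p cSup_upper[OF _ bdd, of p] by (auto simp: D_def)
      have "x \<in> oscillating f v p q" unfolding oscillating_def
      proof (intro CollectI conjI allI)
        fix m :: nat
        let ?d = "inverse (real (Suc m))"
        have d0: "?d > 0" by simp
        have "\<exists>h>0. h < ?d \<and> \<not> p \<le> \<phi> h"
          using pA unfolding A_def eventually_at_right_field using d0 by blast
        then obtain h where h: "h > 0" "h < ?d" "\<phi> h < p" by force
        let ?S = "{h. f (x + h *\<^sub>R v) - f x < p * h} \<inter> {0<..<?d}"
        have "open ?S" by (intro open_Int open_Collect_less c continuous_intros)
        moreover have "h \<in> ?S" using h by (simp add: \<phi>_def field_simps)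
        ultimately show "\<exists>h\<in>\<rat> \<inter> {0<..<inverse (real (Suc m))}. f (x + h *\<^sub>R v) - f x < p * h"
          using open_inter_Rats[of ?S] by blast
        have "\<exists>h>0. h < ?d \<and> \<not> \<phi> h < a"
          using fr unfolding eventually_at_right_field using d0 by blast
        then obtain h where h: "h > 0" "h < ?d" "\<phi> h > q" using q by force
        let ?S = "{h. f (x + h *\<^sub>R v) - f x > q * h} \<inter> {0<..<?d}"
        have "open ?S" by (intro open_Int open_Collect_less c continuous_intros)
        moreover have "h \<in> ?S" using h by (simp add: \<phi>_def field_simps)
        ultimately show "\<exists>h\<in>\<rat> \<inter> {0<..<inverse (real (Suc m))}. q * h < f (x + h *\<^sub>R v) - f x"
          using open_inter_Rats[of ?S] by blast
      qed
      with no p q show False by blast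
    qed
  qed
  then show ?thesis unfolding \<phi>_def by blast
qed

text \<open>All translates of \<open>E\<close> have the same measure, so averaging over \<open>t \<in> [0, 1]\<close> and exchanging the integrals
  reduces the claim to lines, without choosing coordinates adapted to \<open>v\<close>.\<close>

lemma null_if_null_on_lines:
  fixes E :: "'a::euclidean_space set"
  assumes Eb[measurable]: "E \<in> sets borel"
    and lines: "\<And>x. {t. x + t *\<^sub>R v \<in> E} \<in> null_sets lborel"
  shows "E \<in> null_sets lborel"
proof -
  have "(\<integral>\<^sup>+t. indicator {0..1::real} t * (\<integral>\<^sup>+x. indicator E (x + t *\<^sub>R v) \<partial>(lborel::'a measure)) \<partial>lborel)
      = (\<integral>\<^sup>+t. (\<integral>\<^sup>+x. indicator {0..1::real} t * indicator E (x + t *\<^sub>R v) \<partial>(lborel::'a measure)) \<partial>lborel)"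
    by (intro nn_integral_cong nn_integral_cmult[symmetric]) auto
  also have "\<dots> = (\<integral>\<^sup>+x. (\<integral>\<^sup>+t. indicator {0..1::real} t * indicator E (x + t *\<^sub>R v) \<partial>lborel) \<partial>(lborel::'a measure))"
    by (rule lborel_pair.Fubini') measurable
  also have "\<dots> = (\<integral>\<^sup>+x. 0 \<partial>(lborel::'a measure))"
  proof (rule nn_integral_cong)
    fix x :: 'a
    have "AE t in lborel. t \<notin> {t. x + t *\<^sub>R v \<in> E}" by (rule AE_not_in[OF lines])
    then have "AE t in lborel. (indicator {0..1::real} t * indicator E (x + t *\<^sub>R v) :: ennreal) = 0"
      by (auto elim!: eventually_mono simp: indicator_def)
    then show "(\<integral>\<^sup>+t. indicator {0..1::real} t * indicator E (x + t *\<^sub>R v) \<partial>lborel) = 0"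
      by (subst nn_integral_0_iff_AE) auto
  qed
  finally have 0: "(\<integral>\<^sup>+t. indicator {0..1::real} t * (\<integral>\<^sup>+x. indicator E (x + t *\<^sub>R v) \<partial>(lborel::'a measure)) \<partial>lborel) = 0"
    by simp
  have "(\<integral>\<^sup>+x. indicator E (x + t *\<^sub>R v) \<partial>(lborel::'a measure)) = emeasure lborel E" for t :: real
  proof -
    have "emeasure lborel E = (\<integral>\<^sup>+x. indicator E x \<partial>distr lborel borel ((+) (t *\<^sub>R v)))"
      by (simp add: lborel_distr_plus)
    also have "\<dots> = (\<integral>\<^sup>+x. indicator E (t *\<^sub>R v + x) \<partial>(lborel::'a measure))"
      by (subst nn_integral_distr) auto
    finally show ?thesis by (simp add: add.commute)
  qed
  with 0 have "emeasure lborel E = 0"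
    by (simp add: nn_integral_multc)
  then show ?thesis by (simp add: null_sets_def)
qed

lemma lipschitz_AE_right_derivative:
  fixes f :: "'a::euclidean_space \<Rightarrow> real"
  assumes lip: "L-lipschitz_on UNIV f"
  shows "AE x in lborel. \<exists>D. ((\<lambda>h. (f (x + h *\<^sub>R v) - f x) / h) \<longlongrightarrow> D) (at_right 0)"
proof -
  have cont: "continuous_on UNIV f" using lip lipschitz_on_continuous_on by blast
  have "oscillating f v p q \<in> null_sets lborel" if "p < q" for p q
  proof (rule null_if_null_on_lines[where v=v])
    show "oscillating f v p q \<in> sets borel" by (rule oscillating_borel[OF cont])
    fix x
    define g where "g t = f (x + t *\<^sub>R v)" for t
    have "(L * norm v)-lipschitz_on UNIV g"
    proof (rule lipschitz_onI)
      show "0 \<le> L * norm v" using lipschitz_on_nonneg[OF lip] by simp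
      show "dist (g s) (g t) \<le> L * norm v * dist s t" for s t
        using lipschitz_onD[OF lip, of "x + s *\<^sub>R v" "x + t *\<^sub>R v"]
        by (simp add: g_def dist_norm flip: scaleR_diff_left) (simp add: mult_ac)
    qed
    then have "oscillating g 1 p q \<in> null_sets lborel" using that by (rule oscillating_real_null)
    moreover have "oscillating g 1 p q = {t. x + t *\<^sub>R v \<in> oscillating f v p q}"
      by (auto simp: oscillating_def g_def algebra_simps)
    ultimately show "{t. x + t *\<^sub>R v \<in> oscillating f v p q} \<in> null_sets lborel" by simp
  qed
  then have "AE x in lborel. x \<notin> oscillating f v p q" if "p < q" for p q using that AE_not_in by blast
  then have "AE x in lborel. \<forall>p\<in>\<rat>. \<forall>q\<in>\<rat>. p < q \<longrightarrow> x \<notin> oscillating f v p q"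
    by (intro AE_ball_countable[THEN iffD2] countable_rat ballI) (auto simp: AE_all_countable)
  then show ?thesis
    by (rule eventually_mono) (blast intro: not_oscillating_imp_right_derivative[OF lip])
qed

section \<open>Test functions and the fundamental lemma\<close>

text \<open>For \<open>m = 0\<close> this is the standard flat function exp(-1/t). The powers of 1/t
  are included because differentiation produces them, so that derivatives stay in the span of the
  family.\<close>

definition flat_exp :: "nat \<Rightarrow> real \<Rightarrow> real" where
  "flat_exp m t = (if t > 0 then exp (- inverse t) * inverse t ^ m else 0)"

lemma flat_exp_bounds: "0 \<le> flat_exp 0 t" "flat_exp 0 t \<le> 1"
  by (auto simp: flat_exp_def)

lemma flat_exp_tendsto_0: "(flat_exp m \<longlongrightarrow> 0) (at_right 0)"
proof -
  have "((\<lambda>x. x ^ m / exp x) \<longlongrightarrow> 0) (at_top :: real filter)" by (rule tendsto_power_div_exp_0)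
  then have "((\<lambda>t. inverse t ^ m / exp (inverse t)) \<longlongrightarrow> 0) (at_right (0::real))"
    by (rule filterlim_compose[OF _ filterlim_inverse_at_top_right])
  then show ?thesis
    by (rule Lim_transform_eventually)
       (auto simp: flat_exp_def eventually_at_right_field exp_minus field_simps intro!: exI[of _ 1])
qed

lemma flat_exp_DERIV:
  "(flat_exp m has_real_derivative flat_exp (m + 2) t - real m * flat_exp (m + 1) t) (at t)"
proof -
  consider "t < 0" | "t > 0" | "t = 0" by linarith
  then show ?thesis
  proof cases
    case 1
    have "(flat_exp m has_real_derivative 0) (at t)"
      by (rule has_field_derivative_transform_within_open[where S="{..<0}" and f="\<lambda>_. 0"])
         (use 1 in \<open>auto simp: flat_exp_def\<close>)
    with 1 show ?thesis by (simp add: flat_exp_def)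
  next
    case 2
    have "((\<lambda>t. exp (- inverse t) * inverse t ^ m) has_real_derivative 
       flat_exp (m + 2) t - real m * flat_exp (m + 1) t) (at t)"
    proof -
      have i: "(inverse has_real_derivative - (inverse t ^ 2)) (at t)"
        using DERIV_inverse[of t UNIV] 2 by (simp add: numeral_2_eq_2)
      have e: "((\<lambda>t. exp (- inverse t)) has_real_derivative exp (- inverse t) * inverse t ^ 2) (at t)"
        by (rule derivative_eq_intros refl i)+ simp
      have p: "((\<lambda>t. inverse t ^ m) has_real_derivative - (real m * inverse t ^ (m + 1))) (at t)"
        using DERIV_power[OF i, of m] by (cases m) (simp_all add: power2_eq_square mult_ac)
      show ?thesis using DERIV_mult[OF e p] 2 by (simp add: flat_exp_def algebra_simps power2_eq_square)
    qed
    then show ?thesis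
      by (rule has_field_derivative_transform_within_open[where S="{0<..}"]) (use 2 in \<open>auto simp: flat_exp_def\<close>)
  next
    case 3
    have "((\<lambda>h. flat_exp m h / h) \<longlongrightarrow> 0) (at 0)"
    proof (subst filterlim_at_split, intro conjI)
      show "((\<lambda>h. flat_exp m h / h) \<longlongrightarrow> 0) (at_left 0)"
        by (rule tendsto_eventually) (auto simp: flat_exp_def eventually_at_left_field intro!: exI[of _ "-1"])
      \<comment> \<open>To the right of 0 the difference quotient is
        \<open>flat_exp (Suc m)\<close>, so differentiability at 0 is the known limit for the next
        index.\<close>
      show "((\<lambda>h. flat_exp m h / h) \<longlongrightarrow> 0) (at_right 0)"
        by (rule Lim_transform_eventually[OF flat_exp_tendsto_0[of "Suc m"]])
           (auto simp: flat_exp_def eventually_at_right_field field_simps intro!: exI[of _ 1])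
    qed
    then show ?thesis using 3 by (simp add: DERIV_def flat_exp_def)
  qed
qed

text \<open>This class is closed under partial derivatives, and all of its members are differentiable; hence they
  are smooth in the iterated sense of \<open>smooth_fun\<close>.\<close>

inductive smooth_gen :: "('a::euclidean_space \<Rightarrow> real) \<Rightarrow> bool" where
  const: "smooth_gen (\<lambda>x. c)"
| flat: "smooth_gen (\<lambda>x. flat_exp m (x \<bullet> a + c))"
| add: "smooth_gen f \<Longrightarrow> smooth_gen g \<Longrightarrow> smooth_gen (\<lambda>x. f x + g x)"
| mult: "smooth_gen f \<Longrightarrow> smooth_gen g \<Longrightarrow> smooth_gen (\<lambda>x. f x * g x)"

lemma smooth_gen_derivative:
  "smooth_gen f \<Longrightarrow> \<exists>f'. (\<forall>x. (f has_derivative f' x) (at x)) \<and> (\<forall>b. smooth_gen (\<lambda>x. f' x b))"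
proof (induction rule: smooth_gen.induct)
  case (const c)
  then show ?case by (intro exI[of _ "\<lambda>x b. 0"]) (auto intro: smooth_gen.const)
next
  case (flat m a c)
  have "((\<lambda>x. flat_exp m (x \<bullet> a + c)) has_derivative
      (\<lambda>b. (flat_exp (m + 2) (x \<bullet> a + c) + (- real m) * flat_exp (m + 1) (x \<bullet> a + c)) * (b \<bullet> a))) (at x)" for x
  proof -
    have "((\<lambda>x. x \<bullet> a + c) has_derivative (\<lambda>b. b \<bullet> a)) (at x)" by (auto intro!: derivative_eq_intros)
    from DERIV_compose_FDERIV[where f="flat_exp m" and g="\<lambda>x. x \<bullet> a + c", OF flat_exp_DERIV this]
    show ?thesis by (simp add: mult.commute)
  qed
  moreover have "smooth_gen (\<lambda>x. (flat_exp (m + 2) (x \<bullet> a + c) + (- real m) * flat_exp (m + 1) (x \<bullet> a + c)) * (b \<bullet> a))" for b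
    by (intro smooth_gen.intros)
  ultimately show ?case by (intro exI[of _ "\<lambda>x b. (flat_exp (m + 2) (x \<bullet> a + c) + (- real m) * flat_exp (m + 1) (x \<bullet> a + c)) * (b \<bullet> a)"]) auto
next
  case (add f g)
  then obtain f' g' where "\<And>x. (f has_derivative f' x) (at x)" "\<And>b. smooth_gen (\<lambda>x. f' x b)"
     "\<And>x. (g has_derivative g' x) (at x)" "\<And>b. smooth_gen (\<lambda>x. g' x b)" by blast
  then show ?case by (intro exI[of _ "\<lambda>x b. f' x b + g' x b"]) (auto intro!: has_derivative_add smooth_gen.intros)
next
  case (mult f g)
  then obtain f' g' where "\<And>x. (f has_derivative f' x) (at x)" "\<And>b. smooth_gen (\<lambda>x. f' x b)"
     "\<And>x. (g has_derivative g' x) (at x)" "\<And>b. smooth_gen (\<lambda>x. g' x b)" by blast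
  then show ?case using mult
    by (intro exI[of _ "\<lambda>x b. f x * g' x b + f' x b * g x"]) (auto intro!: has_derivative_mult smooth_gen.intros)
qed

lemma smooth_gen_partial: "smooth_gen f \<Longrightarrow> smooth_gen (partial b f)"
proof -
  assume "smooth_gen f"
  then obtain f' where f': "\<And>x. (f has_derivative f' x) (at x)" "\<And>b. smooth_gen (\<lambda>x. f' x b)"
    using smooth_gen_derivative by metis
  have "partial b f = (\<lambda>x. f' x b)" using frechet_derivative_at[OF f'(1)] by (auto simp: partial_def)
  with f' show ?thesis by simp
qed

lemma smooth_gen_imp_smooth_fun: assumes "smooth_gen f" shows "smooth_fun f"
proof -
  have "smooth_gen (iter_partial bs f)" for bs using assms by (induction bs) (auto intro: smooth_gen_partial)
  then show ?thesis unfolding smooth_fun_def using smooth_gen_derivative unfolding differentiable_def by blast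
qed

lemma smooth_gen_prod: "finite A \<Longrightarrow> (\<And>a. a \<in> A \<Longrightarrow> smooth_gen (f a)) \<Longrightarrow> smooth_gen (\<lambda>x. \<Prod>a\<in>A. f a x)"
  by (induction A rule: finite_induct) (auto intro: smooth_gen.intros)

text \<open>The factor \<open>Suc k\<close> steepens the flat functions, so that these test
  functions, bounded by 1, tend to the indicator of the open box.\<close>

definition box_bump :: "'a::euclidean_space \<Rightarrow> 'a \<Rightarrow> nat \<Rightarrow> 'a \<Rightarrow> real" where
  "box_bump l u k x = (\<Prod>b\<in>Basis. flat_exp 0 (real (Suc k) * (x \<bullet> b - l \<bullet> b)) * flat_exp 0 (real (Suc k) * (u \<bullet> b - x \<bullet> b)))"

lemma box_bump_bounds: "0 \<le> box_bump l u k x" "box_bump l u k x \<le> 1"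
  unfolding box_bump_def by (auto intro!: prod_nonneg prod_le_1 mult_nonneg_nonneg mult_le_one flat_exp_bounds)

lemma box_bump_outside: "x \<notin> box l u \<Longrightarrow> box_bump l u k x = 0"
  by (simp add: box_bump_def mem_box flat_exp_def zero_less_mult_iff not_less del: of_nat_Suc) (meson linorder_not_le)

lemma box_bump_tendsto: "(\<lambda>k. box_bump l u k x) \<longlonglongrightarrow> indicator (box l u) x"
proof (cases "x \<in> box l u")
  case True
  have *: "(\<lambda>k. flat_exp 0 (real (Suc k) * t)) \<longlonglongrightarrow> 1" if "t > 0" for t
  proof -
    have "(\<lambda>k. exp (- (inverse (real (Suc k)) * inverse t))) \<longlonglongrightarrow> exp (- (0 * inverse t))"
      by (intro tendsto_intros LIMSEQ_inverse_real_of_nat)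
    then show ?thesis using that by (simp add: flat_exp_def zero_less_mult_iff del: of_nat_Suc)
  qed
  have "(\<lambda>k. box_bump l u k x) \<longlonglongrightarrow> (\<Prod>b\<in>(Basis::'a set). 1 * 1)"
    unfolding box_bump_def by (intro tendsto_prod tendsto_mult *) (use True in \<open>auto simp: mem_box\<close>)
  then show ?thesis using True by simp
qed (simp add: box_bump_outside)

lemma box_bump_test: assumes "cbox l u \<subseteq> \<Omega>" shows "test_function \<Omega> (box_bump l u k)"
proof -
  have "smooth_gen (\<lambda>x::'a. flat_exp 0 (real (Suc k) * (x \<bullet> b - l \<bullet> b)) * flat_exp 0 (real (Suc k) * (u \<bullet> b - x \<bullet> b)))" for b
    using smooth_gen.mult[OF smooth_gen.flat[of 0 "real (Suc k) *\<^sub>R b" "- real (Suc k) * (l \<bullet> b)"]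
       smooth_gen.flat[of 0 "- real (Suc k) *\<^sub>R b" "real (Suc k) * (u \<bullet> b)"]]
    by (simp add: algebra_simps del: of_nat_Suc)
  then have "smooth_gen (box_bump l u k)" unfolding box_bump_def by (intro smooth_gen_prod) auto
  moreover have "\<forall>x. x \<notin> cbox l u \<longrightarrow> box_bump l u k x = 0" using box_subset_cbox box_bump_outside by blast
  ultimately show ?thesis using assms by (auto simp: test_function_def smooth_gen_imp_smooth_fun intro!: exI[of _ "cbox l u"])
qed

lemma box_Int_box_eq:
  obtains c d where "box a b \<inter> box l u = box c (d::'a::euclidean_space)" "box c d \<noteq> {} \<longrightarrow> cbox c d \<subseteq> cbox l u"
proof -
  define c d where "c = (\<Sum>i\<in>Basis. max (a \<bullet> i) (l \<bullet> i) *\<^sub>R i)" and "d = (\<Sum>i\<in>Basis. min (b \<bullet> i) (u \<bullet> i) *\<^sub>R (i::'a))"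
  have "box a b \<inter> box l u = box c d" "cbox c d \<subseteq> cbox l u"
    by (auto simp: mem_box c_def d_def)
  then show ?thesis using that by blast
qed

text \<open>Boxes form a generator of the Borel sets that is stable under intersection, so vanishing
  integrals over boxes spread to all Borel sets and then determine the density.\<close>

lemma zero_on_box:
  fixes g :: "'a::euclidean_space \<Rightarrow> real"
  assumes int: "set_integrable lebesgue (cbox l u) g"
    and z: "\<And>c d. cbox c d \<subseteq> cbox l u \<Longrightarrow> (LINT x:box c d|lebesgue. g x) = 0"
  shows "AE x in lebesgue. x \<in> box l u \<longrightarrow> g x = 0"
proof -
  \<comment> \<open>Extended by zero the function is integrable on the whole space, as the
    complement step of the induction over Borel sets requires.\<close>
  let ?g = "\<lambda>x. indicator (box l u) x * g x"
  have ig: "integrable lebesgue ?g"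
    using set_integrable_subset[OF int, of "box l u"] box_subset_cbox[of l u] by (auto simp: set_integrable_def)
  have b0: "(LINT x:box a b|lebesgue. ?g x) = 0" for a b
  proof -
    obtain c d where cd: "box a b \<inter> box l u = box c d" "box c d \<noteq> {} \<longrightarrow> cbox c d \<subseteq> cbox l u" by (rule box_Int_box_eq)
    have "(LINT x:box a b|lebesgue. ?g x) = (LINT x:box c d|lebesgue. g x)"
      unfolding set_lebesgue_integral_def by (intro Bochner_Integration.integral_cong) (auto simp: cd(1)[symmetric] indicator_def)
    also have "\<dots> = 0" using z[of c d] cd(2) by (cases "box c d = {}") (auto simp: set_lebesgue_integral_def)
    finally show ?thesis .
  qed
  have tot: "(LINT x|lebesgue. ?g x) = 0"
    using b0[of l u] by (simp add: set_lebesgue_integral_def mult.assoc[symmetric] indicator_inter_arith[symmetric])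
  have si: "set_integrable lebesgue A ?g" if "A \<in> sets lebesgue" for A
    using integrable_mult_indicator[OF that ig] by (simp add: set_integrable_def)
  have bor: "(LINT x:A|lebesgue. ?g x) = 0" if "A \<in> sets borel" for A
  proof -
    have "A \<in> sigma_sets UNIV (range (\<lambda>(a, b). box a b))"
      using that by (simp add: borel_eq_box)
    then show ?thesis
    proof (induction rule: sigma_sets_induct_disjoint[rotated 2, consumes 1, case_names basic empty compl union stable sub])
      case (basic A) then show ?case using b0 by auto
    next case empty show ?case by (simp add: set_lebesgue_integral_def)
    next
      case (compl A)
      then have A: "A \<in> sets lebesgue" by (metis borel_eq_box sets_completionI_sets sets_lborel sets_measure_of top_greatest subset_UNIV Pow_UNIV)
      have "(LINT x:UNIV - A|lebesgue. ?g x) = (LINT x|lebesgue. ?g x - indicator A x * ?g x)"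
        unfolding set_lebesgue_integral_def by (intro Bochner_Integration.integral_cong) (auto simp: indicator_def)
      also have "\<dots> = (LINT x|lebesgue. ?g x) - (LINT x:A|lebesgue. ?g x)"
        using ig si[OF A] by (subst Bochner_Integration.integral_diff) (auto simp: set_integrable_def set_lebesgue_integral_def)
      finally show ?case using tot compl by simp
    next
      case (union F)
      then have F: "F i \<in> sets lebesgue" for i
        by (metis borel_eq_box sets_completionI_sets sets_lborel sets_measure_of subset_UNIV Pow_UNIV range_subsetD)
      have "(LINT x:(\<Union>i. F i)|lebesgue. ?g x) = (\<Sum>i. (LINT x:F i|lebesgue. ?g x))"
        using F union(1) by (intro lebesgue_integral_countable_add si) (auto simp: disjoint_family_on_def)
      then show ?case using union by simp
    next
      case stable
      show ?case
      proof (rule Int_stableI)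
        fix A B :: "'a set" assume "A \<in> range (\<lambda>(a, b). box a b)" "B \<in> range (\<lambda>(a, b). box a b)"
        then obtain a b c d where "A = box a b" "B = box c d" by auto
        then show "A \<inter> B \<in> range (\<lambda>(a, b). box a b)" using box_Int_box_eq[of a b c d] by (metis case_prod_conv rangeI)
      qed
    qed auto
  qed
  have "AE x in lebesgue. ?g x = 0"
  proof (rule density_unique_real[OF ig])
    show "integrable lebesgue (\<lambda>x. 0::real)" by simp
    fix A :: "'a set" assume A: "A \<in> sets lebesgue"
    \<comment> \<open>A Lebesgue measurable set differs from a Borel set by part of a null set, so
      the Borel case suffices.\<close>
    obtain C N N' where A_eq: "A = C \<union> N" "N \<subseteq> N'" "N' \<in> null_sets lborel" "C \<in> sets lborel"
      using sets_completionE[OF A] by metis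
    have "N' \<in> null_sets lebesgue" using A_eq null_sets_completionI by blast
    then have "AE x in lebesgue. x \<notin> N'" by (rule AE_not_in)
    then have "AE x in lebesgue. indicator A x *\<^sub>R ?g x = indicator C x *\<^sub>R ?g x"
      by (rule eventually_mono) (use A_eq in \<open>auto simp: indicator_def\<close>)
    then have "(LINT x:A|lebesgue. ?g x) = (LINT x:C|lebesgue. ?g x)"
      unfolding set_lebesgue_integral_def
      using si[OF A] si[of C] A_eq(4) by (intro integral_cong_AE) (auto simp: set_integrable_def)
    then show "(LINT x:A|lebesgue. ?g x) = (LINT x:A|lebesgue. 0)" using bor[of C] A_eq by (simp add: set_lebesgue_integral_def)
  qed
  then show ?thesis by (rule eventually_mono) (auto simp: indicator_def)
qed

text \<open>Testing with \<open>box_bump\<close> and letting its index grow gives zero integrals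
  over all boxes whose closures lie in \<open>\<Omega>\<close>. Countably many such boxes exhaust
  \<open>\<Omega>\<close> up to their faces, which are negligible.\<close>

lemma fundamental_lemma_real:
  fixes g :: "'a::euclidean_space \<Rightarrow> real"
  assumes "open \<Omega>"
    and int: "\<And>l u. cbox l u \<subseteq> \<Omega> \<Longrightarrow> set_integrable lebesgue (cbox l u) g"
    and z: "\<And>\<phi>. test_function \<Omega> \<phi> \<Longrightarrow> (LINT x:\<Omega>|lebesgue. \<phi> x * g x) = 0"
  shows "AE x in lebesgue. x \<in> \<Omega> \<longrightarrow> g x = 0"
proof -
  have box0: "(LINT x:box c d|lebesgue. g x) = 0" if cd: "cbox c d \<subseteq> \<Omega>" for c d
  proof -
    have i: "integrable lebesgue (\<lambda>x. indicator (cbox c d) x * g x)" using int[OF cd] by (simp add: set_integrable_def)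
    have i': "integrable lebesgue (\<lambda>x. indicator (box c d) x * g x)" 
      using set_integrable_subset[OF int[OF cd], of "box c d"] box_subset_cbox[of c d] by (auto simp: set_integrable_def)
    have meas: "box_bump c d k \<in> borel_measurable borel" for k
    proof (rule borel_measurable_continuous_onI)
      have "box_bump c d k differentiable at x" for x
        using box_bump_test[OF cd, of k] by (auto simp: test_function_def smooth_fun_def dest!: spec[of _ "[]"])
      then show "continuous_on UNIV (box_bump c d k)"
        by (simp add: continuous_at_imp_continuous_on differentiable_imp_continuous_within)
    qed
    have "(\<lambda>k. LINT x|lebesgue. box_bump c d k x * (indicator (cbox c d) x * g x)) \<longlonglongrightarrow> (LINT x|lebesgue. indicator (box c d) x * g x)"
    proof (rule integral_dominated_convergence[where w="\<lambda>x. \<bar>indicator (cbox c d) x * g x\<bar>"])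
      show "(\<lambda>x. box_bump c d k x * (indicator (cbox c d) x * g x)) \<in> borel_measurable lebesgue" for k
        by (rule borel_measurable_times[OF _ borel_measurable_integrable[OF i]]) (rule measurable_completion, simp add: meas)
      show "AE x in lebesgue. (\<lambda>k. box_bump c d k x * (indicator (cbox c d) x * g x)) \<longlonglongrightarrow> indicator (box c d) x * g x"
      proof (rule AE_I2)
        fix x
        have "(\<lambda>k. box_bump c d k x * (indicator (cbox c d) x * g x)) \<longlonglongrightarrow> indicator (box c d) x * (indicator (cbox c d) x * g x)"
          by (intro tendsto_mult box_bump_tendsto tendsto_const)
        moreover have "indicator (box c d) x * (indicator (cbox c d) x * g x) = indicator (box c d) x * g x"
          using box_subset_cbox[of c d] by (auto simp: indicator_def)
        ultimately show "(\<lambda>k. box_bump c d k x * (indicator (cbox c d) x * g x)) \<longlonglongrightarrow> indicator (box c d) x * g x" by simp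
      qed
      show "AE x in lebesgue. norm (box_bump c d k x * (indicator (cbox c d) x * g x)) \<le> \<bar>indicator (cbox c d) x * g x\<bar>" for k
        using box_bump_bounds[of c d k] by (auto simp: abs_mult intro!: mult_left_le_one_le AE_I2)
    qed (use i i' in auto)
    moreover have "(LINT x|lebesgue. box_bump c d k x * (indicator (cbox c d) x * g x)) = 0" for k
    proof -
      have "(LINT x|lebesgue. box_bump c d k x * (indicator (cbox c d) x * g x)) = (LINT x:\<Omega>|lebesgue. box_bump c d k x * g x)"
        unfolding set_lebesgue_integral_def
        using cd box_subset_cbox[of c d] box_bump_outside[of _ c d k]
        by (intro Bochner_Integration.integral_cong refl) (auto simp: indicator_def)
      then show ?thesis using z[OF box_bump_test[OF cd]] by simp
    qed
    ultimately show ?thesis by (simp add: set_lebesgue_integral_def LIMSEQ_const_iff)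
  qed
  obtain \<D> where D: "countable \<D>" "\<D> \<subseteq> Pow \<Omega>" "\<And>X. X \<in> \<D> \<Longrightarrow> \<exists>a b. X = cbox a b" "\<Union>\<D> = \<Omega>"
    using open_countable_Union_open_cbox[OF \<open>open \<Omega>\<close>] by metis
  have "AE x in lebesgue. x \<in> X \<longrightarrow> g x = 0" if X: "X \<in> \<D>" for X
  proof -
    obtain l u where lu: "X = cbox l u" using D X by blast
    then have sub: "cbox l u \<subseteq> \<Omega>" using D X by blast
    have "AE x in lebesgue. x \<in> box l u \<longrightarrow> g x = 0"
      using int[OF sub] box0 sub by (intro zero_on_box) blast+
    moreover have "AE x in lebesgue. x \<notin> cbox l u - box l u"
      using negligible_frontier_interval[of l u] by (intro AE_not_in) (simp add: negligible_iff_null_sets)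
    ultimately show ?thesis unfolding lu by (rule eventually_elim2) auto
  qed
  then have "AE x in lebesgue. \<forall>X\<in>\<D>. x \<in> X \<longrightarrow> g x = 0" using D(1) by (intro AE_ball_countable[THEN iffD2]) auto
  then show ?thesis by (rule eventually_mono) (use D(4) in blast)
qed

section \<open>Integration by parts and Rademacher's theorem\<close>

definition dquot :: "('a::real_normed_vector \<Rightarrow> 'b::real_normed_vector) \<Rightarrow> 'a \<Rightarrow> nat \<Rightarrow> 'a \<Rightarrow> 'b" where
  "dquot f v k x = real (Suc k) *\<^sub>R (f (x + v /\<^sub>R real (Suc k)) - f x)"

text \<open>The derivative is taken along a sequence of forward steps: it is always Borel in \<open>x\<close>, it exists almost
  everywhere by the one-sided result above, and it is unspecified where the limit does not exist.\<close>

definition ddir :: "('a::real_normed_vector \<Rightarrow> 'b::real_normed_vector) \<Rightarrow> 'a \<Rightarrow> 'a \<Rightarrow> 'b" where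
  "ddir f v x = lim (\<lambda>k. dquot f v k x)"

lemma right_derivative_imp_dquot_tendsto:
  fixes f :: "'a::real_normed_vector \<Rightarrow> real"
  assumes "((\<lambda>h. (f (x + h *\<^sub>R v) - f x) / h) \<longlongrightarrow> D) (at_right 0)"
  shows "(\<lambda>k. dquot f v k x) \<longlonglongrightarrow> D"
proof -
  have "filterlim (\<lambda>k. inverse (real (Suc k))) (at_right 0) sequentially"
    by (auto simp: filterlim_at simp del: of_nat_Suc intro: LIMSEQ_inverse_real_of_nat)
  from filterlim_compose[OF assms this] show ?thesis
    by (simp add: dquot_def field_simps del: of_nat_Suc)
qed

lemma has_derivative_imp_dquot_tendsto:
  assumes "(f has_derivative f') (at x)"
  shows "(\<lambda>k. dquot f v k x) \<longlonglongrightarrow> f' v"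
proof -
  have lin: "linear f'" using assms has_derivative_linear by blast
  have "((\<lambda>h. norm (f (x + h) - f x - f' h) / norm h) \<longlongrightarrow> 0) (at 0)"
    using assms by (simp add: has_derivative_at)
  show ?thesis
  proof (cases "v = 0")
    case True
    then show ?thesis using linear_0[OF lin] by (simp add: dquot_def)
  next
    case False
    have "filterlim (\<lambda>k. v /\<^sub>R real (Suc k)) (at 0) sequentially"
      unfolding filterlim_at
    proof (intro conjI)
      have "(\<lambda>k. inverse (real (Suc k)) *\<^sub>R v) \<longlonglongrightarrow> 0 *\<^sub>R v"
        by (intro tendsto_intros LIMSEQ_inverse_real_of_nat)
      then show "(\<lambda>k. v /\<^sub>R real (Suc k)) \<longlonglongrightarrow> 0" by simp
    qed (use False in simp)
    from filterlim_compose[OF \<open>((\<lambda>h. norm (f (x + h) - f x - f' h) / norm h) \<longlongrightarrow> 0) (at 0)\<close> this]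
    have "(\<lambda>k. norm v * (norm (f (x + v /\<^sub>R real (Suc k)) - f x - f' (v /\<^sub>R real (Suc k))) / norm (v /\<^sub>R real (Suc k)))) \<longlonglongrightarrow> norm v * 0"
      by (intro tendsto_intros)
    moreover have "norm v * (norm (f (x + v /\<^sub>R real (Suc k)) - f x - f' (v /\<^sub>R real (Suc k))) / norm (v /\<^sub>R real (Suc k)))
        = norm (dquot f v k x - f' v)" for k
    proof -
      have "dquot f v k x - f' v = real (Suc k) *\<^sub>R (f (x + v /\<^sub>R real (Suc k)) - f x - f' (v /\<^sub>R real (Suc k)))"
        by (simp add: dquot_def linear_cmul[OF lin] scaleR_diff_right del: of_nat_Suc)
      moreover have "norm (v /\<^sub>R real (Suc k)) = norm v / real (Suc k)" by (simp add: divide_inverse mult.commute)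
      ultimately show ?thesis using False by (simp del: of_nat_Suc)
    qed
    ultimately have "(\<lambda>k. norm (dquot f v k x - f' v)) \<longlonglongrightarrow> 0" by simp
    then show ?thesis by (metis LIM_zero_cancel tendsto_norm_zero_cancel)
  qed
qed

lemma ddir_eq: "(\<lambda>k. dquot f v k x) \<longlonglongrightarrow> D \<Longrightarrow> ddir f v x = D"
  unfolding ddir_def by (rule limI)

lemma has_derivative_imp_ddir: "(f has_derivative f') (at x) \<Longrightarrow> ddir f v x = f' v"
  by (rule ddir_eq[OF has_derivative_imp_dquot_tendsto])

lemma dquot_bound:
  assumes "L-lipschitz_on UNIV f"
  shows "norm (dquot f v k x) \<le> L * norm v"
  using lipschitz_onD[OF assms, of "x + v /\<^sub>R real (Suc k)" x]
  by (simp add: dquot_def dist_norm pos_le_divide_eq mult.commute divide_inverse[symmetric] del: of_nat_Suc)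

lemma dquot_continuous:
  fixes f :: "'a::real_normed_vector \<Rightarrow> 'b::real_normed_vector"
  assumes "continuous_on UNIV f"
  shows "continuous_on UNIV (dquot f v k)"
  unfolding dquot_def[abs_def] by (intro continuous_intros continuous_on_compose2[OF assms]) auto

lemma ddir_borel_measurable:
  fixes f :: "'a::euclidean_space \<Rightarrow> 'b::euclidean_space"
  assumes "continuous_on UNIV f"
  shows "ddir f v \<in> borel_measurable borel"
  unfolding ddir_def[abs_def]
  by (intro borel_measurable_lim_metric borel_measurable_continuous_onI dquot_continuous assms)

lemma lipschitz_inner:
  fixes f :: "'a::metric_space \<Rightarrow> 'b::euclidean_space"
  assumes "L-lipschitz_on S f" "i \<in> Basis"
  shows "L-lipschitz_on S (\<lambda>x. f x \<bullet> i)"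
proof (rule lipschitz_onI)
  show "0 \<le> L" using assms lipschitz_on_nonneg by blast
  fix x y assume "x \<in> S" "y \<in> S"
  have "\<bar>f x \<bullet> i - f y \<bullet> i\<bar> \<le> norm (f x - f y)"
    using Basis_le_norm[OF assms(2), of "f x - f y"] by (simp add: inner_diff_left)
  also have "\<dots> \<le> L * dist x y" using lipschitz_onD[OF assms(1) \<open>x \<in> S\<close> \<open>y \<in> S\<close>] by (simp add: dist_norm)
  finally show "dist (f x \<bullet> i) (f y \<bullet> i) \<le> L * dist x y" by (simp add: dist_real_def)
qed

lemma dquot_inner: "dquot f v k x \<bullet> i = dquot (\<lambda>x. f x \<bullet> i) v k x"
  by (simp add: dquot_def inner_diff_left)

lemma lipschitz_AE_dquot_tendsto:
  fixes f :: "'a::euclidean_space \<Rightarrow> 'b::euclidean_space"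
  assumes lip: "L-lipschitz_on UNIV f"
  shows "AE x in lborel. (\<lambda>k. dquot f v k x) \<longlonglongrightarrow> ddir f v x"
proof -
  have "AE x in lborel. \<exists>D. (\<lambda>k. dquot (\<lambda>x. f x \<bullet> i) v k x) \<longlonglongrightarrow> D" if "i \<in> Basis" for i
    using lipschitz_AE_right_derivative[OF lipschitz_inner[OF lip that], of v]
  proof (rule eventually_mono)
    fix x assume "\<exists>D. ((\<lambda>h. (f (x + h *\<^sub>R v) \<bullet> i - f x \<bullet> i) / h) \<longlongrightarrow> D) (at_right 0)"
    then show "\<exists>D. (\<lambda>k. dquot (\<lambda>x. f x \<bullet> i) v k x) \<longlonglongrightarrow> D"
      using right_derivative_imp_dquot_tendsto[of "\<lambda>x. f x \<bullet> i" x v] by fast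
  qed
  then have "AE x in lborel. \<forall>i\<in>Basis. \<exists>D. (\<lambda>k. dquot (\<lambda>x. f x \<bullet> i) v k x) \<longlonglongrightarrow> D"
    by (intro AE_ball_countable[THEN iffD2]) (auto intro: countable_finite)
  then show ?thesis
  proof (rule eventually_mono)
    fix x assume "\<forall>i\<in>Basis. \<exists>D. (\<lambda>k. dquot (\<lambda>x. f x \<bullet> i) v k x) \<longlonglongrightarrow> D"
    then obtain D where D: "\<And>i. i \<in> Basis \<Longrightarrow> (\<lambda>k. dquot (\<lambda>x. f x \<bullet> i) v k x) \<longlonglongrightarrow> D i" by metis
    have "(\<lambda>k. \<Sum>i\<in>Basis. (dquot f v k x \<bullet> i) *\<^sub>R i) \<longlonglongrightarrow> (\<Sum>i\<in>Basis. D i *\<^sub>R i)"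
      unfolding dquot_inner by (intro tendsto_sum tendsto_scaleR D tendsto_const)
    then have "(\<lambda>k. dquot f v k x) \<longlonglongrightarrow> (\<Sum>i\<in>Basis. D i *\<^sub>R i)"
      by (simp add: euclidean_representation)
    then show "(\<lambda>k. dquot f v k x) \<longlonglongrightarrow> ddir f v x" using ddir_eq by fastforce
  qed
qed

lemma ddir_bound:
  assumes "L-lipschitz_on UNIV f" "(\<lambda>k. dquot f v k x) \<longlonglongrightarrow> ddir f v x"
  shows "norm (ddir f v x) \<le> L * norm v"
  by (rule LIMSEQ_le_const2[OF tendsto_norm[OF assms(2)]]) (use dquot_bound[OF assms(1)] in auto)

lemma lborel_integral_translation:
  fixes g :: "'a::euclidean_space \<Rightarrow> 'b::euclidean_space"
  assumes "g \<in> borel_measurable borel"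
  shows "integral\<^sup>L lborel (\<lambda>x. g (x + c)) = integral\<^sup>L lborel g"
proof -
  have "integral\<^sup>L lborel g = integral\<^sup>L (distr lborel borel ((+) c)) g" by (simp add: lborel_distr_plus)
  also have "\<dots> = integral\<^sup>L lborel (\<lambda>x. g (c + x))" by (rule integral_distr) (use assms in auto)
  finally show ?thesis by (simp add: add.commute)
qed

lemma integrable_compact_support:
  fixes g :: "'a::euclidean_space \<Rightarrow> 'b::euclidean_space"
  assumes "continuous_on UNIV g" "compact K" "\<And>x. x \<notin> K \<Longrightarrow> g x = 0"
  shows "integrable lborel g"
proof -
  have "integrable lborel (\<lambda>x. indicator K x *\<^sub>R g x)"
    by (rule borel_integrable_compact[OF assms(2) continuous_on_subset[OF assms(1) subset_UNIV]])
  moreover have "(\<lambda>x. indicator K x *\<^sub>R g x) = g" using assms(3) by (auto simp: indicator_def)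
  ultimately show ?thesis by simp
qed

text \<open>The sign sits in the direction because a translation turns forward steps along \<open>v\<close> into
  forward steps along \<open>-v\<close>, which for one-sided derivatives is not yet known to be the same as a sign in front.\<close>

lemma integral_by_parts_lipschitz:
  fixes f :: "'a::euclidean_space \<Rightarrow> 'b::euclidean_space" and \<phi> :: "'a \<Rightarrow> real"
  assumes f: "L-lipschitz_on UNIV f" and \<phi>: "M-lipschitz_on UNIV \<phi>"
    and K: "compact K" "\<And>x. x \<notin> K \<Longrightarrow> \<phi> x = 0"
  shows "integral\<^sup>L lborel (\<lambda>x. \<phi> x *\<^sub>R ddir f v x) = integral\<^sup>L lborel (\<lambda>x. ddir \<phi> (- v) x *\<^sub>R f x)"
proof -
  have fc: "continuous_on UNIV f" and \<phi>c: "continuous_on UNIV \<phi>"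
    using f \<phi> lipschitz_on_continuous_on by blast+
  have fc': "continuous_on S f" "continuous_on S \<phi>" for S using fc \<phi>c continuous_on_subset by blast+
  obtain R where R: "K \<subseteq> cball 0 R" using compact_imp_bounded[OF K(1)] by (force simp: bounded_iff)
  \<comment> \<open>The steps of all the difference quotients have length at most
    \<open>norm v\<close>, so this ball contains the support of every translate of
    \<open>\<phi>\<close> that occurs.\<close>
  let ?C = "cball (0::'a) (R + norm v)"
  have \<phi>0: "\<phi> x = 0" if "x \<notin> cball 0 R" for x using K(2) R that by blast
  have \<phi>0': "\<phi> (x - v /\<^sub>R real (Suc k)) = 0" if "x \<notin> ?C" for x k
  proof (rule \<phi>0)
    have "norm x \<le> norm (x - v /\<^sub>R real (Suc k)) + norm (v /\<^sub>R real (Suc k))" by (metis diff_add_cancel norm_triangle_ineq)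
    also have "norm (v /\<^sub>R real (Suc k)) \<le> norm v"
      by (simp add: divide_inverse mult_left_le_one_le inverse_le_1_iff)
    finally show "x - v /\<^sub>R real (Suc k) \<notin> cball 0 R" using that by auto
  qed
  have \<phi>0'': "\<phi> x = 0" if "x \<notin> ?C" for x using that by (intro \<phi>0) (auto intro: order_trans)
  have \<phi>q0: "dquot \<phi> (- v) k x = 0" if "x \<notin> ?C" for x k
    using \<phi>0'[OF that, of k] \<phi>0''[OF that] by (simp add: dquot_def)
  \<comment> \<open>An exact discrete version of the claim: a translation of the integration
    variable moves the increment from \<open>f\<close> to \<open>\<phi>\<close>. The limit is taken
    only afterwards.\<close>
  have eq: "integral\<^sup>L lborel (\<lambda>x. \<phi> x *\<^sub>R dquot f v k x) = integral\<^sup>L lborel (\<lambda>x. dquot \<phi> (- v) k x *\<^sub>R f x)" for k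
  proof -
    let ?h = "v /\<^sub>R real (Suc k)" and ?n = "real (Suc k)"
    have i1: "integrable lborel (\<lambda>x. \<phi> x *\<^sub>R f (x + ?h))"
      by (rule integrable_compact_support[OF _ compact_cball[of 0 R]])
         (auto intro!: continuous_intros fc' continuous_on_compose2[OF fc] simp: \<phi>0)
    have i2: "integrable lborel (\<lambda>x. \<phi> x *\<^sub>R f x)"
      by (rule integrable_compact_support[OF _ compact_cball[of 0 R]])
         (auto intro!: continuous_intros fc' simp: \<phi>0)
    have c3: "continuous_on UNIV (\<lambda>x. \<phi> (x - ?h) *\<^sub>R f x)"
      by (intro continuous_intros fc' continuous_on_compose2[OF \<phi>c]) auto
    have i3: "integrable lborel (\<lambda>x. \<phi> (x - ?h) *\<^sub>R f x)"
      by (rule integrable_compact_support[OF c3 compact_cball[of 0 "R + norm v"]]) (metis \<phi>0' scaleR_zero_left)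
    have "integral\<^sup>L lborel (\<lambda>x. \<phi> x *\<^sub>R dquot f v k x) = 
       integral\<^sup>L lborel (\<lambda>x. ?n *\<^sub>R (\<phi> x *\<^sub>R f (x + ?h) - \<phi> x *\<^sub>R f x))"
      by (simp add: dquot_def algebra_simps)
    also have "\<dots> = ?n *\<^sub>R (integral\<^sup>L lborel (\<lambda>x. \<phi> x *\<^sub>R f (x + ?h)) - integral\<^sup>L lborel (\<lambda>x. \<phi> x *\<^sub>R f x))"
      using i1 i2 by (simp del: of_nat_Suc)
    also have "integral\<^sup>L lborel (\<lambda>x. \<phi> x *\<^sub>R f (x + ?h)) = integral\<^sup>L lborel (\<lambda>x. \<phi> (x - ?h) *\<^sub>R f x)"
      using lborel_integral_translation[OF borel_measurable_continuous_onI[OF c3], of ?h] by simp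
    also have "?n *\<^sub>R (integral\<^sup>L lborel (\<lambda>x. \<phi> (x - ?h) *\<^sub>R f x) - integral\<^sup>L lborel (\<lambda>x. \<phi> x *\<^sub>R f x))
       = integral\<^sup>L lborel (\<lambda>x. ?n *\<^sub>R (\<phi> (x - ?h) *\<^sub>R f x - \<phi> x *\<^sub>R f x))"
      using i3 i2 by (simp del: of_nat_Suc)
    also have "\<dots> = integral\<^sup>L lborel (\<lambda>x. dquot \<phi> (- v) k x *\<^sub>R f x)"
      by (simp add: dquot_def algebra_simps)
    finally show ?thesis .
  qed
  have ind: "integrable lborel (\<lambda>x. indicator ?C x * g x)" if "continuous_on UNIV g" for g :: "'a \<Rightarrow> real"
    using borel_integrable_compact[of ?C g] that continuous_on_subset by fastforce
  have "(\<lambda>k. integral\<^sup>L lborel (\<lambda>x. \<phi> x *\<^sub>R dquot f v k x)) \<longlonglongrightarrow> integral\<^sup>L lborel (\<lambda>x. \<phi> x *\<^sub>R ddir f v x)"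
  proof (rule integral_dominated_convergence[where w="\<lambda>x. indicator ?C x * (\<bar>\<phi> x\<bar> * (L * norm v))"])
    show "(\<lambda>x. \<phi> x *\<^sub>R dquot f v k x) \<in> borel_measurable lborel" for k
      using \<phi>c dquot_continuous[OF fc] by (simp add: borel_measurable_continuous_onI borel_measurable_scaleR)
    show "(\<lambda>x. \<phi> x *\<^sub>R ddir f v x) \<in> borel_measurable lborel"
      using \<phi>c ddir_borel_measurable[OF fc] by (simp add: borel_measurable_continuous_onI borel_measurable_scaleR)
    show "integrable lborel (\<lambda>x. indicator ?C x * (\<bar>\<phi> x\<bar> * (L * norm v)))" by (intro ind continuous_intros fc')
    show "AE x in lborel. (\<lambda>k. \<phi> x *\<^sub>R dquot f v k x) \<longlonglongrightarrow> \<phi> x *\<^sub>R ddir f v x"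
      using lipschitz_AE_dquot_tendsto[OF f, of v] by (rule eventually_mono) (intro tendsto_intros)
    show "AE x in lborel. norm (\<phi> x *\<^sub>R dquot f v k x) \<le> indicator ?C x * (\<bar>\<phi> x\<bar> * (L * norm v))" for k
      using dquot_bound[OF f, of v k] \<phi>0'' by (intro AE_I2) (auto simp: indicator_def intro!: mult_left_mono)
  qed
  moreover have "(\<lambda>k. integral\<^sup>L lborel (\<lambda>x. dquot \<phi> (-v) k x *\<^sub>R f x)) \<longlonglongrightarrow> integral\<^sup>L lborel (\<lambda>x. ddir \<phi> (-v) x *\<^sub>R f x)"
  proof (rule integral_dominated_convergence[where w="\<lambda>x. indicator ?C x * (M * norm v * norm (f x))"])
    show "(\<lambda>x. dquot \<phi> (-v) k x *\<^sub>R f x) \<in> borel_measurable lborel" for k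
      using fc dquot_continuous[OF \<phi>c] by (simp add: borel_measurable_continuous_onI borel_measurable_scaleR)
    show "(\<lambda>x. ddir \<phi> (-v) x *\<^sub>R f x) \<in> borel_measurable lborel"
      using fc ddir_borel_measurable[OF \<phi>c] by (simp add: borel_measurable_continuous_onI borel_measurable_scaleR)
    show "integrable lborel (\<lambda>x. indicator ?C x * (M * norm v * norm (f x)))" by (intro ind continuous_intros fc')
    show "AE x in lborel. (\<lambda>k. dquot \<phi> (-v) k x *\<^sub>R f x) \<longlonglongrightarrow> ddir \<phi> (-v) x *\<^sub>R f x"
      using lipschitz_AE_dquot_tendsto[OF \<phi>, of "-v"] by (rule eventually_mono) (intro tendsto_intros)
    show "AE x in lborel. norm (dquot \<phi> (-v) k x *\<^sub>R f x) \<le> indicator ?C x * (M * norm v * norm (f x))" for k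
    proof (rule AE_I2)
      fix x
      show "norm (dquot \<phi> (-v) k x *\<^sub>R f x) \<le> indicator ?C x * (M * norm v * norm (f x))"
      proof (cases "x \<in> ?C")
        case True
        then show ?thesis using dquot_bound[OF \<phi>, of "-v" k x] by (auto intro!: mult_right_mono)
      next
        case False
        from \<phi>q0[OF this] False show ?thesis by simp
      qed
    qed
  qed
  ultimately show ?thesis unfolding eq using LIMSEQ_unique by blast
qed

lemma test_function_derivative:
  assumes t: "test_function \<Omega> \<phi>"
  shows "(\<phi> has_derivative (\<lambda>v. \<Sum>b\<in>Basis. (v \<bullet> b) * partial b \<phi> x)) (at x)"
proof -
  have d: "\<phi> differentiable at x" using t by (auto simp: test_function_def smooth_fun_def dest!: spec[of _ "[]"])
  then have "(\<phi> has_derivative frechet_derivative \<phi> (at x)) (at x)" by (simp add: frechet_derivative_works)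
  moreover have "frechet_derivative \<phi> (at x) v = (\<Sum>b\<in>Basis. (v \<bullet> b) * partial b \<phi> x)" for v
  proof -
    have "frechet_derivative \<phi> (at x) (\<Sum>b\<in>Basis. (v \<bullet> b) *\<^sub>R b) = (\<Sum>b\<in>Basis. (v \<bullet> b) *\<^sub>R frechet_derivative \<phi> (at x) b)"
      using linear_frechet_derivative[OF d] by (simp add: linear_sum linear_cmul)
    then show ?thesis by (simp add: euclidean_representation partial_def)
  qed
  ultimately show ?thesis by (auto elim!: has_derivative_eq_rhs)
qed

lemma test_function_ddir:
  assumes t: "test_function \<Omega> \<phi>"
  shows "ddir \<phi> v x = (\<Sum>b\<in>Basis. (v \<bullet> b) * partial b \<phi> x)"
  by (rule has_derivative_imp_ddir[OF test_function_derivative[OF t]])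

lemma test_function_partial_continuous:
  assumes t: "test_function \<Omega> \<phi>"
  shows "continuous_on UNIV (partial b \<phi>)"
proof -
  have "partial b \<phi> differentiable at x" for x
    using t by (auto simp: test_function_def smooth_fun_def dest!: spec[of _ "[b]"])
  then show ?thesis by (simp add: continuous_at_imp_continuous_on differentiable_imp_continuous_within)
qed

lemma test_function_partial_zero:
  assumes t: "test_function \<Omega> \<phi>" and K: "compact K" "\<And>x. x \<notin> K \<Longrightarrow> \<phi> x = 0" and x: "x \<notin> K"
  shows "partial b \<phi> x = 0"
proof -
  have "((\<lambda>_. 0::real) has_derivative (\<lambda>_. 0)) (at x)" by simp
  then have "(\<phi> has_derivative (\<lambda>_. 0)) (at x)"
    by (rule has_derivative_transform_within_open[where s="-K"])
       (use x K in \<open>auto simp: compact_imp_closed open_Compl\<close>)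
  then show ?thesis unfolding partial_def using frechet_derivative_at[of \<phi> "\<lambda>_. 0" x] by metis
qed

lemma test_function_lipschitz:
  fixes \<phi> :: "'a::euclidean_space \<Rightarrow> real"
  assumes t: "test_function \<Omega> \<phi>"
  shows "\<exists>M. M-lipschitz_on UNIV \<phi>"
proof -
  obtain K where K: "compact K" "\<And>x. x \<notin> K \<Longrightarrow> \<phi> x = 0" using t by (auto simp: test_function_def)
  note p0 = test_function_partial_zero[OF t K] and pc = test_function_partial_continuous[OF t]
  have "\<exists>B. \<forall>x. \<bar>partial b \<phi> x\<bar> \<le> B" for b
  proof -
    have "compact (partial b \<phi> ` K)" using pc K continuous_on_subset by (blast intro: compact_continuous_image)
    then obtain B where "\<And>x. x \<in> K \<Longrightarrow> \<bar>partial b \<phi> x\<bar> \<le> B"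
      using compact_imp_bounded by (force simp: bounded_iff)
    then have "\<bar>partial b \<phi> x\<bar> \<le> max B 0" for x using p0[of x b] by (cases "x \<in> K") (auto simp: le_max_iff_disj)
    then show ?thesis by blast
  qed
  then obtain B where B: "\<And>b x. \<bar>partial b \<phi> x\<bar> \<le> B b" by metis
  have B0: "0 \<le> B b" for b using B[of b 0] by linarith
  have "(\<Sum>b\<in>(Basis::'a set). B b)-lipschitz_on UNIV \<phi>"
  proof (rule lipschitz_onI)
    show "0 \<le> (\<Sum>b\<in>(Basis::'a set). B b)" using B0 by (intro sum_nonneg) auto
    fix x y
    have "norm (\<phi> x - \<phi> y) \<le> (\<Sum>b\<in>(Basis::'a set). B b) * norm (x - y)"
    proof (rule differentiable_bound[of UNIV \<phi>])
      show "(\<phi> has_derivative (\<lambda>v. \<Sum>b\<in>Basis. (v \<bullet> b) * partial b \<phi> x)) (at x within UNIV)" for x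
        using test_function_derivative[OF t] by simp
      show "onorm (\<lambda>v. \<Sum>b\<in>Basis. (v \<bullet> b) * partial b \<phi> x) \<le> (\<Sum>b\<in>Basis. B b)" for x
      proof (rule onorm_le)
        fix v
        have "norm (\<Sum>b\<in>Basis. (v \<bullet> b) * partial b \<phi> x) \<le> (\<Sum>b\<in>Basis. \<bar>v \<bullet> b\<bar> * \<bar>partial b \<phi> x\<bar>)"
          by (rule order_trans[OF norm_sum]) (simp add: abs_mult)
        also have "\<dots> \<le> (\<Sum>b\<in>Basis. norm v * B b)"
          by (intro sum_mono mult_mono B) (auto simp: Basis_le_norm)
        finally show "norm (\<Sum>b\<in>Basis. (v \<bullet> b) * partial b \<phi> x) \<le> (\<Sum>b\<in>Basis. B b) * norm v"
          by (simp add: sum_distrib_left mult.commute)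
      qed
    qed auto
    then show "dist (\<phi> x) (\<phi> y) \<le> (\<Sum>b\<in>(Basis::'a set). B b) * dist x y" by (simp add: dist_norm)
  qed
  then show ?thesis by blast
qed

lemma integral_by_parts_test:
  fixes f :: "'a::euclidean_space \<Rightarrow> 'b::euclidean_space"
  assumes f: "L-lipschitz_on UNIV f" and t: "test_function \<Omega> \<phi>"
  shows "integral\<^sup>L lborel (\<lambda>x. \<phi> x *\<^sub>R ddir f v x) = - integral\<^sup>L lborel (\<lambda>x. (\<Sum>b\<in>Basis. (v \<bullet> b) * partial b \<phi> x) *\<^sub>R f x)"
proof -
  obtain M where M: "M-lipschitz_on UNIV \<phi>" using test_function_lipschitz[OF t] by blast
  obtain K where K: "compact K" "\<And>x. x \<notin> K \<Longrightarrow> \<phi> x = 0" using t by (auto simp: test_function_def)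
  have "ddir \<phi> (-v) x *\<^sub>R f x = - ((\<Sum>b\<in>Basis. (v \<bullet> b) * partial b \<phi> x) *\<^sub>R f x)" for x
    by (simp add: test_function_ddir[OF t] sum_negf)
  then show ?thesis using integral_by_parts_lipschitz[OF f M K, of v] by (simp add: sum_negf)
qed

text \<open>By compactness finitely many directions of \<open>D\<close> form an \<epsilon>-net of
  the unit sphere, so the limits are uniform over the net. Replacing a unit vector by a net point
  costs \<open>L * \<epsilon>\<close> in \<open>f\<close> and \<open>\<epsilon> * norm g\<close> in
  the linear part; the choice of \<epsilon> makes the three errors add up to
  \<open>e\<close>.\<close>

lemma lipschitz_derivative_from_dense_directions:
  fixes f :: "'a::euclidean_space \<Rightarrow> real"
  assumes lip: "L-lipschitz_on UNIV f"
    and dense: "\<And>X. open X \<Longrightarrow> X \<noteq> {} \<Longrightarrow> \<exists>d\<in>D. d \<in> X"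
    and dir: "\<And>v. v \<in> D \<Longrightarrow> ((\<lambda>h. (f (x + h *\<^sub>R v) - f x) / h) \<longlongrightarrow> v \<bullet> g) (at_right 0)"
  shows "(f has_derivative (\<lambda>v. v \<bullet> g)) (at x)"
  unfolding has_derivative_at_alt
proof (intro conjI allI impI)
  show "bounded_linear (\<lambda>v. v \<bullet> g)" by (rule bounded_linear_inner_left)
  fix e :: real assume e: "e > 0"
  define \<epsilon> where "\<epsilon> = e / (L + 1 + norm g)"
  have L0: "L \<ge> 0" using lip lipschitz_on_nonneg by blast
  then have pos: "L + 1 + norm g > 0" by (simp add: add_nonneg_pos add_pos_nonneg)
  have \<epsilon>: "\<epsilon> > 0" using e pos by (simp add: \<epsilon>_def)
  have "sphere 0 1 \<subseteq> (\<Union>v\<in>D. ball v \<epsilon>)"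
  proof
    fix w :: 'a
    obtain d where "d \<in> D" "d \<in> ball w \<epsilon>" using dense[of "ball w \<epsilon>"] \<epsilon> by auto
    then show "w \<in> (\<Union>v\<in>D. ball v \<epsilon>)" by (auto simp: dist_commute)
  qed
  then obtain F where F: "F \<subseteq> D" "finite F" "sphere 0 1 \<subseteq> (\<Union>v\<in>F. ball v \<epsilon>)"
    using compactE_image[OF compact_sphere[of 0 1], of D "\<lambda>v. ball v \<epsilon>"] by blast
  have "\<forall>\<^sub>F h in at_right 0. \<forall>v\<in>F. \<bar>(f (x + h *\<^sub>R v) - f x) / h - v \<bullet> g\<bar> < \<epsilon>"
    using F(1,2) tendstoD[OF dir \<epsilon>] by (intro eventually_ball_finite) (auto simp: dist_real_def)
  then obtain d where d: "d > 0" "\<And>h v. 0 < h \<Longrightarrow> h < d \<Longrightarrow> v \<in> F \<Longrightarrow> \<bar>(f (x + h *\<^sub>R v) - f x) / h - v \<bullet> g\<bar> < \<epsilon>"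
    unfolding eventually_at_right_field by auto
  show "\<exists>d>0. \<forall>y. norm (y - x) < d \<longrightarrow> norm (f y - f x - (y - x) \<bullet> g) \<le> e * norm (y - x)"
  proof (intro exI[of _ d] conjI allI impI)
    show "d > 0" by fact
    fix y assume y: "norm (y - x) < d"
    show "norm (f y - f x - (y - x) \<bullet> g) \<le> e * norm (y - x)"
    proof (cases "y = x")
      case False
      define h w where "h = norm (y - x)" and "w = (y - x) /\<^sub>R h"
      have h: "0 < h" "h < d" and yw: "y = x + h *\<^sub>R w" "norm w = 1" using False y by (auto simp: h_def w_def)
      then obtain v where v: "v \<in> F" "norm (v - w) < \<epsilon>" using F(3) by (force simp: dist_norm)
      have 1: "\<bar>f (x + h *\<^sub>R w) - f (x + h *\<^sub>R v)\<bar> \<le> L * (h * \<epsilon>)"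
      proof -
        have "\<bar>f (x + h *\<^sub>R w) - f (x + h *\<^sub>R v)\<bar> \<le> L * norm (h *\<^sub>R (w - v))"
          using lipschitz_onD[OF lip, of "x + h *\<^sub>R w" "x + h *\<^sub>R v"]
          by (simp add: dist_real_def dist_norm scaleR_diff_right)
        also have "\<dots> \<le> L * (h * \<epsilon>)" using v h L0 by (intro mult_left_mono) (auto simp: norm_minus_commute)
        finally show ?thesis .
      qed
      have 2: "\<bar>f (x + h *\<^sub>R v) - f x - h * (v \<bullet> g)\<bar> \<le> h * \<epsilon>"
      proof -
        have "f (x + h *\<^sub>R v) - f x - h * (v \<bullet> g) = h * ((f (x + h *\<^sub>R v) - f x) / h - v \<bullet> g)"
          using h by (simp add: field_simps)
        then show ?thesis using d(2)[OF h v(1)] h by (simp add: abs_mult)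
      qed
      have 3: "\<bar>h * (v \<bullet> g) - h * (w \<bullet> g)\<bar> \<le> h * (\<epsilon> * norm g)"
      proof -
        have "\<bar>(v - w) \<bullet> g\<bar> \<le> norm (v - w) * norm g" by (rule Cauchy_Schwarz_ineq2)
        also have "\<dots> \<le> \<epsilon> * norm g" using v by (intro mult_right_mono) auto
        finally have "h * \<bar>(v - w) \<bullet> g\<bar> \<le> h * (\<epsilon> * norm g)" using h by (intro mult_left_mono) auto
        then show ?thesis using h by (simp add: abs_mult inner_diff_left flip: right_diff_distrib)
      qed
      have "\<bar>f y - f x - h * (w \<bullet> g)\<bar> \<le> L * (h * \<epsilon>) + h * \<epsilon> + h * (\<epsilon> * norm g)"
        using 1 2 3 unfolding yw(1) by linarith
      also have "\<dots> = (\<epsilon> * (L + 1 + norm g)) * h" by (simp add: algebra_simps)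
      also have "\<dots> = e * h" using pos by (simp add: \<epsilon>_def)
      finally have "\<bar>f y - f x - h * (w \<bullet> g)\<bar> \<le> e * h" .
      moreover have "(y - x) \<bullet> g = h * (w \<bullet> g)" unfolding yw(1) by (simp only: add_diff_cancel_left' inner_scaleR_left)
      ultimately show ?thesis unfolding h_def[symmetric] by (simp only: real_norm_def)
    qed simp
  qed
qed

text \<open>Almost everywhere linearity in a fixed direction \<open>v\<close> comes from integration
  by parts: the derivative moves to a smooth test function, where it is linear in \<open>v\<close>,
  and the fundamental lemma removes the test function. The exceptional set depends on
  \<open>v\<close>, so this is done for a countable dense set of directions, and the Lipschitz bound
  supplies the others.\<close>

theorem rademacher_real:
  fixes f :: "'a::euclidean_space \<Rightarrow> real"
  assumes lip: "L-lipschitz_on UNIV f"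
  shows "AE x in lborel. f differentiable (at x)"
proof -
  have fc: "continuous_on UNIV f" using lip lipschitz_on_continuous_on by blast
  obtain D :: "'a set" where D: "countable D" "\<And>X. open X \<Longrightarrow> X \<noteq> {} \<Longrightarrow> \<exists>d\<in>D. d \<in> X"
    using countable_dense_setE by metis
  have lin: "AE x in lborel. ddir f v x = (\<Sum>b\<in>Basis. (v \<bullet> b) * ddir f b x)" for v
  proof -
    let ?g = "\<lambda>x. ddir f v x - (\<Sum>b\<in>Basis. (v \<bullet> b) * ddir f b x)"
    have meas: "ddir f w \<in> borel_measurable borel" for w by (rule ddir_borel_measurable[OF fc])
    have AEb: "AE x in lborel. norm (ddir f w x) \<le> L * norm w" for w
      using lipschitz_AE_dquot_tendsto[OF lip, of w] by (rule eventually_mono) (rule ddir_bound[OF lip])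
    have si: "integrable lborel (\<lambda>x. \<phi> x * ddir f w x)" if \<phi>: "\<phi> \<in> borel_measurable borel" "\<And>x. \<bar>\<phi> x\<bar> \<le> B * indicator (cbox l u) x" for \<phi> l u w B
    proof (rule Bochner_Integration.integrable_bound)
      show "integrable lborel (\<lambda>x. (L * norm w) * (B * indicator (cbox l u) x))"
        by (intro integrable_mult_right) (auto simp: integrable_indicator_iff emeasure_lborel_cbox_eq)
      show "(\<lambda>x. \<phi> x * ddir f w x) \<in> borel_measurable lborel" using \<phi> meas by simp
      show "AE x in lborel. norm (\<phi> x * ddir f w x) \<le> norm ((L * norm w) * (B * indicator (cbox l u) x))"
        using AEb[of w]
      proof (rule eventually_mono)
        fix x assume "norm (ddir f w x) \<le> L * norm w"
        then have "\<bar>\<phi> x\<bar> * \<bar>ddir f w x\<bar> \<le> (B * indicator (cbox l u) x) * (L * norm w)"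
          using \<phi>(2)[of x] by (intro mult_mono) (auto intro: order_trans[OF abs_ge_zero])
        then show "norm (\<phi> x * ddir f w x) \<le> norm ((L * norm w) * (B * indicator (cbox l u) x))"
          unfolding real_norm_def by (subst abs_mult) (simp add: mult.commute)
      qed
    qed
    have "AE x in lebesgue. x \<in> UNIV \<longrightarrow> ?g x = 0"
    proof (rule fundamental_lemma_real)
      show "open (UNIV :: 'a set)" by simp
      fix l u :: 'a
      have i: "integrable lborel (\<lambda>x. indicator (cbox l u) x * ddir f w x)" for w
        by (rule si[where B=1]) auto
      have "integrable lborel (\<lambda>x. indicator (cbox l u) x * ?g x)"
        using i by (simp add: right_diff_distrib sum_distrib_left mult.left_commute)
      then show "set_integrable lebesgue (cbox l u) ?g" using meas
        unfolding set_integrable_def by (subst integrable_completion) auto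
    next
      fix \<phi> :: "'a \<Rightarrow> real" assume t: "test_function UNIV \<phi>"
      obtain M where M: "M-lipschitz_on UNIV \<phi>" using test_function_lipschitz[OF t] by blast
      have \<phi>c: "continuous_on UNIV \<phi>" using M lipschitz_on_continuous_on by blast
      obtain K where K: "compact K" "\<And>x. x \<notin> K \<Longrightarrow> \<phi> x = 0" using t by (auto simp: test_function_def)
      obtain l u where lu: "K \<subseteq> cbox l u" using bounded_subset_cbox_symmetric[OF compact_imp_bounded[OF K(1)]] by metis
      have "compact (\<phi> ` cbox l u)" by (intro compact_continuous_image compact_cbox continuous_on_subset[OF \<phi>c]) auto
      then obtain B where B: "\<And>x. x \<in> cbox l u \<Longrightarrow> \<bar>\<phi> x\<bar> \<le> B" using compact_imp_bounded by (force simp: bounded_iff)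
      have Bi: "\<bar>\<phi> x\<bar> \<le> B * indicator (cbox l u) x" for x using B[of x] K(2)[of x] lu by (auto simp: indicator_def)
      have i: "integrable lborel (\<lambda>x. \<phi> x * ddir f w x)" for w
        by (rule si[OF borel_measurable_continuous_onI[OF \<phi>c] Bi])
      have ibp: "integral\<^sup>L lborel (\<lambda>x. \<phi> x * ddir f w x) = - integral\<^sup>L lborel (\<lambda>x. (\<Sum>b\<in>Basis. (w \<bullet> b) * partial b \<phi> x) * f x)" for w
        using integral_by_parts_test[OF lip t, of w] by simp
      note p0 = test_function_partial_zero[OF t K] and pc = test_function_partial_continuous[OF t]
      have ip: "integrable lborel (\<lambda>x. partial b \<phi> x * f x)" for b
        by (rule integrable_compact_support[OF _ K(1)]) (auto intro!: continuous_intros pc fc simp: p0)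
      have one: "integral\<^sup>L lborel (\<lambda>x. \<phi> x * ddir f b x) = - integral\<^sup>L lborel (\<lambda>x. partial b \<phi> x * f x)" if "b \<in> Basis" for b
      proof -
        have "(\<Sum>c\<in>Basis. (b \<bullet> c) * partial c \<phi> x) = partial b \<phi> x" for x
          using that by (simp add: inner_Basis if_distrib[of "\<lambda>t. t * _"] sum.delta cong: if_cong)
        then show ?thesis using ibp[of b] by simp
      qed
      have "(LINT x:UNIV|lebesgue. \<phi> x * ?g x) = integral\<^sup>L lborel (\<lambda>x. \<phi> x * ?g x)"
        using meas borel_measurable_continuous_onI[OF \<phi>c]
        unfolding set_lebesgue_integral_def by (subst integral_completion) auto
      also have "\<dots> = integral\<^sup>L lborel (\<lambda>x. \<phi> x * ddir f v x) - (\<Sum>b\<in>Basis. (v \<bullet> b) * integral\<^sup>L lborel (\<lambda>x. \<phi> x * ddir f b x))"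
      proof -
        have "integral\<^sup>L lborel (\<lambda>x. \<phi> x * ?g x) = integral\<^sup>L lborel (\<lambda>x. \<phi> x * ddir f v x - (\<Sum>b\<in>Basis. (v \<bullet> b) * (\<phi> x * ddir f b x)))"
          by (simp add: right_diff_distrib sum_distrib_left mult.left_commute)
        also have "\<dots> = integral\<^sup>L lborel (\<lambda>x. \<phi> x * ddir f v x) - integral\<^sup>L lborel (\<lambda>x. \<Sum>b\<in>Basis. (v \<bullet> b) * (\<phi> x * ddir f b x))"
          by (intro Bochner_Integration.integral_diff Bochner_Integration.integrable_sum integrable_mult_right i)
        also have "integral\<^sup>L lborel (\<lambda>x. \<Sum>b\<in>Basis. (v \<bullet> b) * (\<phi> x * ddir f b x)) = (\<Sum>b\<in>Basis. (v \<bullet> b) * integral\<^sup>L lborel (\<lambda>x. \<phi> x * ddir f b x))"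
          by (subst Bochner_Integration.integral_sum) (auto intro: i)
        finally show ?thesis .
      qed
      also have "\<dots> = 0" using one ip by (simp add: ibp[of v] sum_distrib_right mult.assoc sum_negf)
      finally show "(LINT x:UNIV|lebesgue. \<phi> x * ?g x) = 0" .
    qed
    then have "AE x in lborel. ?g x = 0"
      using meas by (subst (asm) AE_completion_iff) auto
    then show ?thesis by (rule eventually_mono) simp
  qed
  have "AE x in lborel. \<forall>v\<in>D. ddir f v x = (\<Sum>b\<in>Basis. (v \<bullet> b) * ddir f b x)"
    using D(1) lin by (intro AE_ball_countable[THEN iffD2]) auto
  moreover have "AE x in lborel. \<forall>v\<in>D. \<exists>d. ((\<lambda>h. (f (x + h *\<^sub>R v) - f x) / h) \<longlongrightarrow> d) (at_right 0)"
    using D(1) lipschitz_AE_right_derivative[OF lip] by (intro AE_ball_countable[THEN iffD2]) auto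
  ultimately show ?thesis
  proof (rule eventually_elim2)
    fix x assume 1: "\<forall>v\<in>D. ddir f v x = (\<Sum>b\<in>Basis. (v \<bullet> b) * ddir f b x)"
      and 2: "\<forall>v\<in>D. \<exists>d. ((\<lambda>h. (f (x + h *\<^sub>R v) - f x) / h) \<longlongrightarrow> d) (at_right 0)"
    have "(f has_derivative (\<lambda>v. v \<bullet> (\<Sum>b\<in>Basis. ddir f b x *\<^sub>R b))) (at x)"
    proof (rule lipschitz_derivative_from_dense_directions[OF lip D(2)])
      fix v assume v: "v \<in> D"
      then obtain d where d: "((\<lambda>h. (f (x + h *\<^sub>R v) - f x) / h) \<longlongrightarrow> d) (at_right 0)" using 2 by blast
      have "d = ddir f v x" using ddir_eq[OF right_derivative_imp_dquot_tendsto[OF d]] by simp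
      also have "\<dots> = v \<bullet> (\<Sum>b\<in>Basis. ddir f b x *\<^sub>R b)"
        using 1 v by (simp add: inner_sum_right mult.commute)
      finally show "((\<lambda>h. (f (x + h *\<^sub>R v) - f x) / h) \<longlongrightarrow> v \<bullet> (\<Sum>b\<in>Basis. ddir f b x *\<^sub>R b)) (at_right 0)" using d by simp
    qed auto
    then show "f differentiable (at x)" unfolding differentiable_def by blast
  qed
qed

theorem rademacher:
  fixes f :: "'a::euclidean_space \<Rightarrow> 'b::euclidean_space"
  assumes lip: "L-lipschitz_on UNIV f"
  shows "AE x in lborel. f differentiable (at x)"
proof -
  have "AE x in lborel. \<forall>i\<in>Basis. (\<lambda>x. f x \<bullet> i) differentiable (at x)"
    using rademacher_real[OF lipschitz_inner[OF lip]] by (intro AE_ball_countable[THEN iffD2]) (auto intro: countable_finite)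
  then show ?thesis by (rule eventually_mono) (rule differentiable_componentwise_within[THEN iffD2])
qed

lemma differentiable_has_derivative_ddir:
  assumes "f differentiable (at x)"
  shows "(f has_derivative (\<lambda>v. ddir f v x)) (at x)"
proof -
  obtain f' where "(f has_derivative f') (at x)" using assms by (auto simp: differentiable_def)
  then show ?thesis using has_derivative_imp_ddir[of f f' x] by (metis (no_types, lifting) ext)
qed

section \<open>Jacobians of Lipschitz maps\<close>

text \<open>Determinants and the change of variables formula are available only for \<open>real ^ 'n\<close> with a
  well-ordered finite index type, hence this copy of the basis.\<close>

typedef (overloaded) ('a::euclidean_space) ix = "Basis :: 'a set"
  morphisms ix_basis mk_ix
  by (rule nonempty_Basis[folded ex_in_conv])

lemma ix_basis_Basis [simp]: "ix_basis i \<in> Basis"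
  by (rule ix_basis)

lemma ix_basis_bij: "bij_betw ix_basis UNIV (Basis :: 'a::euclidean_space set)"
  by (rule bij_betwI[where g=mk_ix]) (auto simp: ix_basis_inverse mk_ix_inverse)

instance ix :: (euclidean_space) finite
proof
  show "finite (UNIV :: 'a ix set)" using ix_basis_bij finite_Basis bij_betw_finite by blast
qed

instantiation ix :: (euclidean_space) wellorder
begin

definition ix_rank :: "'a ix \<Rightarrow> nat" where "ix_rank = (SOME r. inj r)"
definition less_eq_ix :: "'a ix \<Rightarrow> 'a ix \<Rightarrow> bool" where "less_eq_ix i j \<longleftrightarrow> ix_rank i \<le> ix_rank j"
definition less_ix :: "'a ix \<Rightarrow> 'a ix \<Rightarrow> bool" where "less_ix i j \<longleftrightarrow> ix_rank i < ix_rank j"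

lemma ix_rank_inj: "inj ix_rank"
proof -
  have "\<exists>r :: 'a ix \<Rightarrow> nat. inj r" using finite_imp_inj_to_nat_seg[OF finite_class.finite_UNIV] by blast
  then show ?thesis unfolding ix_rank_def by (rule someI_ex)
qed

instance
proof
  fix i j k :: "'a ix"
  show "i < j \<longleftrightarrow> i \<le> j \<and> \<not> j \<le> i" "i \<le> i" "i \<le> j \<or> j \<le> i"
    by (simp_all add: less_eq_ix_def less_ix_def less_le_not_le nat_le_linear)
  show "i \<le> k" if "i \<le> j" "j \<le> k" using that le_trans by (simp add: less_eq_ix_def)
  show "i = j" if "i \<le> j" "j \<le> i"
    using that le_antisym by (intro injD[OF ix_rank_inj]) (simp add: less_eq_ix_def)
next
  fix P :: "'a ix \<Rightarrow> bool" and a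
  assume step: "\<And>x. (\<And>y. y < x \<Longrightarrow> P y) \<Longrightarrow> P x"
  show "P a"
  proof (induction a rule: measure_induct_rule[of ix_rank])
    case (less x)
    show ?case by (rule step) (rule less, simp add: less_ix_def)
  qed
qed

end

lemma card_ix: "CARD('a::euclidean_space ix) = DIM('a)"
  using bij_betw_same_card[OF ix_basis_bij] .

lemma sum_ix: "(\<Sum>i\<in>(UNIV::'a::euclidean_space ix set). f (ix_basis i)) = (\<Sum>b\<in>Basis. f b)"
  by (rule sum.reindex_bij_betw[OF ix_basis_bij])

lemma inner_ix_basis: "ix_basis i \<bullet> ix_basis j = (if i = j then 1 else 0)"
  by (simp add: inner_Basis ix_basis_inject)

section \<open>Isometric coordinates\<close>

definition to_vec :: "'a::euclidean_space \<Rightarrow> real ^ 'a ix" where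
  "to_vec x = (\<chi> i. x \<bullet> ix_basis i)"

definition of_vec :: "real ^ 'a ix \<Rightarrow> 'a::euclidean_space" where
  "of_vec y = (\<Sum>i\<in>UNIV. (y $ i) *\<^sub>R ix_basis i)"

lemma of_vec_inner: "of_vec y \<bullet> ix_basis i = y $ i"
  by (simp add: of_vec_def inner_sum_left inner_ix_basis if_distrib sum.delta cong: if_cong)

lemma to_of_vec [simp]: "to_vec (of_vec y) = y"
  by (simp add: to_vec_def of_vec_inner)

lemma of_to_vec [simp]: "of_vec (to_vec x) = x"
proof -
  have "of_vec (to_vec x) = (\<Sum>b\<in>Basis. (x \<bullet> b) *\<^sub>R b)"
    unfolding of_vec_def to_vec_def by (simp add: sum_ix[of "\<lambda>b. (x \<bullet> b) *\<^sub>R b"])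
  then show ?thesis by (simp add: euclidean_representation)
qed

lemma linear_to_vec: "linear to_vec"
  by (rule linearI) (auto simp: to_vec_def vec_eq_iff inner_add_left)

lemma linear_of_vec: "linear of_vec"
  by (rule linearI) (auto simp: of_vec_def scaleR_add_left sum.distrib scaleR_sum_right)

lemma of_vec_axis: "of_vec (axis j 1) = ix_basis j"
  by (simp add: of_vec_def axis_def if_distrib[of "\<lambda>t. t *\<^sub>R _"] sum.delta cong: if_cong)

lemma to_vec_continuous: "continuous_on S to_vec"
  by (simp add: linear_continuous_on linear_conv_bounded_linear[symmetric] linear_to_vec)

lemma of_vec_continuous: "continuous_on S of_vec"
  by (simp add: linear_continuous_on linear_conv_bounded_linear[symmetric] linear_of_vec)

lemma to_vec_borel [measurable]: "to_vec \<in> borel_measurable borel"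
  by (rule borel_measurable_continuous_onI[OF to_vec_continuous])

lemma of_vec_borel [measurable]: "of_vec \<in> borel_measurable borel"
  by (rule borel_measurable_continuous_onI[OF of_vec_continuous])

text \<open>Boxes correspond to boxes with the same side lengths, and these determine Lebesgue
  measure.\<close>

lemma distr_to_vec: "distr lborel borel to_vec = (lborel :: (real ^ 'a::euclidean_space ix) measure)"
proof (rule lborel_eqI[symmetric])
  fix l u :: "real ^ 'a ix"
  assume le: "\<And>b. b \<in> Basis \<Longrightarrow> l \<bullet> b \<le> u \<bullet> b"
  have leix: "l $ i \<le> u $ i" for i using le[of "axis i 1"] by (simp add: inner_axis axis_in_Basis_iff)
  have pre: "to_vec -` box l u = box (of_vec l) (of_vec u)"
  proof (intro set_eqI)
    fix x :: 'a
    have "x \<in> to_vec -` box l u \<longleftrightarrow> (\<forall>i. l $ i < x \<bullet> ix_basis i \<and> x \<bullet> ix_basis i < u $ i)"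
      by (simp add: mem_box_cart to_vec_def)
    also have "\<dots> \<longleftrightarrow> (\<forall>b\<in>range ix_basis. of_vec l \<bullet> b < x \<bullet> b \<and> x \<bullet> b < of_vec u \<bullet> b)"
      by (simp add: of_vec_inner)
    also have "\<dots> \<longleftrightarrow> x \<in> box (of_vec l) (of_vec u)"
      unfolding mem_box bij_betw_imp_surj_on[OF ix_basis_bij] by simp
    finally show "x \<in> to_vec -` box l u \<longleftrightarrow> x \<in> box (of_vec l) (of_vec u)" .
  qed
  have "emeasure (distr lborel borel to_vec) (box l u) = emeasure lborel (box (of_vec l) (of_vec u))"
    by (subst emeasure_distr) (auto simp: pre)
  also have "\<dots> = ennreal (\<Prod>b\<in>Basis. (of_vec u - of_vec l) \<bullet> b)"
  proof (rule emeasure_lborel_box)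
    fix b :: 'a assume "b \<in> Basis"
    then obtain i where "b = ix_basis i" using ix_basis_bij by (auto simp: bij_betw_def)
    then show "of_vec l \<bullet> b \<le> of_vec u \<bullet> b" using leix by (simp add: of_vec_inner)
  qed
  also have "(\<Prod>b\<in>(Basis::'a set). (of_vec u - of_vec l) \<bullet> b) = (\<Prod>i\<in>UNIV. (u - l) $ i)"
    using prod.reindex_bij_betw[OF ix_basis_bij, of "\<lambda>b. (of_vec u - of_vec l) \<bullet> b"]
    by (simp add: inner_diff_left of_vec_inner)
  also have "\<dots> = (\<Prod>b\<in>Basis. (u - l) \<bullet> b)"
  proof -
    have "bij_betw (\<lambda>i. axis i 1) UNIV (Basis :: (real ^ 'a ix) set)"
      by (auto simp: bij_betw_def inj_on_def axis_eq_axis Basis_vec_def)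
    from prod.reindex_bij_betw[OF this, of "\<lambda>b. (u - l) \<bullet> b"] show ?thesis by (simp add: inner_axis)
  qed
  finally show "emeasure (distr lborel borel to_vec) (box l u) = (\<Prod>b\<in>Basis. (u - l) \<bullet> b)" .
qed simp

text \<open>Formed from \<open>ddir\<close>, hence Borel for every continuous map; it is the true
  Jacobian determinant wherever the map is differentiable.\<close>

definition jac :: "('a::euclidean_space \<Rightarrow> 'a) \<Rightarrow> 'a \<Rightarrow> real" where
  "jac \<Phi> x = det (\<chi> i j. ddir \<Phi> (ix_basis j) x \<bullet> ix_basis i)"

lemma jac_measurable: "continuous_on UNIV \<Phi> \<Longrightarrow> jac \<Phi> \<in> borel_measurable borel"
  unfolding jac_def[abs_def] det_def
  by (auto intro!: borel_measurable_sum borel_measurable_times borel_measurable_prod borel_measurable_inner ddir_borel_measurable)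

section \<open>Determinants\<close>

lemma det_entry_bound:
  fixes A :: "real ^ 'n::finite ^ 'n"
  assumes "\<And>i j. \<bar>A $ i $ j\<bar> \<le> B"
  shows "\<bar>det A\<bar> \<le> fact CARD('n) * B ^ CARD('n)"
proof -
  have "\<bar>det A\<bar> \<le> (\<Sum>p\<in>{p. p permutes (UNIV::'n set)}. \<bar>of_int (sign p) * (\<Prod>i\<in>UNIV. A $ i $ p i)\<bar>)"
    unfolding det_def by (rule sum_abs)
  also have "\<dots> \<le> (\<Sum>p\<in>{p. p permutes (UNIV::'n set)}. B ^ CARD('n))"
  proof (rule sum_mono)
    fix p :: "'n \<Rightarrow> 'n"
    have "\<bar>\<Prod>i\<in>UNIV. A $ i $ p i\<bar> \<le> (\<Prod>i\<in>(UNIV::'n set). B)"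
      unfolding abs_prod using assms by (intro prod_mono) auto
    then show "\<bar>of_int (sign p) * (\<Prod>i\<in>UNIV. A $ i $ p i)\<bar> \<le> B ^ CARD('n)"
      by (simp add: abs_mult sign_def)
  qed
  also have "\<dots> = fact CARD('n) * B ^ CARD('n)" by (simp add: card_permutations[OF refl])
  finally show ?thesis .
qed

text \<open>In each Leibniz product the entry of \<open>M\<close> is written as the entry of
  \<open>A + M\<close> plus that of \<open>- A\<close>, and the product is expanded over the set
  \<open>S\<close> of rows that take the first summand. With the identity for \<open>A\<close>, the
  determinant of \<open>M\<close> becomes a combination of determinants of perturbed
  identities.\<close>

lemma det_inclusion_exclusion:
  fixes A M :: "real ^ 'n::finite ^ 'n"
  shows "(\<Sum>S\<in>Pow UNIV. (-1) ^ card (UNIV - S) * det (\<chi> i j. A $ i $ j + (if i \<in> S then M $ i $ j else 0))) = det M"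
proof -
  have "(\<Sum>S\<in>Pow UNIV. (-1) ^ card (UNIV - S) * det (\<chi> i j. A $ i $ j + (if i \<in> S then M $ i $ j else 0)))
     = (\<Sum>p\<in>{p. p permutes (UNIV::'n set)}. of_int (sign p) * 
        (\<Sum>S\<in>Pow UNIV. (-1) ^ card (UNIV - S) * (\<Prod>i\<in>UNIV. A $ i $ p i + (if i \<in> S then M $ i $ p i else 0))))"
    unfolding det_def by (simp add: sum_distrib_left sum.swap[of _ "{p. p permutes UNIV}"] mult.left_commute)
  also have "\<dots> = (\<Sum>p\<in>{p. p permutes (UNIV::'n set)}. of_int (sign p) * (\<Prod>i\<in>UNIV. M $ i $ p i))"
  proof (intro sum.cong refl arg_cong2[where f="(*)"])
    fix p :: "'n \<Rightarrow> 'n"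
    have "(\<Prod>i\<in>UNIV. M $ i $ p i) = (\<Prod>i\<in>UNIV. (A $ i $ p i + M $ i $ p i) + (- A $ i $ p i))" by simp
    also have "\<dots> = (\<Sum>S\<in>Pow UNIV. (\<Prod>i\<in>S. A $ i $ p i + M $ i $ p i) * (\<Prod>i\<in>UNIV - S. - A $ i $ p i))"
      by (rule prod_add) simp
    also have "\<dots> = (\<Sum>S\<in>Pow UNIV. (-1) ^ card (UNIV - S) * (\<Prod>i\<in>UNIV. A $ i $ p i + (if i \<in> S then M $ i $ p i else 0)))"
    proof (rule sum.cong[OF refl])
      fix S :: "'n set"
      have "(\<Prod>i\<in>UNIV. A $ i $ p i + (if i \<in> S then M $ i $ p i else 0)) = 
         (\<Prod>i\<in>S. A $ i $ p i + (if i \<in> S then M $ i $ p i else 0)) * (\<Prod>i\<in>UNIV - S. A $ i $ p i + (if i \<in> S then M $ i $ p i else 0))"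
        by (subst prod.subset_diff[of S UNIV]) (auto simp: mult.commute)
      also have "\<dots> = (\<Prod>i\<in>S. A $ i $ p i + M $ i $ p i) * (\<Prod>i\<in>UNIV - S. A $ i $ p i)"
        by (intro arg_cong2[where f="(*)"] prod.cong) auto
      finally show "(\<Prod>i\<in>S. A $ i $ p i + M $ i $ p i) * (\<Prod>i\<in>UNIV - S. - A $ i $ p i)
         = (-1) ^ card (UNIV - S) * (\<Prod>i\<in>UNIV. A $ i $ p i + (if i \<in> S then M $ i $ p i else 0))"
        by (simp add: prod_uminus mult_ac)
    qed
    finally show "(\<Sum>S\<in>Pow UNIV. (-1) ^ card (UNIV - S) * (\<Prod>i\<in>UNIV. A $ i $ p i + (if i \<in> S then M $ i $ p i else 0))) = (\<Prod>i\<in>UNIV. M $ i $ p i)" by simp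
  qed
  finally show ?thesis by (simp add: det_def)
qed

text \<open>The binomial expansion of \<open>(1 - 1) ^ CARD('n)\<close>.\<close>

lemma alternating_powerset_sum: "(\<Sum>S\<in>Pow (UNIV::'n::finite set). (-1) ^ card (UNIV - S) :: real) = 0"
  using prod_add[of "UNIV::'n set" "\<lambda>_. 1::real" "\<lambda>_. -1"] by (simp add: zero_power)

text \<open>Along the path from the identity to \<open>mat 1 + M\<close> every matrix has trivial
  kernel, so by the intermediate value theorem the determinant keeps the sign it has at the
  identity.\<close>

lemma det_perturbed_identity_pos:
  fixes M :: "real ^ 'n::finite ^ 'n"
  assumes c: "c < 1" and bound: "\<And>v. norm (M *v v) \<le> c * norm v"
  shows "det (mat 1 + M) > 0"
proof (rule ccontr)
  assume neg: "\<not> ?thesis"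
  let ?f = "\<lambda>t. det (mat 1 + t *\<^sub>R M)"
  have nz: "?f t \<noteq> 0" if t: "0 \<le> t" "t \<le> 1" for t
  proof -
    have "v = 0" if "(mat 1 + t *\<^sub>R M) *v v = 0" for v
    proof -
      have "v = - (t *\<^sub>R (M *v v))"
        using that by (simp add: matrix_vector_mult_add_rdistrib scaleR_matrix_vector_assoc eq_neg_iff_add_eq_0)
      then have "norm v = t * norm (M *v v)" using t by (metis abs_of_nonneg norm_minus_cancel norm_scaleR)
      also have "\<dots> \<le> 1 * (c * norm v)" using t bound by (intro mult_mono) auto
      finally have "(1 - c) * norm v \<le> 0" by (simp add: algebra_simps)
      then show "v = 0" using c by (simp add: mult_le_0_iff)
    qed
    then have "invertible (mat 1 + t *\<^sub>R M)"
      using matrix_left_invertible_ker[of "mat 1 + t *\<^sub>R M"] invertible_left_inverse by blast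
    then show ?thesis by (simp add: invertible_det_nz)
  qed
  have cont: "continuous_on {0..1} ?f"
    unfolding det_def by (intro continuous_intros)
  have "\<exists>t. 0 \<le> t \<and> t \<le> 1 \<and> ?f t = 0"
    by (rule IVT2'[of ?f 1 0 0]) (use neg cont in auto)
  then show False using nz by blast
qed

text \<open>Solving \<open>x + \<Psi> x = y\<close> is a fixed point problem for the contraction
  sending \<open>x\<close> to \<open>y - \<Psi> x\<close>. The map is the identity outside the ball,
  so by injectivity no point of the ball can leave it, and no preimage of a point of the ball lies
  outside.\<close>

lemma lipschitz_perturbation_bij:
  fixes \<Psi> :: "'a::euclidean_space \<Rightarrow> 'a"
  assumes \<Psi>: "c-lipschitz_on UNIV \<Psi>" and c: "c < 1" and out: "\<And>x. x \<notin> cball 0 R \<Longrightarrow> \<Psi> x = 0"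
  shows "inj (\<lambda>x. x + \<Psi> x)" "(\<lambda>x. x + \<Psi> x) ` cball 0 R = cball 0 R"
proof -
  let ?T = "\<lambda>x. x + \<Psi> x"
  have c0: "0 \<le> c" using \<Psi> lipschitz_on_nonneg by blast
  show inj: "inj ?T"
  proof (rule injI)
    fix x y assume "x + \<Psi> x = y + \<Psi> y"
    then have "x - y = \<Psi> y - \<Psi> x" by (simp add: algebra_simps)
    then have "norm (x - y) \<le> c * norm (x - y)"
      using lipschitz_onD[OF \<Psi>, of y x] by (simp add: dist_norm norm_minus_commute)
    then have "(1 - c) * norm (x - y) \<le> 0" by (simp add: algebra_simps)
    then show "x = y" using c by (simp add: mult_le_0_iff)
  qed
  show "?T ` cball 0 R = cball 0 R"
  proof (intro equalityI subsetI)
    fix y assume "y \<in> ?T ` cball 0 R"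
    then obtain x where x: "x \<in> cball 0 R" "y = x + \<Psi> x" by blast
    show "y \<in> cball 0 R"
    proof (rule ccontr)
      assume y: "y \<notin> cball 0 R"
      then have "?T y = ?T x" using out x by simp
      then have "y = x" by (rule injD[OF inj])
      with x y show False by simp
    qed
  next
    fix y :: 'a assume y: "y \<in> cball 0 R"
    have "\<exists>!x. x \<in> (UNIV::'a set) \<and> y - \<Psi> x = x"
    proof (rule Banach_fix[where c=c])
      fix a b :: 'a
      show "dist (y - \<Psi> a) (y - \<Psi> b) \<le> c * dist a b"
        using lipschitz_onD[OF \<Psi>, of a b] by (simp add: dist_norm norm_minus_commute)
    qed (use c c0 in \<open>auto simp: complete_UNIV\<close>)
    then obtain x where x: "y - \<Psi> x = x" by blast
    then have yx: "y = x + \<Psi> x" by (simp add: algebra_simps)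
    have "x \<in> cball 0 R" using out[of x] y yx by (cases "x \<in> cball 0 R") auto
    with yx show "y \<in> ?T ` cball 0 R" by blast
  qed
qed

lemma inner_to_vec: "to_vec x \<bullet> to_vec y = x \<bullet> y"
proof -
  have "to_vec x \<bullet> to_vec y = (\<Sum>b\<in>Basis. (x \<bullet> b) * (y \<bullet> b))"
    unfolding inner_vec_def to_vec_def by (simp add: sum_ix[of "\<lambda>b. (x \<bullet> b) * (y \<bullet> b)"])
  then show ?thesis by (simp only: euclidean_inner[of x y])
qed

lemma norm_to_vec [simp]: "norm (to_vec x) = norm x"
  by (simp add: norm_eq_sqrt_inner inner_to_vec)

lemma norm_of_vec [simp]: "norm (of_vec y) = norm y"
  by (metis norm_to_vec to_of_vec)

lemma of_vec_vimage: "of_vec -` S = to_vec ` S"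
  by (auto simp: image_iff) (metis to_of_vec)

lemma to_vec_image_borel: "S \<in> sets borel \<Longrightarrow> to_vec ` S \<in> sets borel"
  using measurable_sets[OF of_vec_borel, of S] by (simp add: of_vec_vimage)

lemma emeasure_to_vec:
  assumes "S \<in> sets borel"
  shows "emeasure lborel (to_vec ` S) = emeasure lborel S"
proof -
  have "emeasure lborel (to_vec ` S) = emeasure (distr lborel borel to_vec) (to_vec ` S)" by (simp add: distr_to_vec)
  also have "\<dots> = emeasure lborel (to_vec -` to_vec ` S)"
    by (subst emeasure_distr) (auto simp: to_vec_image_borel[OF assms])
  also have "to_vec -` to_vec ` S = S" by (metis inj_vimage_image_eq inj_on_inverseI of_to_vec)
  finally show ?thesis .
qed

lemma integral_of_vec:
  fixes F :: "'a::euclidean_space \<Rightarrow> real"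
  assumes [measurable]: "F \<in> borel_measurable borel"
  shows "integral\<^sup>L lborel (\<lambda>y. F (of_vec y)) = integral\<^sup>L lborel F"
proof -
  have "integral\<^sup>L lborel (\<lambda>y. F (of_vec y)) = integral\<^sup>L (distr lborel borel to_vec) (\<lambda>y. F (of_vec y))"
    by (simp add: distr_to_vec)
  also have "\<dots> = integral\<^sup>L lborel F" by (subst integral_distr) auto
  finally show ?thesis .
qed

lemma jac_bound:
  fixes \<Phi> :: "'a::euclidean_space \<Rightarrow> 'a"
  assumes \<Phi>: "L-lipschitz_on UNIV \<Phi>" and d: "\<Phi> differentiable (at x)"
  shows "\<bar>jac \<Phi> x\<bar> \<le> fact DIM('a) * L ^ DIM('a)"
proof -
  have "\<bar>ddir \<Phi> (ix_basis j) x \<bullet> ix_basis i\<bar> \<le> L" for i j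
  proof -
    have "\<bar>ddir \<Phi> (ix_basis j) x \<bullet> ix_basis i\<bar> \<le> norm (ddir \<Phi> (ix_basis j) x)"
      by (rule Basis_le_norm) simp
    also have "\<dots> \<le> L * norm (ix_basis j)"
      using has_derivative_imp_dquot_tendsto[OF differentiable_has_derivative_ddir[OF d]]
      by (rule ddir_bound[OF \<Phi>])
    finally show ?thesis by simp
  qed
  then show ?thesis unfolding jac_def
    by (intro order_trans[OF det_entry_bound[where B=L]]) (auto simp: card_ix)
qed

text \<open>The perturbed identity permutes the ball, so the change of variables formula evaluates
  the integral as the volume. The null set where differentiability may fail is removed first; its
  Lipschitz image is again null.\<close>

lemma perturbation_jac_integral:
  fixes \<Psi> :: "'a::euclidean_space \<Rightarrow> 'a"
  assumes \<Psi>: "c-lipschitz_on UNIV \<Psi>" and c: "c < 1" and out: "\<And>x. x \<notin> cball 0 R \<Longrightarrow> \<Psi> x = 0"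
  shows "integral\<^sup>L lborel (\<lambda>x. indicator (cball 0 R) x * jac (\<lambda>x. x + \<Psi> x) x) = measure lborel (cball (0::'a) R)"
proof -
  define T where "T x = x + \<Psi> x" for x
  have T: "(1 + c)-lipschitz_on UNIV T"
    unfolding T_def[abs_def] by (rule lipschitz_on_add[OF lipschitz_on_id \<Psi>])
  have Tc: "continuous_on UNIV T" using T lipschitz_on_continuous_on by blast
  have injT: "inj T" and Tball: "T ` cball 0 R = cball 0 R"
    unfolding T_def[abs_def] by (rule lipschitz_perturbation_bij[OF \<Psi> c out]; simp)+
  obtain N where N: "N \<in> null_sets lborel" "{x. \<not> T differentiable (at x)} \<subseteq> N"
    using rademacher[OF T] by (auto simp: eventually_ae_filter)
  have Nb: "N \<in> sets borel" using N by auto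
  define S where "S = cball 0 R - N"
  have Sb: "S \<in> sets borel" using Nb by (simp add: S_def)
  have der: "(T has_derivative (\<lambda>v. ddir T v x)) (at x)" if "x \<in> S" for x
    using that N(2) by (intro differentiable_has_derivative_ddir) (auto simp: S_def)
  define g where "g = to_vec \<circ> T \<circ> of_vec"
  define g' where "g' y = to_vec \<circ> (\<lambda>v. ddir T v (of_vec y)) \<circ> of_vec" for y
  have S'b: "to_vec ` S \<in> sets borel" by (rule to_vec_image_borel[OF Sb])
  have der_g: "(g has_derivative g' y) (at y within to_vec ` S)" if y: "y \<in> to_vec ` S" for y
  proof -
    have "of_vec y \<in> S" using y by auto
    from der[OF this] have "(T has_derivative (\<lambda>v. ddir T v (of_vec y))) (at (of_vec y))" .
    moreover have "(of_vec has_derivative of_vec) (at y)" "(to_vec has_derivative to_vec) (at z)" for z :: 'a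
      using linear_of_vec linear_to_vec by (auto intro: linear_imp_has_derivative)
    ultimately have "(g has_derivative g' y) (at y)"
      unfolding g_def g'_def by (intro diff_chain_at) auto
    then show ?thesis by (rule has_derivative_at_withinI)
  qed
  have inj_g: "inj_on g (to_vec ` S)"
    using injT unfolding g_def by (auto simp: inj_on_def) (metis injD of_to_vec)
  have mat: "det (matrix (g' y)) = jac T (of_vec y)" for y
    unfolding jac_def matrix_def g'_def by (simp add: of_vec_axis to_vec_def)
  \<comment> \<open>The derivative of a contraction has norm at most \<open>c < 1\<close>, so that
    of \<open>T\<close> is a small perturbation of the identity. Positivity removes the absolute
    value from the change of variables formula.\<close>
  have pos: "jac T x > 0" if x: "x \<in> S" for x
  proof -
    have \<Psi>d: "(\<Psi> has_derivative (\<lambda>v. ddir T v x - v)) (at x)"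
    proof -
      have "((\<lambda>x. T x - x) has_derivative (\<lambda>v. ddir T v x - v)) (at x)" by (intro has_derivative_diff der x has_derivative_ident)
      then show ?thesis by (simp add: T_def)
    qed
    have dd: "ddir \<Psi> v x = ddir T v x - v" for v by (rule has_derivative_imp_ddir[OF \<Psi>d])
    define M where "M = matrix (to_vec \<circ> (\<lambda>v. ddir \<Psi> v x) \<circ> of_vec)"
    have lin: "linear (\<lambda>v. ddir \<Psi> v x)" using has_derivative_linear[OF \<Psi>d] dd by simp
    have lin': "linear (to_vec \<circ> (\<lambda>v. ddir \<Psi> v x) \<circ> of_vec)"
      by (intro linear_compose linear_of_vec linear_to_vec lin)
    have "det (mat 1 + M) > 0"
    proof (rule det_perturbed_identity_pos[OF c])
      fix v
      have "M *v v = to_vec (ddir \<Psi> (of_vec v) x)" unfolding M_def using fun_cong[OF matrix_vector_mul(2)[OF lin'], of v] by simp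
      moreover have "norm (ddir \<Psi> (of_vec v) x) \<le> c * norm (of_vec v :: 'a)"
        using has_derivative_imp_dquot_tendsto[OF \<Psi>d, of "of_vec v"] by (intro ddir_bound[OF \<Psi>]) (simp add: dd)
      ultimately show "norm (M *v v) \<le> c * norm v" by simp
    qed
    moreover have "mat 1 + M = (\<chi> i j. ddir T (ix_basis j) x \<bullet> ix_basis i)"
      by (auto simp: vec_eq_iff mat_def M_def matrix_def of_vec_axis to_vec_def dd inner_diff_left inner_ix_basis)
    ultimately show ?thesis by (simp add: jac_def)
  qed
  define B where "B = fact DIM('a) * (1 + c) ^ DIM('a)"
  have bnd: "\<bar>jac T x\<bar> \<le> B" if "x \<in> S" for x
    unfolding B_def using that N(2) by (intro jac_bound[OF T]) (auto simp: S_def)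
  have jm: "jac T \<in> borel_measurable borel" by (rule jac_measurable[OF Tc])
  let ?F = "\<lambda>x. indicator S x * \<bar>jac T x\<bar>"
  have Fm: "?F \<in> borel_measurable borel" using jm Sb by simp
  have ind: "indicator (to_vec ` S) y = (indicator S (of_vec y) :: real)" for y
    by (auto simp: indicator_def image_iff) (metis to_of_vec)
  have Sfin: "emeasure lborel (to_vec ` S) < \<infinity>"
  proof -
    have "emeasure lborel (to_vec ` S) = emeasure lborel S" by (rule emeasure_to_vec[OF Sb])
    also have "\<dots> \<le> emeasure lborel (cball (0::'a) R)" by (intro emeasure_mono) (auto simp: S_def)
    also have "\<dots> < \<infinity>" using emeasure_lborel_cball_finite by blast
    finally show ?thesis .
  qed
  have si: "set_integrable lborel (to_vec ` S) (\<lambda>y. \<bar>det (matrix (g' y))\<bar>)"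
    unfolding set_integrable_def mat
  proof (rule Bochner_Integration.integrable_bound)
    show "integrable lborel (\<lambda>y. B * indicator (to_vec ` S) y :: real)"
      using Sfin S'b by (intro integrable_mult_right) (simp add: integrable_indicator_iff)
    show "(\<lambda>y. indicator (to_vec ` S) y *\<^sub>R \<bar>jac T (of_vec y)\<bar>) \<in> borel_measurable lborel"
      using jm S'b by simp
    show "AE y in lborel. norm (indicator (to_vec ` S) y *\<^sub>R \<bar>jac T (of_vec y)\<bar>) \<le> norm (B * indicator (to_vec ` S) y)"
      using bnd by (intro AE_I2) (auto simp: indicator_def image_iff intro: order_trans[OF _ abs_ge_self])
  qed
  have "measure lebesgue (g ` to_vec ` S) = integral (to_vec ` S) (\<lambda>y. \<bar>det (matrix (g' y))\<bar>)"
    using S'b set_borel_integral_eq_integral(1)[OF si]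
    by (intro measure_differentiable_image_eq der_g inj_g) auto
  also have "\<dots> = (LINT y:to_vec ` S|lborel. \<bar>det (matrix (g' y))\<bar>)"
    by (rule set_borel_integral_eq_integral(2)[OF si, symmetric])
  also have "\<dots> = integral\<^sup>L lborel (\<lambda>y. ?F (of_vec y))"
    unfolding set_lebesgue_integral_def mat ind by simp
  also have "\<dots> = integral\<^sup>L lborel ?F" by (rule integral_of_vec[OF Fm])
  also have "\<dots> = integral\<^sup>L lborel (\<lambda>x. indicator (cball 0 R) x * jac T x)"
  proof (rule integral_cong_AE)
    show "AE x in lborel. ?F x = indicator (cball 0 R) x * jac T x"
      using AE_not_in[OF N(1)]
    proof (rule eventually_mono)
      fix x assume "x \<notin> N"
      then show "?F x = indicator (cball 0 R) x * jac T x" using pos[of x] by (auto simp: indicator_def S_def)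
    qed
    show "(\<lambda>x. indicator (cball 0 R) x * jac T x) \<in> borel_measurable lborel"
      unfolding measurable_lborel2 by (intro borel_measurable_times borel_measurable_indicator jm) simp
  qed (use Fm in simp)
  finally have *: "measure lebesgue (g ` to_vec ` S) = integral\<^sup>L lborel (\<lambda>x. indicator (cball 0 R) x * jac T x)" .
  have gS: "g ` to_vec ` S = to_vec ` T ` S" by (simp add: g_def image_image)
  have cb: "to_vec ` cball (0::'a) R = cball 0 R"
    by (auto simp: image_iff) (metis norm_of_vec to_of_vec mem_cball_0)
  have "negligible (to_vec ` N)"
    using N(1) emeasure_to_vec[OF Nb] to_vec_image_borel[OF Nb]
    by (auto simp: negligible_iff_null_sets null_sets_def intro!: null_sets_completionI)
  then have negl: "negligible (g ` to_vec ` N)"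
  proof (rule negligible_locally_Lipschitz_image[OF order_refl])
    fix x assume "x \<in> to_vec ` N"
    have "norm (g y - g x) \<le> (1 + c) * norm (y - x)" for y
    proof -
      have "g y - g x = to_vec (T (of_vec y) - T (of_vec x))" by (simp add: g_def linear_diff[OF linear_to_vec])
      then have "norm (g y - g x) \<le> (1 + c) * norm (of_vec y - of_vec x :: 'a)"
        using lipschitz_onD[OF T, of "of_vec y" "of_vec x"] by (simp add: dist_norm)
      also have "of_vec y - of_vec x = (of_vec (y - x) :: 'a)" by (simp add: linear_diff[OF linear_of_vec])
      finally show ?thesis by simp
    qed
    then show "\<exists>U B. open U \<and> x \<in> U \<and> (\<forall>y\<in>to_vec ` N \<inter> U. norm (g y - g x) \<le> B * norm (y - x))"
      by (intro exI[of _ UNIV] exI[of _ "1 + c"]) auto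
  qed
  have "measure lebesgue (g ` to_vec ` S) = measure lebesgue (cball (0 :: real ^ 'a ix) R)"
  proof (rule measure_negligible_symdiff)
    show "cball (0 :: real ^ 'a ix) R \<in> lmeasurable" by simp
    have "T ` S \<subseteq> cball 0 R" using Tball unfolding S_def by blast
    then have 1: "g ` to_vec ` S \<subseteq> cball 0 R" unfolding gS using cb by blast
    have "cball 0 R \<subseteq> g ` to_vec ` S \<union> g ` to_vec ` N"
    proof
      fix y :: "real ^ 'a ix" assume "y \<in> cball 0 R"
      then have "y \<in> to_vec ` T ` cball 0 R" unfolding Tball cb .
      then obtain x where x: "x \<in> cball 0 R" "y = to_vec (T x)" by blast
      then have "y = g (to_vec x)" "x \<in> S \<or> x \<in> N" by (auto simp: g_def S_def)
      then show "y \<in> g ` to_vec ` S \<union> g ` to_vec ` N" by blast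
    qed
    with 1 have "sym_diff (cball 0 R) (g ` to_vec ` S) \<subseteq> g ` to_vec ` N" by blast
    then show "negligible (sym_diff (cball 0 R) (g ` to_vec ` S))" using negl negligible_subset by blast
  qed
  also have "\<dots> = measure lborel (cball (0 :: real ^ 'a ix) R)" by (simp add: measure_completion)
  also have "\<dots> = measure lborel (cball (0 :: 'a) R)"
    using emeasure_to_vec[of "cball (0::'a) R"] by (simp add: cb measure_def)
  finally show ?thesis using * by (simp add: T_def[abs_def])
qed

text \<open>The determinant of \<open>s D\<Phi>\<close> is the alternating sum, over the sets \<open>S\<close> of components, of the Jacobians
  of \<open>x + s \<Phi>\<^sub>S(x)\<close>, where \<open>\<Phi>\<^sub>S\<close> keeps the components in \<open>S\<close>. For small \<open>s\<close> each of these maps permutes the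
  ball, so that all the integrals equal its volume and cancel.\<close>

theorem jac_integral_zero:
  fixes \<Phi> :: "'a::euclidean_space \<Rightarrow> 'a"
  assumes \<Phi>: "L-lipschitz_on UNIV \<Phi>" and out: "\<And>x. x \<notin> cball 0 R \<Longrightarrow> \<Phi> x = 0"
  shows "integral\<^sup>L lborel (jac \<Phi>) = 0"
proof -
  have L0: "0 \<le> L" using \<Phi> lipschitz_on_nonneg by blast
  \<comment> \<open>Small enough to make every \<open>\<Psi> S\<close> a contraction: its Lipschitz
    constant is at most \<open>s * (DIM('a) * L)\<close>, whatever \<open>S\<close> is.\<close>
  define s where "s = 1 / (2 * (DIM('a) * L + 1))"
  have sp: "0 < s" "s * (DIM('a) * L) < 1"
    using L0 by (auto simp: s_def field_simps add_pos_nonneg intro!: add_pos_nonneg) 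
  define \<Psi> where "\<Psi> S x = (\<Sum>i\<in>S. (s * (\<Phi> x \<bullet> ix_basis i)) *\<^sub>R ix_basis i)" for S :: "'a ix set" and x
  let ?c = "s * (DIM('a) * L)"
  have \<Psi>L: "?c-lipschitz_on UNIV (\<Psi> S)" for S
  proof (rule lipschitz_onI)
    show "0 \<le> ?c" using sp(1) L0 by simp
    fix x y
    have "\<Psi> S x - \<Psi> S y = (\<Sum>i\<in>S. (s * ((\<Phi> x - \<Phi> y) \<bullet> ix_basis i)) *\<^sub>R ix_basis i)"
      by (simp add: \<Psi>_def inner_diff_left right_diff_distrib scaleR_diff_left sum_subtractf)
    also have "norm \<dots> \<le> (\<Sum>i\<in>S. norm ((s * ((\<Phi> x - \<Phi> y) \<bullet> ix_basis i)) *\<^sub>R ix_basis i))" by (rule norm_sum)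
    also have "\<dots> \<le> (\<Sum>i\<in>S. s * (L * dist x y))"
    proof (rule sum_mono)
      fix i
      have "\<bar>(\<Phi> x - \<Phi> y) \<bullet> ix_basis i\<bar> \<le> norm (\<Phi> x - \<Phi> y)" by (rule Basis_le_norm) simp
      also have "\<dots> \<le> L * dist x y" using lipschitz_onD[OF \<Phi>, of x y] by (simp add: dist_norm)
      finally show "norm ((s * ((\<Phi> x - \<Phi> y) \<bullet> ix_basis i)) *\<^sub>R ix_basis i) \<le> s * (L * dist x y)"
        using sp(1) by (simp add: abs_mult)
    qed
    also have "\<dots> \<le> (\<Sum>i\<in>(UNIV::'a ix set). s * (L * dist x y))" using sp(1) L0 by (intro sum_mono2) auto
    also have "\<dots> = ?c * dist x y" by (simp add: card_ix)
    finally show "dist (\<Psi> S x) (\<Psi> S y) \<le> ?c * dist x y" by (simp add: dist_norm)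
  qed
  let ?B = "cball (0::'a) R"
  let ?A = "mat 1 :: real ^ 'a ix ^ 'a ix"
  define M where "M x = (\<chi> i j. s * (ddir \<Phi> (ix_basis j) x \<bullet> ix_basis i))" for x
  have jacS: "jac (\<lambda>x. x + \<Psi> S x) x = det (\<chi> i j. ?A $ i $ j + (if i \<in> S then M x $ i $ j else 0))"
    if d: "\<Phi> differentiable (at x)" for S x
  proof -
    have "((\<lambda>x. x + \<Psi> S x) has_derivative (\<lambda>v. v + (\<Sum>i\<in>S. (s * (ddir \<Phi> v x \<bullet> ix_basis i)) *\<^sub>R ix_basis i))) (at x)"
      unfolding \<Psi>_def
      by (rule derivative_eq_intros differentiable_has_derivative_ddir[OF d] refl)+ simp
    note dd = has_derivative_imp_ddir[OF this]
    have "(v + (\<Sum>i\<in>S. (s * (ddir \<Phi> v x \<bullet> ix_basis i)) *\<^sub>R ix_basis i)) \<bullet> ix_basis k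
       = v \<bullet> ix_basis k + (if k \<in> S then s * (ddir \<Phi> v x \<bullet> ix_basis k) else 0)" for v k
      by (simp add: inner_add_left inner_sum_left inner_ix_basis if_distrib[of "(*) _"] sum.delta cong: if_cong)
    then show ?thesis unfolding jac_def dd M_def mat_def by (simp add: inner_ix_basis)
      (intro arg_cong[where f=det], auto simp: vec_eq_iff)
  qed
  have \<Psi>0: "\<Psi> S x = 0" if "x \<notin> ?B" for S x using out[OF that] by (simp add: \<Psi>_def)
  have TL: "(1 + ?c)-lipschitz_on UNIV (\<lambda>x. x + \<Psi> S x)" for S
    by (rule lipschitz_on_add[OF lipschitz_on_id \<Psi>L])
  have int: "integrable lborel (\<lambda>x. indicator ?B x * jac (\<lambda>x. x + \<Psi> S x) x)" for S
  proof (rule Bochner_Integration.integrable_bound)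
    show "integrable lborel (\<lambda>x. (fact DIM('a) * (1 + ?c) ^ DIM('a)) * indicator ?B x :: real)"
      using emeasure_lborel_cball_finite by (intro integrable_mult_right) (simp add: integrable_indicator_iff)
    show "(\<lambda>x. indicator ?B x * jac (\<lambda>x. x + \<Psi> S x) x) \<in> borel_measurable lborel"
      unfolding measurable_lborel2
      by (intro borel_measurable_times borel_measurable_indicator jac_measurable lipschitz_on_continuous_on[OF TL]) simp
    show "AE x in lborel. norm (indicator ?B x * jac (\<lambda>x. x + \<Psi> S x) x) \<le> norm ((fact DIM('a) * (1 + ?c) ^ DIM('a)) * indicator ?B x :: real)"
      using rademacher[OF TL]
      by (rule eventually_mono) (use jac_bound[OF TL] in \<open>auto simp: indicator_def intro: order_trans[OF _ abs_ge_self]\<close>)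
  qed
  have detM: "det (M x) = s ^ DIM('a) * jac \<Phi> x" for x
    unfolding M_def jac_def using det_rows_mul[of "\<lambda>_. s" "\<lambda>i. \<chi> j. ddir \<Phi> (ix_basis j) x \<bullet> ix_basis i"]
    by (simp add: card_ix vector_scalar_mult_def)
  have "s ^ DIM('a) * integral\<^sup>L lborel (\<lambda>x. indicator ?B x * jac \<Phi> x)
     = integral\<^sup>L lborel (\<lambda>x. \<Sum>S\<in>Pow UNIV. (-1) ^ card (UNIV - S) * (indicator ?B x * jac (\<lambda>x. x + \<Psi> S x) x))"
    unfolding integral_mult_right_zero[symmetric]
  proof (rule integral_cong_AE)
    show "AE x in lborel. s ^ DIM('a) * (indicator ?B x * jac \<Phi> x) = (\<Sum>S\<in>Pow UNIV. (-1) ^ card (UNIV - S) * (indicator ?B x * jac (\<lambda>x. x + \<Psi> S x) x))"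
      using rademacher[OF \<Phi>]
    proof (rule eventually_mono)
      fix x assume "\<Phi> differentiable at x"
      then have "(\<Sum>S\<in>Pow UNIV. (-1) ^ card (UNIV - S) * (indicator ?B x * jac (\<lambda>x. x + \<Psi> S x) x))
        = indicator ?B x * (\<Sum>S\<in>Pow UNIV. (-1) ^ card (UNIV - S) * det (\<chi> i j. ?A $ i $ j + (if i \<in> S then M x $ i $ j else 0)))"
        using jacS by (simp add: sum_distrib_left mult.left_commute)
      also have "\<dots> = indicator ?B x * det (M x)" by (simp only: det_inclusion_exclusion)
      finally show "s ^ DIM('a) * (indicator ?B x * jac \<Phi> x) = (\<Sum>S\<in>Pow UNIV. (-1) ^ card (UNIV - S) * (indicator ?B x * jac (\<lambda>x. x + \<Psi> S x) x))"
        by (simp add: detM)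
    qed
    show "(\<lambda>x. s ^ DIM('a) * (indicator ?B x * jac \<Phi> x)) \<in> borel_measurable lborel"
      unfolding measurable_lborel2
      by (intro borel_measurable_times borel_measurable_indicator borel_measurable_const jac_measurable lipschitz_on_continuous_on[OF \<Phi>]) simp
  qed (use int in \<open>auto intro!: borel_measurable_sum borel_measurable_times borel_measurable_integrable\<close>)
  also have "\<dots> = (\<Sum>S\<in>Pow (UNIV::'a ix set). (-1) ^ card (UNIV - S) * measure lborel ?B)"
    using int perturbation_jac_integral[OF \<Psi>L sp(2) \<Psi>0] by (subst Bochner_Integration.integral_sum) auto
  also have "\<dots> = 0" by (simp only: sum_distrib_right[symmetric] alternating_powerset_sum mult_zero_left)
  finally have "integral\<^sup>L lborel (\<lambda>x. indicator ?B x * jac \<Phi> x) = 0" using sp(1) by simp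
  moreover have "indicator ?B x * jac \<Phi> x = jac \<Phi> x" for x
  proof (cases "x \<in> ?B")
    case False
    have "((\<lambda>_. 0) has_derivative (\<lambda>_. 0)) (at x)" by simp
    then have "(\<Phi> has_derivative (\<lambda>_. 0)) (at x)"
      by (rule has_derivative_transform_within_open[where s="- ?B"]) (use False out in \<open>auto simp: open_Compl\<close>)
    then have "ddir \<Phi> v x = 0" for v by (rule has_derivative_imp_ddir)
    then have "jac \<Phi> x = det (\<chi> i j. 0 :: real ^ 'a ix ^ 'a ix)" by (simp add: jac_def)
    also have "\<dots> = 0" using det_0[where 'n="'a ix" and 'a=real] by (simp add: zero_vec_def)
    finally show ?thesis by simp
  qed simp
  ultimately show ?thesis by simp
qed

section \<open>The oscillating profile\<close>

text \<open>\<open>lev\<close> inverts \<open>osc_phase\<close> on \<open>[0, 1)\<close>. At the pole \<open>h = 1\<close> the junk value \<open>ln 0 = 0\<close> gives \<open>hump 1 = 0\<close>.\<close>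

definition osc_phase :: "real \<Rightarrow> real" where "osc_phase h = ln (1 - ln (1 - h))"
definition lev :: "real \<Rightarrow> real" where "lev c = 1 - exp (1 - exp c)"
definition hump :: "real \<Rightarrow> real" where "hump h = (sin (osc_phase (max 0 h)))\<^sup>2"

lemma osc_phase_lev [simp]: "osc_phase (lev c) = c"
  by (simp add: osc_phase_def lev_def)

lemma lev_less_1 [simp]: "lev c < 1" by (simp add: lev_def)
lemma lev_0 [simp]: "lev 0 = 0" by (simp add: lev_def)
lemma lev_less_iff [simp]: "lev a < lev b \<longleftrightarrow> a < b" by (simp add: lev_def)
lemma lev_le_iff [simp]: "lev a \<le> lev b \<longleftrightarrow> a \<le> b" by (simp add: lev_def)
lemma lev_nonneg [simp]: "0 \<le> lev c \<longleftrightarrow> 0 \<le> c" using lev_le_iff[of 0 c] by simp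
lemma lev_pos [simp]: "0 < lev c \<longleftrightarrow> 0 < c" using lev_less_iff[of 0 c] by simp

lemma lev_osc_phase: assumes "0 \<le> h" "h < 1" shows "lev (osc_phase h) = h"
proof -
  have "ln (1 - h) \<le> 0" using assms by simp
  then have "exp (osc_phase h) = 1 - ln (1 - h)" unfolding osc_phase_def by (subst exp_ln) auto
  then show ?thesis using assms by (simp add: lev_def)
qed

lemma osc_phase_less_iff: "0 \<le> h \<Longrightarrow> h < 1 \<Longrightarrow> osc_phase h > c \<longleftrightarrow> h > lev c"
  using lev_osc_phase lev_less_iff by metis

lemma osc_phase_mono: assumes "0 \<le> h" "h \<le> h'" "h' < 1" shows "osc_phase h \<le> osc_phase h'"
  using assms lev_le_iff[of "osc_phase h" "osc_phase h'"] lev_osc_phase[of h] lev_osc_phase[of h'] by simp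

lemma osc_phase_nonneg: "0 \<le> h \<Longrightarrow> h < 1 \<Longrightarrow> 0 \<le> osc_phase h"
  using osc_phase_mono[of 0 h] by (simp add: osc_phase_def)

text \<open>Up to height 1/2 the phase stays in the first quarter period. So the profile is
  increasing there, and all its maxima lie at heights of at least 1/2.\<close>

lemma osc_phase_half: "osc_phase (1/2) \<le> pi / 2"
proof -
  have "ln (1 - 1/2 :: real) = - ln 2" by (simp add: ln_div)
  then have "osc_phase (1/2) = ln (1 + ln 2)" by (simp add: osc_phase_def)
  also have "\<dots> \<le> ln 2" by (rule ln_add_one_self_le_self) simp
  also have "\<dots> \<le> 1" using ln_le_minus_one[of 2] by simp
  finally show ?thesis using pi_gt3 by simp
qed

lemma hump_nonpos [simp]: "h \<le> 0 \<Longrightarrow> hump h = 0"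
  by (simp add: hump_def osc_phase_def)

lemma hump_1 [simp]: "hump 1 = 0"
  by (simp add: hump_def osc_phase_def)

lemma hump_bounds: "0 \<le> hump h" "hump h \<le> 1"
  by (auto simp: hump_def abs_square_le_1)

lemma hump_mono: assumes "a \<le> b" "b \<le> 1/2" shows "hump a \<le> hump b"
proof (cases "a \<le> 0")
  case True then show ?thesis by (simp add: hump_bounds)
next
  case False
  have 1: "osc_phase a \<le> osc_phase b" "0 \<le> osc_phase a" "osc_phase b \<le> osc_phase (1/2)"
    using False assms by (auto intro!: osc_phase_mono osc_phase_nonneg)
  then have "sin (osc_phase a) \<le> sin (osc_phase b)" "0 \<le> sin (osc_phase a)"
    using osc_phase_half by (auto intro!: sin_monotone_2pi_le sin_ge_zero)
  then show ?thesis using False assms by (simp add: hump_def max_def power_mono)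
qed

text \<open>Cutting at a zero \<open>j \<pi>\<close> of the squared sine keeps the profile continuously differentiable.\<close>

definition hump_cut :: "nat \<Rightarrow> real \<Rightarrow> real" where
  "hump_cut j h = (sin (osc_phase (max 0 (min (lev (j * pi)) h))))\<^sup>2"

definition hump_deriv :: "real \<Rightarrow> real" where
  "hump_deriv h = 2 * sin (osc_phase h) * cos (osc_phase h) / ((1 - ln (1 - h)) * (1 - h))"

definition hump_cut_deriv :: "nat \<Rightarrow> real \<Rightarrow> real" where
  "hump_cut_deriv j h = (if 0 \<le> h \<and> h \<le> lev (j * pi) then hump_deriv h else 0)"

text \<open>Freezing a function outside an interval creates no corner if its derivative vanishes at
  both ends. This serves the truncated profile here and \<open>bevel\<close> in the degree
  argument.\<close>

lemma has_derivative_clamp: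
  fixes G :: "real \<Rightarrow> real"
  assumes ab: "a \<le> b" and G: "\<And>t. a \<le> t \<Longrightarrow> t \<le> b \<Longrightarrow> (G has_real_derivative G' t) (at t)"
    and ends: "G' a = 0" "G' b = 0"
  shows "((\<lambda>t. G (max a (min b t))) has_real_derivative (if a \<le> t \<and> t \<le> b then G' t else 0)) (at t)"
proof -
  let ?F = "\<lambda>t. G (max a (min b t))"
  show ?thesis
  proof -
    consider "t < a" | "t > b" | "a < t \<and> t < b" | "t = a \<or> t = b" by linarith
    then show ?thesis
    proof cases
      case 1
      have "(?F has_real_derivative 0) (at t)"
        by (rule has_field_derivative_transform_within_open[where S="{..<a}" and f="\<lambda>_. G a"]) (use 1 ab in auto)
      with 1 show ?thesis by simp
    next
      case 2
      have "(?F has_real_derivative 0) (at t)"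
        by (rule has_field_derivative_transform_within_open[where S="{b<..}" and f="\<lambda>_. G b"]) (use 2 ab in auto)
      with 2 show ?thesis using ab by simp
    next
      case 3
      have "(?F has_real_derivative G' t) (at t)"
        by (rule has_field_derivative_transform_within_open[where S="{a<..<b}" and f=G]) (use 3 G in auto)
      with 3 show ?thesis by simp
    next
      case 4
      then have G0: "(G has_real_derivative 0) (at t)" using G[of t] ab ends by auto
      have "((\<lambda>h. (?F (t + h) - ?F t) / h) \<longlongrightarrow> 0) (at 0)"
      proof (rule Lim_null_comparison)
        have "((\<lambda>h. (G (t + h) - G t) / h) \<longlongrightarrow> 0) (at 0)" using G0 by (simp add: DERIV_def)
        then have d: "((\<lambda>h. \<bar>(G (t + h) - G t) / h\<bar>) \<longlongrightarrow> 0) (at 0)" using tendsto_rabs_zero by blast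
        show "\<forall>\<^sub>F h in at 0. norm ((?F (t + h) - ?F t) / h) \<le> \<bar>(G (t + h) - G t) / h\<bar>"
        proof (cases "a = b")
          case True
          then show ?thesis by simp
        next
          case False
          then have "\<forall>\<^sub>F h in at 0. \<bar>h\<bar> < b - a"
            using ab eventually_at[of "\<lambda>h. \<bar>h\<bar> < b - a" "0::real" UNIV] by (auto intro!: exI[of _ "b - a"])
          then show ?thesis
          proof (rule eventually_mono)
            fix h assume h: "\<bar>h\<bar> < b - a"
            have "?F t = G t" using 4 ab by auto
            moreover have "?F (t + h) = G (t + h) \<or> ?F (t + h) = G t" using 4 ab h by (auto simp: max_def min_def)
            ultimately show "norm ((?F (t + h) - ?F t) / h) \<le> \<bar>(G (t + h) - G t) / h\<bar>"
              by (elim disjE) simp_all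
          qed
        qed
        show "((\<lambda>h. \<bar>(G (t + h) - G t) / h\<bar>) \<longlongrightarrow> 0) (at 0)" by (rule d)
      qed
      then show ?thesis using 4 ab ends by (auto simp: DERIV_def)
    qed
  qed
qed

lemma hump_cut_DERIV: "(hump_cut j has_real_derivative hump_cut_deriv j h) (at h)"
proof -
  have "((\<lambda>t. (sin (osc_phase t))\<^sup>2) has_real_derivative hump_deriv t) (at t)" if "0 \<le> t" "t \<le> lev (j * pi)" for t
  proof -
    have t1: "t < 1" using that(2) lev_less_1[of "j * pi"] by linarith
    then have "ln (1 - t) \<le> 0" using that by simp
    then have "ln (1 - t) < 1" by linarith
    then show ?thesis using t1 unfolding hump_deriv_def osc_phase_def
      by (auto intro!: derivative_eq_intros simp: field_simps)
  qed
  moreover have "hump_deriv 0 = 0" by (simp add: hump_deriv_def osc_phase_def)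
  moreover have "hump_deriv (lev (j * pi)) = 0" by (simp add: hump_deriv_def)
  ultimately show ?thesis
    unfolding hump_cut_def[abs_def] hump_cut_deriv_def
    by (intro has_derivative_clamp) auto
qed

lemma hump_cut_eq: "h \<le> lev (j * pi) \<Longrightarrow> hump_cut j h = hump h"
  by (simp add: hump_cut_def hump_def)

lemma hump_cut_bounds: "0 \<le> hump_cut j h" "hump_cut j h \<le> 1"
  by (auto simp: hump_cut_def abs_square_le_1)

lemma hump_deriv_bound:
  assumes "0 \<le> h" "h < 1"
  shows "\<bar>hump_deriv h\<bar> \<le> 2 / ((1 - ln (1 - h)) * (1 - h))"
proof -
  have p: "(1 - ln (1 - h)) * (1 - h) > 0" using assms ln_le_zero_iff[of "1 - h"] by (intro mult_pos_pos) linarith+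
  have "\<bar>sin (osc_phase h) * cos (osc_phase h)\<bar> \<le> 1 * 1"
    unfolding abs_mult by (intro mult_mono) auto
  then have "\<bar>2 * sin (osc_phase h) * cos (osc_phase h)\<bar> \<le> 2" by (simp add: abs_mult)
  then show ?thesis using p unfolding hump_deriv_def abs_divide abs_of_pos[OF p] by (intro divide_right_mono) auto
qed

lemma hump_cut_deriv_bound: "\<bar>hump_cut_deriv j h\<bar> \<le> 2 / (1 - lev (j * pi))"
proof (cases "0 \<le> h \<and> h \<le> lev (j * pi)")
  case True
  have h1: "h < 1" using True lev_less_1[of "j * pi"] by linarith
  have "\<bar>hump_deriv h\<bar> \<le> 2 / ((1 - ln (1 - h)) * (1 - h))" using True h1 by (intro hump_deriv_bound) auto
  also have "\<dots> \<le> 2 / (1 * (1 - lev (j * pi)))"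
  proof -
    have "ln (1 - h) \<le> 0" using True h1 by simp
    moreover have "1 - lev (j * pi) > 0" by simp
    moreover have "1 - h > 0" "1 - lev (j * pi) \<le> 1 - h" using True h1 by auto
    ultimately show ?thesis by (intro divide_left_mono mult_mono mult_pos_pos) linarith+
  qed
  finally show ?thesis using True by (simp add: hump_cut_deriv_def)
next
  case False
  then have "hump_cut_deriv j h = 0" unfolding hump_cut_deriv_def by (rule if_not_P)
  then show ?thesis by (simp add: less_imp_le)
qed

lemma hump_cut_lipschitz: "(2 / (1 - lev (j * pi)))-lipschitz_on UNIV (hump_cut j)"
proof (rule lipschitz_onI)
  show "0 \<le> 2 / (1 - lev (j * pi))" by (simp add: less_imp_le)
  fix x y
  have "norm (hump_cut j x - hump_cut j y) \<le> 2 / (1 - lev (j * pi)) * norm (x - y)"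
    by (rule field_differentiable_bound[of UNIV "hump_cut j" "hump_cut_deriv j"])
       (use hump_cut_DERIV hump_cut_deriv_bound in auto)
  then show "dist (hump_cut j x) (hump_cut j y) \<le> 2 / (1 - lev (j * pi)) * dist x y" by (simp add: dist_norm)
qed

text \<open>\<open>sgn\<close> has a Lipschitz constant of order \<open>1 / norm x\<close>, and the
  weight absorbs it. This is what makes cones over sphere maps and radial truncations Lipschitz at
  the origin as well.\<close>

lemma norm_sgn_diff:
  fixes x y :: "'a::real_normed_vector"
  shows "norm x * norm (sgn x - sgn y) \<le> 2 * norm (x - y)"
proof (cases "x = 0 \<or> y = 0")
  case True
  then show ?thesis by (auto simp: norm_sgn)
next
  case False
  then have "norm x * norm (sgn x - sgn y) = norm (norm x *\<^sub>R (sgn x - sgn y))" by simp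
  also have "norm x *\<^sub>R (sgn x - sgn y) = (x - y) + (norm y - norm x) *\<^sub>R sgn y"
  proof -
    have "norm x *\<^sub>R sgn x = x" "norm y *\<^sub>R sgn y = y" using False by (simp_all add: sgn_div_norm)
    then show ?thesis by (simp add: scaleR_diff_right scaleR_diff_left)
  qed
  also have "norm \<dots> \<le> norm (x - y) + \<bar>norm y - norm x\<bar> * norm (sgn y)"
    by (metis norm_scaleR norm_triangle_ineq)
  also have "\<dots> \<le> norm (x - y) + norm (x - y)"
    using False norm_triangle_ineq3[of y x] by (simp add: norm_sgn norm_minus_commute)
  finally show ?thesis by simp
qed

section \<open>The space and the Lipschitz paths in it\<close>

locale whiskered =
  fixes e :: "'a::euclidean_space"
  assumes e_Basis: "e \<in> Basis"
begin

lemma e_norm [simp]: "norm e = 1" "e \<bullet> e = 1" using e_Basis by auto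

definition perp :: "'a \<Rightarrow> 'a" where "perp z = z - (z \<bullet> e) *\<^sub>R e"

text \<open>The map u of the overview.\<close>

definition crimp :: "'a \<Rightarrow> 'a" where "crimp x = x + hump (x \<bullet> e) *\<^sub>R e"

text \<open>The part from \<open>e\<close> to \<open>2e\<close> is the limit set of the oscillations; the rest joins it to the south pole
  and makes the space rectifiably connected.\<close>

definition whisker :: "'a set" where "whisker = (\<lambda>s. s *\<^sub>R e) ` {-1..2}"

definition Z :: "'a set" where "Z = crimp ` sphere 0 1 \<union> whisker"

lemma perp_decomp: "z = perp z + (z \<bullet> e) *\<^sub>R e" by (simp add: perp_def)
lemma perp_e [simp]: "perp z \<bullet> e = 0" by (simp add: perp_def inner_diff_left)
lemma perp_add: "perp (a + b) = perp a + perp b" by (simp add: perp_def inner_add_left scaleR_add_left)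
lemma perp_diff: "perp (a - b) = perp a - perp b" by (simp add: perp_def inner_diff_left scaleR_diff_left)
lemma perp_scaleR: "perp (c *\<^sub>R a) = c *\<^sub>R perp a" by (simp add: perp_def scaleR_diff_right)
lemma perp_axis [simp]: "perp (c *\<^sub>R e) = 0" by (simp add: perp_def)
lemma perp_e_0 [simp]: "perp e = 0" by (simp add: perp_def)
lemma perp_orth: "w \<bullet> e = 0 \<Longrightarrow> perp w = w" by (simp add: perp_def)

lemma norm_perp_sq: "(norm z)\<^sup>2 = (norm (perp z))\<^sup>2 + (z \<bullet> e)\<^sup>2"
  unfolding power2_norm_eq_inner perp_def
  by (simp add: inner_diff_left inner_diff_right inner_commute power2_eq_square)

lemma norm_perp_le: "norm (perp z) \<le> norm z"
  by (rule power2_le_imp_le) (simp_all add: norm_perp_sq[of z])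

lemma abs_inner_e_le: "\<bar>z \<bullet> e\<bar> \<le> norm z"
  using Basis_le_norm[OF e_Basis] .

lemma crimp_e [simp]: "crimp x \<bullet> e = x \<bullet> e + hump (x \<bullet> e)" by (simp add: crimp_def inner_add_left)
lemma perp_crimp [simp]: "perp (crimp x) = perp x" by (simp add: crimp_def perp_add)

lemma unit_height: "norm x = 1 \<Longrightarrow> (norm (perp x))\<^sup>2 = 1 - (x \<bullet> e)\<^sup>2"
  using norm_perp_sq[of x] by simp

lemma unit_height_bounds: "norm x = 1 \<Longrightarrow> \<bar>x \<bullet> e\<bar> \<le> 1" using abs_inner_e_le[of x] by simp

lemma unit_pole: assumes "norm x = 1" "x \<bullet> e = 1" shows "x = e"
proof -
  have "norm (perp x) = 0" using unit_height[OF assms(1)] assms(2) by simp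
  then show ?thesis using perp_decomp[of x] assms(2) by simp
qed

lemma unit_perp_0: assumes "norm x = 1" "perp x = 0" shows "x = e \<or> x = - e"
proof -
  have "(x \<bullet> e)\<^sup>2 = 1" using unit_height[OF assms(1)] assms(2) by simp
  then have "x \<bullet> e = 1 \<or> x \<bullet> e = -1" by (simp add: power2_eq_1_iff)
  then show ?thesis using perp_decomp[of x] assms(2) by auto
qed

lemma crimp_pole: "crimp e = e" "crimp (- e) = - e" by (simp_all add: crimp_def)

lemma height_crimp_bounds: assumes "norm x = 1" shows "-1 \<le> crimp x \<bullet> e" "crimp x \<bullet> e \<le> 2"
  using unit_height_bounds[OF assms] hump_bounds[of "x \<bullet> e"] by auto

lemma perp_0_whisker: assumes "z \<in> Z" "perp z = 0" shows "z \<in> whisker"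
proof -
  have z: "z = (z \<bullet> e) *\<^sub>R e" using perp_decomp[of z] assms(2) by simp
  show ?thesis
  proof (cases "z \<in> whisker")
    case False
    then obtain x where x: "norm x = 1" "z = crimp x" using assms(1) by (auto simp: Z_def)
    then show ?thesis using z height_crimp_bounds[OF x(1)] unfolding whisker_def by (metis atLeastAtMost_iff image_eqI)
  qed
qed

lemma whisker_perp: "z \<in> whisker \<Longrightarrow> perp z = 0" by (auto simp: whisker_def)

text \<open>\<open>crimp\<close> itself is not Lipschitz, but its inverse is. If the heights have
  sum at least 1/2, the horizontal parts determine them stably, since the difference of the squared
  heights is a difference of squared horizontal norms. Otherwise the smaller height is nonpositive,
  with profile value 0, or both are below 1/2 where the profile increases; in either case the
  profile only enlarges the height difference.\<close>

lemma crimp_inverse_lipschitz: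
  assumes x: "norm x = 1" and x': "norm x' = 1"
  shows "norm (x - x') \<le> 5 * norm (crimp x - crimp x')"
proof -
  define h h' where "h = x \<bullet> e" and "h' = x' \<bullet> e"
  let ?d = "norm (crimp x - crimp x')"
  have y: "norm (perp x - perp x') \<le> ?d"
    using norm_perp_le[of "crimp x - crimp x'"] by (simp add: perp_diff)
  have z: "\<bar>(h + hump h) - (h' + hump h')\<bar> \<le> ?d"
    using abs_inner_e_le[of "crimp x - crimp x'"] by (simp add: inner_diff_left h_def h'_def)
  have hh: "\<bar>h - h'\<bar> \<le> 4 * ?d"
  proof (cases "h + h' \<ge> 1/2")
    case True
    have "(h - h') * (h + h') = (norm (perp x'))\<^sup>2 - (norm (perp x))\<^sup>2"
      using unit_height[OF x] unit_height[OF x'] by (simp add: h_def h'_def power2_eq_square algebra_simps)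
    also have "\<dots> = (norm (perp x') - norm (perp x)) * (norm (perp x') + norm (perp x))"
      by (simp add: power2_eq_square algebra_simps)
    finally have "\<bar>h - h'\<bar> * (h + h') = \<bar>norm (perp x') - norm (perp x)\<bar> * (norm (perp x') + norm (perp x))"
      using True abs_mult[of "h - h'" "h + h'"] abs_mult[of "norm (perp x') - norm (perp x)" "norm (perp x') + norm (perp x)"]
        abs_of_nonneg[of "h + h'"] abs_of_nonneg[of "norm (perp x') + norm (perp x)"] by simp
    also have "\<dots> \<le> ?d * 2"
    proof (rule mult_mono)
      show "\<bar>norm (perp x') - norm (perp x)\<bar> \<le> ?d"
        using norm_triangle_ineq3[of "perp x'" "perp x"] y by (simp add: norm_minus_commute)
      show "norm (perp x') + norm (perp x) \<le> 2" using norm_perp_le[of x] norm_perp_le[of x'] x x' by simp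
    qed auto
    finally have 1: "\<bar>h - h'\<bar> * (h + h') \<le> 2 * ?d" by simp
    have "\<bar>h - h'\<bar> * (1/2) \<le> \<bar>h - h'\<bar> * (h + h')" using True by (intro mult_left_mono) auto
    with 1 show ?thesis by simp
  next
    case False
    have gen: "\<bar>a - b\<bar> \<le> \<bar>(a + hump a) - (b + hump b)\<bar>" if "a \<le> b" "a + b < 1/2" for a b
    proof -
      have "hump a \<le> hump b"
      proof (cases "a \<le> 0")
        case True then show ?thesis by (simp add: hump_bounds)
      next
        case False then show ?thesis using that by (intro hump_mono) auto
      qed
      then show ?thesis using that by simp
    qed
    have "\<bar>h - h'\<bar> \<le> \<bar>(h + hump h) - (h' + hump h')\<bar>"
      using gen[of h h'] gen[of h' h] False by (cases "h \<le> h'") (auto simp: abs_minus_commute add.commute)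
    then show ?thesis using z by linarith
  qed
  have "x - x' = (perp x - perp x') + (h - h') *\<^sub>R e"
    using perp_decomp[of "x - x'"] by (simp add: perp_diff inner_diff_left h_def h'_def)
  then have "norm (x - x') \<le> norm (perp x - perp x') + \<bar>h - h'\<bar>"
    by (metis e_norm(1) mult.right_neutral norm_scaleR norm_triangle_ineq)
  with y hh show ?thesis by linarith
qed

lemma crimp_inj: "norm x = 1 \<Longrightarrow> norm x' = 1 \<Longrightarrow> crimp x = crimp x' \<Longrightarrow> x = x'"
  using crimp_inverse_lipschitz[of x x'] by simp

section \<open>The tail of the oscillating sheet, and Lipschitz paths that start in it\<close>

definition tail :: "real \<Rightarrow> 'a \<Rightarrow> bool" where
  "tail c z \<longleftrightarrow> (\<exists>x. norm x = 1 \<and> 0 < x \<bullet> e \<and> x \<bullet> e < 1 \<and> z = crimp x \<and> c < osc_phase (x \<bullet> e))"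

text \<open>The sheet is cut at a zero of the profile, in agreement with \<open>hump_cut j\<close>,
  so that \<open>crimp\<close> is Lipschitz on the part kept. The whole whisker is kept.\<close>

definition core :: "nat \<Rightarrow> 'a set" where
  "core j = crimp ` {x \<in> sphere 0 1. x \<bullet> e \<le> lev (j * pi)} \<union> whisker"

lemma core_subset: "core j \<subseteq> Z" by (auto simp: core_def Z_def)

lemma not_tail_imp_core:
  assumes z: "z \<in> Z" and nt: "\<not> tail c z" and c: "c \<le> j * pi"
  shows "z \<in> core j"
proof (cases "z \<in> whisker")
  case False
  then obtain x where x: "norm x = 1" "z = crimp x" using z by (auto simp: Z_def)
  show ?thesis
  proof (cases "x \<bullet> e \<le> lev (j * pi)")
    case True then show ?thesis using x by (auto simp: core_def)
  next
    case F: False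
    have "x \<bullet> e \<noteq> 1" using unit_pole[OF x(1)] x(2) False crimp_pole by (auto simp: whisker_def intro: image_eqI[of _ _ 1])
    then have h: "0 < x \<bullet> e" "x \<bullet> e < 1"
      using unit_height_bounds[OF x(1)] F lev_nonneg[of "real j * pi"] pi_ge_zero by (auto simp: not_le simp del: lev_nonneg)
    then have "osc_phase (x \<bullet> e) > j * pi" using F by (subst osc_phase_less_iff) auto
    then show ?thesis using nt x h c unfolding tail_def by (metis le_less_trans)
  qed
qed (simp add: core_def)

text \<open>A set of small height oscillation misses either all the rings at the minima (phase in \<open>\<pi> \<nat>\<close>) or all the
  rings at the maxima of the profile. Two consecutive missed rings enclose the phase of \<open>z0\<close>, and a
  connected set cannot leave the region between them.\<close>

lemma connected_tail:
  assumes C: "connected C" "C \<subseteq> Z" and osc: "\<And>z z'. z \<in> C \<Longrightarrow> z' \<in> C \<Longrightarrow> \<bar>z \<bullet> e - z' \<bullet> e\<bar> < 1/2"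
    and c: "0 \<le> c" and z0: "z0 \<in> C" "tail (c + pi) z0" and z: "z \<in> C"
  shows "tail c z"
proof -
  define ring where "ring t = crimp ` {x. norm x = 1 \<and> x \<bullet> e = lev t}" for t
  have ring_e: "z \<bullet> e = lev t + (sin t)\<^sup>2" if "z \<in> ring t" "t \<ge> 0" for z t
    using that by (auto simp: ring_def hump_def max_def)
  have sin_e: "(sin (real i * pi))\<^sup>2 = 0" "(sin (pi/2 + real i * pi))\<^sup>2 = 1" for i
    by (auto simp: sin_add minus_one_power_iff)
  \<comment> \<open>Image points on a minimum ring have height \<open>lev t < 1\<close>, those on a
    maximum ring at least 1/2 + 1. A set whose heights vary by less than 1/2 cannot meet both
    families.\<close>
  have "\<exists>P\<in>{0, pi/2}. \<forall>i::nat. ring (P + i * pi) \<inter> C = {}"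
  proof (rule ccontr)
    assume "\<not> ?thesis"
    then obtain i i' z z' where 1: "z \<in> ring (0 + real i * pi)" "z \<in> C" "z' \<in> ring (pi/2 + real i' * pi)" "z' \<in> C"
      by blast
    have "z \<bullet> e \<le> 1" using ring_e[OF 1(1)] sin_e(1)[of i] by (simp add: less_imp_le)
    moreover have "z' \<bullet> e \<ge> 3/2"
    proof -
      have "lev (osc_phase (1/2)) \<le> lev (pi/2 + real i' * pi)"
        using osc_phase_half by (simp add: add_increasing2)
      then have "1/2 \<le> lev (pi/2 + real i' * pi)" by (simp add: lev_osc_phase)
      then show ?thesis using ring_e[OF 1(3)] sin_e(2)[of i'] by simp
    qed
    ultimately show False using osc[OF 1(2) 1(4)] by simp
  qed
  then obtain P where P: "P = 0 \<or> P = pi/2" "\<And>i::nat. ring (P + i * pi) \<inter> C = {}" by blast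
  obtain x0 where x0: "norm x0 = 1" "0 < x0 \<bullet> e" "x0 \<bullet> e < 1" "z0 = crimp x0" "c + pi < osc_phase (x0 \<bullet> e)"
    using z0(2) by (auto simp: tail_def)
  define \<phi> where "\<phi> = osc_phase (x0 \<bullet> e)"
  \<comment> \<open>Selects the two consecutive missed rings around the phase of \<open>z0\<close>.
    As this phase exceeds \<open>c + pi\<close> and the rings are \<open>pi\<close> apart, even the
    lower ring is beyond \<open>c\<close>.\<close>
  define i where "i = nat \<lfloor>(\<phi> - P) / pi\<rfloor>"
  have "P \<le> \<phi>" using x0(5) c P(1) pi_gt_zero unfolding \<phi>_def by (elim disjE) linarith+
  then have "0 \<le> (\<phi> - P) / pi" by simp
  then have i: "real i \<le> (\<phi> - P) / pi" "(\<phi> - P) / pi < real i + 1" unfolding i_def by linarith+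
  define a b where "a = P + real i * pi" and "b = P + real (Suc i) * pi"
  have ab: "a \<le> \<phi>" "\<phi> < b" "c < a" "b = a + pi"
    using i pi_gt_zero x0(5) by (auto simp: a_def b_def \<phi>_def field_simps)
  have miss: "ring a \<inter> C = {}" "ring b \<inter> C = {}" unfolding a_def b_def using P(2) by blast+
  have x0lev: "x0 \<bullet> e = lev \<phi>" using x0 lev_osc_phase by (simp add: \<phi>_def)
  have "a \<noteq> \<phi>" using miss(1) z0(1) x0 x0lev by (auto simp: ring_def)
  then have a\<phi>: "a < \<phi>" using ab by simp
  have apos: "0 < a" "0 < b" using ab c pi_gt_zero by linarith+
  \<comment> \<open>The region between the rings, open and closed version, described by the
    horizontal norm and the sign of the height alone. The versions agree on \<open>C\<close>, which
    avoids the rings; the positive lower bound on the horizontal norm excludes the whisker.\<close>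
  define U where "U = {z. 0 < z \<bullet> e \<and> (norm (perp z))\<^sup>2 < 1 - (lev a)\<^sup>2 \<and> 1 - (lev b)\<^sup>2 < (norm (perp z))\<^sup>2}"
  define K where "K = {z. 0 \<le> z \<bullet> e \<and> (norm (perp z))\<^sup>2 \<le> 1 - (lev a)\<^sup>2 \<and> 1 - (lev b)\<^sup>2 \<le> (norm (perp z))\<^sup>2}"
  have pc: "continuous_on UNIV (\<lambda>z. (norm (perp z))\<^sup>2)" unfolding perp_def by (intro continuous_intros)
  have U: "open U" unfolding U_def
    by (intro open_Collect_conj open_Collect_less pc continuous_intros)
  have K: "closed K" unfolding K_def
    by (intro closed_Collect_conj closed_Collect_le pc continuous_intros)
  have key: "\<exists>x. norm x = 1 \<and> z = crimp x \<and> lev a < x \<bullet> e \<and> x \<bullet> e < lev b \<and> z \<in> U" if z: "z \<in> C" "z \<in> K" for z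
  proof -
    have "(lev b)\<^sup>2 < 1" using apos by (simp add: abs_square_less_1)
    then have "perp z \<noteq> 0" using z(2) by (auto simp: K_def)
    then have "z \<notin> whisker" using whisker_perp by blast
    then obtain x where x: "norm x = 1" "z = crimp x" using z C by (auto simp: Z_def)
    have h0: "0 \<le> x \<bullet> e"
    proof (rule ccontr)
      assume "\<not> 0 \<le> x \<bullet> e"
      then show False using z(2) x by (simp add: K_def)
    qed
    have "(lev a)\<^sup>2 \<le> (x \<bullet> e)\<^sup>2" "(x \<bullet> e)\<^sup>2 \<le> (lev b)\<^sup>2" using z(2) unit_height[OF x(1)] x(2) by (auto simp: K_def)
    then have "lev a \<le> x \<bullet> e" "x \<bullet> e \<le> lev b" using h0 apos by (auto simp: power2_le_iff_abs_le abs_le_square_iff[symmetric])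
    moreover have "x \<bullet> e \<noteq> lev a" "x \<bullet> e \<noteq> lev b" using miss x z(1) by (auto simp: ring_def)
    ultimately have h: "lev a < x \<bullet> e" "x \<bullet> e < lev b" by auto
    then have "(lev a)\<^sup>2 < (x \<bullet> e)\<^sup>2" "(x \<bullet> e)\<^sup>2 < (lev b)\<^sup>2" using apos h0 by (auto intro!: power_strict_mono simp: less_imp_le)
    moreover have "0 < z \<bullet> e"
    proof -
      have "0 < x \<bullet> e" using h(1) apos(1) lev_pos[of a] by linarith
      then show ?thesis using x(2) hump_bounds(1)[of "x \<bullet> e"] by simp
    qed
    ultimately have "z \<in> U" using unit_height[OF x(1)] x(2) by (simp add: U_def)
    with x h show ?thesis by blast
  qed
  have UK: "U \<subseteq> K" by (auto simp: U_def K_def)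
  have "z0 \<in> K"
  proof -
    have "(lev a)\<^sup>2 \<le> (x0 \<bullet> e)\<^sup>2" "(x0 \<bullet> e)\<^sup>2 \<le> (lev b)\<^sup>2"
      unfolding x0lev using ab a\<phi> apos by (auto intro!: power_mono)
    then show ?thesis using x0 unit_height[OF x0(1)] hump_bounds(1)[of "x0 \<bullet> e"] by (simp add: K_def)
  qed
  then have "U \<inter> C \<noteq> {}" using key[OF z0(1)] z0(1) by blast
  then have "- K \<inter> C = {}"
    using connectedD[OF C(1) U, of "- K"] K UK key open_Compl[OF K] by blast
  then have "z \<in> K" using z by blast
  from key[OF z this] obtain x where x: "norm x = 1" "z = crimp x" "lev a < x \<bullet> e" "x \<bullet> e < lev b" by blast
  have h: "0 < x \<bullet> e" "x \<bullet> e < 1" using x apos lev_pos[of a] lev_less_1[of b] by linarith+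
  have "lev c < x \<bullet> e" using x(3) ab(3) lev_less_iff[of c a] by linarith
  then have "c < osc_phase (x \<bullet> e)" using h by (subst osc_phase_less_iff) auto
  with x h show ?thesis by (auto simp: tail_def)
qed

text \<open>The path is cut into \<open>m\<close> pieces on each of which the height varies by less
  than 1/2; every piece costs at most one period \<open>pi\<close> of phase.\<close>

lemma lipschitz_path_tail:
  assumes \<gamma>: "M-lipschitz_on {0..1} \<gamma>" and im: "\<gamma> ` {0..1} \<subseteq> Z" and c: "0 \<le> c"
    and m: "2 * M < real m" and t0: "tail (c + real m * pi) (\<gamma> 0)"
  shows "tail c (\<gamma> (1::real))"
proof -
  have M0: "0 \<le> M" using \<gamma> lipschitz_on_nonneg by blast
  then have m0: "0 < real m" using m by simp
  have "tail (c + real (m - i) * pi) (\<gamma> (real i / real m))" if "i \<le> m" for i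
    using that
  proof (induction i)
    case 0 then show ?case using t0 by simp
  next
    case (Suc i)
    let ?I = "{real i / real m..real (Suc i) / real m}"
    have sub: "?I \<subseteq> {0..1}" using Suc.prems m0 by (auto simp: field_simps order_trans[OF divide_nonneg_nonneg])
    have osc: "\<bar>z \<bullet> e - z' \<bullet> e\<bar> < 1/2" if z: "z \<in> \<gamma> ` ?I" "z' \<in> \<gamma> ` ?I" for z z'
    proof -
      obtain t t' where t: "t \<in> ?I" "t' \<in> ?I" "z = \<gamma> t" "z' = \<gamma> t'" using z by auto
      have "\<bar>z \<bullet> e - z' \<bullet> e\<bar> \<le> norm (z - z')" using abs_inner_e_le[of "z - z'"] by (simp add: inner_diff_left)
      also have "\<dots> \<le> M * \<bar>t - t'\<bar>"
      proof -
        have "t \<in> {0..1}" "t' \<in> {0..1}" using t sub by blast+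
        from lipschitz_onD[OF \<gamma> this] show ?thesis using t by (simp add: dist_norm)
      qed
      also have "\<dots> \<le> M * (1 / real m)"
        using t M0 by (intro mult_left_mono) (auto simp: abs_le_iff add_divide_distrib)
      also have "\<dots> < 1/2" using m m0 by (simp add: field_simps)
      finally show ?thesis .
    qed
    have "real (m - i) = real (m - Suc i) + 1" using Suc.prems by simp
    then have eq: "c + real (m - i) * pi = (c + real (m - Suc i) * pi) + pi" by (simp add: algebra_simps)
    show ?case
    proof (rule connected_tail[where C="\<gamma> ` ?I"])
      show "connected (\<gamma> ` ?I)"
        using lipschitz_on_continuous_on[OF \<gamma>] 
        by (intro connected_continuous_image continuous_on_subset[OF _ sub] connected_Icc)
      show "\<gamma> ` ?I \<subseteq> Z" using im sub by blast
      show "0 \<le> c + real (m - Suc i) * pi" using c by simp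
      show "tail (c + real (m - Suc i) * pi + pi) (\<gamma> (real i / real m))"
        using Suc.IH Suc.prems unfolding eq by (simp only: Suc_leD)
      show "\<gamma> (real i / real m) \<in> \<gamma> ` ?I" "\<gamma> (real (Suc i) / real m) \<in> \<gamma> ` ?I"
        using m0 by (auto intro!: imageI divide_right_mono)
    qed (rule osc)
  qed
  from this[of m] show ?thesis using m0 by simp
qed

lemma not_tail_exists: "\<exists>c\<ge>0. \<not> tail c z"
proof (cases "tail 0 z")
  case True
  then obtain x where x: "norm x = 1" "0 < x \<bullet> e" "x \<bullet> e < 1" "z = crimp x" "0 < osc_phase (x \<bullet> e)"
    by (auto simp: tail_def)
  have "\<not> tail (osc_phase (x \<bullet> e)) z"
    using x crimp_inj[OF x(1)] by (auto simp: tail_def)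
  with x show ?thesis by (intro exI[of _ "osc_phase (x \<bullet> e)"]) auto
qed auto

text \<open>The number \<open>m\<close> of periods lost along a path depends on \<open>M\<close>
  only. A point too deep in the tail would therefore drag every other point of \<open>S\<close>,
  reached by two such paths, into a tail that misses a fixed base point. Two legs are allowed so
  that opposite points of a sphere can be joined through a third.\<close>

lemma path_connected_in_core:
  assumes S: "S \<subseteq> Z"
    and paths: "\<And>z z'. z \<in> S \<Longrightarrow> z' \<in> S \<Longrightarrow> \<exists>w \<gamma> \<delta>. M-lipschitz_on {0..1::real} \<gamma> \<and> \<gamma> ` {0..1} \<subseteq> Z \<and> \<gamma> 0 = z \<and> \<gamma> 1 = w \<and>
        M-lipschitz_on {0..1::real} \<delta> \<and> \<delta> ` {0..1} \<subseteq> Z \<and> \<delta> 0 = w \<and> \<delta> 1 = z'"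
  shows "\<exists>j. S \<subseteq> core j"
proof (cases "S = {}")
  case False
  then obtain z1 where z1: "z1 \<in> S" by blast
  obtain c where c: "0 \<le> c" "\<not> tail c z1" using not_tail_exists by blast
  obtain m :: nat where m: "2 * M < real m" using reals_Archimedean2 by blast
  obtain j :: nat where j: "(c + real m * pi) + real m * pi \<le> real j * pi"
  proof -
    obtain j :: nat where "((c + real m * pi) + real m * pi) / pi \<le> real j" using real_arch_simple by blast
    then show ?thesis using that[of j] pi_gt_zero by (simp add: pos_divide_le_eq)
  qed
  have "z \<in> core j" if z: "z \<in> S" for z
  proof (rule not_tail_imp_core[OF _ _ j])
    show "z \<in> Z" using z S by blast
    obtain w \<gamma> \<delta> where p: "M-lipschitz_on {0..1::real} \<gamma>" "\<gamma> ` {0..1} \<subseteq> Z" "\<gamma> 0 = z" "\<gamma> 1 = w"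
        "M-lipschitz_on {0..1::real} \<delta>" "\<delta> ` {0..1} \<subseteq> Z" "\<delta> 0 = w" "\<delta> 1 = z1"
      using paths[OF z z1] by blast
    show "\<not> tail ((c + real m * pi) + real m * pi) z"
    proof
      assume "tail ((c + real m * pi) + real m * pi) z"
      then have "tail (c + real m * pi) w"
        using lipschitz_path_tail[OF p(1,2) _ m, of "c + real m * pi"] p c by simp
      then have "tail c z1" using lipschitz_path_tail[OF p(5,6) c(1) m] p by simp
      with c show False by simp
    qed
  qed
  then show ?thesis by blast
qed auto


section \<open>Compactness and Lipschitz contractibility\<close>

lemma compact_whisker: "compact whisker"
  unfolding whisker_def by (intro compact_continuous_image continuous_intros compact_Icc)

lemma continuous_perp: "continuous_on S perp" unfolding perp_def by (intro continuous_intros)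

lemma crimp_lipschitz_below:
  fixes j :: nat
  shows "(1 + 2 / (1 - lev (j * pi)))-lipschitz_on {x. x \<bullet> e \<le> lev (j * pi)} crimp"
proof (rule lipschitz_onI)
  let ?B = "2 / (1 - lev (j * pi))"
  show "0 \<le> 1 + ?B" by (simp add: less_imp_le)
  fix x y assume "x \<in> {x. x \<bullet> e \<le> lev (j * pi)}" "y \<in> {x. x \<bullet> e \<le> lev (j * pi)}"
  then have "crimp x - crimp y = (x - y) + (hump_cut j (x \<bullet> e) - hump_cut j (y \<bullet> e)) *\<^sub>R e"
    by (simp add: crimp_def hump_cut_eq scaleR_diff_left)
  then have "norm (crimp x - crimp y) \<le> norm (x - y) + \<bar>hump_cut j (x \<bullet> e) - hump_cut j (y \<bullet> e)\<bar>"
    by (metis e_norm(1) mult.right_neutral norm_scaleR norm_triangle_ineq)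
  also have "\<bar>hump_cut j (x \<bullet> e) - hump_cut j (y \<bullet> e)\<bar> \<le> ?B * \<bar>x \<bullet> e - y \<bullet> e\<bar>"
    using lipschitz_onD[OF hump_cut_lipschitz[of j], of "x \<bullet> e" "y \<bullet> e"] by (simp add: dist_real_def)
  also have "?B * \<bar>x \<bullet> e - y \<bullet> e\<bar> \<le> ?B * norm (x - y)"
    using abs_inner_e_le[of "x - y"] by (intro mult_left_mono) (auto simp: inner_diff_left less_imp_le)
  finally show "dist (crimp x) (crimp y) \<le> (1 + ?B) * dist x y" by (simp add: dist_norm distrib_right)
qed

lemma compact_core: "compact (core j)"
proof -
  have "compact ({x. x \<bullet> e \<le> lev (j * pi)} \<inter> sphere 0 1)"
    by (intro closed_Int_compact closed_Collect_le continuous_intros compact_sphere)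
  moreover have "{x. x \<bullet> e \<le> lev (j * pi)} \<inter> sphere 0 1 = {x \<in> sphere 0 1. x \<bullet> e \<le> lev (j * pi)}" by auto
  ultimately have "compact {x \<in> sphere 0 1. x \<bullet> e \<le> lev (j * pi)}" by simp
  then show ?thesis unfolding core_def
    by (intro compact_Un compact_whisker compact_continuous_image
          continuous_on_subset[OF lipschitz_on_continuous_on[OF crimp_lipschitz_below[of j]]]) auto
qed

lemma lev_ge_limit: assumes "a < 1" shows "\<exists>j::nat. a \<le> lev (j * pi)"
proof -
  obtain j :: nat where j: "osc_phase (max 0 a) / pi \<le> real j" using real_arch_simple by blast
  then have "osc_phase (max 0 a) \<le> real j * pi" by (simp add: pos_divide_le_eq)
  then have "lev (osc_phase (max 0 a)) \<le> lev (real j * pi)" by simp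
  then have "max 0 a \<le> lev (real j * pi)" using assms by (simp add: lev_osc_phase)
  then show ?thesis by auto
qed

text \<open>\<open>Z\<close> is an intersection of closed sets \<open>core j \<union> W j\<close>,
  where the cylinders \<open>W j\<close> shrink to the limit segment: a point off the axis leaves
  \<open>W j\<close> for large \<open>j\<close> and so lies in a core, and a point of
  \<open>W 0\<close> on the axis lies on the whisker.\<close>

lemma compact_Z: "compact Z"
proof -
  define W where "W j = {z. (norm (perp z))\<^sup>2 \<le> 1 - (lev (real j * pi))\<^sup>2 \<and> 0 \<le> z \<bullet> e \<and> z \<bullet> e \<le> 2}" for j :: nat
  have pc: "continuous_on UNIV (\<lambda>z. (norm (perp z))\<^sup>2)" by (intro continuous_intros continuous_perp)
  have Wcl: "closed (W j)" for j unfolding W_def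
    by (intro closed_Collect_conj closed_Collect_le pc continuous_intros)
  have ZW: "Z \<subseteq> core j \<union> W j" for j
  proof
    fix z assume z: "z \<in> Z"
    show "z \<in> core j \<union> W j"
    proof (cases "z \<in> core j")
      case False
      then obtain x where x0: "norm x = 1" "z = crimp x" using z by (auto simp: Z_def core_def)
      with False have x: "norm x = 1" "z = crimp x" "\<not> x \<bullet> e \<le> lev (j * pi)" by (auto simp: core_def)
      have l0: "0 \<le> lev (j * pi)" by simp
      have h: "0 \<le> x \<bullet> e" "x \<bullet> e \<le> 1" using l0 x(3) unit_height_bounds[OF x(1)] by linarith+
      have "(lev (j * pi))\<^sup>2 \<le> (x \<bullet> e)\<^sup>2" using l0 x(3) by (intro power_mono) auto
      then have "z \<in> W j" using x h hump_bounds[of "x \<bullet> e"] unit_height[OF x(1)] by (simp add: W_def)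
      then show ?thesis by simp
    qed simp
  qed
  have "Z = (\<Inter>j. core j \<union> W j)"
  proof (intro equalityI subsetI)
    fix z assume z: "z \<in> (\<Inter>j. core j \<union> W j)"
    show "z \<in> Z"
    proof (cases "perp z = 0")
      case True
      have "z \<in> core 0 \<or> z \<in> W 0" using z by blast
      then show ?thesis
      proof
        assume "z \<in> W 0"
        then have "z \<in> whisker" unfolding W_def whisker_def
          using perp_decomp[of z] True by (intro image_eqI[of _ _ "z \<bullet> e"]) auto
        then show ?thesis by (simp add: Z_def)
      qed (use core_subset in blast)
    next
      case False
      define q where "q = (norm (perp z))\<^sup>2"
      have q: "q > 0" using False by (simp add: q_def)
      obtain j :: nat where j: "1 - q/2 \<le> lev (j * pi)" using lev_ge_limit[of "1 - q/2"] q by auto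
      have l: "0 \<le> lev (real j * pi)" "lev (real j * pi) < 1" by simp_all
      have "1 - (lev (j * pi))\<^sup>2 = (1 - lev (j * pi)) * (1 + lev (j * pi))" by (simp add: power2_eq_square algebra_simps)
      also have "\<dots> < (q/2) * 2 \<or> 1 - (lev (j * pi))\<^sup>2 < q"
      proof -
        have "(1 - lev (j * pi)) * (1 + lev (j * pi)) < (1 - lev (j * pi)) * 2" using l by (intro mult_strict_left_mono) auto
        also have "\<dots> \<le> (q/2) * 2" using j by (intro mult_right_mono) auto
        finally show ?thesis by blast
      qed
      ultimately have "1 - (lev (j * pi))\<^sup>2 < q" by auto
      then have "z \<notin> W j" by (simp add: W_def q_def)
      then have "z \<in> core j" using z by blast
      then show ?thesis using core_subset by blast
    qed
  qed (use ZW in blast)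
  moreover have "closed (\<Inter>j. core j \<union> W j)"
    using compact_core compact_imp_closed Wcl by (intro closed_INT ballI closed_Un) auto
  moreover have "bounded Z"
  proof -
    have "norm (crimp x) \<le> 2" if "norm x = 1" for x
      using norm_triangle_ineq[of x "hump (x \<bullet> e) *\<^sub>R e"] that hump_bounds[of "x \<bullet> e"] by (simp add: crimp_def)
    then have "bounded (crimp ` sphere 0 1)" by (auto simp: bounded_iff intro!: exI[of _ 2])
    then show ?thesis unfolding Z_def using compact_imp_bounded[OF compact_whisker] by simp
  qed
  ultimately show ?thesis by (simp add: compact_eq_bounded_closed)
qed

text \<open>Recovers the height of \<open>x\<close> from \<open>z = crimp x\<close>; the profile is nonnegative and vanishes on the southern
  hemisphere, so \<open>z \<bullet> e\<close> and \<open>x \<bullet> e\<close> have the same sign.\<close>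

definition hgt :: "'a \<Rightarrow> real" where
  "hgt z = (if z \<bullet> e \<ge> 0 then sqrt (1 - (norm (perp z))\<^sup>2) else - sqrt (1 - (norm (perp z))\<^sup>2))"

text \<open>Stereographic projection from the north pole straightens the sheet to a horizontal disc; the whisker
  is shifted so that it starts at the centre of the disc.\<close>

definition chart :: "'a \<Rightarrow> 'a" where
  "chart z = (if perp z = 0 then (z \<bullet> e + 1) *\<^sub>R e else perp z /\<^sub>R (1 - hgt z))"

definition inv_stereo :: "'a \<Rightarrow> 'a" where
  "inv_stereo w = (2 / (1 + (norm w)\<^sup>2)) *\<^sub>R w + (((norm w)\<^sup>2 - 1) / (1 + (norm w)\<^sup>2)) *\<^sub>R e"

text \<open>Inverts \<open>chart\<close> on \<open>Z\<close>. At the origin, the common point of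
  disc and shifted whisker, both branches would give the south pole.\<close>

definition unchart :: "'a \<Rightarrow> 'a" where
  "unchart p = (if p \<bullet> e = 0 then crimp (inv_stereo p) else p - e)"

section \<open>Stereographic projection and its inverse\<close>

lemma hgt_crimp: assumes "norm x = 1" shows "hgt (crimp x) = x \<bullet> e"
  using unit_height[OF assms] hump_bounds(1)[of "x \<bullet> e"] by (cases "x \<bullet> e < 0") (simp_all add: hgt_def)

lemma unit_less_1: assumes "norm x = 1" "x \<noteq> e" shows "x \<bullet> e < 1"
  using unit_height_bounds[OF assms(1)] unit_pole[OF assms(1)] assms(2) by fastforce

lemma chart_crimp: assumes "norm x = 1" "x \<noteq> e" shows "chart (crimp x) = perp x /\<^sub>R (1 - x \<bullet> e)"
proof (cases "perp x = 0")
  case True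
  then have "x = - e" using unit_perp_0[OF assms(1)] assms(2) by simp
  then show ?thesis using True by (simp add: chart_def)
qed (simp add: chart_def hgt_crimp assms)

lemma chart_whisker: "chart (s *\<^sub>R e) = (s + 1) *\<^sub>R e" by (simp add: chart_def)

lemma stereo_norm_sq:
  assumes "norm x = 1" "x \<noteq> e"
  shows "(norm (perp x /\<^sub>R (1 - x \<bullet> e)))\<^sup>2 = (1 + x \<bullet> e) / (1 - x \<bullet> e)"
proof -
  have h: "1 - x \<bullet> e > 0" using unit_less_1[OF assms] by simp
  have "(norm (perp x /\<^sub>R (1 - x \<bullet> e)))\<^sup>2 = (norm (perp x))\<^sup>2 / (1 - x \<bullet> e)\<^sup>2"
    by (simp add: power_mult_distrib power_inverse divide_inverse mult.commute)
  also have "\<dots> = ((1 + x \<bullet> e) * (1 - x \<bullet> e)) / ((1 - x \<bullet> e) * (1 - x \<bullet> e))"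
    unfolding unit_height[OF assms(1)] by (simp add: power2_eq_square algebra_simps)
  also have "\<dots> = (1 + x \<bullet> e) / (1 - x \<bullet> e)" using h by simp
  finally show ?thesis .
qed

text \<open>The classical formula for chordal distance under stereographic projection, cleared of
  denominators. Away from the north pole it bounds the projection, and everywhere it bounds the
  inverse.\<close>

lemma stereo_dist:
  assumes x: "norm x = 1" "x \<noteq> e" and y: "norm y = 1" "y \<noteq> e"
  shows "(norm (perp x /\<^sub>R (1 - x \<bullet> e) - perp y /\<^sub>R (1 - y \<bullet> e)))\<^sup>2 * ((1 - x \<bullet> e) * (1 - y \<bullet> e)) = (norm (x - y))\<^sup>2"
proof -
  let ?h = "x \<bullet> e" and ?k = "y \<bullet> e"
  have h: "1 - ?h > 0" "1 - ?k > 0" using unit_less_1 x y by auto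
  have in_perp: "x \<bullet> y = perp x \<bullet> perp y + ?h * ?k"
    by (simp add: perp_def inner_diff_left inner_diff_right inner_commute)
  have exp: "(norm (a - b))\<^sup>2 = (norm a)\<^sup>2 + (norm b)\<^sup>2 - 2 * (a \<bullet> b)" for a b :: 'a
    by (simp add: power2_norm_eq_inner inner_diff_left inner_diff_right inner_commute)
  have "(norm (perp x /\<^sub>R (1 - ?h) - perp y /\<^sub>R (1 - ?k)))\<^sup>2
     = (1 + ?h) / (1 - ?h) + (1 + ?k) / (1 - ?k) - 2 * (perp x \<bullet> perp y) / ((1 - ?h) * (1 - ?k))"
    unfolding exp stereo_norm_sq[OF x] stereo_norm_sq[OF y] by (simp add: divide_inverse mult_ac)
  note nsq = this
  have "(norm (perp x /\<^sub>R (1 - ?h) - perp y /\<^sub>R (1 - ?k)))\<^sup>2 * ((1 - ?h) * (1 - ?k))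
     = (1 + ?h) * (1 - ?k) + (1 + ?k) * (1 - ?h) - 2 * (perp x \<bullet> perp y)"
  proof -
    have "(a / A + b / B - c / (A * B)) * (A * B) = a * B + b * A - c" if "A \<noteq> 0" "B \<noteq> 0" for a b c A B :: real
      using that by (simp add: field_simps)
    from this[of "1 - ?h" "1 - ?k" "1 + ?h" "1 + ?k" "2 * (perp x \<bullet> perp y)"] show ?thesis unfolding nsq using h by linarith
  qed
  also have "\<dots> = (norm (x - y))\<^sup>2" unfolding exp using x y in_perp by (simp add: algebra_simps)
  finally show ?thesis .
qed

lemma inv_stereo:
  assumes w: "w \<bullet> e = 0"
  shows "norm (inv_stereo w) = 1" "inv_stereo w \<noteq> e" "perp (inv_stereo w) = (2 / (1 + (norm w)\<^sup>2)) *\<^sub>R w"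
    "inv_stereo w \<bullet> e = ((norm w)\<^sup>2 - 1) / (1 + (norm w)\<^sup>2)" "1 - inv_stereo w \<bullet> e = 2 / (1 + (norm w)\<^sup>2)"
    "perp (inv_stereo w) /\<^sub>R (1 - inv_stereo w \<bullet> e) = w"
proof -
  have p: "1 + (norm w)\<^sup>2 > 0" by (simp add: add_pos_nonneg)
  show h: "inv_stereo w \<bullet> e = ((norm w)\<^sup>2 - 1) / (1 + (norm w)\<^sup>2)" by (simp add: inv_stereo_def inner_add_left w)
  show pe: "perp (inv_stereo w) = (2 / (1 + (norm w)\<^sup>2)) *\<^sub>R w" by (simp add: inv_stereo_def perp_add perp_scaleR perp_orth w)
  show h1: "1 - inv_stereo w \<bullet> e = 2 / (1 + (norm w)\<^sup>2)" unfolding h using p by (simp add: field_simps)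
  show "inv_stereo w \<noteq> e" using h1 p by auto
  show "perp (inv_stereo w) /\<^sub>R (1 - inv_stereo w \<bullet> e) = w" 
  proof -
    have "(t *\<^sub>R w) /\<^sub>R t = w" if "t \<noteq> 0" for t :: real using that by simp
    from this[of "2 / (1 + (norm w)\<^sup>2)"] show ?thesis unfolding pe h1 using p by auto
  qed
  have "(norm (inv_stereo w))\<^sup>2 = ((2 * norm w)\<^sup>2 + ((norm w)\<^sup>2 - 1)\<^sup>2) / (1 + (norm w)\<^sup>2)\<^sup>2"
    unfolding norm_perp_sq[of "inv_stereo w"] h pe using p by (simp add: power_divide power_mult_distrib add_divide_distrib)
  also have "(2 * norm w)\<^sup>2 + ((norm w)\<^sup>2 - 1)\<^sup>2 = (1 + (norm w)\<^sup>2)\<^sup>2" by (simp add: power2_eq_square algebra_simps)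
  finally have "(norm (inv_stereo w))\<^sup>2 = 1" using p by simp
  then show "norm (inv_stereo w) = 1" using norm_ge_zero[of "inv_stereo w"] by (auto simp: power2_eq_1_iff)
qed

lemma inv_stereo_stereo:
  assumes x: "norm x = 1" "x \<noteq> e"
  shows "inv_stereo (perp x /\<^sub>R (1 - x \<bullet> e)) = x"
proof -
  have h: "1 - x \<bullet> e > 0" using unit_less_1[OF x] by simp
  have 1: "1 + (1 + x \<bullet> e) / (1 - x \<bullet> e) = 2 / (1 - x \<bullet> e)" "(1 + x \<bullet> e) / (1 - x \<bullet> e) - 1 = 2 * (x \<bullet> e) / (1 - x \<bullet> e)"
    using h by (simp_all add: field_simps)
  have 2: "(2 - 2 * (x \<bullet> e)) * inverse (1 - x \<bullet> e) / 2 = 1" using h by (simp add: field_simps)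
  have "inv_stereo (perp x /\<^sub>R (1 - x \<bullet> e)) = perp x + (x \<bullet> e) *\<^sub>R e"
    unfolding inv_stereo_def stereo_norm_sq[OF x] 1 using h 2 by simp
  then show ?thesis using perp_decomp[of x] by simp
qed

lemma inv_stereo_lipschitz: assumes "w \<bullet> e = 0" "w' \<bullet> e = 0" shows "norm (inv_stereo w - inv_stereo w') \<le> 2 * norm (w - w')"
proof (rule power2_le_imp_le)
  have "(norm (inv_stereo w - inv_stereo w'))\<^sup>2 = (norm (w - w'))\<^sup>2 * ((1 - inv_stereo w \<bullet> e) * (1 - inv_stereo w' \<bullet> e))"
    using stereo_dist[of "inv_stereo w" "inv_stereo w'"] inv_stereo[OF assms(1)] inv_stereo[OF assms(2)] by simp
  also have "\<dots> \<le> (norm (w - w'))\<^sup>2 * (2 * 2)"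
    using unit_height_bounds[of "inv_stereo w"] unit_height_bounds[of "inv_stereo w'"] inv_stereo(1)[OF assms(1)] inv_stereo(1)[OF assms(2)]
    by (intro mult_left_mono mult_mono) auto
  finally show "(norm (inv_stereo w - inv_stereo w'))\<^sup>2 \<le> (2 * norm (w - w'))\<^sup>2" by (simp add: power_mult_distrib)
qed simp

lemma unchart_chart: assumes z: "z \<in> Z" shows "unchart (chart z) = z"
proof (cases "perp z = 0")
  case True
  then obtain s where s: "z = s *\<^sub>R e" using perp_0_whisker[OF z] by (auto simp: whisker_def)
  have i0: "inv_stereo 0 = - e" by (simp add: inv_stereo_def)
  show ?thesis
  proof (cases "s = -1")
    case True
    then have "chart z = 0" using s chart_whisker[of "-1"] by simp
    then show ?thesis using s True by (simp add: unchart_def i0 crimp_pole)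
  next
    case False
    then have "s + 1 \<noteq> 0" by linarith
    then have "((s + 1) *\<^sub>R e) \<bullet> e \<noteq> 0" "chart z = (s + 1) *\<^sub>R e" using s by (simp_all add: chart_whisker)
    then show ?thesis using s unfolding unchart_def by (simp only: if_False) (simp add: scaleR_add_left)
  qed
next
  case False
  then have "z \<notin> whisker" using whisker_perp by blast
  then obtain x where x: "norm x = 1" "z = crimp x" using z by (auto simp: Z_def)
  have xe: "x \<noteq> e" using False x by (auto simp: crimp_pole)
  show ?thesis unfolding x(2) chart_crimp[OF x(1) xe] unchart_def
    using inv_stereo_stereo[OF x(1) xe] by simp
qed

text \<open>The segment has length 3 because the whisker runs from height -1 to 2.\<close>

definition cross :: "real \<Rightarrow> 'a set" where
  "cross R = {w. w \<bullet> e = 0 \<and> norm w \<le> R} \<union> (\<lambda>s. s *\<^sub>R e) ` {0..3}"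

lemma coreE:
  assumes "z \<in> core j"
  obtains (crimp) x where "norm x = 1" "x \<noteq> e" "x \<bullet> e \<le> lev (j * pi)" "z = crimp x"
    | (whisker) s where "-1 \<le> s" "s \<le> 2" "z = s *\<^sub>R e"
proof (cases "z \<in> whisker")
  case True then show ?thesis using that(2) by (auto simp: whisker_def)
next
  case False
  then obtain x where x: "norm x = 1" "x \<bullet> e \<le> lev (j * pi)" "z = crimp x" using assms by (auto simp: core_def)
  have "x \<noteq> e"
  proof
    assume "x = e"
    then have "1 \<le> lev (real j * pi)" using x(2) by simp
    then show False using lev_less_1[of "real j * pi"] by linarith
  qed
  with x show ?thesis using that(1) by blast
qed

lemma chart_core: "chart ` core j \<subseteq> cross (1 / (1 - lev (j * pi)))"
proof
  fix p assume "p \<in> chart ` core j"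
  then obtain z where z: "z \<in> core j" "p = chart z" by blast
  from z(1) show "p \<in> cross (1 / (1 - lev (j * pi)))"
  proof (cases rule: coreE)
    case (crimp x)
    have "norm (perp x) / (1 - x \<bullet> e) \<le> 1 / (1 - lev (j * pi))"
      using crimp norm_perp_le[of x] by (intro frac_le) auto
    moreover have "1 - x \<bullet> e > 0" using unit_less_1 crimp by auto
    ultimately show ?thesis using z crimp by (simp add: chart_crimp cross_def divide_inverse mult.commute)
  next
    case (whisker s)
    then show ?thesis using z by (auto simp: chart_whisker cross_def intro!: image_eqI[of _ _ "s+1"])
  qed
qed

lemma chart_lipschitz: "(5 / (1 - lev (j * pi)))-lipschitz_on (core j) chart"
proof (rule lipschitz_onI)
  define d where "d = 1 - lev (j * pi)"
  have d: "0 < d" "d \<le> 1" using lev_nonneg[of "j * pi"] by (auto simp: d_def simp del: lev_nonneg)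
  have d5: "1 \<le> 5 / d" using d by (simp add: field_simps)
  show "0 \<le> 5 / (1 - lev (j * pi))" by (simp add: less_imp_le)
  \<comment> \<open>The delicate pair: one point on the sheet, one on the whisker. Their distance
    controls the horizontal part of the first. That part controls how far this point lies above the
    south pole, and so both chart images are bounded by multiples of the distance.\<close>
  have cross: "norm (chart z - chart z') \<le> 5 / d * norm (z - z')"
    if x: "norm x = 1" "x \<noteq> e" "x \<bullet> e \<le> lev (j * pi)" "z = crimp x" and s: "-1 \<le> s" "z' = s *\<^sub>R e" for z z' x s
  proof -
    let ?D = "norm (z - z')" and ?h = "x \<bullet> e"
    have pD: "norm (perp x) \<le> ?D" using norm_perp_le[of "z - z'"] x s by (simp add: perp_diff)
    have hd: "d \<le> 1 - ?h" using x by (simp add: d_def)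
    have 1: "norm (chart z) \<le> ?D / d"
    proof -
      have "norm (chart z) = norm (perp x) / (1 - ?h)" using x hd d by (simp add: chart_crimp divide_inverse mult.commute)
      also have "\<dots> \<le> ?D / d" using pD hd d by (intro frac_le) auto
      finally show ?thesis .
    qed
    have p1: "norm (perp x) \<le> 1" using norm_perp_le[of x] x by simp
    have p2: "(norm (perp x))\<^sup>2 \<le> norm (perp x)" using p1 by (simp add: power2_eq_square mult_left_le)
    have p3: "(norm (perp x))\<^sup>2 = (1 + ?h) * (1 - ?h)" using unit_height[OF x(1)] by (simp add: power2_eq_square algebra_simps)
    have hb: "-1 \<le> ?h" using unit_height_bounds[OF x(1)] by simp
    \<comment> \<open>On the southern hemisphere \<open>1 + x \<bullet> e\<close> is at most the
      squared horizontal norm. On the northern one that norm is at least \<open>d\<close>, and the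
      height above the south pole never exceeds 3.\<close>
    have 2: "z \<bullet> e + 1 \<le> 3 * norm (perp x) / d"
    proof (cases "?h \<le> 0")
      case True
      have "(1 + ?h) * 1 \<le> (1 + ?h) * (1 - ?h)" using True hb by (intro mult_left_mono) auto
      then have "z \<bullet> e + 1 \<le> norm (perp x)" using True x p2 p3 by simp
      also have "\<dots> \<le> 3 * norm (perp x) / d"
        using d mult_right_mono[OF d(2) norm_ge_zero[of "perp x"]] norm_ge_zero[of "perp x"]
        by (simp only: pos_le_divide_eq mult.commute[of _ d])
      finally show ?thesis .
    next
      case False
      have "1 * d \<le> (1 + ?h) * (1 - ?h)" using False hd d by (intro mult_mono) auto
      then have "d \<le> norm (perp x)" using p2 p3 by simp
      then have "3 \<le> 3 * norm (perp x) / d" using d by (simp add: field_simps)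
      moreover have "z \<bullet> e + 1 \<le> 3" using height_crimp_bounds[OF x(1)] x by simp
      ultimately show ?thesis by linarith
    qed
    have 3: "s - z \<bullet> e \<le> ?D" using abs_inner_e_le[of "z - z'"] s by (simp add: inner_diff_left)
    have 4: "3 * norm (perp x) / d \<le> 3 * ?D / d" using pD d by (intro divide_right_mono) auto
    have "norm (chart z - chart z') \<le> norm (chart z) + norm (chart z')" by (rule norm_triangle_ineq4)
    also have "\<dots> \<le> ?D / d + (?D + 3 * ?D / d)" using 1 2 3 4 s by (simp add: chart_whisker)
    also have "\<dots> \<le> ?D / d + (?D / d + 3 * ?D / d)"
    proof -
      have "?D * d \<le> ?D * 1" using d by (intro mult_left_mono) auto
      then have "?D \<le> ?D / d" using d by (simp add: pos_le_divide_eq)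
      then show ?thesis by simp
    qed
    also have "\<dots> = 5 / d * ?D" by (simp add: field_simps)
    finally show ?thesis .
  qed
  fix z z' assume z: "z \<in> core j" and z': "z' \<in> core j"
  have "norm (chart z - chart z') \<le> 5 / d * norm (z - z')"
    using z
  proof (cases rule: coreE)
    case fx: (crimp x)
    show ?thesis using z'
    proof (cases rule: coreE)
      case fy: (crimp y)
      let ?N = "norm (perp x /\<^sub>R (1 - x \<bullet> e) - perp y /\<^sub>R (1 - y \<bullet> e))"
      have "d \<le> 1 - x \<bullet> e" "d \<le> 1 - y \<bullet> e" using fx fy by (auto simp: d_def)
      then have "d * d \<le> (1 - x \<bullet> e) * (1 - y \<bullet> e)" using d by (intro mult_mono) auto
      then have "?N\<^sup>2 * (d * d) \<le> ?N\<^sup>2 * ((1 - x \<bullet> e) * (1 - y \<bullet> e))" by (intro mult_left_mono) auto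
      also have "\<dots> = (norm (x - y))\<^sup>2" using stereo_dist fx fy by blast
      finally have "(?N * d)\<^sup>2 \<le> (norm (x - y))\<^sup>2" by (simp add: power_mult_distrib power2_eq_square mult_ac)
      then have "?N * d \<le> norm (x - y)" by (rule power2_le_imp_le) simp
      also have "\<dots> \<le> 5 * norm (z - z')" using crimp_inverse_lipschitz fx fy by simp
      finally have "?N \<le> 5 / d * norm (z - z')" using d by (simp add: field_simps)
      then show ?thesis using fx fy by (simp add: chart_crimp)
    next
      case (whisker s)
      then show ?thesis using cross[OF fx] by blast
    qed
  next
    case ws: (whisker s)
    show ?thesis using z'
    proof (cases rule: coreE)
      case fy: (crimp y)
      then show ?thesis using cross[OF fy ws(1,3)] by (simp add: norm_minus_commute)
    next
      case (whisker t)
      have "chart z - chart z' = z - z'" using ws whisker by (simp add: chart_whisker scaleR_add_left)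
      then show ?thesis using d5 mult_right_mono[OF d5, of "norm (z - z')"] by simp
    qed
  qed
  then show "dist (chart z) (chart z') \<le> 5 / (1 - lev (j * pi)) * dist z z'" by (simp add: dist_norm d_def)
qed

lemma unchart_cross: "unchart ` cross R \<subseteq> Z"
proof
  fix z assume "z \<in> unchart ` cross R"
  then obtain p where p: "p \<in> cross R" "z = unchart p" by blast
  show "z \<in> Z"
  proof (cases "p \<bullet> e = 0")
    case True
    then show ?thesis using p inv_stereo(1) by (auto simp: unchart_def Z_def)
  next
    case False
    then have "p \<in> (\<lambda>s. s *\<^sub>R e) ` {0..3}" using p by (simp add: cross_def)
    then obtain s where s': "p = s *\<^sub>R e" "s \<in> {0..3}" by (rule imageE)
    then have s: "p = s *\<^sub>R e" "0 \<le> s" "s \<le> 3" by simp_all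
    then have "z = (s - 1) *\<^sub>R e" using p False by (simp add: unchart_def scaleR_diff_left)
    then have "z \<in> whisker" unfolding whisker_def by (rule image_eqI) (use s in auto)
    then show ?thesis by (simp add: Z_def)
  qed
qed

lemma unchart_lipschitz: "\<exists>L. L-lipschitz_on (cross R) unchart"
proof -
  \<comment> \<open>This is the greatest height that inverse stereographic projection reaches from
    the disc of radius \<open>R\<close>; being below 1 it lies under some truncation level, where
    \<open>crimp\<close> is Lipschitz.\<close>
  have "((R\<^sup>2 - 1) / (1 + R\<^sup>2)) < 1" by (simp add: field_simps add_pos_nonneg)
  then obtain j :: nat where j: "(R\<^sup>2 - 1) / (1 + R\<^sup>2) \<le> lev (j * pi)" using lev_ge_limit by blast
  define B where "B = 1 + 2 / (1 - lev (j * pi))"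
  have B1: "1 \<le> B" by (simp add: B_def less_imp_le)
  have ww: "norm (unchart w - unchart w') \<le> 2 * B * norm (w - w')"
    if w: "w \<bullet> e = 0" "norm w \<le> R" and w': "w' \<bullet> e = 0" "norm w' \<le> R" for w w'
  proof -
    have low: "inv_stereo w \<bullet> e \<le> lev (j * pi)" if w: "w \<bullet> e = 0" "norm w \<le> R" for w
    proof -
      have R: "(norm w)\<^sup>2 \<le> R\<^sup>2" using w by (intro power_mono) auto
      have "inv_stereo w \<bullet> e = 1 - 2 / (1 + (norm w)\<^sup>2)" using inv_stereo(5)[OF w(1)] by simp
      also have "\<dots> \<le> 1 - 2 / (1 + R\<^sup>2)" using R by (intro diff_left_mono frac_le) (auto simp: add_pos_nonneg)
      also have "\<dots> = (R\<^sup>2 - 1) / (1 + R\<^sup>2)"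
      proof -
        have "1 + R\<^sup>2 \<noteq> 0" using add_pos_nonneg[of 1 "R\<^sup>2"] by auto
        then show ?thesis by (simp add: field_simps)
      qed
      finally show ?thesis using j by simp
    qed
    have "norm (crimp (inv_stereo w) - crimp (inv_stereo w')) \<le> B * norm (inv_stereo w - inv_stereo w')"
      using lipschitz_onD[OF crimp_lipschitz_below[of j], of "inv_stereo w" "inv_stereo w'"] low w w' by (simp add: B_def dist_norm)
    also have "\<dots> \<le> B * (2 * norm (w - w'))" using inv_stereo_lipschitz[OF w(1) w'(1)] B1 by (intro mult_left_mono) auto
    finally show ?thesis using w w' by (simp add: unchart_def)
  qed
  have u0: "unchart 0 = - e" by (simp add: unchart_def inv_stereo_def crimp_pole)
  have us: "unchart (s *\<^sub>R e) = (s - 1) *\<^sub>R e" for s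
    by (cases "s = 0") (auto simp: u0, simp add: unchart_def scaleR_diff_left)
  have ws: "norm (unchart w - unchart (s *\<^sub>R e)) \<le> (2 * B + 1) * norm (w - s *\<^sub>R e)"
    if w: "w \<bullet> e = 0" "norm w \<le> R" and s: "0 \<le> s" for w s
  proof -
    have 1: "norm (unchart w - unchart (s *\<^sub>R e)) \<le> norm (unchart w - unchart 0) + norm (unchart 0 - unchart (s *\<^sub>R e))"
      by (metis dist_norm dist_triangle)
    have 2: "norm (unchart w - unchart 0) \<le> 2 * B * norm (w - 0)"
      using w order_trans[OF norm_ge_zero w(2)] by (intro ww) auto
    have 3: "norm (unchart 0 - unchart (s *\<^sub>R e)) = s"
      unfolding us u0 using s by (simp add: scaleR_diff_left)
    have 4: "norm w \<le> norm (w - s *\<^sub>R e)"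
      using norm_perp_le[of "w - s *\<^sub>R e"] w by (simp add: perp_diff perp_orth)
    have 5: "s \<le> norm (w - s *\<^sub>R e)" using abs_inner_e_le[of "w - s *\<^sub>R e"] w s by (simp add: inner_diff_left)
    have "2 * B * norm w \<le> 2 * B * norm (w - s *\<^sub>R e)" using 4 B1 by (intro mult_left_mono) auto
    then show ?thesis using 1 2 3 5 by (simp add: distrib_right)
  qed
  have "(2 * B + 1)-lipschitz_on (cross R) unchart"
  proof (rule lipschitz_onI)
    show "0 \<le> 2 * B + 1" using B1 by simp
    fix p q assume p: "p \<in> cross R" and q: "q \<in> cross R"
    have 1: "2 * B * norm (p - q) \<le> (2 * B + 1) * norm (p - q)" by (intro mult_right_mono) auto
    have 2: "1 * norm (p - q) \<le> (2 * B + 1) * norm (p - q)" using B1 by (intro mult_right_mono) auto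
    have "norm (unchart p - unchart q) \<le> (2 * B + 1) * norm (p - q)"
    proof (cases "p \<bullet> e = 0 \<and> norm p \<le> R")
      case True
      show ?thesis
      proof (cases "q \<bullet> e = 0 \<and> norm q \<le> R")
        case T: True then show ?thesis using ww[of p q] True 1 by linarith
      next
        case False then show ?thesis using ws[of p] True q by (auto simp: cross_def)
      qed
    next
      case False
      then have "p \<in> (\<lambda>s. s *\<^sub>R e) ` {0..3}" using p unfolding cross_def by blast
      then obtain s where "p = s *\<^sub>R e" "s \<in> {0..3}" by (rule imageE)
      then have s: "p = s *\<^sub>R e" "0 \<le> s" by simp_all
      show ?thesis
      proof (cases "q \<bullet> e = 0 \<and> norm q \<le> R")
        case True then show ?thesis using ws[of q s] s by (simp add: norm_minus_commute)
      next
        case F: False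
        then have "q \<in> (\<lambda>s. s *\<^sub>R e) ` {0..3}" using q unfolding cross_def by blast
        then obtain t where t: "q = t *\<^sub>R e" by (rule imageE)
        show ?thesis using 2 unfolding s t us by (simp add: scaleR_diff_left)
      qed
    qed
    then show "dist (unchart p) (unchart q) \<le> (2 * B + 1) * dist p q" by (simp add: dist_norm)
  qed
  then show ?thesis by blast
qed

text \<open>Soft thresholding: the smaller of the horizontal and the vertical part is removed.\<close>

definition retr :: "'a \<Rightarrow> 'a" where
  "retr p = max 0 (norm (perp p) - p \<bullet> e) *\<^sub>R sgn (perp p) + max 0 (p \<bullet> e - norm (perp p)) *\<^sub>R e"

text \<open>The convex set in which homotopies run along straight lines before \<open>retr\<close>
  returns them to the cross.\<close>

definition tube :: "real \<Rightarrow> 'a set" where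
  "tube R = {p. norm (perp p) \<le> R \<and> 0 \<le> p \<bullet> e \<and> p \<bullet> e \<le> 3}"

lemma convex_tube: "convex (tube R)"
proof (rule convexI)
  fix p q u v assume pq: "p \<in> tube R" "q \<in> tube R" and uv: "0 \<le> u" "0 \<le> v" "u + v = (1::real)"
  have "norm (perp (u *\<^sub>R p + v *\<^sub>R q)) \<le> u * norm (perp p) + v * norm (perp q)"
    using norm_triangle_ineq[of "u *\<^sub>R perp p" "v *\<^sub>R perp q"] uv by (simp add: perp_add perp_scaleR)
  also have "\<dots> \<le> R" using pq uv by (intro convex_bound_le) (auto simp: tube_def)
  finally show "u *\<^sub>R p + v *\<^sub>R q \<in> tube R"
    using pq uv convex_bound_le[of "p \<bullet> e" 3 "q \<bullet> e" u v] by (simp add: tube_def inner_add_left)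
qed

lemma retr_cross: "p \<in> cross R \<Longrightarrow> retr p = p"
proof -
  have "norm w *\<^sub>R sgn w = w" for w :: 'a by (cases "w = 0") (auto simp: sgn_div_norm)
  then show "p \<in> cross R \<Longrightarrow> retr p = p" by (auto simp: cross_def retr_def perp_orth)
qed

lemma cross_tube: "0 \<le> R \<Longrightarrow> cross R \<subseteq> tube R" by (auto simp: cross_def tube_def perp_orth)

lemma retr_tube: "p \<in> tube R \<Longrightarrow> retr p \<in> cross R"
proof -
  assume p: "p \<in> tube R"
  have sg: "sgn (perp p) \<bullet> e = 0" by (simp add: sgn_div_norm)
  show "retr p \<in> cross R"
  proof (cases "norm (perp p) \<ge> p \<bullet> e")
    case True
    have "norm (retr p) \<le> norm (perp p) - p \<bullet> e" using True by (auto simp: retr_def norm_sgn)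
    then have "norm (retr p) \<le> R" using p by (simp add: tube_def)
    then show ?thesis using True sg by (simp add: retr_def cross_def)
  next
    case False
    moreover have "p \<bullet> e - norm (perp p) \<le> 3" 
    proof -
      have "p \<bullet> e \<le> 3" using p by (simp add: tube_def)
      then show ?thesis using norm_ge_zero[of "perp p"] by linarith
    qed
    ultimately show ?thesis by (auto simp: retr_def cross_def intro!: image_eqI[of _ _ "p \<bullet> e - norm (perp p)"])
  qed
qed

lemma retr_lipschitz: "6-lipschitz_on {p. 0 \<le> p \<bullet> e} retr"
proof (rule lipschitz_onI)
  fix p q :: 'a assume pq: "p \<in> {p. 0 \<le> p \<bullet> e}" "q \<in> {p. 0 \<le> p \<bullet> e}"
  define A where "A p = max 0 (norm (perp p) - p \<bullet> e)" for p
  define B where "B p = max 0 (p \<bullet> e - norm (perp p))" for p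
  define D where "D = norm (p - q)"
  have pp: "norm (perp p - perp q) \<le> D" using norm_perp_le[of "p - q"] by (simp add: perp_diff D_def)
  have n: "\<bar>norm (perp p) - norm (perp q)\<bar> \<le> D" 
    using norm_triangle_ineq3[of "perp p" "perp q"] pp by simp
  have hh: "\<bar>p \<bullet> e - q \<bullet> e\<bar> \<le> D" using abs_inner_e_le[of "p - q"] by (simp add: inner_diff_left D_def)
  have AB: "\<bar>A p - A q\<bar> \<le> 2 * D" "\<bar>B p - B q\<bar> \<le> 2 * D" using n hh by (auto simp: A_def B_def max_def)
  \<comment> \<open>Since the height of \<open>p\<close> is nonnegative, the coefficient of the
    horizontal direction is at most the horizontal norm, so \<open>norm_sgn_diff\<close> absorbs the
    singularity of \<open>sgn\<close> on the axis. The constant 6 is 2 for each of the three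
    summands.\<close>
  have "A p * norm (sgn (perp p) - sgn (perp q)) \<le> norm (perp p) * norm (sgn (perp p) - sgn (perp q))"
    using pq by (intro mult_right_mono) (auto simp: A_def)
  also have "\<dots> \<le> 2 * norm (perp p - perp q)" by (rule norm_sgn_diff)
  finally have 1: "A p * norm (sgn (perp p) - sgn (perp q)) \<le> 2 * D" using pp by simp
  have 2: "\<bar>A p - A q\<bar> * norm (sgn (perp q)) \<le> 2 * D * 1" using AB(1) by (intro mult_mono) (auto simp: norm_sgn)
  have "retr p - retr q = A p *\<^sub>R (sgn (perp p) - sgn (perp q)) + (A p - A q) *\<^sub>R sgn (perp q) + (B p - B q) *\<^sub>R e"
    by (simp add: retr_def A_def[symmetric] B_def[symmetric] algebra_simps)
  then have "norm (retr p - retr q) \<le> norm (A p *\<^sub>R (sgn (perp p) - sgn (perp q))) + norm ((A p - A q) *\<^sub>R sgn (perp q)) + norm ((B p - B q) *\<^sub>R e)"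
    by (simp only:) (intro order_trans[OF norm_triangle_ineq] add_mono order_refl)
  also have "\<dots> = A p * norm (sgn (perp p) - sgn (perp q)) + \<bar>A p - A q\<bar> * norm (sgn (perp q)) + \<bar>B p - B q\<bar>"
    by (simp add: A_def)
  also have "\<dots> \<le> 6 * D" using 1 2 AB by linarith
  finally show "dist (retr p) (retr q) \<le> 6 * dist p q" by (simp add: dist_norm D_def)
qed simp

text \<open>\<open>core j\<close> is sent into a convex set and back, both ways Lipschitz, the
  composite being the identity on \<open>core j\<close>. Hence straight-line homotopies in the
  convex set become Lipschitz homotopies inside \<open>Z\<close>.\<close>

lemma contraction_chart:
  obtains R K L where "chart ` core j \<subseteq> tube R" "K-lipschitz_on (core j) chart"
    "L-lipschitz_on (tube R) (\<lambda>p. unchart (retr p))" "(\<lambda>p. unchart (retr p)) ` tube R \<subseteq> Z"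
    "\<And>z. z \<in> core j \<Longrightarrow> unchart (retr (chart z)) = z"
proof -
  define R where "R = 1 / (1 - lev (j * pi))"
  have R0: "0 \<le> R" by (simp add: R_def less_imp_le)
  obtain L where L: "L-lipschitz_on (cross R) unchart" using unchart_lipschitz by blast
  have r: "6-lipschitz_on (tube R) retr" by (rule lipschitz_on_subset[OF retr_lipschitz]) (auto simp: tube_def)
  have im: "retr ` tube R \<subseteq> cross R" using retr_tube by blast
  have ch: "chart ` core j \<subseteq> cross R" using chart_core by (simp add: R_def)
  show ?thesis
  proof (rule that[OF _ chart_lipschitz])
    show "chart ` core j \<subseteq> tube R" using ch cross_tube[OF R0] by blast
    show "(L * 6)-lipschitz_on (tube R) (\<lambda>p. unchart (retr p))"
      by (rule lipschitz_on_compose2[OF r lipschitz_on_subset[OF L im]])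
    show "(\<lambda>p. unchart (retr p)) ` tube R \<subseteq> Z" using im unchart_cross[of R] by blast
    show "unchart (retr (chart z)) = z" if "z \<in> core j" for z
    proof -
      have "z \<in> Z" "chart z \<in> cross R" using that ch core_subset by blast+
      then show ?thesis by (simp add: retr_cross unchart_chart)
    qed
  qed
qed

section \<open>Vanishing of the Lipschitz homotopy groups\<close>

lemma core_mono: "j \<le> k \<Longrightarrow> core j \<subseteq> core k"
proof -
  assume "j \<le> k"
  then have "lev (real j * pi) \<le> lev (real k * pi)" by simp
  then show ?thesis unfolding core_def by (auto simp del: lev_le_iff intro: order_trans)
qed

lemma Z_core: assumes "z \<in> Z" shows "\<exists>j. z \<in> core j"
proof -
  obtain c where c: "\<not> tail c z" using not_tail_exists by blast
  obtain j :: nat where "c / pi \<le> real j" using real_arch_simple by blast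
  then have "c \<le> real j * pi" by (simp add: pos_divide_le_eq)
  then show ?thesis using not_tail_imp_core[OF assms c] by blast
qed

lemma segment_tube_lipschitz:
  assumes "p \<in> tube R" "q \<in> tube R"
  shows "(norm (q - p))-lipschitz_on {0..1} (\<lambda>t. (1 - t) *\<^sub>R p + t *\<^sub>R q)"
proof (rule lipschitz_onI)
  fix s t :: real
  have "((1 - s) *\<^sub>R p + s *\<^sub>R q) - ((1 - t) *\<^sub>R p + t *\<^sub>R q) = (s - t) *\<^sub>R (q - p)" by (simp add: algebra_simps)
  then show "dist ((1 - s) *\<^sub>R p + s *\<^sub>R q) ((1 - t) *\<^sub>R p + t *\<^sub>R q) \<le> norm (q - p) * dist s t"
    by (simp add: dist_norm)
qed simp

lemma pi0_Z: "lip_pi0_trivial Z"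
  unfolding lip_pi0_trivial_def
proof (intro conjI ballI)
  show "Z \<noteq> {}" by (auto simp: Z_def)
  fix x y assume "x \<in> Z" "y \<in> Z"
  then obtain i k where "x \<in> core i" "y \<in> core k" using Z_core by blast
  then have xy: "x \<in> core (max i k)" "y \<in> core (max i k)" using core_mono[of i "max i k"] core_mono[of k "max i k"] by auto
  obtain R K L where E: "chart ` core (max i k) \<subseteq> tube R" "K-lipschitz_on (core (max i k)) chart"
    "L-lipschitz_on (tube R) (\<lambda>p. unchart (retr p))" "(\<lambda>p. unchart (retr p)) ` tube R \<subseteq> Z"
    "\<And>z. z \<in> core (max i k) \<Longrightarrow> unchart (retr (chart z)) = z" 
    by (rule contraction_chart[where j="max i k"]) (rule that; assumption)
  let ?s = "\<lambda>t. (1 - t) *\<^sub>R chart x + t *\<^sub>R chart y"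
  have c: "chart x \<in> tube R" "chart y \<in> tube R" using E(1) xy by auto
  have im: "?s ` {0..1} \<subseteq> tube R"
    using convexD[OF convex_tube c] by auto
  have "(L * norm (chart y - chart x))-lipschitz_on {0..1} (\<lambda>t. unchart (retr (?s t)))"
    by (rule lipschitz_on_compose2[OF segment_tube_lipschitz[OF c] lipschitz_on_subset[OF E(3) im]])
  then show "\<exists>\<gamma>::real \<Rightarrow> 'a. (\<exists>L. L-lipschitz_on {0..1} \<gamma>) \<and> \<gamma> ` {0..1} \<subseteq> Z \<and> \<gamma> 0 = x \<and> \<gamma> 1 = y"
    using im E(4) xy by (intro exI[of _ "\<lambda>t. unchart (retr (?s t))"]) (auto simp: E(5))
qed

lemma cdist_nonneg: "0 \<le> cdist k x y" by (simp add: cdist_def sum_nonneg)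

lemma cdist_Suc_ge: "cdist k x y \<le> cdist (Suc k) x y" "\<bar>x k - y k\<bar> \<le> cdist (Suc k) x y"
  unfolding cdist_def by (auto intro!: real_le_rsqrt real_sqrt_le_mono simp: sum_nonneg)

lemma cdist_cong: "(\<And>i. i < k \<Longrightarrow> x i = x' i) \<Longrightarrow> (\<And>i. i < k \<Longrightarrow> y i = y' i) \<Longrightarrow> cdist k x y = cdist k x' y'"
  by (simp add: cdist_def)

lemma cube_image_core:
  assumes f: "cube_lipschitz k (cube k) f" and im: "f ` cube k \<subseteq> Z"
  shows "\<exists>j. f ` cube k \<subseteq> core j"
proof -
  obtain L0 where L0: "\<And>x y. x \<in> cube k \<Longrightarrow> y \<in> cube k \<Longrightarrow> dist (f x) (f y) \<le> L0 * cdist k x y"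
    using f by (auto simp: cube_lipschitz_def)
  \<comment> \<open>\<open>cube_lipschitz\<close> puts no sign condition on its constant.\<close>
  define L where "L = max L0 0"
  have L: "dist (f x) (f y) \<le> L * cdist k x y" if "x \<in> cube k" "y \<in> cube k" for x y
    using L0[OF that] mult_right_mono[of L0 L "cdist k x y"] cdist_nonneg[of k x y] by (simp add: L_def)
  have L0: "0 \<le> L" by (simp add: L_def)
  \<comment> \<open>The cube has diameter at most \<open>sqrt k\<close>, so \<open>M\<close> bounds
    the Lipschitz constant of \<open>f\<close> along every segment parametrised by the unit
    interval.\<close>
  define M where "M = L * sqrt k"
  have M0: "0 \<le> M" using L0 by (simp add: M_def)
  have cd: "cdist k x y \<le> sqrt k" if "x \<in> cube k" "y \<in> cube k" for x y
  proof -
    have "(\<Sum>i<k. (x i - y i)\<^sup>2) \<le> (\<Sum>i<k. 1)"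
    proof (rule sum_mono)
      fix i assume "i \<in> {..<k}"
      then have "\<bar>x i - y i\<bar> \<le> 1" using that unfolding cube_def by (smt (verit) lessThan_iff mem_Collect_eq)
      then show "(x i - y i)\<^sup>2 \<le> 1" by (simp add: abs_square_le_1)
    qed
    then show ?thesis unfolding cdist_def by (intro real_sqrt_le_mono) simp
  qed
  show ?thesis
  proof (rule path_connected_in_core[OF im, of M])
    fix z z' assume "z \<in> f ` cube k" "z' \<in> f ` cube k"
    then obtain x y where xy: "x \<in> cube k" "y \<in> cube k" "z = f x" "z' = f y" by blast
    define seg where "seg t i = (1 - t) * x i + t * y i" for t :: real and i
    have seg: "seg t \<in> cube k" if "t \<in> {0..1}" for t
      using xy that by (auto simp: cube_def seg_def intro!: add_nonneg_nonneg convex_bound_le)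
    have segd: "cdist k (seg s) (seg t) = \<bar>s - t\<bar> * cdist k x y" for s t
    proof -
      have "(\<Sum>i<k. (seg s i - seg t i)\<^sup>2) = (s - t)\<^sup>2 * (\<Sum>i<k. (x i - y i)\<^sup>2)"
        unfolding sum_distrib_left by (intro sum.cong refl) (simp add: seg_def power2_eq_square algebra_simps)
      then show ?thesis by (simp add: cdist_def real_sqrt_mult)
    qed
    have 1: "M-lipschitz_on {0..1} (\<lambda>t. f (seg t))"
    proof (rule lipschitz_onI[OF _ M0])
      fix s t :: real assume st: "s \<in> {0..1}" "t \<in> {0..1}"
      have "dist (f (seg s)) (f (seg t)) \<le> L * (\<bar>s - t\<bar> * cdist k x y)" using L[OF seg[OF st(1)] seg[OF st(2)]] by (simp add: segd)
      also have "\<dots> \<le> L * (\<bar>s - t\<bar> * sqrt k)" using L0 cd xy by (intro mult_left_mono) auto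
      finally show "dist (f (seg s)) (f (seg t)) \<le> M * dist s t" by (simp add: M_def dist_real_def mult_ac)
    qed
    have 2: "seg 0 = x" "seg 1 = y" by (auto simp: seg_def)
    \<comment> \<open>The cube is convex, so one segment suffices and the second leg is
      constant.\<close>
    have 3: "M-lipschitz_on {0..1} (\<lambda>t::real. z')" by (rule lipschitz_on_mono[OF lipschitz_on_constant subset_refl M0])
    show "\<exists>w \<gamma> \<delta>. M-lipschitz_on {0..1::real} \<gamma> \<and> \<gamma> ` {0..1} \<subseteq> Z \<and> \<gamma> 0 = z \<and> \<gamma> 1 = w \<and>
        M-lipschitz_on {0..1::real} \<delta> \<and> \<delta> ` {0..1} \<subseteq> Z \<and> \<delta> 0 = w \<and> \<delta> 1 = z'"
      using 1 2 3 seg im xy by (intro exI[of _ z'] exI[of _ "\<lambda>t. f (seg t)"] exI[of _ "\<lambda>t. z'"]) auto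
  qed
qed

lemma pik_Z: "lip_pik_trivial k Z"
  unfolding lip_pik_trivial_def
proof (intro ballI allI impI)
  fix z0 f assume z0: "z0 \<in> Z" and f: "cube_lipschitz k (cube k) f \<and> f ` cube k \<subseteq> Z \<and> (\<forall>x\<in>cube_boundary k. f x = z0)"
  obtain j1 where j1: "f ` cube k \<subseteq> core j1" 
    using cube_image_core[OF conjunct1[OF f] conjunct1[OF conjunct2[OF f]]] by (rule exE)
  \<comment> \<open>For \<open>k = 0\<close> the boundary is empty and \<open>z0\<close> need not be
    a value of \<open>f\<close>, so it is placed in a core separately.\<close>
  obtain j2 where j2: "z0 \<in> core j2" using Z_core[OF z0] by blast
  define j where "j = max j1 j2"
  have j: "f ` cube k \<subseteq> core j" "z0 \<in> core j" using j1 j2 core_mono[of j1 j] core_mono[of j2 j] by (auto simp: j_def)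
  obtain R K L where E: "chart ` core j \<subseteq> tube R" "K-lipschitz_on (core j) chart"
    "L-lipschitz_on (tube R) (\<lambda>p. unchart (retr p))" "(\<lambda>p. unchart (retr p)) ` tube R \<subseteq> Z"
    "\<And>z. z \<in> core j \<Longrightarrow> unchart (retr (chart z)) = z" 
    by (rule contraction_chart[where j=j]) (rule that; assumption)
  obtain L1 where L1: "\<And>x y. x \<in> cube k \<Longrightarrow> y \<in> cube k \<Longrightarrow> dist (f x) (f y) \<le> L1 * cdist k x y"
    using f by (auto simp: cube_lipschitz_def)
  have K0: "0 \<le> K" and L0: "0 \<le> L" using E lipschitz_on_nonneg by blast+
  define F where "F x = chart (f x)" for x
  have Ft: "F x \<in> tube R" if "x \<in> cube k" for x using that j E(1) by (auto simp: F_def)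
  have Fl: "norm (F x - F y) \<le> K * \<bar>L1\<bar> * cdist k x y" if "x \<in> cube k" "y \<in> cube k" for x y
  proof -
    have "norm (F x - F y) \<le> K * dist (f x) (f y)"
      using lipschitz_onD[OF E(2), of "f x" "f y"] j that by (auto simp: F_def dist_norm)
    also have "\<dots> \<le> K * (\<bar>L1\<bar> * cdist k x y)"
      using L1[OF that] mult_right_mono[OF abs_ge_self[of L1] cdist_nonneg[of k x y]] K0 by (intro mult_left_mono) auto
    finally show ?thesis by (simp add: mult.assoc)
  qed
  define p0 where "p0 = chart z0"
  have p0: "p0 \<in> tube R" using j E(1) by (auto simp: p0_def)
  obtain B where B: "\<And>p. p \<in> tube R \<Longrightarrow> norm p \<le> B"
  proof
    fix p assume p: "p \<in> tube R"
    have "norm p \<le> norm (perp p) + norm ((p \<bullet> e) *\<^sub>R e)" using perp_decomp[of p] norm_triangle_ineq by metis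
    then show "norm p \<le> R + 3" using p by (simp add: tube_def)
  qed
  define cut where "cut x = x(k := 0::real)" for x :: "nat \<Rightarrow> real"
  have cut: "cut x \<in> cube k" if "x \<in> cube (Suc k)" for x
    using that by (auto simp: cut_def cube_def less_Suc_eq)
  \<comment> \<open>The straight line in the tube from the chart of \<open>f\<close> to that of
    \<open>z0\<close>, with the last coordinate as time. Over the boundary both ends are
    \<open>p0\<close>, so the homotopy rests there.\<close>
  define pp where "pp x = (1 - x k) *\<^sub>R F (cut x) + x k *\<^sub>R p0" for x
  have xk: "0 \<le> x k" "x k \<le> 1" if "x \<in> cube (Suc k)" for x using that by (auto simp: cube_def)
  have ppt: "pp x \<in> tube R" if "x \<in> cube (Suc k)" for x
    unfolding pp_def using convexD[OF convex_tube Ft[OF cut[OF that]] p0, of "1 - x k" "x k"] xk[OF that] by simp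
  define H where "H x = unchart (retr (pp x))" for x
  define C where "C = K * \<bar>L1\<bar> + 2 * B"
  have ppl: "norm (pp x - pp y) \<le> C * cdist (Suc k) x y" if xy: "x \<in> cube (Suc k)" "y \<in> cube (Suc k)" for x y
  proof -
    have "pp x - pp y = (1 - x k) *\<^sub>R (F (cut x) - F (cut y)) + (x k - y k) *\<^sub>R (p0 - F (cut y))"
      by (simp add: pp_def algebra_simps)
    then have "norm (pp x - pp y) \<le> norm ((1 - x k) *\<^sub>R (F (cut x) - F (cut y))) + norm ((x k - y k) *\<^sub>R (p0 - F (cut y)))"
      by (simp only: norm_triangle_ineq)
    also have "\<dots> \<le> 1 * norm (F (cut x) - F (cut y)) + \<bar>x k - y k\<bar> * (2 * B)"
    proof (intro add_mono)
      show "norm ((1 - x k) *\<^sub>R (F (cut x) - F (cut y))) \<le> 1 * norm (F (cut x) - F (cut y))"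
        unfolding norm_scaleR using xk[OF xy(1)] by (intro mult_right_mono) auto
      have "norm (p0 - F (cut y)) \<le> B + B"
        using norm_triangle_ineq4[of p0 "F (cut y)"] B[OF p0] B[OF Ft[OF cut[OF xy(2)]]] by linarith
      then show "norm ((x k - y k) *\<^sub>R (p0 - F (cut y))) \<le> \<bar>x k - y k\<bar> * (2 * B)"
        unfolding norm_scaleR by (intro mult_left_mono) auto
    qed
    also have "norm (F (cut x) - F (cut y)) \<le> K * \<bar>L1\<bar> * cdist (Suc k) x y"
    proof -
      have "cdist k (cut x) (cut y) = cdist k x y" by (rule cdist_cong) (auto simp: cut_def)
      then have "norm (F (cut x) - F (cut y)) \<le> K * \<bar>L1\<bar> * cdist k x y" using Fl[OF cut[OF xy(1)] cut[OF xy(2)]] by simp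
      also have "\<dots> \<le> K * \<bar>L1\<bar> * cdist (Suc k) x y" using K0 cdist_Suc_ge(1) by (intro mult_left_mono) auto
      finally show ?thesis .
    qed
    also have "\<bar>x k - y k\<bar> * (2 * B) \<le> cdist (Suc k) x y * (2 * B)"
      using cdist_Suc_ge(2)[of x k y] order_trans[OF norm_ge_zero B[OF p0]] by (intro mult_right_mono) auto
    finally show ?thesis by (simp add: C_def algebra_simps)
  qed
  show "\<exists>H. cube_lipschitz (Suc k) (cube (Suc k)) H \<and> H ` cube (Suc k) \<subseteq> Z \<and>
           (\<forall>x\<in>cube k. H x = f x) \<and> (\<forall>x\<in>cube k. H (x(k := 1)) = z0) \<and>
           (\<forall>x\<in>cube_boundary k. \<forall>t\<in>{0..1}. H (x(k := t)) = z0)"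
  proof (intro exI[of _ H] conjI ballI)
    show "cube_lipschitz (Suc k) (cube (Suc k)) H" unfolding cube_lipschitz_def
    proof (intro exI[of _ "L * C"] ballI)
      fix x y assume xy: "x \<in> cube (Suc k)" "y \<in> cube (Suc k)"
      have "dist (H x) (H y) \<le> L * norm (pp x - pp y)"
        using lipschitz_onD[OF E(3) ppt[OF xy(1)] ppt[OF xy(2)]] by (simp add: H_def dist_norm)
      also have "\<dots> \<le> L * (C * cdist (Suc k) x y)" using ppl[OF xy] L0 by (intro mult_left_mono) auto
      finally show "dist (H x) (H y) \<le> L * C * cdist (Suc k) x y" by (simp add: mult.assoc)
    qed
    show "H ` cube (Suc k) \<subseteq> Z" using ppt E(4) by (auto simp: H_def)
    have x0: "cut x = x" "x k = 0" if "x \<in> cube k" for x using that by (auto simp: cut_def cube_def)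
    show "H x = f x" if "x \<in> cube k" for x
      using x0[OF that] that j by (auto simp: H_def pp_def F_def intro!: E(5))
    have Hz: "unchart (retr p0) = z0" unfolding p0_def by (rule E(5)[OF j(2)])
    show "H (x(k := 1)) = z0" if "x \<in> cube k" for x by (simp add: H_def pp_def Hz)
    show "H (x(k := t)) = z0" if "x \<in> cube_boundary k" "t \<in> {0..1}" for x t
    proof -
      have xc: "x \<in> cube k" using that by (simp add: cube_boundary_def)
      have "cut (x(k := t)) = x" using x0[OF xc] by (auto simp: cut_def)
      moreover have "F x = p0" using f that by (auto simp: F_def p0_def)
      ultimately have "pp (x(k := t)) = p0" by (simp add: pp_def scaleR_add_left[symmetric])
      then show ?thesis by (simp add: H_def Hz)
    qed
  qed
qed


section \<open>The oscillating map is Sobolev\<close>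

text \<open>Points with nonnegative inner product are joined by the normalised segment: before
  normalisation it keeps norm at least 1/2, which gives the constant 8. A general pair is joined
  through a unit vector orthogonal to the first point, with its sign chosen towards the second;
  dimension at least 2 provides it.\<close>

lemma sphere_image_core:
  fixes v :: "'a \<Rightarrow> 'a"
  assumes dim: "2 \<le> DIM('a)" and v: "L-lipschitz_on (sphere 0 1) v" and im: "v ` sphere 0 1 \<subseteq> Z"
  shows "\<exists>j. v ` sphere 0 1 \<subseteq> core j"
proof (rule path_connected_in_core[OF im, of "L * 8"])
  have L0: "0 \<le> L" using v lipschitz_on_nonneg by blast
  have arc: "\<exists>\<gamma>. (L * 8)-lipschitz_on {0..1::real} \<gamma> \<and> \<gamma> ` {0..1} \<subseteq> Z \<and> \<gamma> 0 = v x \<and> \<gamma> 1 = v y"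
    if x: "norm x = 1" and y: "norm y = 1" and xy: "0 \<le> x \<bullet> y" for x y :: 'a
  proof -
    define p where "p t = (1 - t) *\<^sub>R x + t *\<^sub>R y" for t :: real
    have p_half: "1/2 \<le> norm (p t)" if t: "t \<in> {0..1}" for t
    proof (rule power2_le_imp_le)
      have "(norm (p t))\<^sup>2 = (1 - t)\<^sup>2 + t\<^sup>2 + 2 * ((1 - t) * t * (x \<bullet> y))"
        using x y unfolding p_def power2_norm_eq_inner
        by (simp add: inner_add_left inner_add_right inner_commute power2_eq_square norm_eq_1 algebra_simps)
      moreover have "0 \<le> (1 - t) * t * (x \<bullet> y)" using t xy by simp
      moreover have "(1 - t)\<^sup>2 + t\<^sup>2 = 1/2 + 2 * (t - 1/2)\<^sup>2" by (simp add: power2_eq_square field_simps)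
      ultimately show "(1/2)\<^sup>2 \<le> (norm (p t))\<^sup>2" using zero_le_power2[of "t - 1/2"] by (simp add: power2_eq_square)
    qed simp
    have sph: "sgn (p t) \<in> sphere 0 1" if "t \<in> {0..1}" for t using p_half[OF that] by (auto simp: norm_sgn)
    have pd: "norm (p s - p t) \<le> 2 * \<bar>s - t\<bar>" for s t
    proof -
      have "p s - p t = (s - t) *\<^sub>R (y - x)" by (simp add: p_def algebra_simps)
      moreover have "norm (y - x) \<le> 2" using norm_triangle_ineq4[of y x] x y by simp
      ultimately show ?thesis using mult_left_mono[of "norm (y - x)" 2 "\<bar>s - t\<bar>"] by simp
    qed
    have "(L * 8)-lipschitz_on {0..1} (\<lambda>t. v (sgn (p t)))"
    proof (rule lipschitz_onI)
      fix s t :: real assume st: "s \<in> {0..1}" "t \<in> {0..1}"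
      have "1/2 * norm (sgn (p s) - sgn (p t)) \<le> norm (p s) * norm (sgn (p s) - sgn (p t))"
        using p_half[OF st(1)] by (intro mult_right_mono) auto
      also have "\<dots> \<le> 2 * norm (p s - p t)" by (rule norm_sgn_diff)
      finally have "norm (sgn (p s) - sgn (p t)) \<le> 8 * \<bar>s - t\<bar>" using pd[of s t] by linarith
      then have "L * norm (sgn (p s) - sgn (p t)) \<le> L * (8 * \<bar>s - t\<bar>)" using L0 by (rule mult_left_mono)
      then show "dist (v (sgn (p s))) (v (sgn (p t))) \<le> L * 8 * dist s t"
        using lipschitz_onD[OF v sph[OF st(1)] sph[OF st(2)]] by (simp add: dist_norm)
    qed (use L0 in simp)
    moreover have "p 0 = x" "p 1 = y" by (simp_all add: p_def)
    ultimately show ?thesis using sph im x y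
      by (intro exI[of _ "\<lambda>t. v (sgn (p t))"]) (auto simp: sgn_div_norm)
  qed
  fix z z' assume "z \<in> v ` sphere 0 1" "z' \<in> v ` sphere 0 1"
  then obtain x y where xy: "norm x = 1" "norm y = 1" "z = v x" "z' = v y" by auto
  obtain q0 where q0: "q0 \<noteq> 0" "orthogonal x q0" using orthogonal_to_vector_exists[OF dim] by blast
  define q where "q = (if 0 \<le> q0 \<bullet> y then sgn q0 else - sgn q0)"
  have q: "norm q = 1" "x \<bullet> q = 0" "0 \<le> q \<bullet> y"
    using q0 by (auto simp: q_def norm_sgn orthogonal_def sgn_div_norm divide_nonpos_pos mult_nonneg_nonpos)
  obtain \<gamma> where \<gamma>: "(L * 8)-lipschitz_on {0..1::real} \<gamma>" "\<gamma> ` {0..1} \<subseteq> Z" "\<gamma> 0 = v x" "\<gamma> 1 = v q"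
    using arc[OF xy(1) q(1)] q by auto
  obtain \<delta> where \<delta>: "(L * 8)-lipschitz_on {0..1::real} \<delta>" "\<delta> ` {0..1} \<subseteq> Z" "\<delta> 0 = v q" "\<delta> 1 = v y"
    using arc[OF q(1) xy(2) q(3)] by auto
  show "\<exists>w \<gamma> \<delta>. (L * 8)-lipschitz_on {0..1::real} \<gamma> \<and> \<gamma> ` {0..1} \<subseteq> Z \<and> \<gamma> 0 = z \<and> \<gamma> 1 = w \<and>
        (L * 8)-lipschitz_on {0..1::real} \<delta> \<and> \<delta> ` {0..1} \<subseteq> Z \<and> \<delta> 0 = w \<and> \<delta> 1 = z'"
    using \<gamma> \<delta> xy by blast
qed

end

section \<open>Cones over maps of the sphere\<close>

definition radial_cut :: "real \<Rightarrow> real" where "radial_cut r = max 0 (min 1 (min r (3 - r)))"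

text \<open>Coincides with \<open>radial_ext\<close> on the annulus, but has compact support and,
  for Lipschitz \<open>g\<close>, is Lipschitz on the whole space.\<close>

definition cone_ext :: "('a::euclidean_space \<Rightarrow> 'b::euclidean_space) \<Rightarrow> 'a \<Rightarrow> 'b" where
  "cone_ext g x = radial_cut (norm x) *\<^sub>R g (sgn x)"

lemma radial_cut_lipschitz: "\<bar>radial_cut r - radial_cut s\<bar> \<le> \<bar>r - s\<bar>"
proof -
  have 1: "\<bar>max 0 a - max 0 b\<bar> \<le> \<bar>a - b\<bar>" and 2: "\<bar>min 1 a - min 1 b\<bar> \<le> \<bar>a - b\<bar>" for a b :: real
    by (auto simp: max_def min_def)
  have 3: "\<bar>min r (3 - r) - min s (3 - s)\<bar> \<le> \<bar>r - s\<bar>" by (auto simp: min_def)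
  show ?thesis unfolding radial_cut_def by (rule order_trans[OF 1 order_trans[OF 2 3]])
qed

lemma radial_ext_sgn: "radial_ext g x = g (sgn x)"
  by (simp add: radial_ext_def sgn_div_norm)

lemma cone_ext_annulus: "x \<in> annulus \<Longrightarrow> cone_ext g x = g (sgn x)"
  by (simp add: cone_ext_def annulus_def radial_cut_def)

lemma cone_ext_outside: "x \<notin> cball 0 3 \<Longrightarrow> cone_ext g x = 0"
  by (simp add: cone_ext_def radial_cut_def)

lemma open_annulus: "open annulus"
  unfolding annulus_def by (intro open_Collect_conj open_Collect_less continuous_intros)

lemma annulus_nonzero: "x \<in> annulus \<Longrightarrow> x \<noteq> 0" by (auto simp: annulus_def)

lemma sgn_sphere: "x \<noteq> 0 \<Longrightarrow> sgn x \<in> sphere (0::'a::euclidean_space) 1" by (simp add: norm_sgn)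

lemma cone_ext_lipschitz:
  fixes g :: "'a::euclidean_space \<Rightarrow> 'b::euclidean_space"
  assumes g: "L-lipschitz_on (sphere 0 1) g" and M: "\<And>x. x \<in> sphere 0 1 \<Longrightarrow> norm (g x) \<le> M"
  shows "(2 * L + M)-lipschitz_on UNIV (cone_ext g)"
proof (rule lipschitz_onI)
  have L0: "0 \<le> L" using g lipschitz_on_nonneg by blast
  obtain b :: 'a where "b \<in> Basis" using nonempty_Basis by blast
  then have M0: "0 \<le> M" using order_trans[OF norm_ge_zero M[of b]] by simp
  show "0 \<le> 2 * L + M" using L0 M0 by simp
  fix x y :: 'a
  let ?m = "\<lambda>x::'a. radial_cut (norm x)"
  have md: "\<bar>?m x - ?m y\<bar> \<le> norm (x - y)"
    using norm_triangle_ineq3[of x y] radial_cut_lipschitz[of "norm x" "norm y"] by linarith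
  have m: "0 \<le> ?m x" "?m x \<le> norm x" for x :: 'a by (auto simp: radial_cut_def)
  have "norm (cone_ext g x - cone_ext g y) \<le> (2 * L + M) * norm (x - y)"
  proof (cases "x = 0 \<or> y = 0")
    case True
    have *: "norm (cone_ext g x) \<le> (2 * L + M) * norm x" if "x \<noteq> 0" for x
    proof -
      have "norm (cone_ext g x) = ?m x * norm (g (sgn x))" using m by (simp add: cone_ext_def)
      also have "\<dots> \<le> norm x * M" using m M[OF sgn_sphere[OF that]] by (intro mult_mono) auto
      also have "\<dots> \<le> norm x * (2 * L + M)" using L0 by (intro mult_left_mono) auto
      finally show ?thesis by (simp add: mult.commute)
    qed
    have "cone_ext g 0 = 0" by (simp add: cone_ext_def radial_cut_def)
    then show ?thesis using True *[of x] *[of y] L0 M0 by (cases "x = 0"; cases "y = 0") auto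
  next
    case False
    have "cone_ext g x - cone_ext g y = ?m x *\<^sub>R (g (sgn x) - g (sgn y)) + (?m x - ?m y) *\<^sub>R g (sgn y)"
      by (simp add: cone_ext_def algebra_simps)
    then have "norm (cone_ext g x - cone_ext g y) \<le> norm (?m x *\<^sub>R (g (sgn x) - g (sgn y))) + norm ((?m x - ?m y) *\<^sub>R g (sgn y))"
      by (simp only: norm_triangle_ineq)
    also have "norm (?m x *\<^sub>R (g (sgn x) - g (sgn y))) \<le> norm x * (L * norm (sgn x - sgn y))"
      using m[of x] lipschitz_onD[OF g sgn_sphere sgn_sphere, of x y] False
      by (auto simp: dist_norm intro!: mult_mono)
    also have "\<dots> \<le> L * (2 * norm (x - y))"
      using mult_left_mono[OF norm_sgn_diff[of x y] L0] by (simp add: mult_ac)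
    also have "norm ((?m x - ?m y) *\<^sub>R g (sgn y)) \<le> norm (x - y) * M"
      unfolding norm_scaleR using md M[OF sgn_sphere, of y] False by (intro mult_mono) auto
    finally show ?thesis by (simp add: algebra_simps)
  qed
  then show "dist (cone_ext g x) (cone_ext g y) \<le> (2 * L + M) * dist x y" by (simp add: dist_norm)
qed

lemma cone_ext_lipschitz_exists:
  fixes g :: "'a::euclidean_space \<Rightarrow> 'b::euclidean_space"
  assumes g: "L-lipschitz_on (sphere 0 1) g"
  shows "\<exists>L'. L'-lipschitz_on UNIV (cone_ext g)"
proof -
  have "compact (g ` sphere 0 1)" using lipschitz_on_continuous_on[OF g] by (intro compact_continuous_image compact_sphere)
  then obtain M where "\<And>x. x \<in> sphere 0 1 \<Longrightarrow> norm (g x) \<le> M" using compact_imp_bounded by (force simp: bounded_iff)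
  then show ?thesis using cone_ext_lipschitz[OF g] by blast
qed

lemma integral_lebesgue_on_eq_lborel:
  fixes h :: "'a::euclidean_space \<Rightarrow> 'b::euclidean_space"
  assumes "\<Omega> \<in> sets borel" "h \<in> borel_measurable borel" "\<And>x. x \<notin> \<Omega> \<Longrightarrow> h x = 0"
  shows "integral\<^sup>L (lebesgue_on \<Omega>) h = integral\<^sup>L lborel h"
proof -
  have "integral\<^sup>L (lebesgue_on \<Omega>) h = integral\<^sup>L lebesgue (\<lambda>x. indicator \<Omega> x *\<^sub>R h x)"
    using assms(1) by (subst integral_restrict_space) auto
  also have "(\<lambda>x. indicator \<Omega> x *\<^sub>R h x) = h" using assms(3) by (auto simp: indicator_def)
  also have "integral\<^sup>L lebesgue h = integral\<^sup>L lborel h" using assms(2) by (intro integral_completion) simp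
  finally show ?thesis .
qed

lemma test_function_borel: "test_function \<Omega> \<phi> \<Longrightarrow> \<phi> \<in> borel_measurable borel"
  using test_function_lipschitz lipschitz_on_continuous_on borel_measurable_continuous_onI by blast

lemma test_function_zero_outside: "test_function \<Omega> \<phi> \<Longrightarrow> x \<notin> \<Omega> \<Longrightarrow> \<phi> x = 0"
  unfolding test_function_def by blast

lemma test_function_partial_zero_outside: "test_function \<Omega> \<phi> \<Longrightarrow> x \<notin> \<Omega> \<Longrightarrow> partial b \<phi> x = 0"
  using test_function_partial_zero unfolding test_function_def by (metis (full_types) subsetD test_function_def)

lemma compact_support_bounded:
  fixes f :: "'b::euclidean_space \<Rightarrow> real"
  assumes "continuous_on UNIV f" "compact K" "\<And>x. x \<notin> K \<Longrightarrow> f x = 0"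
  shows "\<exists>B\<ge>0. \<forall>x. \<bar>f x\<bar> \<le> B"
proof -
  have "compact (f ` K)" using assms continuous_on_subset by (blast intro: compact_continuous_image)
  then obtain B where B: "\<And>x. x \<in> K \<Longrightarrow> \<bar>f x\<bar> \<le> B" using compact_imp_bounded by (force simp: bounded_iff)
  have "\<bar>f x\<bar> \<le> max B 0" for x using B[of x] assms(3)[of x] by (cases "x \<in> K") (auto simp: le_max_iff_disj)
  then show ?thesis by (intro exI[of _ "max B 0"]) auto
qed

lemma weak_partial_lipschitz:
  fixes f :: "'a::euclidean_space \<Rightarrow> 'b::euclidean_space"
  assumes f: "L-lipschitz_on UNIV f" and \<Omega>: "open \<Omega>" and b: "b \<in> Basis"
    and U: "\<And>x. x \<in> \<Omega> \<Longrightarrow> U x = f x"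
  shows "weak_partial \<Omega> U b (ddir f b)"
  unfolding weak_partial_def
proof (intro allI impI)
  fix \<phi> assume t: "test_function \<Omega> \<phi>"
  have fc: "continuous_on UNIV f" using f lipschitz_on_continuous_on by blast
  have m: "\<phi> \<in> borel_measurable borel" "partial b \<phi> \<in> borel_measurable borel" "f \<in> borel_measurable borel" "ddir f b \<in> borel_measurable borel"
    using test_function_borel[OF t] borel_measurable_continuous_onI[OF test_function_partial_continuous[OF t]]
      borel_measurable_continuous_onI[OF fc] ddir_borel_measurable[OF fc] by auto
  have "integral\<^sup>L (lebesgue_on \<Omega>) (\<lambda>x. partial b \<phi> x *\<^sub>R U x) = integral\<^sup>L (lebesgue_on \<Omega>) (\<lambda>x. partial b \<phi> x *\<^sub>R f x)"
    by (intro Bochner_Integration.integral_cong refl) (simp add: U)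
  also have "\<dots> = integral\<^sup>L lborel (\<lambda>x. partial b \<phi> x *\<^sub>R f x)"
    using \<Omega> m test_function_partial_zero_outside[OF t] by (intro integral_lebesgue_on_eq_lborel borel_measurable_scaleR) auto
  also have "\<dots> = - integral\<^sup>L lborel (\<lambda>x. \<phi> x *\<^sub>R ddir f b x)"
  proof -
    have "(\<Sum>c\<in>Basis. (b \<bullet> c) * partial c \<phi> x) = partial b \<phi> x" for x
      using b by (simp add: inner_Basis if_distrib[of "\<lambda>t. t * _"] sum.delta cong: if_cong)
    then show ?thesis using integral_by_parts_test[OF f t, of b] by simp
  qed
  also have "integral\<^sup>L lborel (\<lambda>x. \<phi> x *\<^sub>R ddir f b x) = integral\<^sup>L (lebesgue_on \<Omega>) (\<lambda>x. \<phi> x *\<^sub>R ddir f b x)"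
    using \<Omega> m test_function_zero_outside[OF t] by (intro integral_lebesgue_on_eq_lborel[symmetric] borel_measurable_scaleR) auto
  finally show "integral\<^sup>L (lebesgue_on \<Omega>) (\<lambda>x. partial b \<phi> x *\<^sub>R U x) = - integral\<^sup>L (lebesgue_on \<Omega>) (\<lambda>x. \<phi> x *\<^sub>R ddir f b x)" .
qed

definition sgn_deriv :: "'a::euclidean_space \<Rightarrow> 'a \<Rightarrow> 'a" where
  "sgn_deriv v x = (v - (v \<bullet> sgn x) *\<^sub>R sgn x) /\<^sub>R norm x"

lemma sgn_has_derivative:
  assumes "x \<noteq> (0::'a::euclidean_space)"
  shows "(sgn has_derivative (\<lambda>v. sgn_deriv v x)) (at x)"
proof -
  have n: "(norm has_derivative (\<lambda>v. v \<bullet> sgn x)) (at x)" using has_derivative_norm[OF assms] by (simp add: inner_commute)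
  have i: "((\<lambda>x. inverse (norm x)) has_derivative (\<lambda>v. - (inverse (norm x) * (v \<bullet> sgn x) * inverse (norm x)))) (at x)"
    by (rule Deriv.has_derivative_inverse[OF _ n]) (use assms in simp)
  have "((\<lambda>x. inverse (norm x) *\<^sub>R x) has_derivative (\<lambda>v. inverse (norm x) *\<^sub>R v + (- (inverse (norm x) * (v \<bullet> sgn x) * inverse (norm x))) *\<^sub>R x)) (at x)"
    by (rule has_derivative_scaleR[OF i has_derivative_ident])
  then have "((\<lambda>x. inverse (norm x) *\<^sub>R x) has_derivative (\<lambda>v. sgn_deriv v x)) (at x)"
    by (rule has_derivative_eq_rhs) (auto simp: sgn_deriv_def sgn_div_norm algebra_simps)
  moreover have "sgn = (\<lambda>x::'a. inverse (norm x) *\<^sub>R x)" by (simp add: sgn_div_norm fun_eq_iff)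
  ultimately show ?thesis by (simp only:)
qed

lemma norm_orthogonal_part:
  fixes s v :: "'a::real_inner"
  assumes "s \<bullet> s = 1" "norm v = 1"
  shows "(norm (v - (v \<bullet> s) *\<^sub>R s))\<^sup>2 = 1 - (v \<bullet> s)\<^sup>2"
proof -
  have "v \<bullet> v = 1" using assms(2) by (simp add: norm_eq_1)
  moreover have "(v - c *\<^sub>R s) \<bullet> (v - c *\<^sub>R s) = v \<bullet> v - 2 * c * (v \<bullet> s) + c * c * (s \<bullet> s)" for c
    by (simp add: inner_diff_left inner_diff_right inner_commute algebra_simps)
  ultimately show ?thesis unfolding power2_norm_eq_inner assms(1) by (simp add: power2_eq_square)
qed

lemma norm_sgn_deriv_le: assumes "x \<in> annulus" "norm v = 1" shows "norm (sgn_deriv v x) \<le> 1"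
proof -
  let ?s = "sgn x"
  have s: "?s \<bullet> ?s = 1" using annulus_nonzero[OF assms(1)] norm_sgn[of x] by (simp add: norm_eq_1)
  have "norm (v - (v \<bullet> ?s) *\<^sub>R ?s) \<le> 1"
  proof (rule power2_le_imp_le)
    show "(norm (v - (v \<bullet> ?s) *\<^sub>R ?s))\<^sup>2 \<le> 1\<^sup>2"
      unfolding norm_orthogonal_part[OF s assms(2)] one_power2 using zero_le_power2[of "v \<bullet> ?s"] by linarith
  qed (rule zero_le_one)
  moreover have "1 < norm x" using assms by (simp add: annulus_def)
  moreover have "norm (sgn_deriv v x) = norm (v - (v \<bullet> ?s) *\<^sub>R ?s) / norm x"
    by (simp add: sgn_deriv_def divide_inverse mult.commute)
  ultimately show ?thesis by (simp add: divide_le_eq)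
qed

lemma emeasure_annulus_finite: "emeasure lebesgue (annulus :: 'a::euclidean_space set) < \<infinity>"
proof -
  have "(annulus :: 'a set) \<subseteq> cball 0 2" by (auto simp: annulus_def)
  then have "annulus \<in> (lmeasurable :: 'a set set)"
    using bounded_subset[OF bounded_cball] open_annulus by (intro lmeasurable_open) auto
  then show ?thesis unfolding fmeasurable_def by blast
qed

lemma integrable_annulus_const: "integrable (lebesgue_on (annulus :: 'a::euclidean_space set)) (\<lambda>x. c :: real)"
proof -
  have m: "(annulus :: 'a set) \<in> sets lebesgue" using borel_open[OF open_annulus] by (rule sets_completionI_sets[of _ lborel, simplified])
  have "integrable lebesgue (\<lambda>x. indicator (annulus :: 'a set) x :: real)"
    using emeasure_annulus_finite[where 'a='a] m by (intro integrable_real_indicator)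
  then have "integrable lebesgue (\<lambda>x. indicator (annulus :: 'a set) x *\<^sub>R c)" by (intro integrable_scaleR_left)
  then show ?thesis using m by (subst integrable_restrict_space) simp_all
qed

lemma borel_measurable_lebesgue_on_annulus:
  fixes f :: "'a::euclidean_space \<Rightarrow> 'b::euclidean_space"
  assumes "f \<in> borel_measurable borel"
  shows "f \<in> borel_measurable (lebesgue_on annulus)"
  using assms by (intro measurable_restrict_space1 measurable_completion) simp

section \<open>Weak differentiability of the oscillating map\<close>

context whiskered
begin

definition crimp_cut :: "nat \<Rightarrow> 'a \<Rightarrow> 'a" where "crimp_cut j x = x + hump_cut j (x \<bullet> e) *\<^sub>R e"

definition Dhump :: "real \<Rightarrow> real" where "Dhump h = (if 0 \<le> h \<and> h < 1 then hump_deriv h else 0)"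

definition crimp_grad :: "'a \<Rightarrow> 'a \<Rightarrow> 'a" where
  "crimp_grad v x = sgn_deriv v x + (Dhump (sgn x \<bullet> e) * (sgn_deriv v x \<bullet> e)) *\<^sub>R e"

text \<open>Majorant for the slope of the oscillating component. \<open>hump_deriv_bound\<close>
  contributes \<open>1 / (1 - h)\<close> with a logarithm, and the gradient of the height
  contributes a factor of at most \<open>2 * sqrt (1 - h)\<close>, which halves the order of the
  singularity.\<close>

definition slope_bound :: "'a \<Rightarrow> real" where
  "slope_bound x = (if 0 \<le> sgn x \<bullet> e \<and> sgn x \<bullet> e < 1 then 4 / ((1 - ln (1 - sgn x \<bullet> e)) * sqrt (1 - sgn x \<bullet> e)) else 0)"

lemma crimp_cut_lipschitz: "(1 + 2 / (1 - lev (j * pi)))-lipschitz_on UNIV (crimp_cut j)"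
proof (rule lipschitz_onI)
  let ?B = "2 / (1 - lev (j * pi))"
  show "0 \<le> 1 + ?B" by (simp add: less_imp_le)
  fix x y
  have "crimp_cut j x - crimp_cut j y = (x - y) + (hump_cut j (x \<bullet> e) - hump_cut j (y \<bullet> e)) *\<^sub>R e"
    by (simp add: crimp_cut_def scaleR_diff_left)
  then have "norm (crimp_cut j x - crimp_cut j y) \<le> norm (x - y) + \<bar>hump_cut j (x \<bullet> e) - hump_cut j (y \<bullet> e)\<bar>"
    by (metis e_norm(1) mult.right_neutral norm_scaleR norm_triangle_ineq)
  also have "\<bar>hump_cut j (x \<bullet> e) - hump_cut j (y \<bullet> e)\<bar> \<le> ?B * \<bar>x \<bullet> e - y \<bullet> e\<bar>"
    using lipschitz_onD[OF hump_cut_lipschitz[of j], of "x \<bullet> e" "y \<bullet> e"] by (simp add: dist_real_def)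
  also have "?B * \<bar>x \<bullet> e - y \<bullet> e\<bar> \<le> ?B * norm (x - y)"
    using abs_inner_e_le[of "x - y"] by (intro mult_left_mono) (auto simp: inner_diff_left less_imp_le)
  finally show "dist (crimp_cut j x) (crimp_cut j y) \<le> (1 + ?B) * dist x y" by (simp add: dist_norm distrib_right)
qed

lemma cone_crimp_cut_lipschitz: "\<exists>L. L-lipschitz_on UNIV (cone_ext (crimp_cut j))"
  by (rule cone_ext_lipschitz_exists[OF lipschitz_on_subset[OF crimp_cut_lipschitz]]) simp

lemma ddir_cone_crimp_cut:
  assumes x: "x \<in> annulus"
  shows "ddir (cone_ext (crimp_cut j)) v x = sgn_deriv v x + (hump_cut_deriv j (sgn x \<bullet> e) * (sgn_deriv v x \<bullet> e)) *\<^sub>R e"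
proof -
  have d: "(sgn has_derivative (\<lambda>v. sgn_deriv v x)) (at x)" by (rule sgn_has_derivative[OF annulus_nonzero[OF x]])
  have di: "((\<lambda>x. sgn x \<bullet> e) has_derivative (\<lambda>v. sgn_deriv v x \<bullet> e)) (at x)"
    by (rule has_derivative_inner_left[OF d])
  have "((\<lambda>x. hump_cut j (sgn x \<bullet> e)) has_derivative (\<lambda>v. (sgn_deriv v x \<bullet> e) * hump_cut_deriv j (sgn x \<bullet> e))) (at x)"
    using DERIV_compose_FDERIV[where f="hump_cut j" and g="\<lambda>x. sgn x \<bullet> e", OF hump_cut_DERIV di] .
  then have "((\<lambda>x. sgn x + hump_cut j (sgn x \<bullet> e) *\<^sub>R e) has_derivative (\<lambda>v. sgn_deriv v x + ((sgn_deriv v x \<bullet> e) * hump_cut_deriv j (sgn x \<bullet> e)) *\<^sub>R e)) (at x)"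
    by (intro has_derivative_add d has_derivative_scaleR_left)
  then have "(cone_ext (crimp_cut j) has_derivative (\<lambda>v. sgn_deriv v x + ((sgn_deriv v x \<bullet> e) * hump_cut_deriv j (sgn x \<bullet> e)) *\<^sub>R e)) (at x)"
    by (rule has_derivative_transform_within_open[OF _ open_annulus x]) (simp add: cone_ext_annulus crimp_cut_def)
  then show ?thesis by (simp add: has_derivative_imp_ddir mult.commute)
qed

lemma eventually_lev: assumes "h < 1" shows "\<forall>\<^sub>F j in sequentially. h \<le> lev (real j * pi)"
proof -
  obtain J :: nat where J: "h \<le> lev (real J * pi)" using lev_ge_limit[OF assms] by blast
  have "h \<le> lev (real j * pi)" if "J \<le> j" for j
  proof -
    have "lev (real J * pi) \<le> lev (real j * pi)" using that by simp
    then show ?thesis using J by linarith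
  qed
  then show ?thesis by (auto simp: eventually_sequentially)
qed

lemma hump_cut_deriv_tendsto: "(\<lambda>j. hump_cut_deriv j h) \<longlonglongrightarrow> Dhump h"
proof (cases "h < 1")
  case True
  show ?thesis
    by (rule tendsto_eventually, rule eventually_mono[OF eventually_lev[OF True]])
       (use True in \<open>auto simp: hump_cut_deriv_def Dhump_def\<close>)
next
  case False
  have "hump_cut_deriv j h = Dhump h" for j
  proof -
    have "\<not> h \<le> lev (real j * pi)" using False lev_less_1[of "real j * pi"] by linarith
    then show ?thesis using False by (simp add: hump_cut_deriv_def Dhump_def)
  qed
  then show ?thesis by simp
qed

lemma hump_cut_deriv_le: "\<bar>hump_cut_deriv j h\<bar> \<le> \<bar>Dhump h\<bar>"
proof -
  have "h < 1" if "h \<le> lev (real j * pi)" using that lev_less_1[of "real j * pi"] by linarith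
  then show ?thesis by (auto simp: hump_cut_deriv_def Dhump_def)
qed

lemma hump_cut_tendsto: assumes "h \<le> 1" shows "(\<lambda>j. hump_cut j h) \<longlonglongrightarrow> hump h"
proof (cases "h < 1")
  case True
  show ?thesis
    by (rule tendsto_eventually, rule eventually_mono[OF eventually_lev[OF True]]) (rule hump_cut_eq)
next
  case False
  then have h: "h = 1" using assms by simp
  \<comment> \<open>At the pole the clamp yields the phase \<open>j * pi\<close>, where the sine
    vanishes, in agreement with the default value of \<open>hump\<close> there.\<close>
  have "hump_cut j 1 = 0" for j
  proof -
    have "max 0 (min (lev (real j * pi)) 1) = lev (real j * pi)"
      using lev_less_1[of "real j * pi"] lev_nonneg[of "real j * pi"] by (simp add: max_def min_def del: lev_nonneg lev_less_1)
    then show ?thesis by (simp add: hump_cut_def)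
  qed
  then show ?thesis by (simp add: h)
qed

lemma norm_crimp_le: "norm x = 1 \<Longrightarrow> norm (crimp x) \<le> 2" "norm x = 1 \<Longrightarrow> norm (crimp_cut j x) \<le> 2"
  using norm_triangle_ineq[of x "hump (x \<bullet> e) *\<^sub>R e"] norm_triangle_ineq[of x "hump_cut j (x \<bullet> e) *\<^sub>R e"]
    hump_bounds[of "x \<bullet> e"] hump_cut_bounds[of j "x \<bullet> e"] by (auto simp: crimp_def crimp_cut_def)

lemma sgn_deriv_e_le:
  assumes x: "x \<in> annulus" and v: "norm v = 1"
  shows "\<bar>sgn_deriv v x \<bullet> e\<bar> \<le> sqrt (1 - (sgn x \<bullet> e)\<^sup>2)"
proof -
  let ?s = "sgn x"
  have s: "?s \<bullet> ?s = 1" using annulus_nonzero[OF x] norm_sgn[of x] by (simp add: norm_eq_1)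
  have "(v - (v \<bullet> ?s) *\<^sub>R ?s) \<bullet> e = v \<bullet> (e - (e \<bullet> ?s) *\<^sub>R ?s)"
    by (simp add: inner_diff_left inner_diff_right inner_commute)
  then have "\<bar>(v - (v \<bullet> ?s) *\<^sub>R ?s) \<bullet> e\<bar> \<le> norm (e - (e \<bullet> ?s) *\<^sub>R ?s)"
    using Cauchy_Schwarz_ineq2[of v "e - (e \<bullet> ?s) *\<^sub>R ?s"] v by simp
  also have "norm (e - (e \<bullet> ?s) *\<^sub>R ?s) = sqrt (1 - (?s \<bullet> e)\<^sup>2)"
    using norm_orthogonal_part[OF s e_norm(1)] by (metis inner_commute norm_ge_zero real_sqrt_unique)
  finally have 1: "\<bar>(v - (v \<bullet> ?s) *\<^sub>R ?s) \<bullet> e\<bar> \<le> sqrt (1 - (?s \<bullet> e)\<^sup>2)" .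
  have x1: "1 < norm x" using x by (simp add: annulus_def)
  have "\<bar>sgn_deriv v x \<bullet> e\<bar> = \<bar>(v - (v \<bullet> ?s) *\<^sub>R ?s) \<bullet> e\<bar> / norm x"
    by (simp add: sgn_deriv_def abs_mult divide_inverse mult.commute)
  also have "\<dots> \<le> \<bar>(v - (v \<bullet> ?s) *\<^sub>R ?s) \<bullet> e\<bar> / 1" using x1 by (intro divide_left_mono) auto
  finally show ?thesis using 1 by simp
qed

lemma Dhump_slope_bound:
  assumes x: "x \<in> annulus" and v: "norm v = 1"
  shows "\<bar>Dhump (sgn x \<bullet> e)\<bar> * \<bar>sgn_deriv v x \<bullet> e\<bar> \<le> slope_bound x"
proof (cases "0 \<le> sgn x \<bullet> e \<and> sgn x \<bullet> e < 1")
  case True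
  define h where "h = sgn x \<bullet> e"
  have h: "0 \<le> h" "h < 1" using True by (auto simp: h_def)
  define l where "l = 1 - ln (1 - h)"
  have "ln (1 - h) \<le> 0" using h by simp
  then have l: "l > 0" unfolding l_def by linarith
  have 1: "\<bar>Dhump h\<bar> \<le> 2 / (l * (1 - h))" using hump_deriv_bound[OF h] h by (simp add: Dhump_def l_def)
  have "\<bar>sgn_deriv v x \<bullet> e\<bar> \<le> sqrt (1 - h\<^sup>2)" using sgn_deriv_e_le[OF x v] by (simp add: h_def)
  also have "1 - h\<^sup>2 = (1 + h) * (1 - h)" by (simp add: power2_eq_square algebra_simps)
  also have "sqrt ((1 + h) * (1 - h)) \<le> sqrt (4 * (1 - h))" using h by (intro real_sqrt_le_mono mult_right_mono) auto
  also have "\<dots> = 2 * sqrt (1 - h)" by (simp only: real_sqrt_mult real_sqrt_four)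
  finally have 2: "\<bar>sgn_deriv v x \<bullet> e\<bar> \<le> 2 * sqrt (1 - h)" .
  have "\<bar>Dhump h\<bar> * \<bar>sgn_deriv v x \<bullet> e\<bar> \<le> (2 / (l * (1 - h))) * (2 * sqrt (1 - h))"
    using 1 2 l h by (intro mult_mono) auto
  also have "\<dots> = 4 / (l * sqrt (1 - h))"
  proof -
    have "2 / (l * (q * q)) * (2 * q) = 4 / (l * q)" if "q > 0" for q
      using that l by (simp add: field_simps)
    from this[of "sqrt (1 - h)"] show ?thesis using h by simp
  qed
  finally show ?thesis using True by (simp add: slope_bound_def h_def l_def)
next
  case False
  then have "Dhump (sgn x \<bullet> e) = 0" "slope_bound x = 0" unfolding Dhump_def slope_bound_def by (rule if_not_P)+
  then show ?thesis by simp
qed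

lemma cone_cut_grad_bound:
  assumes x: "x \<in> annulus" and v: "norm v = 1"
  shows "norm (ddir (cone_ext (crimp_cut j)) v x) \<le> 1 + slope_bound x" "norm (crimp_grad v x) \<le> 1 + slope_bound x"
proof -
  have gen: "norm (sgn_deriv v x + (c * (sgn_deriv v x \<bullet> e)) *\<^sub>R e) \<le> 1 + slope_bound x" if c: "\<bar>c\<bar> \<le> \<bar>Dhump (sgn x \<bullet> e)\<bar>" for c
  proof -
    have "norm (sgn_deriv v x + (c * (sgn_deriv v x \<bullet> e)) *\<^sub>R e) \<le> norm (sgn_deriv v x) + \<bar>c\<bar> * \<bar>sgn_deriv v x \<bullet> e\<bar>"
      using norm_triangle_ineq[of "sgn_deriv v x" "(c * (sgn_deriv v x \<bullet> e)) *\<^sub>R e"] by (simp add: abs_mult)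
    moreover have "\<bar>c\<bar> * \<bar>sgn_deriv v x \<bullet> e\<bar> \<le> \<bar>Dhump (sgn x \<bullet> e)\<bar> * \<bar>sgn_deriv v x \<bullet> e\<bar>" using c by (intro mult_right_mono) auto
    ultimately show ?thesis using Dhump_slope_bound[OF x v] norm_sgn_deriv_le[OF x v] by linarith
  qed
  show "norm (ddir (cone_ext (crimp_cut j)) v x) \<le> 1 + slope_bound x"
    unfolding ddir_cone_crimp_cut[OF x] by (rule gen[OF hump_cut_deriv_le])
  show "norm (crimp_grad v x) \<le> 1 + slope_bound x" unfolding crimp_grad_def by (rule gen) simp
qed

lemma cone_cut_grad_tendsto:
  assumes x: "x \<in> annulus"
  shows "(\<lambda>j. ddir (cone_ext (crimp_cut j)) v x) \<longlonglongrightarrow> crimp_grad v x"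
  unfolding ddir_cone_crimp_cut[OF x] crimp_grad_def by (intro tendsto_intros hump_cut_deriv_tendsto)

lemma slope_bound_nonneg: "0 \<le> slope_bound x"
proof (cases "0 \<le> sgn x \<bullet> e \<and> sgn x \<bullet> e < 1")
  case True
  then have "ln (1 - sgn x \<bullet> e) \<le> 0" by simp
  then have "0 \<le> 1 - ln (1 - sgn x \<bullet> e)" by linarith
  with True show ?thesis by (simp add: slope_bound_def)
next
  case False
  then have "slope_bound x = 0" unfolding slope_bound_def by (rule if_not_P)
  then show ?thesis by simp
qed

lemma slope_bound_borel [measurable]: "slope_bound \<in> borel_measurable borel"
proof -
  have [measurable]: "(sgn :: 'a \<Rightarrow> 'a) \<in> borel_measurable borel"
    unfolding sgn_div_norm[abs_def] by measurable
  show ?thesis unfolding slope_bound_def[abs_def] by measurable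
qed

text \<open>On the \<open>i\<close>-th dyadic shell the slope bound is of order \<open>2\<^bsup>i/2\<^esup> / i\<close> and the measure of order
  \<open>2\<^bsup>-in/2\<^esup>\<close>, so the \<open>n\<close>-th powers are summable exactly because \<open>n \<ge> 2\<close>.\<close>

definition shell :: "nat \<Rightarrow> 'a set" where
  "shell i = {x \<in> annulus. 0 \<le> sgn x \<bullet> e \<and> (1/2) ^ Suc i < 1 - sgn x \<bullet> e \<and> 1 - sgn x \<bullet> e \<le> (1/2) ^ i}"

lemma shell_borel [measurable]: "shell i \<in> sets borel"
proof -
  have [measurable]: "(sgn :: 'a \<Rightarrow> 'a) \<in> borel_measurable borel"
    unfolding sgn_div_norm[abs_def] by measurable
  have [measurable]: "annulus \<in> sets (borel :: 'a measure)" using open_annulus by (rule borel_open)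
  show ?thesis unfolding shell_def by measurable
qed

lemma shell_cover:
  assumes "x \<in> annulus" "0 \<le> sgn x \<bullet> e" "sgn x \<bullet> e < 1"
  shows "\<exists>i. x \<in> shell i"
proof -
  define t where "t = 1 - sgn x \<bullet> e"
  have t: "0 < t" "t \<le> 1" using assms by (auto simp: t_def)
  have ex: "\<exists>i. (1/2) ^ Suc i < t"
  proof -
    obtain i where "(1/2::real) ^ i < t" using real_arch_pow_inv[OF t(1), of "1/2"] by auto
    moreover have "(1/2::real) ^ Suc i \<le> (1/2) ^ i" by simp
    ultimately show ?thesis by (intro exI[of _ i]) linarith
  qed
  define i where "i = (LEAST i. (1/2) ^ Suc i < t)"
  have i: "(1/2) ^ Suc i < t" unfolding i_def by (rule LeastI_ex[OF ex])
  have "t \<le> (1/2) ^ i"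
  proof (cases i)
    case 0 then show ?thesis using t by simp
  next
    case (Suc k)
    then have "\<not> (1/2) ^ Suc k < t" using not_less_Least[of k "\<lambda>i. (1/2) ^ Suc i < t"] by (simp add: i_def)
    then show ?thesis using Suc by simp
  qed
  with i assms show ?thesis by (auto simp: shell_def t_def)
qed

lemma shell_slope_bound: assumes x: "x \<in> shell i" shows "slope_bound x \<le> 8 / (real (Suc i) * sqrt (1/2) ^ Suc i)"
proof -
  define t where "t = 1 - sgn x \<bullet> e"
  have t: "(1/2) ^ Suc i < t" "t \<le> (1/2) ^ i" "sgn x \<bullet> e \<ge> 0" using x by (auto simp: shell_def t_def)
  have t0: "0 < t" using t(1) by (rule le_less_trans[rotated]) simp
  have "ln t \<le> ln ((1/2) ^ i)" using t t0 by simp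
  also have "\<dots> = - (real i * ln 2)" by (simp add: ln_realpow ln_div)
  also have "\<dots> \<le> - (real i * (1/2))" using mult_left_mono[of "1/2" "ln 2" "real i"] ln2_ge_two_thirds by simp
  finally have 1: "real (Suc i) / 2 \<le> 1 - ln t" by simp
  have "sqrt ((1/2) ^ Suc i) \<le> sqrt t" using t by simp
  then have 2: "sqrt (1/2) ^ Suc i \<le> sqrt t" by (simp only: real_sqrt_power)
  have "0 < real (Suc i) / 2" by simp
  then have p: "0 < 1 - ln t" using 1 by linarith
  have "(real (Suc i) / 2) * sqrt (1/2) ^ Suc i \<le> (1 - ln t) * sqrt t"
    using 1 2 p by (intro mult_mono) auto
  then have "4 / ((1 - ln t) * sqrt t) \<le> 4 / ((real (Suc i) / 2) * sqrt (1/2) ^ Suc i)"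
    using p t0 by (intro divide_left_mono mult_pos_pos) auto
  also have "\<dots> = 8 / (real (Suc i) * sqrt (1/2) ^ Suc i)" by (simp add: field_simps)
  finally show ?thesis using t t0 by (simp add: slope_bound_def t_def)
qed

lemma shell_measure:
  assumes dim: "DIM('a) = Suc n"
  shows "emeasure lborel (shell i) \<le> ennreal (4 * (6 * sqrt (1/2) ^ i) ^ n)"
proof -
  \<comment> \<open>The squared distance to the axis is at most \<open>8 * (1/2) ^ i\<close> on the
    shell, and \<open>8 \<le> 3 * 3\<close>. Along the axis the outer radius 2 of the annulus serves
    as half-width.\<close>
  define r where "r = 3 * sqrt (1/2) ^ i"
  have r0: "0 \<le> r" by (simp add: r_def)
  define w where "w = (\<Sum>b\<in>Basis. (if b = e then 2 else r) *\<^sub>R b)"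
  have wb: "w \<bullet> b = (if b = e then 2 else r)" if "b \<in> Basis" for b using that by (simp add: w_def)
  have "shell i \<subseteq> cbox (- w) w"
  proof
    fix x assume x: "x \<in> shell i"
    then have xa: "x \<in> annulus" by (simp add: shell_def)
    have x2: "norm x < 2" "x \<noteq> 0" using xa by (auto simp: annulus_def)
    define t where "t = 1 - sgn x \<bullet> e"
    have t: "t \<le> (1/2) ^ i" "0 \<le> t" "t \<le> 1" using x unit_height_bounds[of "sgn x"] x2 by (auto simp: shell_def t_def norm_sgn)
    have "(norm (perp x))\<^sup>2 = (norm x)\<^sup>2 * (norm (perp (sgn x)))\<^sup>2"
      using x2 by (simp add: sgn_div_norm perp_scaleR power_mult_distrib[symmetric])
    also have "(norm (perp (sgn x)))\<^sup>2 = t * (2 - t)"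
      using unit_height[of "sgn x"] x2 by (simp add: norm_sgn t_def power2_eq_square algebra_simps)
    also have "(norm x)\<^sup>2 * (t * (2 - t)) \<le> 4 * ((1/2) ^ i * 2)"
    proof (intro mult_mono)
      show "(norm x)\<^sup>2 \<le> 4" using x2 power_mono[of "norm x" 2 2] by simp
    qed (use t in auto)
    also have "\<dots> \<le> r\<^sup>2"
    proof -
      have "(sqrt (1/2) ^ i)\<^sup>2 = (1/2) ^ i" by (simp add: power_mult[symmetric] mult.commute[of i] power_mult)
      then show ?thesis by (simp add: r_def power_mult_distrib)
    qed
    finally have p: "norm (perp x) \<le> r" using r0 by (rule power2_le_imp_le)
    have "\<bar>x \<bullet> b\<bar> \<le> w \<bullet> b" if b: "b \<in> Basis" for b
    proof (cases "b = e")
      case True then show ?thesis using wb[OF b] abs_inner_e_le[of x] x2 by simp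
    next
      case False
      then have "e \<bullet> b = 0" using b e_Basis by (simp add: inner_Basis)
      then have "x \<bullet> b = perp x \<bullet> b" by (simp add: perp_def inner_diff_left)
      then show ?thesis using Basis_le_norm[OF b, of "perp x"] p wb[OF b] False by simp
    qed
    then show "x \<in> cbox (- w) w" by (auto simp: mem_box abs_le_iff minus_le_iff)
  qed
  then have "emeasure lborel (shell i) \<le> emeasure lborel (cbox (- w) w)" by (intro emeasure_mono) auto
  also have "\<dots> = ennreal (\<Prod>b\<in>Basis. (w - - w) \<bullet> b)"
    using wb r0 by (intro emeasure_lborel_cbox) (auto simp: inner_minus_left)
  also have "(\<Prod>b\<in>Basis. (w - - w) \<bullet> b) = (\<Prod>b\<in>Basis. if b = e then 4 else 2 * r)"
    by (intro prod.cong refl) (simp add: inner_add_left wb)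
  also have "\<dots> = 4 * (2 * r) ^ n"
  proof -
    have "(\<Prod>b\<in>Basis. if b = e then 4 else 2 * r) = 4 * (\<Prod>b\<in>Basis - {e}. if b = e then 4 else 2 * r)"
      using e_Basis by (subst prod.remove[of _ e]) auto
    also have "(\<Prod>b\<in>Basis - {e}. if b = e then 4 else 2 * r) = (\<Prod>b\<in>Basis - {e}. 2 * r)" by (intro prod.cong) auto
    also have "\<dots> = (2 * r) ^ n" using dim e_Basis by (simp add: card_Diff_singleton)
    finally show ?thesis .
  qed
  finally show ?thesis by (simp add: r_def)
qed

lemma slope_bound_power_integral:
  assumes dim: "DIM('a) = Suc n" and n: "2 \<le> n"
  shows "(\<integral>\<^sup>+x. ennreal (indicator annulus x * slope_bound x ^ n) \<partial>lborel) < \<infinity>"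
proof -
  define r where "r = sqrt (1/2)"
  have r: "0 < r" by (simp add: r_def)
  \<comment> \<open>From \<open>q i * (6 * r ^ i) = 48 / (real (Suc i) * r)\<close>: the exponential
    factors of slope and width cancel, and only powers of \<open>1 / Suc i\<close> are left. The 4
    is the length of the box along the axis.\<close>
  define C where "C = 4 * 48 ^ n / r ^ n"
  define q where "q i = 8 / (real (Suc i) * r ^ Suc i)" for i
  have q0: "0 \<le> q i" for i using r by (simp add: q_def)
  have "(\<integral>\<^sup>+x. ennreal (indicator annulus x * slope_bound x ^ n) \<partial>lborel) \<le> (\<integral>\<^sup>+x. (\<Sum>i. ennreal (q i ^ n) * indicator (shell i) x) \<partial>lborel)"
  proof (rule nn_integral_mono)
    fix x :: 'a
    show "ennreal (indicator annulus x * slope_bound x ^ n) \<le> (\<Sum>i. ennreal (q i ^ n) * indicator (shell i) x)"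
    proof (cases "x \<in> annulus \<and> 0 \<le> sgn x \<bullet> e \<and> sgn x \<bullet> e < 1")
      case True
      then obtain i where i: "x \<in> shell i" using shell_cover by blast
      have "slope_bound x ^ n \<le> q i ^ n" using shell_slope_bound[OF i] slope_bound_nonneg by (intro power_mono) (auto simp: q_def r_def)
      then have "ennreal (indicator annulus x * slope_bound x ^ n) \<le> ennreal (q i ^ n) * indicator (shell i) x"
        using True i by (simp add: ennreal_leI)
      also have "\<dots> \<le> (\<Sum>i. ennreal (q i ^ n) * indicator (shell i) x)"
      proof -
        have "f i \<le> suminf f" for f :: "nat \<Rightarrow> ennreal" using sum_le_suminf[of f "{i}"] by simp
        then show ?thesis .
      qed
      finally show ?thesis .
    next
      case False
      then have z: "indicator annulus x * slope_bound x ^ n = 0" using n by (auto simp: slope_bound_def indicator_def)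
      show ?thesis unfolding z by simp
    qed
  qed
  also have "\<dots> = (\<Sum>i. \<integral>\<^sup>+x. ennreal (q i ^ n) * indicator (shell i) x \<partial>lborel)"
    by (intro nn_integral_suminf) auto
  also have "\<dots> = (\<Sum>i. ennreal (q i ^ n) * emeasure lborel (shell i))"
    by (intro suminf_cong nn_integral_cmult_indicator) auto
  also have "\<dots> \<le> (\<Sum>i. ennreal (C * inverse (real (Suc i) ^ 2)))"
  proof (intro suminf_le)
    fix i
    have "ennreal (q i ^ n) * emeasure lborel (shell i) \<le> ennreal (q i ^ n) * ennreal (4 * (6 * r ^ i) ^ n)"
      using shell_measure[OF dim, of i] by (intro mult_left_mono) (auto simp: r_def)
    also have "\<dots> = ennreal (q i ^ n * (4 * (6 * r ^ i) ^ n))" using q0 r by (intro ennreal_mult[symmetric]) auto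
    also have "q i ^ n * (4 * (6 * r ^ i) ^ n) = C * inverse (real (Suc i) ^ n)"
    proof -
      have "8 / (s * (r * p)) * (6 * p) = 48 / (s * r)" if "p \<noteq> 0" for s p using that by simp
      from this[of "r ^ i" "real (Suc i)"] have "q i * (6 * r ^ i) = 48 / (real (Suc i) * r)"
        using r by (simp add: q_def)
      then have "q i ^ n * (6 * r ^ i) ^ n = (48 / (real (Suc i) * r)) ^ n" by (metis power_mult_distrib)
      then show ?thesis by (simp add: C_def power_divide power_mult_distrib field_simps del: of_nat_Suc)
    qed
    also have "\<dots> \<le> C * inverse (real (Suc i) ^ 2)"
      using r n by (intro mult_left_mono le_imp_inverse_le power_increasing) (auto simp: C_def)
    finally show "ennreal (q i ^ n) * emeasure lborel (shell i) \<le> ennreal (C * inverse (real (Suc i) ^ 2))"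
      by (simp add: ennreal_leI)
  qed auto
  also have "\<dots> < \<infinity>"
  proof -
    have "summable (\<lambda>i. inverse (real (Suc i) ^ 2))"
      using inverse_power_summable[of 2, where 'a=real] by (subst summable_Suc_iff[of "\<lambda>i. inverse (real i ^ 2)"]) simp
    then have "summable (\<lambda>i. C * inverse (real (Suc i) ^ 2))" by (rule summable_mult)
    then have "(\<Sum>i. ennreal (C * inverse (real (Suc i) ^ 2))) \<noteq> top"
      using r by (intro ennreal_suminf_neq_top) (auto simp: C_def)
    then show ?thesis by (simp add: less_top)
  qed
  finally show ?thesis .
qed

lemma slope_bound_power_integrable:
  assumes dim: "DIM('a) = Suc n" and n: "2 \<le> n"
  shows "integrable (lebesgue_on annulus) (\<lambda>x. slope_bound x ^ n)"
proof -
  have [measurable]: "annulus \<in> sets (borel :: 'a measure)" using open_annulus by (rule borel_open)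
  have "integrable lborel (\<lambda>x. indicator annulus x * slope_bound x ^ n)"
  proof (rule integrableI_bounded)
    have "ennreal (norm (indicator annulus x * slope_bound x ^ n)) = ennreal (indicator annulus x * slope_bound x ^ n)" for x
      using slope_bound_nonneg[of x] by (simp add: abs_mult)
    then show "(\<integral>\<^sup>+x. ennreal (norm (indicator annulus x * slope_bound x ^ n)) \<partial>lborel) < \<infinity>"
      using slope_bound_power_integral[OF dim n] by simp
  qed measurable
  then have "integrable lebesgue (\<lambda>x. indicator annulus x * slope_bound x ^ n)"
    by (subst integrable_completion) auto
  then show ?thesis using open_annulus by (subst integrable_restrict_space) auto
qed

lemma power_sum_le: fixes a :: real assumes "0 \<le> a" shows "(1 + a) ^ n \<le> 2 ^ n * (1 + a ^ n)"
proof -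
  have "(1 + a) ^ n \<le> (2 * max 1 a) ^ n" using assms by (intro power_mono) auto
  also have "\<dots> = 2 ^ n * max 1 a ^ n" by (simp add: power_mult_distrib)
  also have "max 1 a ^ n \<le> 1 + a ^ n" using assms by (auto simp: max_def)
  finally show ?thesis by simp
qed

lemma Lp_on_annulusI:
  fixes F :: "'a \<Rightarrow> 'a"
  assumes dim: "DIM('a) = Suc n" and n: "2 \<le> n"
    and F: "F \<in> borel_measurable (lebesgue_on annulus)" and bound: "AE x in lebesgue_on annulus. norm (F x) \<le> c * (1 + slope_bound x)"
  shows "Lp_on (real n) annulus F"
  unfolding Lp_on_def
proof (rule conjI[OF F], rule Bochner_Integration.integrable_bound)
  show "integrable (lebesgue_on annulus) (\<lambda>x. \<bar>c\<bar> ^ n * (2 ^ n * (1 + slope_bound x ^ n)))"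
    using slope_bound_power_integrable[OF dim n] integrable_annulus_const[of 1] by (intro integrable_mult_right Bochner_Integration.integrable_add) auto
  show "(\<lambda>x. norm (F x) powr real n) \<in> borel_measurable (lebesgue_on annulus)" using F by measurable
  show "AE x in lebesgue_on annulus. norm (norm (F x) powr real n) \<le> norm (\<bar>c\<bar> ^ n * (2 ^ n * (1 + slope_bound x ^ n)))"
    using bound
  proof (rule eventually_mono)
    fix x :: 'a assume bx: "norm (F x) \<le> c * (1 + slope_bound x)"
    have "norm (F x) \<le> \<bar>c\<bar> * (1 + slope_bound x)" using bx slope_bound_nonneg[of x] mult_right_mono[OF abs_ge_self[of c], of "1 + slope_bound x"] by linarith
    then have "norm (F x) ^ n \<le> (\<bar>c\<bar> * (1 + slope_bound x)) ^ n" by (intro power_mono) auto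
    also have "\<dots> \<le> \<bar>c\<bar> ^ n * (2 ^ n * (1 + slope_bound x ^ n))"
      unfolding power_mult_distrib using power_sum_le[OF slope_bound_nonneg] by (intro mult_left_mono) auto
    finally have "norm (F x) ^ n \<le> \<bar>c\<bar> ^ n * (2 ^ n * (1 + slope_bound x ^ n))" .
    moreover have "norm (F x) powr real n = norm (F x) ^ n" using n by (intro powr_realpow') auto
    ultimately show "norm (norm (F x) powr real n) \<le> norm (\<bar>c\<bar> ^ n * (2 ^ n * (1 + slope_bound x ^ n)))" using slope_bound_nonneg[of x] by simp
  qed
qed

lemma crimp_grad_measurable: "crimp_grad b \<in> borel_measurable (lebesgue_on annulus)"
proof (rule borel_measurable_LIMSEQ_metric[where f="\<lambda>j. ddir (cone_ext (crimp_cut j)) b"])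
  fix j
  obtain L where "L-lipschitz_on UNIV (cone_ext (crimp_cut j))" using cone_crimp_cut_lipschitz by blast
  then show "ddir (cone_ext (crimp_cut j)) b \<in> borel_measurable (lebesgue_on annulus)"
    using lipschitz_on_continuous_on by (intro borel_measurable_lebesgue_on_annulus ddir_borel_measurable) blast
qed (simp add: space_restrict_space cone_cut_grad_tendsto)

lemma radial_crimp_measurable: "radial_ext crimp \<in> borel_measurable (lebesgue_on annulus)"
proof (rule borel_measurable_LIMSEQ_metric)
  fix j
  obtain L where "L-lipschitz_on UNIV (cone_ext (crimp_cut j))" using cone_crimp_cut_lipschitz by blast
  then show "cone_ext (crimp_cut j) \<in> borel_measurable (lebesgue_on annulus)"
    using lipschitz_on_continuous_on by (intro borel_measurable_lebesgue_on_annulus borel_measurable_continuous_onI) blast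
next
  fix x :: 'a assume "x \<in> space (lebesgue_on annulus)"
  then have x: "x \<in> annulus" by (simp add: space_restrict_space)
  have "sgn x \<bullet> e \<le> 1" using unit_height_bounds[of "sgn x"] annulus_nonzero[OF x] by (simp add: norm_sgn)
  then show "(\<lambda>j. cone_ext (crimp_cut j) x) \<longlonglongrightarrow> radial_ext crimp x"
    unfolding cone_ext_annulus[OF x] radial_ext_sgn crimp_cut_def crimp_def by (intro tendsto_intros hump_cut_tendsto)
qed

lemma crimp_tendsto: "x \<in> annulus \<Longrightarrow> (\<lambda>j. crimp_cut j (sgn x)) \<longlonglongrightarrow> radial_ext crimp x"
proof -
  assume x: "x \<in> annulus"
  have "sgn x \<bullet> e \<le> 1" using unit_height_bounds[of "sgn x"] annulus_nonzero[OF x] by (simp add: norm_sgn)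
  then show ?thesis unfolding radial_ext_sgn crimp_cut_def crimp_def by (intro tendsto_intros hump_cut_tendsto)
qed

lemma slope_bound_integrable:
  assumes dim: "DIM('a) = Suc n" and n: "2 \<le> n"
  shows "integrable (lebesgue_on annulus) (\<lambda>x. c * (1 + slope_bound x))"
proof (intro integrable_mult_right Bochner_Integration.integrable_add integrable_annulus_const)
  show "integrable (lebesgue_on annulus) slope_bound"
  proof (rule Bochner_Integration.integrable_bound)
    show "integrable (lebesgue_on annulus) (\<lambda>x. 1 + slope_bound x ^ n)"
      using slope_bound_power_integrable[OF dim n] integrable_annulus_const[of 1] by (intro Bochner_Integration.integrable_add) auto
    show "slope_bound \<in> borel_measurable (lebesgue_on annulus)" by (rule borel_measurable_lebesgue_on_annulus[OF slope_bound_borel])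
    show "AE x in lebesgue_on annulus. norm (slope_bound x) \<le> norm (1 + slope_bound x ^ n)"
    proof (rule AE_I2)
      fix x
      have "slope_bound x \<le> 1 + slope_bound x ^ n"
        using slope_bound_nonneg[of x] power_increasing[of 1 n "slope_bound x"] n by (cases "1 \<le> slope_bound x") (auto intro: order_trans[of _ 1] simp: add_increasing2)
      then show "norm (slope_bound x) \<le> norm (1 + slope_bound x ^ n)" using slope_bound_nonneg[of x] by simp
    qed
  qed
qed

text \<open>Integration by parts holds for the Lipschitz truncations. Truncation only deletes part
  of the derivative, so \<open>slope_bound\<close> dominates all of them at once, and both sides
  pass to the limit. No boundary term arises from the ray through the pole.\<close>

lemma crimp_weak_partial:
  assumes dim: "DIM('a) = Suc n" and n: "2 \<le> n" and b: "b \<in> Basis"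
  shows "weak_partial annulus (radial_ext crimp) b (crimp_grad b)"
  unfolding weak_partial_def
proof (intro allI impI)
  fix \<phi> :: "'a \<Rightarrow> real" assume t: "test_function annulus \<phi>"
  obtain K where K: "compact K" "\<And>x. x \<notin> K \<Longrightarrow> \<phi> x = 0" using t by (auto simp: test_function_def)
  have \<phi>c: "continuous_on UNIV \<phi>" using test_function_lipschitz[OF t] lipschitz_on_continuous_on by blast
  have pc: "continuous_on UNIV (partial b \<phi>)" by (rule test_function_partial_continuous[OF t])
  obtain B where B: "0 \<le> B" "\<And>x. \<bar>\<phi> x\<bar> \<le> B" using compact_support_bounded[OF \<phi>c K] by blast
  obtain B' where B': "0 \<le> B'" "\<And>x. \<bar>partial b \<phi> x\<bar> \<le> B'"
    using compact_support_bounded[OF pc K(1) test_function_partial_zero[OF t K]] by blast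
  have m: "\<phi> \<in> borel_measurable (lebesgue_on annulus)" "partial b \<phi> \<in> borel_measurable (lebesgue_on annulus)"
    using borel_measurable_continuous_onI[OF \<phi>c] borel_measurable_continuous_onI[OF pc] by (auto intro: borel_measurable_lebesgue_on_annulus)
  have Lj: "\<exists>L. L-lipschitz_on UNIV (cone_ext (crimp_cut j))" for j by (rule cone_crimp_cut_lipschitz)
  have cj: "continuous_on UNIV (cone_ext (crimp_cut j))" for j using Lj lipschitz_on_continuous_on by blast
  have mj: "cone_ext (crimp_cut j) \<in> borel_measurable (lebesgue_on annulus)" "ddir (cone_ext (crimp_cut j)) b \<in> borel_measurable (lebesgue_on annulus)" for j
    by (intro borel_measurable_lebesgue_on_annulus borel_measurable_continuous_onI ddir_borel_measurable cj)+
  have b1: "norm b = 1" using b by simp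
  have eq: "integral\<^sup>L (lebesgue_on annulus) (\<lambda>x. partial b \<phi> x *\<^sub>R cone_ext (crimp_cut j) x) =
     - integral\<^sup>L (lebesgue_on annulus) (\<lambda>x. \<phi> x *\<^sub>R ddir (cone_ext (crimp_cut j)) b x)" for j
  proof -
    obtain L where "L-lipschitz_on UNIV (cone_ext (crimp_cut j))" using Lj by blast
    from weak_partial_lipschitz[OF this open_annulus b refl] show ?thesis using t unfolding weak_partial_def by blast
  qed
  have "(\<lambda>j. integral\<^sup>L (lebesgue_on annulus) (\<lambda>x. partial b \<phi> x *\<^sub>R cone_ext (crimp_cut j) x)) \<longlonglongrightarrow>
     integral\<^sup>L (lebesgue_on annulus) (\<lambda>x. partial b \<phi> x *\<^sub>R radial_ext crimp x)"
  proof (rule integral_dominated_convergence[where w="\<lambda>x. B' * 2"])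
    show "(\<lambda>x. partial b \<phi> x *\<^sub>R radial_ext crimp x) \<in> borel_measurable (lebesgue_on annulus)"
      using m radial_crimp_measurable by (intro borel_measurable_scaleR)
    show "(\<lambda>x. partial b \<phi> x *\<^sub>R cone_ext (crimp_cut j) x) \<in> borel_measurable (lebesgue_on annulus)" for j
      using m mj by (intro borel_measurable_scaleR)
    show "integrable (lebesgue_on annulus) (\<lambda>x::'a. B' * 2)" by (rule integrable_annulus_const)
    show "AE x in lebesgue_on annulus. (\<lambda>j. partial b \<phi> x *\<^sub>R cone_ext (crimp_cut j) x) \<longlonglongrightarrow> partial b \<phi> x *\<^sub>R radial_ext crimp x"
      by (intro AE_I2 tendsto_intros) (simp add: space_restrict_space cone_ext_annulus crimp_tendsto)
    show "AE x in lebesgue_on annulus. norm (partial b \<phi> x *\<^sub>R cone_ext (crimp_cut j) x) \<le> B' * 2" for j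
    proof (rule AE_I2)
      fix x :: 'a assume "x \<in> space (lebesgue_on annulus)"
      then have x: "x \<in> annulus" by (simp add: space_restrict_space)
      have "norm (crimp_cut j (sgn x)) \<le> 2" using annulus_nonzero[OF x] by (intro norm_crimp_le) (simp add: norm_sgn)
      then show "norm (partial b \<phi> x *\<^sub>R cone_ext (crimp_cut j) x) \<le> B' * 2"
        unfolding norm_scaleR cone_ext_annulus[OF x] using B' by (intro mult_mono) auto
    qed
  qed
  moreover have "(\<lambda>j. - integral\<^sup>L (lebesgue_on annulus) (\<lambda>x. \<phi> x *\<^sub>R ddir (cone_ext (crimp_cut j)) b x)) \<longlonglongrightarrow>
     - integral\<^sup>L (lebesgue_on annulus) (\<lambda>x. \<phi> x *\<^sub>R crimp_grad b x)"
  proof (rule tendsto_minus, rule integral_dominated_convergence[where w="\<lambda>x. B * (1 + slope_bound x)"])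
    show "(\<lambda>x. \<phi> x *\<^sub>R crimp_grad b x) \<in> borel_measurable (lebesgue_on annulus)"
      using m crimp_grad_measurable by (intro borel_measurable_scaleR)
    show "(\<lambda>x. \<phi> x *\<^sub>R ddir (cone_ext (crimp_cut j)) b x) \<in> borel_measurable (lebesgue_on annulus)" for j
      using m mj by (intro borel_measurable_scaleR)
    show "integrable (lebesgue_on annulus) (\<lambda>x. B * (1 + slope_bound x))" by (rule slope_bound_integrable[OF dim n])
    show "AE x in lebesgue_on annulus. (\<lambda>j. \<phi> x *\<^sub>R ddir (cone_ext (crimp_cut j)) b x) \<longlonglongrightarrow> \<phi> x *\<^sub>R crimp_grad b x"
      by (intro AE_I2 tendsto_intros) (simp add: space_restrict_space cone_cut_grad_tendsto)
    show "AE x in lebesgue_on annulus. norm (\<phi> x *\<^sub>R ddir (cone_ext (crimp_cut j)) b x) \<le> B * (1 + slope_bound x)" for j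
    proof (rule AE_I2)
      fix x :: 'a assume "x \<in> space (lebesgue_on annulus)"
      then have x: "x \<in> annulus" by (simp add: space_restrict_space)
      show "norm (\<phi> x *\<^sub>R ddir (cone_ext (crimp_cut j)) b x) \<le> B * (1 + slope_bound x)"
        unfolding norm_scaleR using B cone_cut_grad_bound(1)[OF x b1] by (intro mult_mono) auto
    qed
  qed
  ultimately show "integral\<^sup>L (lebesgue_on annulus) (\<lambda>x. partial b \<phi> x *\<^sub>R radial_ext crimp x) =
     - integral\<^sup>L (lebesgue_on annulus) (\<lambda>x. \<phi> x *\<^sub>R crimp_grad b x)"
    unfolding eq by (rule LIMSEQ_unique)
qed

lemma crimp_sobolev:
  assumes dim: "DIM('a) = Suc n" and n: "2 \<le> n"
  shows "sphere_sobolev_into (real n) Z crimp"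
  unfolding sphere_sobolev_into_def sphere_sobolev_def sobolev_def
proof (intro conjI exI)
  show "Lp_on (real n) annulus (radial_ext crimp)"
  proof (rule Lp_on_annulusI[OF dim n radial_crimp_measurable, of 2], rule AE_I2)
    fix x :: 'a assume "x \<in> space (lebesgue_on annulus)"
    then have x: "x \<in> annulus" by (simp add: space_restrict_space)
    have "norm (crimp (sgn x)) \<le> 2" using annulus_nonzero[OF x] by (intro norm_crimp_le) (simp add: norm_sgn)
    then show "norm (radial_ext crimp x) \<le> 2 * (1 + slope_bound x)" unfolding radial_ext_sgn using slope_bound_nonneg[of x] by simp
  qed
  show "weak_gradient (real n) annulus (radial_ext crimp) crimp_grad"
    unfolding weak_gradient_def
  proof (intro ballI conjI crimp_weak_partial[OF dim n])
    fix b :: 'a assume b: "b \<in> Basis"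
    show "Lp_on (real n) annulus (crimp_grad b)"
      by (rule Lp_on_annulusI[OF dim n crimp_grad_measurable, of b 1])
         (use cone_cut_grad_bound(2) b in \<open>auto simp: space_restrict_space intro!: AE_I2\<close>)
  qed
  show "AE x in lebesgue_on annulus. radial_ext crimp x \<in> Z"
  proof (rule AE_I2)
    fix x :: 'a assume "x \<in> space (lebesgue_on annulus)"
    then have "x \<noteq> 0" by (intro annulus_nonzero) (simp add: space_restrict_space)
    then have "crimp (sgn x) \<in> crimp ` sphere 0 1" by (intro imageI sgn_sphere)
    then show "radial_ext crimp x \<in> Z" unfolding radial_ext_sgn Z_def by blast
  qed
qed

end

section \<open>The degree integrand\<close>

text \<open>The cubic has its critical points exactly at \<open>- d\<close> and \<open>d\<close>, so
  freezing it there gives an increasing C^1 function that is constant outside, with a bump as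
  derivative.\<close>

definition bevel :: "real \<Rightarrow> real \<Rightarrow> real" where
  "bevel d t = 3 * d\<^sup>2 * max (- d) (min d t) - (max (- d) (min d t)) ^ 3"

definition bevel_deriv :: "real \<Rightarrow> real \<Rightarrow> real" where
  "bevel_deriv d t = 3 * d\<^sup>2 - 3 * (max (- d) (min d t))\<^sup>2"

lemma bevel_DERIV: assumes "0 < d" shows "(bevel d has_real_derivative bevel_deriv d t) (at t)"
proof -
  have "((\<lambda>t. 3 * d\<^sup>2 * t - t ^ 3) has_real_derivative 3 * d\<^sup>2 - 3 * t\<^sup>2) (at t)" for t
    by (auto intro!: derivative_eq_intros)
  then have "((\<lambda>t. 3 * d\<^sup>2 * max (- d) (min d t) - (max (- d) (min d t)) ^ 3) has_real_derivative
     (if - d \<le> t \<and> t \<le> d then 3 * d\<^sup>2 - 3 * t\<^sup>2 else 0)) (at t)"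
    using assms by (intro has_derivative_clamp[of "-d" d "\<lambda>t. 3 * d\<^sup>2 * t - t ^ 3" "\<lambda>t. 3 * d\<^sup>2 - 3 * t\<^sup>2" t]) auto
  moreover have "(if - d \<le> t \<and> t \<le> d then 3 * d\<^sup>2 - 3 * t\<^sup>2 else 0) = bevel_deriv d t"
    using assms by (auto simp: bevel_deriv_def max_def min_def)
  ultimately show ?thesis unfolding bevel_def[abs_def] by simp
qed

lemma bevel_deriv_bounds:
  assumes "0 < d" "d \<le> 1/2"
  shows "0 \<le> bevel_deriv d t" "bevel_deriv d t \<le> 1"
proof -
  let ?c = "max (- d) (min d t)"
  have "?c\<^sup>2 \<le> d\<^sup>2" using assms by (intro abs_le_square_iff[THEN iffD1]) (auto simp: max_def min_def)
  then show "0 \<le> bevel_deriv d t" by (simp add: bevel_deriv_def)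
  have "d\<^sup>2 \<le> (1/2)\<^sup>2" using assms by (intro power_mono) auto
  then have "d\<^sup>2 \<le> 1/4" by (simp add: power2_eq_square)
  then show "bevel_deriv d t \<le> 1" using zero_le_power2[of ?c] unfolding bevel_deriv_def by linarith
qed

lemma bevel_deriv_zero: assumes "0 < d" "d \<le> \<bar>t\<bar>" shows "bevel_deriv d t = 0"
proof -
  have "max (- d) (min d t) = d \<or> max (- d) (min d t) = - d" using assms by (auto simp: max_def min_def)
  then show ?thesis by (auto simp: bevel_deriv_def)
qed

lemma bevel_deriv_pos: assumes "\<bar>t\<bar> < d" shows "0 < bevel_deriv d t"
proof -
  have "t\<^sup>2 < d\<^sup>2" using assms power_strict_mono[of "\<bar>t\<bar>" d 2] by simp
  then show ?thesis using assms by (simp add: bevel_deriv_def max_def min_def abs_if split: if_splits)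
qed

lemma clamp_lipschitz:
  fixes s t :: real
  shows "\<bar>max a (min b s) - max a (min b t)\<bar> \<le> \<bar>s - t\<bar>"
proof -
  have "\<bar>max a s - max a t\<bar> \<le> \<bar>s - t\<bar>" and "\<bar>min b s - min b t\<bar> \<le> \<bar>s - t\<bar>" for s t :: real
    by (simp_all add: max_def min_def)
  then show ?thesis by (rule order_trans)
qed

lemma bevel_deriv_lipschitz:
  assumes "0 < d" "d \<le> 1/2"
  shows "\<bar>bevel_deriv d s - bevel_deriv d t\<bar> \<le> 4 * \<bar>s - t\<bar>"
proof -
  let ?c = "\<lambda>t. max (- d) (min d t)"
  have c: "\<bar>?c t\<bar> \<le> 1/2" for t using assms by (simp add: abs_le_iff le_max_iff_disj min_le_iff_disj)
  have "bevel_deriv d s - bevel_deriv d t = 3 * ((?c t - ?c s) * (?c t + ?c s))"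
    by (simp add: bevel_deriv_def power2_eq_square algebra_simps)
  then have "\<bar>bevel_deriv d s - bevel_deriv d t\<bar> = 3 * (\<bar>?c t - ?c s\<bar> * \<bar>?c t + ?c s\<bar>)" by (simp add: abs_mult)
  also have "\<dots> \<le> 3 * (\<bar>s - t\<bar> * 1)"
  proof (intro mult_left_mono mult_mono)
    show "\<bar>?c t - ?c s\<bar> \<le> \<bar>s - t\<bar>" using clamp_lipschitz[of "-d" d t s] by (simp only: abs_minus_commute[of s t])
    show "\<bar>?c t + ?c s\<bar> \<le> 1" 
      by (rule order_trans[OF abs_triangle_ineq order_trans[OF add_mono[OF c c]]]) simp
  qed auto
  finally show ?thesis by simp
qed

lemma bevel_lipschitz: assumes "0 < d" "d \<le> 1/2" shows "1-lipschitz_on UNIV (bevel d)"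
proof (rule lipschitz_onI)
  fix x y
  have "norm (bevel d x - bevel d y) \<le> 1 * norm (x - y)"
  proof (rule field_differentiable_bound[of UNIV "bevel d" "bevel_deriv d"])
    show "norm (bevel_deriv d z) \<le> 1" for z using bevel_deriv_bounds[OF assms, of z] by simp
    show "(bevel d has_field_derivative bevel_deriv d z) (at z within UNIV)" for z by (rule bevel_DERIV[OF assms(1)])
  qed (rule convex_UNIV UNIV_I)+
  then show "dist (bevel d x) (bevel d y) \<le> 1 * dist x y" by (simp add: dist_norm)
qed simp

lemma det_row_zero:
  fixes A :: "real ^ 'n::finite ^ 'n"
  assumes "\<And>j. A $ i $ j = 0"
  shows "det A = 0"
  by (rule det_zero_row(1)[of i]) (use assms in \<open>simp add: row_def vec_eq_iff\<close>)

text \<open>The Leibniz products are compared by telescoping, with the common row taken out. The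
  bound has to vanish with \<open>m\<close> and to grow no faster than its n-th power, because the
  gradient difference will be controlled in L^n only.\<close>

lemma det_difference_bound:
  fixes A B :: "real ^ 'n::finite ^ 'n"
  assumes card: "CARD('n) = Suc n" and m: "0 \<le> m"
    and row: "\<And>j. A $ k $ j = B $ k $ j" "\<And>j. \<bar>A $ k $ j\<bar> \<le> 1"
    and A: "\<And>i j. i \<noteq> k \<Longrightarrow> \<bar>A $ i $ j\<bar> \<le> 1" and AB: "\<And>i j. i \<noteq> k \<Longrightarrow> \<bar>A $ i $ j - B $ i $ j\<bar> \<le> m"
    and n: "1 \<le> n"
  shows "\<bar>det A - det B\<bar> \<le> fact (Suc n) * (n * (m * (1 + m) ^ (n - 1)))"
proof -
  have cU: "card (UNIV - {k}) = n" using card by (simp add: card_Diff_singleton)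
  have prod: "\<bar>(\<Prod>i\<in>UNIV. A $ i $ p i) - (\<Prod>i\<in>UNIV. B $ i $ p i)\<bar> \<le> n * (m * (1 + m) ^ (n - 1))" for p
  proof -
    let ?I = "UNIV - {k}"
    have d: "(\<Prod>i\<in>UNIV. C i) = C k * (\<Prod>i\<in>?I. C i)" for C :: "'n \<Rightarrow> real" by (rule prod.remove) auto
    have m1: "0 < 1 + m" using m by simp
    have B: "\<bar>B $ i $ j\<bar> \<le> 1 + m" if "i \<noteq> k" for i j using A[OF that, of j] AB[OF that, of j] by linarith
    have A': "\<bar>A $ i $ j\<bar> \<le> 1 + m" if "i \<noteq> k" for i j using A[OF that, of j] m by linarith
    \<comment> \<open>Division by \<open>1 + m\<close> brings all factors to absolute value at most
      1, as the telescoping inequality for products requires.\<close>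
    have "norm ((\<Prod>i\<in>?I. A $ i $ p i / (1 + m)) - (\<Prod>i\<in>?I. B $ i $ p i / (1 + m))) \<le> (\<Sum>i\<in>?I. norm (A $ i $ p i / (1 + m) - B $ i $ p i / (1 + m)))"
      by (rule norm_prod_diff) (use A' B m1 in \<open>auto simp: abs_divide divide_le_eq\<close>)
    also have "\<dots> \<le> (\<Sum>i\<in>?I. m / (1 + m))"
    proof (rule sum_mono)
      fix i assume "i \<in> ?I"
      then have "\<bar>A $ i $ p i - B $ i $ p i\<bar> / (1 + m) \<le> m / (1 + m)" using AB m1 by (intro divide_right_mono) auto
      then show "norm (A $ i $ p i / (1 + m) - B $ i $ p i / (1 + m)) \<le> m / (1 + m)"
        using m1 by (simp add: abs_divide flip: diff_divide_distrib)
    qed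
    also have "\<dots> = n * (m / (1 + m))" using cU by simp
    finally have 1: "\<bar>(\<Prod>i\<in>?I. A $ i $ p i) / (1 + m) ^ n - (\<Prod>i\<in>?I. B $ i $ p i) / (1 + m) ^ n\<bar> \<le> n * (m / (1 + m))"
      using cU by (simp add: prod_dividef)
    have "\<bar>(\<Prod>i\<in>?I. A $ i $ p i) - (\<Prod>i\<in>?I. B $ i $ p i)\<bar> / (1 + m) ^ n \<le> n * (m / (1 + m))"
      using 1 m1 by (simp add: abs_divide flip: diff_divide_distrib)
    then have "\<bar>(\<Prod>i\<in>?I. A $ i $ p i) - (\<Prod>i\<in>?I. B $ i $ p i)\<bar> \<le> n * (m / (1 + m)) * (1 + m) ^ n"
      using m1 by (simp add: divide_le_eq)
    also have "\<dots> = n * (m * (1 + m) ^ (n - 1))" using m1 n by (cases n) (simp_all add: field_simps)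
    finally have 2: "\<bar>(\<Prod>i\<in>?I. A $ i $ p i) - (\<Prod>i\<in>?I. B $ i $ p i)\<bar> \<le> n * (m * (1 + m) ^ (n - 1))" .
    have "(\<Prod>i\<in>UNIV. A $ i $ p i) - (\<Prod>i\<in>UNIV. B $ i $ p i) = A $ k $ p k * ((\<Prod>i\<in>?I. A $ i $ p i) - (\<Prod>i\<in>?I. B $ i $ p i))"
      unfolding d[of "\<lambda>i. A $ i $ p i"] d[of "\<lambda>i. B $ i $ p i"] row(1) by (simp add: right_diff_distrib)
    then have "\<bar>(\<Prod>i\<in>UNIV. A $ i $ p i) - (\<Prod>i\<in>UNIV. B $ i $ p i)\<bar> = \<bar>A $ k $ p k\<bar> * \<bar>(\<Prod>i\<in>?I. A $ i $ p i) - (\<Prod>i\<in>?I. B $ i $ p i)\<bar>"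
      by (simp add: abs_mult)
    also have "\<dots> \<le> 1 * \<bar>(\<Prod>i\<in>?I. A $ i $ p i) - (\<Prod>i\<in>?I. B $ i $ p i)\<bar>" using row(2) by (intro mult_right_mono) auto
    finally show ?thesis using 2 by simp
  qed
  have "det A - det B = (\<Sum>p\<in>{p. p permutes (UNIV::'n set)}. of_int (sign p) * ((\<Prod>i\<in>UNIV. A $ i $ p i) - (\<Prod>i\<in>UNIV. B $ i $ p i)))"
    unfolding det_def by (simp add: sum_subtractf right_diff_distrib)
  then have "\<bar>det A - det B\<bar> \<le> (\<Sum>p\<in>{p. p permutes (UNIV::'n set)}. \<bar>of_int (sign p) * ((\<Prod>i\<in>UNIV. A $ i $ p i) - (\<Prod>i\<in>UNIV. B $ i $ p i))\<bar>)"
    by (simp only: sum_abs)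
  also have "\<dots> \<le> (\<Sum>p\<in>{p. p permutes (UNIV::'n set)}. n * (m * (1 + m) ^ (n - 1)))"
    by (rule sum_mono) (use prod in \<open>simp add: abs_mult sign_def\<close>)
  also have "\<dots> = fact (Suc n) * (n * (m * (1 + m) ^ (n - 1)))" by (simp add: card_permutations[OF refl] card del: fact_Suc)
  finally show ?thesis .
qed

text \<open>Lets a row of a Jacobian be computed from a formula that holds only near
  \<open>x\<close>.\<close>

lemma has_derivative_component:
  fixes \<Phi> :: "'a::euclidean_space \<Rightarrow> 'b::euclidean_space"
  assumes d: "\<Phi> differentiable (at x)" and T: "open T" "x \<in> T" "\<And>y. y \<in> T \<Longrightarrow> \<Phi> y \<bullet> b = f y"
    and f: "(f has_derivative f') (at x)"
  shows "ddir \<Phi> v x \<bullet> b = f' v"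
proof -
  have 1: "((\<lambda>y. \<Phi> y \<bullet> b) has_derivative (\<lambda>v. ddir \<Phi> v x \<bullet> b)) (at x)"
    by (rule has_derivative_inner_left[OF differentiable_has_derivative_ddir[OF d]])
  have "((\<lambda>y. \<Phi> y \<bullet> b) has_derivative f') (at x)"
    by (rule has_derivative_transform_within_open[OF f T(1,2)]) (use T(3) in simp)
  from has_derivative_unique[OF 1 this] show ?thesis by metis
qed

section \<open>The weight and the determinant\<close>

context whiskered
begin

definition polar_ix :: "'a ix" where "polar_ix = mk_ix e"

lemma polar_ix_eq: "ix_basis i = e \<longleftrightarrow> i = polar_ix"
  using e_Basis unfolding polar_ix_def by (metis ix_basis_inverse mk_ix_inverse)

lemma ix_basis_polar [simp]: "ix_basis polar_ix = e" using polar_ix_eq by blast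

text \<open>The row of \<open>e\<close> holds the radial direction instead of the derivative of the \<open>e\<close>-component: the form
  is tested against \<open>d|x|\<close>, and the oscillating component of \<open>crimp\<close> never enters.\<close>

definition polar_det :: "'a \<Rightarrow> ('a \<Rightarrow> 'a) \<Rightarrow> real" where
  "polar_det x w = det (\<chi> i j. if i = polar_ix then sgn x \<bullet> ix_basis j else w (ix_basis j) \<bullet> ix_basis i)"

text \<open>With this threshold, a unit vector whose horizontal coordinates are all below \<open>delta\<close> has height at
  least \<open>3/4\<close> in absolute value.\<close>

definition delta :: real where "delta = 1 / (2 * sqrt (DIM('a)))"

lemma delta: "0 < delta" "delta \<le> 1/2" "DIM('a) * delta\<^sup>2 = 1/4"
proof -
  have N: "1 \<le> real (DIM('a))" using DIM_positive[where 'a='a] by linarith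
  then have "1 \<le> sqrt (DIM('a))" by simp
  then show "0 < delta" "delta \<le> 1/2" by (auto simp: delta_def field_simps)
  show "DIM('a) * delta\<^sup>2 = 1/4" using N by (simp add: delta_def power_divide power_mult_distrib)
qed

text \<open>Equal to 1 below height -3/4, the bound of \<open>small_coordinates_low\<close>, and to
  0 above -1/2.\<close>

definition south_cut :: "real \<Rightarrow> real" where "south_cut s = max 0 (min 1 (- 4 * s - 2))"

definition eta_factor :: "'a \<Rightarrow> 'a \<Rightarrow> real" where
  "eta_factor z b = (if b = e then south_cut (z \<bullet> e) else bevel_deriv delta (z \<bullet> b))"

text \<open>The horizontal factors are derivatives of functions of one coordinate, so they can be
  moved into the rows of the determinant, which thereby becomes the Jacobian of the bevelled
  components.\<close>

definition eta :: "'a \<Rightarrow> real" where "eta z = (\<Prod>b\<in>Basis. eta_factor z b)"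

lemma eta_factor_bounds: "0 \<le> eta_factor z b" "eta_factor z b \<le> 1"
  using bevel_deriv_bounds[OF delta(1,2)] by (auto simp: eta_factor_def south_cut_def)

lemma eta_bounds: "0 \<le> eta z" "eta z \<le> 1"
  unfolding eta_def using eta_factor_bounds by (auto intro!: prod_nonneg prod_le_1)

lemma eta_lipschitz: "\<bar>eta z - eta z'\<bar> \<le> 4 * DIM('a) * norm (z - z')"
proof -
  have "\<bar>eta z - eta z'\<bar> \<le> (\<Sum>b\<in>Basis. norm (eta_factor z b - eta_factor z' b))"
    unfolding eta_def real_norm_def[symmetric] by (rule norm_prod_diff) (use eta_factor_bounds in auto)
  also have "\<dots> \<le> (\<Sum>b\<in>(Basis::'a set). 4 * norm (z - z'))"
  proof (rule sum_mono)
    fix b :: 'a assume b: "b \<in> Basis"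
    have i: "\<bar>z \<bullet> b - z' \<bullet> b\<bar> \<le> norm (z - z')" using Basis_le_norm[OF b, of "z - z'"] by (simp add: inner_diff_left)
    have "\<bar>south_cut s - south_cut t\<bar> \<le> 4 * \<bar>s - t\<bar>" for s t
    proof -
      have "\<bar>south_cut s - south_cut t\<bar> \<le> \<bar>(- 4 * s - 2) - (- 4 * t - 2)\<bar>" unfolding south_cut_def by (rule clamp_lipschitz)
      also have "\<dots> = 4 * \<bar>s - t\<bar>" by (simp add: abs_if)
      finally show ?thesis .
    qed
    then have "\<bar>eta_factor z b - eta_factor z' b\<bar> \<le> 4 * \<bar>z \<bullet> b - z' \<bullet> b\<bar>"
      using bevel_deriv_lipschitz[OF delta(1,2)] by (simp add: eta_factor_def)
    then show "norm (eta_factor z b - eta_factor z' b) \<le> 4 * norm (z - z')" using i by simp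
  qed
  finally show ?thesis by simp
qed

lemma eta_continuous: "continuous_on UNIV eta"
  unfolding continuous_on_iff
proof (intro ballI allI impI)
  fix z :: 'a and \<epsilon> :: real assume "\<epsilon> > 0"
  define c where "c = 4 * real DIM('a)"
  have c: "0 < c" by (simp add: c_def)
  show "\<exists>d>0. \<forall>z'\<in>UNIV. dist z' z < d \<longrightarrow> dist (eta z') (eta z) < \<epsilon>"
  proof (intro exI[of _ "\<epsilon> / c"] conjI ballI impI)
    show "\<epsilon> / c > 0" using c \<open>\<epsilon> > 0\<close> by simp
    fix z' assume "dist z' z < \<epsilon> / c"
    then have "c * norm (z' - z) < \<epsilon>" using c by (simp add: dist_norm pos_less_divide_eq mult.commute)
    then show "dist (eta z') (eta z) < \<epsilon>" using eta_lipschitz[of z' z] by (simp add: dist_real_def c_def)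
  qed
qed

lemma eta_zero_above: "- (1/2) \<le> z \<bullet> e \<Longrightarrow> eta z = 0"
  unfolding eta_def by (rule prod_zero) (use e_Basis in \<open>auto simp: eta_factor_def south_cut_def\<close>)

lemma eta_split: "eta z = south_cut (z \<bullet> e) * (\<Prod>b\<in>Basis - {e}. bevel_deriv delta (z \<bullet> b))"
proof -
  have "eta z = eta_factor z e * (\<Prod>b\<in>Basis - {e}. eta_factor z b)"
    unfolding eta_def by (rule prod.remove) (use e_Basis in auto)
  also have "(\<Prod>b\<in>Basis - {e}. eta_factor z b) = (\<Prod>b\<in>Basis - {e}. bevel_deriv delta (z \<bullet> b))"
    by (rule prod.cong) (auto simp: eta_factor_def)
  finally show ?thesis by (simp add: eta_factor_def)
qed

text \<open>The matrix factors as \<open>L ** Q\<close>. Here \<open>Q\<close> is the identity with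
  the polar row replaced by \<open>sgn x\<close>; \<open>L\<close> scales by
  \<open>1 / norm x\<close> and subtracts the radial part in its polar column. Each is altered in a
  single row or column, so Cramer's lemma gives its determinant. The height in the result is the
  Jacobian of the projection of the unit sphere to the equatorial hyperplane.\<close>

lemma polar_det_sgn_deriv:
  assumes dim: "DIM('a) = Suc n" and x: "x \<noteq> 0"
  shows "polar_det x (\<lambda>v. sgn_deriv v x) = (sgn x \<bullet> e) / norm x ^ n"
proof -
  let ?r = "norm x" and ?s = "sgn x" and ?k = "polar_ix"
  have r: "?r > 0" using x by simp
  define D :: "real ^ 'a ix ^ 'a ix" where "D = (\<chi> i j. if i = j then 1 / ?r else 0)"
  define y :: "real ^ 'a ix" where "y = (\<chi> i. if i = ?k then ?r else - (?s \<bullet> ix_basis i))"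
  define L :: "real ^ 'a ix ^ 'a ix" where "L = (\<chi> i j. if j = ?k then (D *v y) $ i else D $ i $ j)"
  define Q :: "real ^ 'a ix ^ 'a ix" where "Q = (\<chi> i j. if i = ?k then ?s \<bullet> ix_basis j else if i = j then 1 else 0)"
  have Dy: "(D *v y) $ i = y $ i / ?r" for i
    by (simp add: D_def matrix_vector_mult_def if_distrib[of "\<lambda>t. t * _"] sum.delta cong: if_cong)
  have detD: "det D = (1 / ?r) ^ Suc n"
    using det_diagonal[of D] dim by (simp add: D_def card_ix)
  have detL: "det L = ?r * (1 / ?r) ^ Suc n"
    unfolding L_def cramer_lemma detD by (simp add: y_def)
  have detQ: "det Q = ?s \<bullet> e"
  proof -
    let ?v = "(\<chi> j. ?s \<bullet> ix_basis j) :: real ^ 'a ix"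
    have "transpose Q = (\<chi> i j. if j = ?k then (mat 1 *v ?v) $ i else (mat 1 :: real ^ 'a ix ^ 'a ix) $ i $ j)"
      unfolding matrix_vector_mul_lid by (simp add: transpose_def Q_def vec_eq_iff mat_def)
    then have "det (transpose Q) = ?v $ ?k * det (mat 1 :: real ^ 'a ix ^ 'a ix)" by (simp only: cramer_lemma)
    then show ?thesis by (simp add: det_transpose)
  qed
  have "(L ** Q) $ i $ j = (if i = ?k then ?s \<bullet> ix_basis j else sgn_deriv (ix_basis j) x \<bullet> ix_basis i)" for i j
  proof -
    have "(L ** Q) $ i $ j = L $ i $ ?k * Q $ ?k $ j + (\<Sum>k\<in>UNIV - {?k}. L $ i $ k * Q $ k $ j)"
      unfolding matrix_matrix_mult_def by (simp add: sum.remove[of UNIV ?k])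
    also have "(\<Sum>k\<in>UNIV - {?k}. L $ i $ k * Q $ k $ j) = (\<Sum>k\<in>UNIV - {?k}. if k = i then (if i = j then 1 / ?r else 0) else 0)"
      by (rule sum.cong) (auto simp: L_def Q_def D_def)
    also have "\<dots> = (if i = ?k then 0 else if i = j then 1 / ?r else 0)" by (simp add: sum.delta)
    also have "L $ i $ ?k * Q $ ?k $ j = y $ i / ?r * (?s \<bullet> ix_basis j)" by (simp add: L_def Q_def Dy)
    finally show ?thesis
      using r by (auto simp: y_def sgn_deriv_def inner_diff_left inner_ix_basis inner_commute[of "ix_basis j" ?s] field_simps)
  qed
  then have "(\<chi> i j. if i = ?k then ?s \<bullet> ix_basis j else sgn_deriv (ix_basis j) x \<bullet> ix_basis i) = L ** Q"
    by (simp add: vec_eq_iff)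
  then have "polar_det x (\<lambda>v. sgn_deriv v x) = det L * det Q" unfolding polar_det_def by (simp add: det_mul)
  then show ?thesis unfolding detL detQ using r by (simp add: power_divide field_simps)
qed

lemma polar_det_crimp_grad: "polar_det x (\<lambda>v. crimp_grad v x) = polar_det x (\<lambda>v. sgn_deriv v x)"
proof -
  have "crimp_grad v x \<bullet> ix_basis i = sgn_deriv v x \<bullet> ix_basis i" if "i \<noteq> polar_ix" for v i
  proof -
    have "e \<bullet> ix_basis i = 0" using that inner_ix_basis[of polar_ix i] by simp
    then show ?thesis by (simp add: crimp_grad_def inner_add_left)
  qed
  then show ?thesis unfolding polar_det_def by (intro arg_cong[where f=det]) (simp add: vec_eq_iff)
qed

definition cap :: "'a \<Rightarrow> 'a" where "cap a = min 1 (norm a) *\<^sub>R sgn a"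

lemma cap_lipschitz: "norm (cap a - cap b) \<le> 3 * norm (a - b)"
proof -
  let ?m = "\<lambda>a::'a. min 1 (norm a)"
  have md: "\<bar>?m a - ?m b\<bar> \<le> norm (a - b)"
  proof -
    have "\<bar>?m a - ?m b\<bar> \<le> \<bar>norm a - norm b\<bar>" by (auto simp: min_def)
    then show ?thesis using norm_triangle_ineq3[of a b] by (rule order_trans)
  qed
  have "cap a - cap b = ?m a *\<^sub>R (sgn a - sgn b) + (?m a - ?m b) *\<^sub>R sgn b" by (simp add: cap_def algebra_simps)
  then have "norm (cap a - cap b) \<le> norm (?m a *\<^sub>R (sgn a - sgn b)) + norm ((?m a - ?m b) *\<^sub>R sgn b)"
    by (simp only: norm_triangle_ineq)
  also have "norm (?m a *\<^sub>R (sgn a - sgn b)) \<le> norm a * norm (sgn a - sgn b)"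
    unfolding norm_scaleR by (intro mult_right_mono) auto
  also have "\<dots> \<le> 2 * norm (a - b)" by (rule norm_sgn_diff)
  also have "norm ((?m a - ?m b) *\<^sub>R sgn b) \<le> norm (a - b) * 1"
    unfolding norm_scaleR using md by (intro mult_mono) (auto simp: norm_sgn)
  finally show ?thesis by simp
qed

lemma cap_orth: "a \<bullet> e = 0 \<Longrightarrow> cap a \<bullet> e = 0" by (simp add: cap_def sgn_div_norm)

lemma cap_inside: "norm a < 1 \<Longrightarrow> cap a = a" by (cases "a = 0") (auto simp: cap_def sgn_div_norm min_def)

lemma cap_outside: "1 \<le> norm a \<Longrightarrow> norm (cap a) = 1" by (auto simp: cap_def norm_sgn min_def)

text \<open>Otherwise the squared norm would be at most \<open>DIM('a)\<close> times the square of
  \<open>delta\<close>, that is 1/4.\<close>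

lemma exists_large_coordinate:
  assumes "norm p = 1" "p \<bullet> e = 0"
  shows "\<exists>b\<in>Basis. b \<noteq> e \<and> delta < \<bar>p \<bullet> b\<bar>"
proof (rule ccontr)
  assume no: "\<not> ?thesis"
  have "(norm p)\<^sup>2 = (\<Sum>b\<in>Basis. (p \<bullet> b) * (p \<bullet> b))"
    unfolding power2_norm_eq_inner by (rule euclidean_inner)
  also have "\<dots> \<le> (\<Sum>b\<in>(Basis::'a set). delta\<^sup>2)"
  proof (rule sum_mono)
    fix b :: 'a assume b: "b \<in> Basis"
    have "\<bar>p \<bullet> b\<bar> \<le> delta" using no b assms(2) delta(1) by (cases "b = e") (auto simp: not_less)
    then have "\<bar>p \<bullet> b\<bar>\<^sup>2 \<le> delta\<^sup>2" by (intro power_mono) auto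
    then show "(p \<bullet> b) * (p \<bullet> b) \<le> delta\<^sup>2" by (simp add: power2_eq_square)
  qed
  also have "\<dots> = 1/4" using delta(3) by simp
  finally show False using assms(1) by simp
qed

lemma small_coordinates_low:
  assumes p: "norm p = 1" "p \<bullet> e \<le> 0" and small: "\<And>b. b \<in> Basis \<Longrightarrow> b \<noteq> e \<Longrightarrow> \<bar>p \<bullet> b\<bar> \<le> delta"
  shows "p \<bullet> e \<le> - (3/4)"
proof -
  have "(norm (perp p))\<^sup>2 = (\<Sum>b\<in>Basis. (perp p \<bullet> b) * (perp p \<bullet> b))"
    unfolding power2_norm_eq_inner by (rule euclidean_inner)
  also have "\<dots> \<le> (\<Sum>b\<in>(Basis::'a set). delta\<^sup>2)"
  proof (rule sum_mono)
    fix b :: 'a assume b: "b \<in> Basis"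
    have "\<bar>perp p \<bullet> b\<bar> \<le> delta"
    proof (cases "b = e")
      case False
      then have "e \<bullet> b = 0" using b e_Basis by (simp add: inner_Basis)
      then show ?thesis using small[OF b False] by (simp add: perp_def inner_diff_left)
    qed (use delta(1) in simp)
    then have "\<bar>perp p \<bullet> b\<bar>\<^sup>2 \<le> delta\<^sup>2" by (intro power_mono) auto
    then show "(perp p \<bullet> b) * (perp p \<bullet> b) \<le> delta\<^sup>2" by (simp add: power2_eq_square)
  qed
  also have "\<dots> = 1/4" using delta(3) by simp
  finally have "(3/4)\<^sup>2 \<le> (- (p \<bullet> e))\<^sup>2" using unit_height[OF p(1)] by (simp add: power2_eq_square)
  then have "3/4 \<le> - (p \<bullet> e)" by (rule power2_le_imp_le) (use p in simp)
  then show ?thesis by simp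
qed

lemma perp_inner: "b \<in> Basis \<Longrightarrow> b \<noteq> e \<Longrightarrow> perp z \<bullet> b = z \<bullet> b"
  using e_Basis by (simp add: perp_def inner_diff_left inner_Basis)

lemma open_annulus_vimage:
  fixes g :: "'a \<Rightarrow> 'a"
  assumes g: "continuous_on (sphere 0 1) g" and B: "open B"
  shows "open {z \<in> annulus. g (sgn z) \<in> B}"
proof -
  have "continuous_on (annulus :: 'a set) sgn"
    using annulus_nonzero by (intro continuous_on_sgn continuous_on_id) auto
  then have "continuous_on annulus (\<lambda>z::'a. g (sgn z))"
    by (rule continuous_on_compose2[OF g]) (use annulus_nonzero sgn_sphere in blast)
  then have "open ((\<lambda>z. g (sgn z)) -` B \<inter> annulus)" using B continuous_on_open_vimage[OF open_annulus] by blast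
  moreover have "(\<lambda>z. g (sgn z)) -` B \<inter> annulus = {z \<in> annulus. g (sgn z) \<in> B}" by auto
  ultimately show ?thesis by simp
qed

lemma prod_off_polar: "(\<Prod>i\<in>UNIV - {polar_ix}. f (ix_basis i)) = (\<Prod>b\<in>Basis - {e}. f b)"
proof (rule prod.reindex_bij_betw)
  have b: "inj ix_basis" "range ix_basis = (Basis :: 'a set)" using ix_basis_bij by (auto simp: bij_betw_def)
  have "ix_basis ` (UNIV - {polar_ix}) = Basis - {e}"
    using image_set_diff[OF b(1), of UNIV "{polar_ix}"] b(2) by simp
  then show "bij_betw ix_basis (UNIV - {polar_ix}) (Basis - {e})"
    using b(1) by (auto simp: bij_betw_def intro: inj_on_subset)
qed

lemma degree_integrand_borel:
  assumes v: "L-lipschitz_on (sphere 0 1) v"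
  shows "(\<lambda>x. indicator annulus x * (eta (v (sgn x)) * polar_det x (\<lambda>b. ddir (cone_ext v) b x))) \<in> borel_measurable borel"
proof -
  define V where "V = cone_ext v"
  obtain LV where VL: "LV-lipschitz_on UNIV V" using cone_ext_lipschitz_exists[OF v] by (auto simp: V_def)
  have [measurable]: "ddir V b \<in> borel_measurable borel" for b by (rule ddir_borel_measurable[OF lipschitz_on_continuous_on[OF VL]])
  have [measurable]: "(sgn :: 'a \<Rightarrow> 'a) \<in> borel_measurable borel" unfolding sgn_div_norm[abs_def] by measurable
  have [measurable]: "eta \<in> borel_measurable borel" by (rule borel_measurable_continuous_onI[OF eta_continuous])
  have [measurable]: "V \<in> borel_measurable borel" by (rule borel_measurable_continuous_onI[OF lipschitz_on_continuous_on[OF VL]])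
  have "(\<lambda>x. if i = polar_ix then sgn x \<bullet> ix_basis j else ddir V (ix_basis j) x \<bullet> ix_basis i) \<in> borel_measurable borel" for i j :: "'a ix"
    by (cases "i = polar_ix") simp_all
  then have [measurable]: "(\<lambda>x. polar_det x (\<lambda>b. ddir V b x)) \<in> borel_measurable borel"
    unfolding polar_det_def det_def by (auto intro!: borel_measurable_sum borel_measurable_times borel_measurable_prod)
  have [measurable]: "annulus \<in> sets (borel :: 'a measure)" using open_annulus by (rule borel_open)
  have "(\<lambda>x. indicator annulus x * (eta (V x) * polar_det x (\<lambda>b. ddir V b x))) \<in> borel_measurable borel" by measurable
  moreover have "(\<lambda>x. indicator annulus x * (eta (v (sgn x)) * polar_det x (\<lambda>b. ddir V b x))) = (\<lambda>x. indicator annulus x * (eta (V x) * polar_det x (\<lambda>b. ddir V b x)))"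
    by (auto simp: indicator_def V_def cone_ext_annulus)
  ultimately show ?thesis by (simp add: V_def)
qed

text \<open>The integrand is, up to sign, the Jacobian of a Lipschitz map \<open>\<Phi>\<close> with compact support. Its
  \<open>e\<close>-component depends on \<open>|x|\<close> only. Its horizontal components are \<open>bevel (P \<bullet> b)\<close>, where \<open>P\<close> is the
  horizontal part of \<open>v\<close> in the chart after the unit disc, the southern hemisphere, has been kept fixed and everything
  else has been pushed radially to the equator. On the equator some coordinate exceeds
  \<open>delta\<close>, where \<open>bevel\<close> is constant, so only the southern part of \<open>v\<close> contributes.\<close>

lemma degree_zero:
  assumes dim: "DIM('a) = Suc n" and n: "2 \<le> n"
    and v: "L-lipschitz_on (sphere 0 1) v" and im: "v ` sphere 0 1 \<subseteq> Z"
  shows "integral\<^sup>L lborel (\<lambda>x. indicator annulus x * (eta (v (sgn x)) * polar_det x (\<lambda>b. ddir (cone_ext v) b x))) = 0"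
proof -
  obtain j where j: "v ` sphere 0 1 \<subseteq> core j" using sphere_image_core[OF _ v im] dim n by auto
  define Lc where "Lc = 5 / (1 - lev (j * pi))"
  have Lc0: "0 \<le> Lc" by (simp add: Lc_def less_imp_le)
  have L0: "0 \<le> L" using v lipschitz_on_nonneg by blast
  define c where "c y = chart (v y)" for y
  have cl: "(Lc * L)-lipschitz_on (sphere 0 1) c"
    unfolding c_def[abs_def] Lc_def by (rule lipschitz_on_compose2[OF v lipschitz_on_subset[OF chart_lipschitz j]])
  define w where "w y = perp (c y)" for y
  have wl: "norm (w y - w y') \<le> Lc * L * norm (y - y')" if "y \<in> sphere 0 1" "y' \<in> sphere 0 1" for y y'
    using norm_perp_le[of "c y - c y'"] lipschitz_onD[OF cl that] by (simp add: w_def perp_diff dist_norm)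
  have we: "w y \<bullet> e = 0" for y by (simp add: w_def)
  define P where "P y = perp (inv_stereo (cap (w y)))" for y
  have Pl: "norm (P y - P y') \<le> 6 * (Lc * L) * norm (y - y')" if "y \<in> sphere 0 1" "y' \<in> sphere 0 1" for y y'
  proof -
    have "norm (P y - P y') \<le> norm (inv_stereo (cap (w y)) - inv_stereo (cap (w y')))"
      using norm_perp_le[of "inv_stereo (cap (w y)) - inv_stereo (cap (w y'))"] by (simp add: P_def perp_diff)
    also have "\<dots> \<le> 2 * norm (cap (w y) - cap (w y'))" by (intro inv_stereo_lipschitz cap_orth we)
    also have "\<dots> \<le> 6 * norm (w y - w y')" using cap_lipschitz[of "w y" "w y'"] by simp
    also have "\<dots> \<le> 6 * (Lc * L * norm (y - y'))" using wl[OF that] by simp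
    finally show ?thesis by simp
  qed
  have PL: "(6 * (Lc * L))-lipschitz_on (sphere 0 1) P"
    by (rule lipschitz_onI) (use Pl Lc0 L0 in \<open>auto simp: dist_norm\<close>)
  define q where "q y = (\<Sum>b\<in>Basis - {e}. bevel delta (P y \<bullet> b) *\<^sub>R b)" for y
  have q_inner: "q y \<bullet> b = (if b = e then 0 else bevel delta (P y \<bullet> b))" if "b \<in> Basis" for y b
  proof -
    have "q y \<bullet> b = (\<Sum>b'\<in>Basis - {e}. if b' = b then bevel delta (P y \<bullet> b) else 0)"
      unfolding q_def inner_sum_left by (rule sum.cong) (use that in \<open>auto simp: inner_Basis\<close>)
    then show ?thesis using that by (simp add: sum.delta)
  qed
  have ql: "(DIM('a) * (6 * (Lc * L)))-lipschitz_on (sphere 0 1) q"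
  proof (rule lipschitz_onI)
    show "0 \<le> DIM('a) * (6 * (Lc * L))" using Lc0 L0 by simp
    fix y y' :: 'a assume y: "y \<in> sphere 0 1" "y' \<in> sphere 0 1"
    have "norm (q y - q y') \<le> (\<Sum>b\<in>Basis. \<bar>(q y - q y') \<bullet> b\<bar>)" by (rule norm_le_l1)
    also have "\<dots> \<le> (\<Sum>b\<in>(Basis::'a set). 6 * (Lc * L) * dist y y')"
    proof (rule sum_mono)
      fix b :: 'a assume b: "b \<in> Basis"
      have "\<bar>(q y - q y') \<bullet> b\<bar> \<le> \<bar>bevel delta (P y \<bullet> b) - bevel delta (P y' \<bullet> b)\<bar>"
        by (simp add: inner_diff_left q_inner[OF b])
      also have "\<dots> \<le> \<bar>P y \<bullet> b - P y' \<bullet> b\<bar>"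
        using lipschitz_onD[OF bevel_lipschitz[OF delta(1,2)], of "P y \<bullet> b" "P y' \<bullet> b"] by (simp add: dist_real_def)
      also have "\<dots> \<le> norm (P y - P y')" using Basis_le_norm[OF b, of "P y - P y'"] by (simp add: inner_diff_left)
      finally show "\<bar>(q y - q y') \<bullet> b\<bar> \<le> 6 * (Lc * L) * dist y y'" using Pl[OF y] by (simp add: dist_norm)
    qed
    finally show "dist (q y) (q y') \<le> DIM('a) * (6 * (Lc * L)) * dist y y'" by (simp add: dist_norm)
  qed
  define V where "V = cone_ext v"
  obtain LV where VL: "LV-lipschitz_on UNIV V" using cone_ext_lipschitz_exists[OF v] by (auto simp: V_def)
  obtain Lq where Lq: "Lq-lipschitz_on UNIV (cone_ext q)" using cone_ext_lipschitz_exists[OF ql] by blast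
  \<comment> \<open>On the annulus \<open>psi (norm x)\<close> is \<open>2 - norm x\<close>, whose
    differential is minus the radial direction; this is the source of the sign in
    \<open>point\<close>. Inside and outside it is locally constant, so the Jacobian vanishes
    there.\<close>
  define psi where "psi r = max 0 (min 1 (2 - r))" for r :: real
  define \<Phi> where "\<Phi> x = psi (norm x) *\<^sub>R e + cone_ext q x" for x
  have "1-lipschitz_on UNIV (\<lambda>x::'a. psi (norm x) *\<^sub>R e)"
  proof (rule lipschitz_onI)
    fix x y :: 'a
    have "\<bar>psi (norm x) - psi (norm y)\<bar> \<le> \<bar>(2 - norm x) - (2 - norm y)\<bar>" unfolding psi_def by (rule clamp_lipschitz)
    also have "\<dots> \<le> norm (x - y)" using norm_triangle_ineq3[of x y] by simp
    finally show "dist (psi (norm x) *\<^sub>R e) (psi (norm y) *\<^sub>R e) \<le> 1 * dist x y"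
      by (simp add: dist_norm flip: scaleR_diff_left)
  qed simp
  then have \<Phi>L: "(1 + Lq)-lipschitz_on UNIV \<Phi>" unfolding \<Phi>_def[abs_def] by (rule lipschitz_on_add[OF _ Lq])
  have "\<Phi> x = 0" if "x \<notin> cball 0 3" for x
    using that cone_ext_outside[OF that, of q] by (simp add: \<Phi>_def psi_def)
  then have int0: "integral\<^sup>L lborel (jac \<Phi>) = 0" by (rule jac_integral_zero[OF \<Phi>L])
  have \<Phi>e: "\<Phi> z \<bullet> e = psi (norm z)" for z
    by (simp add: \<Phi>_def inner_add_left cone_ext_def q_inner[OF e_Basis])
  have \<Phi>b: "\<Phi> z \<bullet> b = bevel delta (P (sgn z) \<bullet> b)" if "z \<in> annulus" "b \<in> Basis" "b \<noteq> e" for z b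
    using that e_Basis by (simp add: \<Phi>_def inner_add_left cone_ext_annulus q_inner inner_Basis)
  have vcore: "v y \<in> core j" if "y \<in> sphere 0 1" for y using j that by blast
  \<comment> \<open>Where \<open>cap\<close> changes nothing, \<open>P\<close> undoes the chart and
    returns the horizontal part of \<open>v\<close>; on the whisker both are 0.\<close>
  have Pin: "P y = perp (v y)" if y: "y \<in> sphere 0 1" "norm (w y) < 1" for y
    using vcore[OF y(1)]
  proof (cases rule: coreE)
    case (crimp p)
    then have "w y = perp p /\<^sub>R (1 - p \<bullet> e)" using chart_crimp[of p] by (simp add: w_def c_def perp_scaleR perp_orth)
    then show ?thesis using crimp inv_stereo_stereo[of p] cap_inside[OF y(2)] by (simp add: P_def)
  next
    case (whisker s)
    then have "w y = 0" "perp (v y) = 0" by (simp_all add: w_def c_def chart_whisker)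
    then show ?thesis by (simp add: P_def cap_def inv_stereo_def perp_def)
  qed
  have w_crimp: "(norm (w y))\<^sup>2 = (1 + p \<bullet> e) / (1 - p \<bullet> e)" if "norm p = 1" "p \<noteq> e" "v y = crimp p" for y p
    using stereo_norm_sq[OF that(1,2)] chart_crimp[OF that(1,2)] that(3) by (simp add: w_def c_def perp_scaleR perp_orth)
  \<comment> \<open>The two excluded spheres carry the corners of \<open>psi\<close>, and they are
    null.\<close>
  have point: "jac \<Phi> x = - (indicator annulus x * (eta (v (sgn x)) * polar_det x (\<lambda>b. ddir V b x)))"
    if d\<Phi>: "\<Phi> differentiable (at x)" and dV: "V differentiable (at x)" and x12: "x \<notin> sphere 0 1 \<union> sphere 0 2" for x
  proof (cases "x \<in> annulus")
    case False
    have "ddir \<Phi> b x \<bullet> e = 0" for b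
    proof (cases "norm x < 1")
      case True
      show ?thesis
        by (rule has_derivative_component[OF d\<Phi>, of "ball 0 1" e "\<lambda>_. 1" "\<lambda>_. 0"])
           (use True in \<open>auto simp: \<Phi>e psi_def\<close>)
    next
      case F: False
      then have "2 < norm x" using False x12 by (auto simp: annulus_def)
      then show ?thesis
        by (intro has_derivative_component[OF d\<Phi>, of "- cball 0 2" e "\<lambda>_. 0" "\<lambda>_. 0"])
           (auto simp: \<Phi>e psi_def)
    qed
    then have "jac \<Phi> x = 0" unfolding jac_def by (intro det_row_zero[of _ polar_ix]) simp
    then show ?thesis using False by simp
  next
    case True
    have xnz: "x \<noteq> 0" by (rule annulus_nonzero[OF True])
    define y where "y = sgn x"
    have y: "y \<in> sphere 0 1" using sgn_sphere[OF xnz] by (simp add: y_def)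
    have Vx: "V z = v (sgn z)" if "z \<in> annulus" for z using cone_ext_annulus[OF that] by (simp add: V_def)
    have rowe: "ddir \<Phi> b x \<bullet> e = - (b \<bullet> sgn x)" for b
    proof (rule has_derivative_component[OF d\<Phi> open_annulus True, of e "\<lambda>z. 2 - norm z" "\<lambda>b. - (b \<bullet> sgn x)"])
      show "\<Phi> z \<bullet> e = 2 - norm z" if "z \<in> annulus" for z using that by (simp add: \<Phi>e psi_def annulus_def)
      have "(norm has_derivative (\<lambda>b. b \<bullet> sgn x)) (at x)" using has_derivative_norm[OF xnz] by (simp add: inner_commute)
      from has_derivative_diff[OF has_derivative_const[of 2] this] show "((\<lambda>z. 2 - norm z) has_derivative (\<lambda>b. - (b \<bullet> sgn x))) (at x)" by simp
    qed
    show ?thesis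
    proof (cases "norm (w y) < 1")
      case inside: True
      let ?T = "{z \<in> annulus. w (sgn z) \<in> ball 0 1}"
      have wc: "continuous_on (sphere 0 1) w"
        unfolding w_def[abs_def] using lipschitz_on_continuous_on[OF cl]
        by (intro continuous_on_compose2[OF continuous_perp[of UNIV]]) auto
      have T: "open ?T" "x \<in> ?T" using open_annulus_vimage[OF wc, of "ball 0 1"] True inside by (auto simp: y_def)
      have rowb: "ddir \<Phi> b x \<bullet> b' = bevel_deriv delta (V x \<bullet> b') * (ddir V b x \<bullet> b')" if b': "b' \<in> Basis" "b' \<noteq> e" for b b'
      proof (rule has_derivative_component[OF d\<Phi> T, of b' "\<lambda>z. bevel delta (V z \<bullet> b')" "\<lambda>b. bevel_deriv delta (V x \<bullet> b') * (ddir V b x \<bullet> b')"])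
        fix z assume z: "z \<in> ?T"
        then have "sgn z \<in> sphere 0 1" using annulus_nonzero sgn_sphere by blast
        then have "P (sgn z) = perp (v (sgn z))" using z by (intro Pin) auto
        then show "\<Phi> z \<bullet> b' = bevel delta (V z \<bullet> b')" using z b' by (simp add: \<Phi>b Vx perp_inner)
      next
        have "((\<lambda>z. V z \<bullet> b') has_derivative (\<lambda>b. ddir V b x \<bullet> b')) (at x)"
          by (rule has_derivative_inner_left[OF differentiable_has_derivative_ddir[OF dV]])
        from DERIV_compose_FDERIV[where f="bevel delta" and g="\<lambda>z. V z \<bullet> b'", OF bevel_DERIV[OF delta(1)] this]
        show "((\<lambda>z. bevel delta (V z \<bullet> b')) has_derivative (\<lambda>b. bevel_deriv delta (V x \<bullet> b') * (ddir V b x \<bullet> b'))) (at x)"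
          by (simp add: mult.commute)
      qed
      define k where "k i = (if i = polar_ix then -1 else bevel_deriv delta (V x \<bullet> ix_basis i))" for i
      define a where "a i = (\<chi> j. if i = polar_ix then sgn x \<bullet> ix_basis j else ddir V (ix_basis j) x \<bullet> ix_basis i)" for i
      have "(\<chi> i j. ddir \<Phi> (ix_basis j) x \<bullet> ix_basis i) = (\<chi> i. k i *s a i)"
      proof -
        have "ddir \<Phi> (ix_basis j) x \<bullet> ix_basis i = k i * (a i $ j)" for i j
        proof (cases "i = polar_ix")
          case True then show ?thesis using rowe[of "ix_basis j"] by (simp add: k_def a_def inner_commute)
        next
          case False
          then have "ix_basis i \<noteq> e" using polar_ix_eq by blast
          then show ?thesis using rowb[of "ix_basis i" "ix_basis j"] False by (simp add: k_def a_def)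
        qed
        then show ?thesis by (simp add: vec_eq_iff)
      qed
      then have "jac \<Phi> x = prod k UNIV * polar_det x (\<lambda>b. ddir V b x)"
        unfolding jac_def polar_det_def using det_rows_mul[of k a] by (simp add: a_def)
      also have "prod k UNIV = k polar_ix * prod k (UNIV - {polar_ix})" by (rule prod.remove) auto
      also have "prod k (UNIV - {polar_ix}) = (\<Prod>i\<in>UNIV - {polar_ix}. bevel_deriv delta (V x \<bullet> ix_basis i))"
        by (rule prod.cong) (auto simp: k_def)
      also have "\<dots> = (\<Prod>b\<in>Basis - {e}. bevel_deriv delta (V x \<bullet> b))" by (rule prod_off_polar)
      finally have jac: "jac \<Phi> x = - ((\<Prod>b\<in>Basis - {e}. bevel_deriv delta (V x \<bullet> b)) * polar_det x (\<lambda>b. ddir V b x))"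
        by (simp add: k_def)
      \<comment> \<open>Compared with \<open>eta\<close>, only the factor \<open>south_cut\<close>
        is missing. Where \<open>?pr\<close> does not vanish, all horizontal coordinates are at most
        \<open>delta\<close>; on the southern part of the sheet this forces a height of at most
        -3/4, where the missing factor is 1. On the whisker above the south pole the determinant
        vanishes instead.\<close>
      let ?pr = "\<Prod>b\<in>Basis - {e}. bevel_deriv delta (V x \<bullet> b)"
      have "?pr * polar_det x (\<lambda>b. ddir V b x) = eta (V x) * polar_det x (\<lambda>b. ddir V b x)"
      proof (cases "?pr = 0")
        case True then show ?thesis by (simp add: eta_split)
      next
        case nz: False
        have small: "\<bar>V x \<bullet> b\<bar> \<le> delta" if "b \<in> Basis" "b \<noteq> e" for b
        proof (rule ccontr)
          assume "\<not> ?thesis"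
          then have "bevel_deriv delta (V x \<bullet> b) = 0" using bevel_deriv_zero[OF delta(1), of "V x \<bullet> b"] by simp
          then have "?pr = 0" using that by (intro prod_zero) auto
          with nz show False by simp
        qed
        have Vy: "V x = v y" using Vx[OF True] by (simp add: y_def)
        from vcore[OF y] show ?thesis
        proof (cases rule: coreE)
          case (crimp p)
          have h1: "1 - p \<bullet> e > 0" using unit_less_1 crimp by simp
          have "(norm (w y))\<^sup>2 < 1" using inside by (simp add: abs_square_less_1)
          then have "1 + p \<bullet> e < 1 - p \<bullet> e" using w_crimp[of p y] crimp h1 by simp
          then have h: "p \<bullet> e \<le> 0" by simp
          have "\<bar>p \<bullet> b\<bar> \<le> delta" if "b \<in> Basis" "b \<noteq> e" for b
            using small[OF that] perp_inner[OF that, of "crimp p"] perp_inner[OF that, of p] crimp Vy by simp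
          then have "p \<bullet> e \<le> - (3/4)" using crimp h by (intro small_coordinates_low)
          then have "south_cut (V x \<bullet> e) = 1" using Vy crimp by (simp add: south_cut_def)
          then show ?thesis by (simp add: eta_split)
        next
          case (whisker s)
          show ?thesis
          proof (cases "s = -1")
            case True
            then have "south_cut (V x \<bullet> e) = 1" using Vy whisker by (simp add: south_cut_def)
            then show ?thesis by (simp add: eta_split)
          next
            case False
            \<comment> \<open>Within the core, a positive vertical chart coordinate characterises
              the whisker above the south pole, and it is an open condition. So \<open>v\<close>
              stays on the axis near this direction, and a horizontal row of the determinant is
              zero.\<close>
            let ?U = "{z \<in> annulus. c (sgn z) \<in> {a. 0 < a \<bullet> e}}"
            have "open {a::'a. 0 < a \<bullet> e}" by (intro open_Collect_less continuous_intros)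
            then have U: "open ?U" using open_annulus_vimage[OF lipschitz_on_continuous_on[OF cl]] by blast
            have xU: "x \<in> ?U" using True whisker False by (auto simp: c_def chart_whisker y_def[symmetric])
            have flat: "V z \<bullet> b = 0" if z: "z \<in> ?U" and b: "b \<in> Basis" "b \<noteq> e" for z b
            proof -
              have za: "z \<in> annulus" and zc: "0 < c (sgn z) \<bullet> e" using z by auto
              have "sgn z \<in> sphere 0 1" using za annulus_nonzero sgn_sphere by blast
              from vcore[OF this] show ?thesis
              proof (cases rule: coreE)
                case (crimp p)
                then show ?thesis using zc chart_crimp[of p] by (simp add: c_def)
              next
                case (whisker s)
                then show ?thesis using Vx[OF za] b e_Basis by (simp add: inner_Basis)
              qed
            qed
            obtain i where i: "i \<noteq> polar_ix"
            proof -
              have "card (UNIV - {polar_ix}) = n" using card_ix[where 'a='a] dim by (simp add: card_Diff_singleton)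
              then have "UNIV - {polar_ix} \<noteq> {}" using n by (metis card.empty not_numeral_le_zero)
              then show ?thesis using that by blast
            qed
            have "ddir V b x \<bullet> ix_basis i = 0" for b
              by (rule has_derivative_component[OF dV U xU, of "ix_basis i" "\<lambda>_. 0" "\<lambda>_. 0"])
                 (use flat i polar_ix_eq in auto)
            then have "polar_det x (\<lambda>b. ddir V b x) = 0" unfolding polar_det_def using i by (intro det_row_zero[of _ i]) simp
            then show ?thesis by simp
          qed
        qed
      qed
      then show ?thesis using jac True Vx[OF True] by simp
    next
      case outside: False
      then have w1: "1 \<le> norm (w y)" by simp
      have capn: "norm (cap (w y)) = 1" by (rule cap_outside[OF w1])
      have "P y = cap (w y)" using inv_stereo(3)[OF cap_orth[OF we, of y]] capn by (simp add: P_def)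
      then obtain b where b: "b \<in> Basis" "b \<noteq> e" "delta < \<bar>P y \<bullet> b\<bar>"
        using exists_large_coordinate[of "P y"] capn cap_orth[OF we, of y] by auto
      have Pc: "continuous_on (sphere 0 1) P" by (rule lipschitz_on_continuous_on[OF PL])
      \<comment> \<open>A coordinate that exceeds \<open>delta\<close> in absolute value continues
        to do so nearby, where \<open>bevel\<close> is constant; hence a zero row. The other side of
        the claim vanishes too: outside the unit disc of the chart the sheet has nonnegative height,
        where \<open>eta\<close> is 0.\<close>
      have "ddir \<Phi> v x \<bullet> b = 0" for v
      proof (cases "P y \<bullet> b > 0")
        case pos: True
        let ?T = "{z \<in> annulus. P (sgn z) \<in> {a. delta < a \<bullet> b}}"
        have "open {a::'a. delta < a \<bullet> b}" by (intro open_Collect_less continuous_intros)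
        then have "open ?T" by (rule open_annulus_vimage[OF Pc])
        moreover have "x \<in> ?T" using True b pos by (simp add: y_def)
        ultimately show ?thesis
          by (rule has_derivative_component[OF d\<Phi>, of _ b "\<lambda>_. bevel delta delta" "\<lambda>_. 0"])
             (use b delta(1) in \<open>auto simp: \<Phi>b bevel_def\<close>)
      next
        case neg: False
        let ?T = "{z \<in> annulus. P (sgn z) \<in> {a. a \<bullet> b < - delta}}"
        have "open {a::'a. a \<bullet> b < - delta}" by (intro open_Collect_less continuous_intros)
        then have "open ?T" by (rule open_annulus_vimage[OF Pc])
        moreover have "x \<in> ?T" using True b neg by (simp add: y_def)
        ultimately show ?thesis
          by (rule has_derivative_component[OF d\<Phi>, of _ b "\<lambda>_. bevel delta (- delta)" "\<lambda>_. 0"])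
             (use b delta(1) in \<open>auto simp: \<Phi>b bevel_def min_def\<close>)
      qed
      moreover obtain i where "ix_basis i = b" using b(1) bij_betw_imp_surj_on[OF ix_basis_bij] by (metis imageE)
      ultimately have "jac \<Phi> x = 0" unfolding jac_def by (intro det_row_zero[of _ i]) simp
      moreover have "eta (v y) = 0"
        using vcore[OF y]
      proof (cases rule: coreE)
        case (crimp p)
        have h1: "1 - p \<bullet> e > 0" using unit_less_1 crimp by simp
        have "1 \<le> (norm (w y))\<^sup>2" using w1 by (simp add: one_le_power)
        then have "1 - p \<bullet> e \<le> 1 + p \<bullet> e" using w_crimp[of p y] crimp h1 by simp
        then show ?thesis using crimp hump_bounds(1)[of "p \<bullet> e"] by (intro eta_zero_above) simp
      next
        case (whisker s)
        then have "w y = 0" by (simp add: w_def c_def chart_whisker)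
        then show ?thesis using w1 by simp
      qed
      ultimately show ?thesis by (simp add: y_def)
    qed
  qed
  have "sphere 0 1 \<union> sphere 0 2 \<in> null_sets (lborel :: 'a measure)"
  proof -
    have "negligible (sphere 0 1 \<union> sphere (0::'a) 2)" by (intro negligible_Un negligible_sphere)
    then show ?thesis by (simp add: negligible_iff_null_sets null_sets_completion_iff)
  qed
  then have "AE x in lborel. x \<notin> sphere 0 1 \<union> sphere (0::'a) 2" by (rule AE_not_in)
  then have "AE x in lborel. jac \<Phi> x = - (indicator annulus x * (eta (v (sgn x)) * polar_det x (\<lambda>b. ddir V b x)))"
    using rademacher[OF \<Phi>L] rademacher[OF VL] by eventually_elim (rule point)
  then have AE: "AE x in lborel. indicator annulus x * (eta (v (sgn x)) * polar_det x (\<lambda>b. ddir V b x)) = - jac \<Phi> x"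
    by (rule eventually_mono) simp
  have jm: "jac \<Phi> \<in> borel_measurable borel" by (rule jac_measurable[OF lipschitz_on_continuous_on[OF \<Phi>L]])
  have "integral\<^sup>L lborel (\<lambda>x. indicator annulus x * (eta (v (sgn x)) * polar_det x (\<lambda>b. ddir V b x))) = integral\<^sup>L lborel (\<lambda>x. - jac \<Phi> x)"
    using AE jm degree_integrand_borel[OF v] by (intro integral_cong_AE) (simp_all add: V_def)
  also have "\<dots> = 0" using int0 by simp
  finally show ?thesis by (simp add: V_def)
qed

end

section \<open>Lower bound for the Sobolev distance\<close>

lemma Lp_on_annulus_integrable:
  fixes F :: "'a::euclidean_space \<Rightarrow> 'b::euclidean_space"
  assumes F: "Lp_on (real n) annulus F" and n: "1 \<le> n"
  shows "integrable (lebesgue_on annulus) F"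
proof (rule Bochner_Integration.integrable_bound)
  show "integrable (lebesgue_on annulus) (\<lambda>x. 1 + norm (F x) powr real n)"
    using F integrable_annulus_const[of 1] unfolding Lp_on_def by (intro Bochner_Integration.integrable_add) auto
  show "F \<in> borel_measurable (lebesgue_on annulus)" using F by (simp add: Lp_on_def)
  show "AE x in lebesgue_on annulus. norm (F x) \<le> norm (1 + norm (F x) powr real n)"
  proof (rule AE_I2)
    fix x :: 'a
    have "norm (F x) \<le> 1 + norm (F x) ^ n"
      using power_increasing[of 1 n "norm (F x)"] n by (cases "1 \<le> norm (F x)") (auto intro: order_trans[of _ 1] simp: add_increasing2)
    moreover have "norm (F x) powr real n = norm (F x) ^ n" using n by (intro powr_realpow') auto
    ultimately show "norm (F x) \<le> norm (1 + norm (F x) powr real n)" by simp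
  qed
qed

lemma annulus_sets_lebesgue: "(annulus :: 'a::euclidean_space set) \<in> sets lebesgue"
  using borel_open[OF open_annulus] by (rule sets_completionI_sets[of _ lborel, simplified])

lemma AE_lborel_imp_lebesgue_on_annulus:
  fixes P :: "'a::euclidean_space \<Rightarrow> bool"
  assumes "AE x in lborel. P x"
  shows "AE x in lebesgue_on annulus. P x"
proof -
  have "AE x in lebesgue. P x" using assms by (rule AE_completion)
  then show ?thesis using annulus_sets_lebesgue by (subst AE_restrict_space_iff) (auto elim: eventually_mono)
qed

lemma test_function_bounded:
  assumes t: "test_function \<Omega> \<phi>"
  shows "\<exists>B\<ge>0. \<forall>x. \<bar>\<phi> x\<bar> \<le> B"
proof -
  obtain K where K: "compact K" "\<And>x. x \<notin> K \<Longrightarrow> \<phi> x = 0" using t by (auto simp: test_function_def)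
  have "continuous_on UNIV \<phi>" using test_function_lipschitz[OF t] lipschitz_on_continuous_on by blast
  then show ?thesis using K by (rule compact_support_bounded)
qed

lemma integrable_bounded_scaleR:
  fixes F :: "'a \<Rightarrow> 'b::{banach,second_countable_topology}"
  assumes "integrable M F" "\<phi> \<in> borel_measurable M" "\<And>x. \<bar>\<phi> x\<bar> \<le> B"
  shows "integrable M (\<lambda>x. \<phi> x *\<^sub>R F x)"
proof (rule Bochner_Integration.integrable_bound)
  show "integrable M (\<lambda>x. B * norm (F x))" using assms by (intro integrable_mult_right integrable_norm)
  show "(\<lambda>x. \<phi> x *\<^sub>R F x) \<in> borel_measurable M" using assms by (intro borel_measurable_scaleR) auto
  show "AE x in M. norm (\<phi> x *\<^sub>R F x) \<le> norm (B * norm (F x))"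
    using assms(3) by (intro AE_I2) (auto simp: abs_mult intro!: mult_right_mono intro: order_trans[OF _ abs_ge_self])
qed

text \<open>\<open>sobolev_norm\<close> takes its gradient by \<open>SOME\<close>; almost everywhere
  uniqueness identifies that choice with a gradient known explicitly.\<close>

lemma weak_gradient_unique:
  fixes U :: "'a::euclidean_space \<Rightarrow> 'b::euclidean_space"
  assumes G: "weak_gradient (real n) annulus U G" and G': "weak_gradient (real n) annulus U G'"
    and n: "1 \<le> n" and b: "b \<in> Basis"
  shows "AE x in lebesgue_on annulus. G b x = G' b x"
proof -
  have i: "integrable (lebesgue_on annulus) (G b)" "integrable (lebesgue_on annulus) (G' b)"
    using G G' b n by (auto simp: weak_gradient_def intro!: Lp_on_annulus_integrable)
  have ms: "annulus \<inter> space lebesgue \<in> sets (lebesgue :: 'a measure)" using annulus_sets_lebesgue by simp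
  have "AE x in lebesgue. x \<in> annulus \<longrightarrow> (G b x - G' b x) \<bullet> k = 0" if k: "k \<in> Basis" for k
  proof (rule fundamental_lemma_real[OF open_annulus])
    have "integrable (lebesgue_on annulus) (\<lambda>x. (G b x - G' b x) \<bullet> k)"
      using i by (intro integrable_inner_left Bochner_Integration.integrable_diff) auto
    then have "set_integrable lebesgue annulus (\<lambda>x. (G b x - G' b x) \<bullet> k)"
      using ms by (simp add: integrable_restrict_space set_integrable_def)
    then show "set_integrable lebesgue (cbox l u) (\<lambda>x. (G b x - G' b x) \<bullet> k)" if "cbox l u \<subseteq> annulus" for l u
      by (rule set_integrable_subset) (use that in auto)
  next
    fix \<phi> :: "'a \<Rightarrow> real" assume t: "test_function annulus \<phi>"
    obtain B where B: "\<And>x. \<bar>\<phi> x\<bar> \<le> B" using test_function_bounded[OF t] by blast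
    have m: "\<phi> \<in> borel_measurable (lebesgue_on annulus)"
      by (rule borel_measurable_lebesgue_on_annulus[OF test_function_borel[OF t]])
    have "- integral\<^sup>L (lebesgue_on annulus) (\<lambda>x. \<phi> x *\<^sub>R G b x) = - integral\<^sup>L (lebesgue_on annulus) (\<lambda>x. \<phi> x *\<^sub>R G' b x)"
      using G G' b t unfolding weak_gradient_def weak_partial_def by metis
    moreover have "integral\<^sup>L (lebesgue_on annulus) (\<lambda>x. \<phi> x *\<^sub>R (G b x - G' b x)) =
        integral\<^sup>L (lebesgue_on annulus) (\<lambda>x. \<phi> x *\<^sub>R G b x) - integral\<^sup>L (lebesgue_on annulus) (\<lambda>x. \<phi> x *\<^sub>R G' b x)"
      unfolding scaleR_diff_right
      by (intro Bochner_Integration.integral_diff integrable_bounded_scaleR[where B=B] i m B)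
    ultimately have z: "integral\<^sup>L (lebesgue_on annulus) (\<lambda>x. \<phi> x *\<^sub>R (G b x - G' b x)) = 0" by simp
    have "integral\<^sup>L (lebesgue_on annulus) (\<lambda>x. (\<phi> x *\<^sub>R (G b x - G' b x)) \<bullet> k) = integral\<^sup>L (lebesgue_on annulus) (\<lambda>x. \<phi> x *\<^sub>R (G b x - G' b x)) \<bullet> k"
      by (rule integral_inner_left) (intro integrable_bounded_scaleR[where B=B] Bochner_Integration.integrable_diff i m B)
    then have "integral\<^sup>L (lebesgue_on annulus) (\<lambda>x. \<phi> x * ((G b x - G' b x) \<bullet> k)) = 0" using z by simp
    then show "(LINT x:annulus|lebesgue. \<phi> x * ((G b x - G' b x) \<bullet> k)) = 0"
      using ms by (simp add: integral_restrict_space set_lebesgue_integral_def)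
  qed
  then have "AE x in lebesgue. \<forall>k\<in>Basis. x \<in> annulus \<longrightarrow> (G b x - G' b x) \<bullet> k = 0"
    by (intro AE_ball_countable[THEN iffD2]) (auto intro: countable_finite)
  then have "AE x in lebesgue. x \<in> annulus \<longrightarrow> G b x = G' b x"
    by (rule eventually_mono) (auto simp: euclidean_eq_iff[of "G b _"] inner_diff_left)
  then show ?thesis using ms by (simp add: AE_restrict_space_iff)
qed

section \<open>The degree of the oscillating map and its stability\<close>

context whiskered
begin

text \<open>The degree integrand of \<open>crimp\<close>, with its determinant already evaluated by
  \<open>polar_det_sgn_deriv\<close>.\<close>

definition crimp_integrand :: "nat \<Rightarrow> 'a \<Rightarrow> real" where
  "crimp_integrand n x = indicator annulus x * (eta (crimp (sgn x)) * ((sgn x \<bullet> e) / norm x ^ n))"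

lemma crimp_integrand_borel: "crimp_integrand n \<in> borel_measurable borel"
proof -
  have [measurable]: "(sgn :: 'a \<Rightarrow> 'a) \<in> borel_measurable borel" unfolding sgn_div_norm[abs_def] by measurable
  have [measurable]: "eta \<in> borel_measurable borel" by (rule borel_measurable_continuous_onI[OF eta_continuous])
  have [measurable]: "hump \<in> borel_measurable borel" unfolding hump_def[abs_def] osc_phase_def by measurable
  have [measurable]: "crimp \<in> borel_measurable borel" unfolding crimp_def[abs_def] by measurable
  have [measurable]: "annulus \<in> sets (borel :: 'a measure)" using open_annulus by (rule borel_open)
  show ?thesis unfolding crimp_integrand_def[abs_def] by measurable
qed

lemma abs_polar_factor_le: assumes x: "x \<in> annulus" shows "\<bar>(sgn x \<bullet> e) / norm x ^ n\<bar> \<le> 1"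
proof -
  have "norm (sgn x) = 1" using annulus_nonzero[OF x] by (simp add: norm_sgn)
  then have "\<bar>sgn x \<bullet> e\<bar> \<le> 1" by (rule unit_height_bounds)
  moreover have "1 \<le> norm x ^ n" using x by (intro one_le_power) (simp add: annulus_def)
  ultimately show ?thesis by (simp add: abs_divide divide_le_eq)
qed

lemma crimp_integrand_nonpos: "crimp_integrand n x \<le> 0"
proof (cases "x \<in> annulus \<and> eta (crimp (sgn x)) \<noteq> 0")
  case True
  then have "crimp (sgn x) \<bullet> e < - (1/2)" using eta_zero_above[of "crimp (sgn x)"] by (auto simp: not_le[symmetric])
  then have "sgn x \<bullet> e \<le> 0" using hump_bounds(1)[of "sgn x \<bullet> e"] by simp
  then show ?thesis using True eta_bounds(1)[of "crimp (sgn x)"]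
    by (simp add: crimp_integrand_def mult_nonneg_nonpos divide_nonpos_nonneg)
qed (auto simp: crimp_integrand_def)

lemma integrable_lborel_annulus: "integrable lborel (\<lambda>x. indicator (annulus :: 'a set) x :: real)"
proof -
  have "(annulus :: 'a set) \<in> sets borel" using open_annulus by (rule borel_open)
  then show ?thesis using emeasure_annulus_finite[where 'a='a] by (intro integrable_real_indicator) auto
qed

lemma crimp_integrand_integrable: "integrable lborel (crimp_integrand n)"
proof (rule Bochner_Integration.integrable_bound[OF integrable_lborel_annulus])
  show "crimp_integrand n \<in> borel_measurable lborel" using crimp_integrand_borel by simp
  show "AE x in lborel. norm (crimp_integrand n x) \<le> norm (indicator annulus x :: real)"
  proof (rule AE_I2)
    fix x :: 'a
    show "norm (crimp_integrand n x) \<le> norm (indicator annulus x :: real)"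
    proof (cases "x \<in> annulus")
      case True
      have "\<bar>eta (crimp (sgn x))\<bar> * \<bar>(sgn x \<bullet> e) / norm x ^ n\<bar> \<le> 1 * 1"
        using eta_bounds[of "crimp (sgn x)"] abs_polar_factor_le[OF True] by (intro mult_mono) auto
      then show ?thesis using True by (simp add: crimp_integrand_def abs_mult)
    qed (simp add: crimp_integrand_def)
  qed
qed

text \<open>The weight lives where the height is negative, so the integrand has one sign, and it is
  nonzero on an open cone sector of the annulus around the south ray.\<close>

lemma crimp_degree_negative: "integral\<^sup>L lborel (crimp_integrand n) < 0"
proof -
  have le: "integral\<^sup>L lborel (crimp_integrand n) \<le> 0"
    using integral_nonneg_AE[where M=lborel and f="\<lambda>x. - crimp_integrand n x"] crimp_integrand_nonpos by simp
  moreover have "integral\<^sup>L lborel (crimp_integrand n) \<noteq> 0"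
  proof
    assume "integral\<^sup>L lborel (crimp_integrand n) = 0"
    then have "integral\<^sup>L lborel (\<lambda>x. - crimp_integrand n x) = 0" by simp
    then have AE0: "AE x in lborel. - crimp_integrand n x = 0"
      using crimp_integrand_integrable crimp_integrand_nonpos by (subst (asm) integral_nonneg_eq_0_iff_AE) auto
    define B where "B = {a::'a. a \<bullet> e < - (3/4)} \<inter> (\<Inter>b\<in>Basis - {e}. {a. \<bar>a \<bullet> b\<bar> < delta})"
    have "open B" unfolding B_def
      by (intro open_Int open_INT ballI open_Collect_less continuous_intros) auto
    then have opn: "open {x \<in> annulus. sgn x \<in> B}"
      using open_annulus_vimage[of "\<lambda>a. a" B] by (simp add: continuous_on_id)
    have "crimp_integrand n x \<noteq> 0" if x: "x \<in> annulus" "sgn x \<in> B" for x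
    proof -
      have s: "sgn x \<bullet> e < - (3/4)" and sb: "\<And>b. b \<in> Basis - {e} \<Longrightarrow> \<bar>sgn x \<bullet> b\<bar> < delta" using x(2) by (auto simp: B_def)
      have "crimp (sgn x) = sgn x" using s by (simp add: crimp_def)
      moreover have "0 < eta (sgn x)" unfolding eta_split
        using s sb by (intro mult_pos_pos prod_pos bevel_deriv_pos) (auto simp: south_cut_def)
      ultimately show ?thesis using x s annulus_nonzero[OF x(1)] by (simp add: crimp_integrand_def)
    qed
    then have "AE x in lborel. x \<notin> {x \<in> annulus. sgn x \<in> B}" using AE0 by (auto elim!: eventually_mono)
    then have "{x \<in> annulus. sgn x \<in> B} \<in> null_sets lborel"
      using borel_open[OF opn] by (subst (asm) AE_iff_null_sets[symmetric]) auto
    then have "negligible {x \<in> annulus. sgn x \<in> B}" by (simp add: negligible_iff_null_sets null_sets_completionI)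
    moreover have "- (3/2) *\<^sub>R e \<in> {x \<in> annulus. sgn x \<in> B}"
    proof -
      have "sgn (- (3/2) *\<^sub>R e) = - e" by (simp add: sgn_div_norm)
      then show ?thesis using e_Basis delta(1) by (auto simp: annulus_def B_def inner_Basis)
    qed
    ultimately show False using open_not_negligible[OF opn] by blast
  qed
  ultimately show ?thesis by simp
qed

text \<open>Either \<open>a\<close> is at most \<open>\<epsilon>\<close>, or the power in the
  denominator is at most \<open>a ^ (n - 1)\<close>. It plays the part of Hoelder's inequality,
  trading first powers for n-th powers at the cost of an additive \<open>\<epsilon>\<close>.\<close>

lemma young_power:
  fixes a \<epsilon> :: real
  assumes "0 \<le> a" "0 < \<epsilon>" "1 \<le> n"
  shows "a \<le> \<epsilon> + a ^ n / \<epsilon> ^ (n - 1)"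
proof (cases "a \<le> \<epsilon>")
  case True
  then show ?thesis using assms by (simp add: add_increasing2)
next
  case False
  then have "\<epsilon> ^ (n - 1) \<le> a ^ (n - 1)" using assms by (intro power_mono) auto
  then have "a * \<epsilon> ^ (n - 1) \<le> a * a ^ (n - 1)" using assms by (intro mult_left_mono) auto
  also have "a * a ^ (n - 1) = a ^ n" using assms(3) by (cases n) auto
  finally have "a \<le> a ^ n / \<epsilon> ^ (n - 1)" using assms by (simp add: pos_le_divide_eq)
  then show ?thesis using assms by simp
qed

lemma powr_half_power: assumes "0 \<le> s" "1 \<le> n" shows "s powr (real n / 2) = sqrt s ^ n"
proof -
  have "sqrt s ^ n = sqrt s powr real n" using assms by (intro powr_realpow'[symmetric]) auto
  also have "\<dots> = s powr (1/2 * real n)" using assms by (simp add: powr_half_sqrt[symmetric] powr_powr)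
  finally show ?thesis by simp
qed

text \<open>The horizontal rows of the gradient of \<open>crimp\<close> are those of
  \<open>sgn\<close> and bounded by 1; its unbounded slope lies in the replaced row. So no product
  of a singular slope with the error \<open>m\<close> occurs, and \<open>m\<close> and
  \<open>m ^ n\<close> suffice.\<close>

lemma polar_det_difference_bound:
  assumes dim: "DIM('a) = Suc n" and n: "2 \<le> n" and x: "x \<in> annulus" and m: "0 \<le> m"
    and G: "\<And>b. b \<in> Basis \<Longrightarrow> norm (crimp_grad b x - w b) \<le> m"
  shows "\<bar>polar_det x (\<lambda>b. crimp_grad b x) - polar_det x w\<bar> \<le> fact (Suc n) * (n * (2 ^ (n - 1) * (m + m ^ n)))"
proof -
  have s: "norm (sgn x) = 1" using annulus_nonzero[OF x] by (simp add: norm_sgn)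
  have orth: "e \<bullet> ix_basis i = 0" if "i \<noteq> polar_ix" for i
    using that inner_ix_basis[of polar_ix i] by simp
  have "\<bar>polar_det x (\<lambda>b. crimp_grad b x) - polar_det x w\<bar> \<le> fact (Suc n) * (n * (m * (1 + m) ^ (n - 1)))"
    unfolding polar_det_def
  proof (rule det_difference_bound[where k=polar_ix])
    show "CARD('a ix) = Suc n" using card_ix[where 'a='a] dim by simp
    show "1 \<le> n" using n by simp
    fix i j :: "'a ix"
    show "\<bar>(\<chi> i j. if i = polar_ix then sgn x \<bullet> ix_basis j else crimp_grad (ix_basis j) x \<bullet> ix_basis i) $ polar_ix $ j\<bar> \<le> 1"
      using Basis_le_norm[OF ix_basis_Basis, of "sgn x" j] s by simp
    assume i: "i \<noteq> polar_ix"
    have "crimp_grad (ix_basis j) x \<bullet> ix_basis i = sgn_deriv (ix_basis j) x \<bullet> ix_basis i"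
      using orth[OF i] by (simp add: crimp_grad_def inner_add_left)
    then show "\<bar>(\<chi> i j. if i = polar_ix then sgn x \<bullet> ix_basis j else crimp_grad (ix_basis j) x \<bullet> ix_basis i) $ i $ j\<bar> \<le> 1"
      using i Basis_le_norm[OF ix_basis_Basis, of "sgn_deriv (ix_basis j) x" i] norm_sgn_deriv_le[OF x, of "ix_basis j"] by simp
    have "\<bar>(crimp_grad (ix_basis j) x - w (ix_basis j)) \<bullet> ix_basis i\<bar> \<le> m"
      using Basis_le_norm[OF ix_basis_Basis, of "crimp_grad (ix_basis j) x - w (ix_basis j)" i] G[OF ix_basis_Basis, of j] by linarith
    then show "\<bar>(\<chi> i j. if i = polar_ix then sgn x \<bullet> ix_basis j else crimp_grad (ix_basis j) x \<bullet> ix_basis i) $ i $ j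
        - (\<chi> i j. if i = polar_ix then sgn x \<bullet> ix_basis j else w (ix_basis j) \<bullet> ix_basis i) $ i $ j\<bar> \<le> m"
      using i by (simp add: inner_diff_left)
  qed (use m in simp_all)
  also have "m * (1 + m) ^ (n - 1) \<le> 2 ^ (n - 1) * (m + m ^ n)"
  proof -
    have "m * (1 + m) ^ (n - 1) \<le> m * (2 ^ (n - 1) * (1 + m ^ (n - 1)))"
      using power_sum_le[OF m] m by (intro mult_left_mono) auto
    also have "\<dots> = 2 ^ (n - 1) * (m + m ^ n)" using n by (cases n) (auto simp: algebra_simps)
    finally show ?thesis .
  qed
  finally show ?thesis by (simp add: mult_left_mono)
qed

text \<open>The degree integral is \<open>- cU < 0\<close> for \<open>crimp\<close> and 0 for every
  admissible \<open>v\<close>. A small distance would bring the two closer than \<open>cU\<close>,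
  since their integrands differ by at most first and n-th powers of the differences of values and
  gradients.\<close>

lemma sobolev_distance_bounded_below:
  assumes dim: "DIM('a) = Suc n" and n: "2 \<le> n"
  shows "\<exists>\<epsilon>>0. \<forall>v. (\<exists>L. L-lipschitz_on (sphere 0 1) v) \<and> v ` sphere 0 1 \<subseteq> Z \<longrightarrow>
           sphere_sobolev_dist (real n) crimp v \<ge> \<epsilon>"
proof -
  define cU where "cU = - integral\<^sup>L lborel (crimp_integrand n)"
  have cU: "0 < cU" using crimp_degree_negative[of n] by (simp add: cU_def)
  define A where "A = integral\<^sup>L (lebesgue_on (annulus :: 'a set)) (\<lambda>x. 1 :: real)"
  have A0: "0 \<le> A" unfolding A_def by (intro integral_nonneg_AE) simp
  \<comment> \<open>The Lipschitz constant of \<open>eta\<close> plus the constant of the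
    determinant estimate.\<close>
  define C where "C = 4 * real DIM('a) + fact (Suc n) * (n * 2 ^ (n - 1))"
  have C0: "0 < C" unfolding C_def using DIM_positive[where 'a='a] by (intro add_pos_nonneg) auto
  \<comment> \<open>A distance below \<open>\<epsilon>\<close> will make the degree integrals differ
    by at most \<open>C * (2 * A + 2) * \<epsilon>\<close>, here no more than half of
    \<open>cU\<close>. The bound by 1 ensures
    \<open>\<epsilon> ^ n \<le> \<epsilon>\<close>.\<close>
  define \<epsilon> where "\<epsilon> = min 1 (cU / (2 * (C * (2 * A + 2))))"
  have den: "0 < C * (2 * A + 2)" using C0 A0 by simp
  have \<epsilon>: "0 < \<epsilon>" "\<epsilon> \<le> 1" using cU den by (auto simp: \<epsilon>_def)
  have half: "D * (c / (2 * D)) = c / 2" if "D \<noteq> 0" for D c :: real using that by simp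
  have \<epsilon>c: "C * (2 * A + 2) * \<epsilon> < cU"
  proof -
    have "\<epsilon> \<le> cU / (2 * (C * (2 * A + 2)))" by (simp add: \<epsilon>_def)
    then have "C * (2 * A + 2) * \<epsilon> \<le> C * (2 * A + 2) * (cU / (2 * (C * (2 * A + 2))))" using den by (intro mult_left_mono) auto
    also have "\<dots> = cU / 2" using half[OF den[THEN less_imp_neq, symmetric], of cU] .
    finally show ?thesis using cU by simp
  qed
  show ?thesis
  proof (intro exI[of _ \<epsilon>] conjI allI impI)
    show "0 < \<epsilon>" by fact
    fix v :: "'a \<Rightarrow> 'a" assume v: "(\<exists>L. L-lipschitz_on (sphere 0 1) v) \<and> v ` sphere 0 1 \<subseteq> Z"
    then obtain L where L: "L-lipschitz_on (sphere 0 1) v" by blast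
    have im: "v ` sphere 0 1 \<subseteq> Z" using v by blast
    define V where "V = cone_ext v"
    obtain LV where VL: "LV-lipschitz_on UNIV V" using cone_ext_lipschitz_exists[OF L] by (auto simp: V_def)
    have LV0: "0 \<le> LV" using VL lipschitz_on_nonneg by blast
    have Vc: "continuous_on UNIV V" by (rule lipschitz_on_continuous_on[OF VL])
    have Vx: "radial_ext v x = V x" if "x \<in> annulus" for x using that by (simp add: radial_ext_sgn V_def cone_ext_annulus)
    define W where "W x = radial_ext crimp x - radial_ext v x" for x
    define G0 where "G0 b x = crimp_grad b x - ddir V b x" for b x
    have sp: "x \<in> space (lebesgue_on annulus) \<longleftrightarrow> x \<in> annulus" for x :: 'a by (simp add: space_restrict_space)
    have mV: "radial_ext v \<in> borel_measurable (lebesgue_on annulus)"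
      using borel_measurable_lebesgue_on_annulus[OF borel_measurable_continuous_onI[OF Vc]]
      by (rule measurable_cong[THEN iffD1, rotated]) (simp add: sp Vx)
    have mD: "ddir V b \<in> borel_measurable (lebesgue_on annulus)" for b
      by (rule borel_measurable_lebesgue_on_annulus[OF ddir_borel_measurable[OF Vc]])
    have mW: "W \<in> borel_measurable (lebesgue_on annulus)"
      unfolding W_def[abs_def] using radial_crimp_measurable mV by (rule borel_measurable_diff)
    obtain M where M: "\<And>x. x \<in> annulus \<Longrightarrow> norm (V x) \<le> M"
    proof -
      have "bounded (V ` cball 0 2)" by (intro compact_imp_bounded compact_continuous_image continuous_on_subset[OF Vc]) auto
      then obtain M where "\<And>x. x \<in> cball 0 2 \<Longrightarrow> norm (V x) \<le> M" by (force simp: bounded_iff)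
      then show ?thesis by (intro that[of M]) (auto simp: annulus_def)
    qed
    have cr2: "norm (radial_ext crimp x) \<le> 2" if "x \<in> annulus" for x
      unfolding radial_ext_sgn using annulus_nonzero[OF that] by (intro norm_crimp_le) (simp add: norm_sgn)
    have LpW: "Lp_on (real n) annulus W"
    proof (rule Lp_on_annulusI[OF dim n mW, of "2 + \<bar>M\<bar>"], rule AE_I2)
      fix x :: 'a assume "x \<in> space (lebesgue_on annulus)"
      then have x: "x \<in> annulus" by (simp add: sp)
      have "norm (W x) \<le> (2 + \<bar>M\<bar>) * 1"
        using norm_triangle_ineq4[of "radial_ext crimp x" "radial_ext v x"] cr2[OF x] M[OF x] Vx[OF x] by (simp add: W_def)
      also have "\<dots> \<le> (2 + \<bar>M\<bar>) * (1 + slope_bound x)" using slope_bound_nonneg[of x] by (intro mult_left_mono) auto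
      finally show "norm (W x) \<le> (2 + \<bar>M\<bar>) * (1 + slope_bound x)" .
    qed
    have wg0: "weak_gradient (real n) annulus W G0"
      unfolding weak_gradient_def
    proof (intro ballI conjI)
      fix b :: 'a assume b: "b \<in> Basis"
      have mG: "G0 b \<in> borel_measurable (lebesgue_on annulus)"
        unfolding G0_def[abs_def] using crimp_grad_measurable mD by (rule borel_measurable_diff)
      have AEb: "AE x in lebesgue_on annulus. norm (ddir V b x) \<le> LV"
      proof (rule AE_lborel_imp_lebesgue_on_annulus)
        show "AE x in lborel. norm (ddir V b x) \<le> LV"
          using lipschitz_AE_dquot_tendsto[OF VL, of b] by (rule eventually_mono) (use ddir_bound[OF VL] b in fastforce)
      qed
      have bnd: "AE x in lebesgue_on annulus. norm (G0 b x) \<le> (1 + LV) * (1 + slope_bound x)"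
        using AEb AE_space
      proof eventually_elim
        fix x :: 'a assume 1: "norm (ddir V b x) \<le> LV" and "x \<in> space (lebesgue_on annulus)"
        then have x: "x \<in> annulus" by (simp add: sp)
        have "norm (G0 b x) \<le> (1 + slope_bound x) + LV"
          using norm_triangle_ineq4[of "crimp_grad b x" "ddir V b x"] cone_cut_grad_bound(2)[OF x, of b] b 1 by (simp add: G0_def)
        also have "\<dots> \<le> (1 + slope_bound x) + LV * (1 + slope_bound x)" using LV0 slope_bound_nonneg[of x] by (simp add: algebra_simps)
        finally show "norm (G0 b x) \<le> (1 + LV) * (1 + slope_bound x)" by (simp add: algebra_simps)
      qed
      show "Lp_on (real n) annulus (G0 b)" by (rule Lp_on_annulusI[OF dim n mG bnd])
      show "weak_partial annulus W b (G0 b)" unfolding weak_partial_def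
      proof (intro allI impI)
        fix \<phi> :: "'a \<Rightarrow> real" assume t: "test_function annulus \<phi>"
        obtain K where K: "compact K" "\<And>x. x \<notin> K \<Longrightarrow> \<phi> x = 0" using t by (auto simp: test_function_def)
        obtain B where B: "\<And>x. \<bar>\<phi> x\<bar> \<le> B" using test_function_bounded[OF t] by blast
        obtain B' where B': "\<And>x. \<bar>partial b \<phi> x\<bar> \<le> B'"
          using compact_support_bounded[OF test_function_partial_continuous[OF t] K(1) test_function_partial_zero[OF t K]] by blast
        have m: "\<phi> \<in> borel_measurable (lebesgue_on annulus)" "partial b \<phi> \<in> borel_measurable (lebesgue_on annulus)"
          using test_function_borel[OF t] borel_measurable_continuous_onI[OF test_function_partial_continuous[OF t]]
          by (auto intro: borel_measurable_lebesgue_on_annulus)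
        have iU: "integrable (lebesgue_on annulus) (radial_ext crimp)" "integrable (lebesgue_on annulus) (radial_ext v)"
          "integrable (lebesgue_on annulus) (crimp_grad b)" "integrable (lebesgue_on annulus) (ddir V b)"
        proof -
          have n1: "1 \<le> n" using n by simp
          show 1: "integrable (lebesgue_on annulus) (radial_ext crimp)"
            using crimp_sobolev[OF dim n] n1 unfolding sphere_sobolev_into_def sphere_sobolev_def sobolev_def
            by (intro Lp_on_annulus_integrable) auto
          have "integrable (lebesgue_on annulus) (\<lambda>x. radial_ext crimp x - W x)"
            by (intro Bochner_Integration.integrable_diff 1 Lp_on_annulus_integrable[OF LpW n1])
          then show "integrable (lebesgue_on annulus) (radial_ext v)" by (simp add: W_def)
          show 2: "integrable (lebesgue_on annulus) (crimp_grad b)"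
          proof (rule Lp_on_annulus_integrable[OF _ n1], rule Lp_on_annulusI[OF dim n crimp_grad_measurable, of b 1], rule AE_I2)
            fix x :: 'a assume "x \<in> space (lebesgue_on annulus)"
            then show "norm (crimp_grad b x) \<le> 1 * (1 + slope_bound x)" using cone_cut_grad_bound(2)[of x b] b by (simp add: sp)
          qed
          have "integrable (lebesgue_on annulus) (\<lambda>x. crimp_grad b x - G0 b x)"
            by (intro Bochner_Integration.integrable_diff 2 Lp_on_annulus_integrable[OF _ n1] Lp_on_annulusI[OF dim n mG bnd])
          then show "integrable (lebesgue_on annulus) (ddir V b)" by (simp add: G0_def)
        qed
        have 1: "integral\<^sup>L (lebesgue_on annulus) (\<lambda>x. partial b \<phi> x *\<^sub>R radial_ext crimp x) = - integral\<^sup>L (lebesgue_on annulus) (\<lambda>x. \<phi> x *\<^sub>R crimp_grad b x)"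
          using crimp_weak_partial[OF dim n b] t unfolding weak_partial_def by blast
        have 2: "integral\<^sup>L (lebesgue_on annulus) (\<lambda>x. partial b \<phi> x *\<^sub>R radial_ext v x) = - integral\<^sup>L (lebesgue_on annulus) (\<lambda>x. \<phi> x *\<^sub>R ddir V b x)"
          using weak_partial_lipschitz[OF VL open_annulus b Vx] t unfolding weak_partial_def by blast
        have "integral\<^sup>L (lebesgue_on annulus) (\<lambda>x. partial b \<phi> x *\<^sub>R W x) =
           integral\<^sup>L (lebesgue_on annulus) (\<lambda>x. partial b \<phi> x *\<^sub>R radial_ext crimp x) - integral\<^sup>L (lebesgue_on annulus) (\<lambda>x. partial b \<phi> x *\<^sub>R radial_ext v x)"
          unfolding W_def scaleR_diff_right
          by (intro Bochner_Integration.integral_diff integrable_bounded_scaleR[where B=B'] iU m B')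
        also have "\<dots> = - (integral\<^sup>L (lebesgue_on annulus) (\<lambda>x. \<phi> x *\<^sub>R crimp_grad b x) - integral\<^sup>L (lebesgue_on annulus) (\<lambda>x. \<phi> x *\<^sub>R ddir V b x))"
          unfolding 1 2 by simp
        also have "integral\<^sup>L (lebesgue_on annulus) (\<lambda>x. \<phi> x *\<^sub>R crimp_grad b x) - integral\<^sup>L (lebesgue_on annulus) (\<lambda>x. \<phi> x *\<^sub>R ddir V b x)
          = integral\<^sup>L (lebesgue_on annulus) (\<lambda>x. \<phi> x *\<^sub>R G0 b x)"
          unfolding G0_def scaleR_diff_right
          by (intro Bochner_Integration.integral_diff[symmetric] integrable_bounded_scaleR[where B=B] iU m B)
        finally show "integral\<^sup>L (lebesgue_on annulus) (\<lambda>x. partial b \<phi> x *\<^sub>R W x) = - integral\<^sup>L (lebesgue_on annulus) (\<lambda>x. \<phi> x *\<^sub>R G0 b x)" .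
      qed
    qed
    \<comment> \<open>The choice made inside \<open>sobolev_norm\<close>. The explicit
      \<open>G0\<close> shows that the choice succeeds and, by uniqueness, tells what it is almost
      everywhere.\<close>
    define G where "G = (SOME G. weak_gradient (real n) annulus W G)"
    have wg: "weak_gradient (real n) annulus W G" unfolding G_def using wg0 by (rule someI[where P="weak_gradient (real n) annulus W"])
    have n1: "1 \<le> n" using n by simp
    define g where "g x = sqrt (\<Sum>b\<in>Basis. (norm (G b x))\<^sup>2)" for x
    have g0: "0 \<le> g x" for x by (simp add: g_def sum_nonneg)
    have gn: "(\<Sum>b\<in>Basis. (norm (G b x))\<^sup>2) powr (real n / 2) = g x ^ n" for x
      unfolding g_def by (rule powr_half_power[OF _ n1]) (simp add: sum_nonneg)
    have Wn: "norm (W x) powr real n = norm (W x) ^ n" for x using n1 by (intro powr_realpow') auto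
    have Gb: "norm (G b x) \<le> g x" if "b \<in> Basis" for b x
      unfolding g_def using that member_le_sum[of b Basis "\<lambda>b. (norm (G b x))\<^sup>2"] by (intro real_le_rsqrt) auto
    have mG: "G b \<in> borel_measurable (lebesgue_on annulus)" if "b \<in> Basis" for b
      using wg that by (auto simp: weak_gradient_def Lp_on_def)
    have mg: "g \<in> borel_measurable (lebesgue_on annulus)"
      unfolding g_def[abs_def] using mG
      by (intro measurable_compose[OF _ borel_measurable_continuous_onI[of sqrt]] borel_measurable_sum borel_measurable_power borel_measurable_norm continuous_intros) auto
    have iW: "integrable (lebesgue_on annulus) (\<lambda>x. norm (W x) ^ n)" using LpW by (simp add: Lp_on_def Wn)
    have ig: "integrable (lebesgue_on annulus) (\<lambda>x. g x ^ n)"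
    proof (rule Bochner_Integration.integrable_bound)
      show "integrable (lebesgue_on annulus) (\<lambda>x. real DIM('a) ^ n * (\<Sum>b\<in>Basis. norm (G b x) powr real n))"
        using wg by (intro integrable_mult_right Bochner_Integration.integrable_sum) (auto simp: weak_gradient_def Lp_on_def)
      show "(\<lambda>x. g x ^ n) \<in> borel_measurable (lebesgue_on annulus)" using mg by (rule borel_measurable_power)
      show "AE x in lebesgue_on annulus. norm (g x ^ n) \<le> norm (real DIM('a) ^ n * (\<Sum>b\<in>Basis. norm (G b x) powr real n))"
      proof (rule AE_I2)
        fix x :: 'a
        \<comment> \<open>The partial derivative of largest norm bounds \<open>g\<close> up to the
          dimension, so integrability of \<open>g x ^ n\<close> follows from that of the single
          partial derivatives.\<close>
        obtain b where b: "b \<in> Basis" "\<And>b'. b' \<in> Basis \<Longrightarrow> norm (G b' x) \<le> norm (G b x)"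
        proof -
          have "Max ((\<lambda>b. norm (G b x)) ` Basis) \<in> (\<lambda>b. norm (G b x)) ` Basis" by (intro Max_in) auto
          then obtain b where b: "Max ((\<lambda>b. norm (G b x)) ` Basis) = norm (G b x)" "b \<in> Basis" by (rule imageE)
          have "norm (G b' x) \<le> norm (G b x)" if "b' \<in> Basis" for b'
            unfolding b(1)[symmetric] using that by (intro Max_ge) auto
          then show ?thesis using b(2) that by blast
        qed
        have "(\<Sum>b\<in>Basis. (norm (G b x))\<^sup>2) \<le> (\<Sum>b'\<in>(Basis::'a set). (norm (G b x))\<^sup>2)"
          using b(2) by (intro sum_mono power_mono) auto
        also have "\<dots> \<le> (real DIM('a) * norm (G b x))\<^sup>2"
        proof -
          have "1 \<le> real DIM('a)" using DIM_positive[where 'a='a] by linarith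
          then have "real DIM('a) \<le> (real DIM('a))\<^sup>2" using self_le_power[of "real DIM('a)" 2] by simp
          then have "real DIM('a) * (norm (G b x))\<^sup>2 \<le> (real DIM('a))\<^sup>2 * (norm (G b x))\<^sup>2" by (rule mult_right_mono) simp
          then show ?thesis by (simp add: power_mult_distrib)
        qed
        finally have "g x \<le> real DIM('a) * norm (G b x)" unfolding g_def by (intro real_le_lsqrt) auto
        then have "g x ^ n \<le> (real DIM('a) * norm (G b x)) ^ n" using g0 by (intro power_mono) auto
        also have "\<dots> = real DIM('a) ^ n * norm (G b x) powr real n"
          using n1 by (simp add: power_mult_distrib powr_realpow')
        also have "\<dots> \<le> real DIM('a) ^ n * (\<Sum>b\<in>Basis. norm (G b x) powr real n)"
          using b(1) member_le_sum[of b Basis "\<lambda>b. norm (G b x) powr real n"] by (intro mult_left_mono) auto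
        finally show "norm (g x ^ n) \<le> norm (real DIM('a) ^ n * (\<Sum>b\<in>Basis. norm (G b x) powr real n))" using g0[of x] by simp
      qed
    qed
    define S where "S = integral\<^sup>L (lebesgue_on annulus) (\<lambda>x. norm (W x) ^ n) + integral\<^sup>L (lebesgue_on annulus) (\<lambda>x. g x ^ n)"
    have dist: "sphere_sobolev_dist (real n) crimp v = S powr (1 / real n)"
      unfolding sphere_sobolev_dist_def sobolev_norm_def W_def[symmetric] G_def[symmetric] Let_def gn Wn S_def by simp
    show "sphere_sobolev_dist (real n) crimp v \<ge> \<epsilon>"
    proof (rule ccontr)
      assume "\<not> ?thesis"
      then have lt: "S powr (1 / real n) < \<epsilon>" by (simp add: dist)
      have Sn: "S < \<epsilon> ^ n"
      proof (rule ccontr)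
        assume "\<not> S < \<epsilon> ^ n"
        then have "(\<epsilon> ^ n) powr (1 / real n) \<le> S powr (1 / real n)" using \<epsilon> by (intro powr_mono2) auto
        moreover have "(\<epsilon> ^ n) powr (1 / real n) = \<epsilon>"
          using \<epsilon> n1 by (simp add: powr_realpow[symmetric] powr_powr)
        ultimately show False using lt by simp
      qed
      define f2 where "f2 x = indicator annulus x * (eta (v (sgn x)) * polar_det x (\<lambda>b. ddir V b x))" for x
      have f2b: "f2 \<in> borel_measurable borel" using degree_integrand_borel[OF L] by (simp add: f2_def[abs_def] V_def)
      have f2z: "integral\<^sup>L lborel f2 = 0" using degree_zero[OF dim n L im] by (simp add: f2_def[abs_def] V_def)
      define R where "R x = C * (2 * \<epsilon> + (norm (W x) ^ n + g x ^ n) / \<epsilon> ^ (n - 1) + g x ^ n)" for x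
      have iR: "integrable (lebesgue_on annulus) R" unfolding R_def[abs_def]
        by (intro integrable_mult_right Bochner_Integration.integrable_add integrable_divide integrable_annulus_const iW ig)
      have AEG: "AE x in lebesgue_on annulus. \<forall>b\<in>Basis. G b x = G0 b x"
        using weak_gradient_unique[OF wg wg0 n1] by (intro AE_ball_countable[THEN iffD2]) (auto intro: countable_finite)
      have bound: "AE x in lebesgue_on annulus. \<bar>crimp_integrand n x - f2 x\<bar> \<le> R x"
        using AEG AE_space
      proof eventually_elim
        fix x :: 'a assume Geq: "\<forall>b\<in>Basis. G b x = G0 b x" and "x \<in> space (lebesgue_on annulus)"
        then have x: "x \<in> annulus" by (simp add: sp)
        let ?J1 = "polar_det x (\<lambda>b. crimp_grad b x)" and ?J2 = "polar_det x (\<lambda>b. ddir V b x)"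
        let ?u = "crimp (sgn x)" and ?v = "v (sgn x)"
        have J1: "?J1 = (sgn x \<bullet> e) / norm x ^ n"
          unfolding polar_det_crimp_grad by (rule polar_det_sgn_deriv[OF dim annulus_nonzero[OF x]])
        have J1b: "\<bar>?J1\<bar> \<le> 1" unfolding J1 by (rule abs_polar_factor_le[OF x])
        have Wx: "W x = ?u - ?v" by (simp add: W_def radial_ext_sgn)
        \<comment> \<open>The first term is controlled by the difference of the values, the second
          by that of the gradients; the remaining factors are at most 1 in absolute value.\<close>
        have "crimp_integrand n x - f2 x = (eta ?u - eta ?v) * ?J1 + eta ?v * (?J1 - ?J2)"
          using x J1 by (simp add: crimp_integrand_def f2_def algebra_simps)
        then have "\<bar>crimp_integrand n x - f2 x\<bar> \<le> \<bar>eta ?u - eta ?v\<bar> * \<bar>?J1\<bar> + \<bar>eta ?v\<bar> * \<bar>?J1 - ?J2\<bar>"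
          by (metis abs_mult abs_triangle_ineq)
        also have "\<dots> \<le> (4 * DIM('a) * norm (W x)) * 1 + 1 * (fact (Suc n) * (n * (2 ^ (n - 1) * (g x + g x ^ n))))"
        proof (intro add_mono mult_mono)
          show "\<bar>eta ?u - eta ?v\<bar> \<le> 4 * DIM('a) * norm (W x)" unfolding Wx by (rule eta_lipschitz)
          show "\<bar>?J1 - ?J2\<bar> \<le> fact (Suc n) * (n * (2 ^ (n - 1) * (g x + g x ^ n)))"
            using Geq Gb[of _ x] by (intro polar_det_difference_bound[OF dim n x g0]) (auto simp: G0_def)
        qed (use J1b eta_bounds[of ?v] in auto)
        also have "\<dots> \<le> C * (norm (W x) + (g x + g x ^ n))"
        proof -
          have "(4 * DIM('a) * norm (W x)) * 1 \<le> C * norm (W x)"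
            by (simp add: C_def mult_right_mono)
          moreover have "1 * (fact (Suc n) * (n * (2 ^ (n - 1) * (g x + g x ^ n)))) \<le> C * (g x + g x ^ n)"
          proof -
            have "fact (Suc n) * (real n * 2 ^ (n - 1)) * (g x + g x ^ n) \<le> C * (g x + g x ^ n)"
              using g0[of x] by (intro mult_right_mono) (auto simp: C_def algebra_simps)
            then show ?thesis by (simp only: mult.assoc mult_1)
          qed
          ultimately show ?thesis by (simp only: distrib_left)
        qed
        also have "\<dots> \<le> R x" unfolding R_def
        proof (intro mult_left_mono)
          have "norm (W x) \<le> \<epsilon> + norm (W x) ^ n / \<epsilon> ^ (n - 1)" by (rule young_power) (use \<epsilon> n1 in auto)
          moreover have "g x \<le> \<epsilon> + g x ^ n / \<epsilon> ^ (n - 1)" by (rule young_power) (use \<epsilon> n1 g0 in auto)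
          ultimately show "norm (W x) + (g x + g x ^ n) \<le> 2 * \<epsilon> + (norm (W x) ^ n + g x ^ n) / \<epsilon> ^ (n - 1) + g x ^ n"
            by (simp add: add_divide_distrib)
        qed (use C0 in simp)
        finally show "\<bar>crimp_integrand n x - f2 x\<bar> \<le> R x" .
      qed
      have ms: "annulus \<in> sets (borel :: 'a measure)" using open_annulus by (rule borel_open)
      have db: "(\<lambda>x. crimp_integrand n x - f2 x) \<in> borel_measurable borel" using crimp_integrand_borel f2b by (intro borel_measurable_diff)
      have d0: "crimp_integrand n x - f2 x = 0" if "x \<notin> annulus" for x using that by (simp add: crimp_integrand_def f2_def)
      have idm: "(\<lambda>x. crimp_integrand n x - f2 x) \<in> borel_measurable (lebesgue_on annulus)" by (rule borel_measurable_lebesgue_on_annulus[OF db])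
      have idiff: "integrable (lebesgue_on annulus) (\<lambda>x. crimp_integrand n x - f2 x)"
        by (rule Bochner_Integration.integrable_bound[OF iR idm])
           (use bound in \<open>auto elim!: eventually_mono intro: order_trans[OF _ abs_ge_self]\<close>)
      have "integrable lborel (\<lambda>x. crimp_integrand n x - f2 x)"
      proof -
        have "integrable lebesgue (\<lambda>x. indicator annulus x *\<^sub>R (crimp_integrand n x - f2 x))"
          using idiff ms by (subst (asm) integrable_restrict_space) auto
        moreover have "(\<lambda>x. indicator annulus x *\<^sub>R (crimp_integrand n x - f2 x)) = (\<lambda>x. crimp_integrand n x - f2 x)"
          using d0 by (intro ext) (simp split: split_indicator)
        ultimately show ?thesis using db by (simp add: integrable_completion)
      qed
      then have "integrable lborel (\<lambda>x. crimp_integrand n x - (crimp_integrand n x - f2 x))"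
        by (rule Bochner_Integration.integrable_diff[OF crimp_integrand_integrable])
      then have if2: "integrable lborel f2" by simp
      have "- cU = integral\<^sup>L lborel (\<lambda>x. crimp_integrand n x - f2 x)"
        using crimp_integrand_integrable if2 f2z by (simp add: cU_def)
      also have "\<dots> = integral\<^sup>L (lebesgue_on annulus) (\<lambda>x. crimp_integrand n x - f2 x)"
        using integral_lebesgue_on_eq_lborel[OF ms db d0] by simp
      finally have "cU \<le> \<bar>integral\<^sup>L (lebesgue_on annulus) (\<lambda>x. crimp_integrand n x - f2 x)\<bar>" by simp
      also have "\<dots> \<le> integral\<^sup>L (lebesgue_on annulus) (\<lambda>x. \<bar>crimp_integrand n x - f2 x\<bar>)" by (rule integral_abs_bound)
      also have "\<dots> \<le> integral\<^sup>L (lebesgue_on annulus) R"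
        using idiff iR bound by (intro integral_mono_AE) auto
      also have "\<dots> = C * (2 * \<epsilon> * A + S / \<epsilon> ^ (n - 1) + integral\<^sup>L (lebesgue_on annulus) (\<lambda>x. g x ^ n))"
      proof -
        have "integral\<^sup>L (lebesgue_on (annulus::'a set)) (\<lambda>x. 2 * \<epsilon>) = 2 * \<epsilon> * A"
          unfolding A_def integral_mult_right_zero[symmetric] by simp
        moreover have "integral\<^sup>L (lebesgue_on annulus) (\<lambda>x. (norm (W x) ^ n + g x ^ n) / \<epsilon> ^ (n - 1)) = S / \<epsilon> ^ (n - 1)"
          using iW ig by (simp add: S_def)
        moreover have "integral\<^sup>L (lebesgue_on annulus) R = C * (integral\<^sup>L (lebesgue_on (annulus::'a set)) (\<lambda>x. 2 * \<epsilon>) +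
           integral\<^sup>L (lebesgue_on annulus) (\<lambda>x. (norm (W x) ^ n + g x ^ n) / \<epsilon> ^ (n - 1)) + integral\<^sup>L (lebesgue_on annulus) (\<lambda>x. g x ^ n))"
        proof -
          have iq: "integrable (lebesgue_on annulus) (\<lambda>x. (norm (W x) ^ n + g x ^ n) / \<epsilon> ^ (n - 1))"
            by (intro integrable_divide Bochner_Integration.integrable_add iW ig)
          have ic: "integrable (lebesgue_on (annulus::'a set)) (\<lambda>x. 2 * \<epsilon>)" by (rule integrable_annulus_const)
          show ?thesis
            unfolding R_def[abs_def] integral_mult_right_zero
              Bochner_Integration.integral_add[OF Bochner_Integration.integrable_add[OF ic iq] ig]
              Bochner_Integration.integral_add[OF ic iq] ..
        qed
        ultimately show ?thesis by (simp only:)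
      qed
      \<comment> \<open>Both terms follow from \<open>S < \<epsilon> ^ n\<close>: one by division by
        \<open>\<epsilon> ^ (n - 1)\<close>, the other by \<open>\<epsilon> \<le> 1\<close>.\<close>
      also have "\<dots> \<le> C * (2 * \<epsilon> * A + \<epsilon> + \<epsilon>)"
      proof -
        have "integral\<^sup>L (lebesgue_on annulus) (\<lambda>x. g x ^ n) \<le> S"
          unfolding S_def using integral_nonneg_AE[where M="lebesgue_on annulus" and f="\<lambda>x. norm (W x) ^ n"] by simp
        also have "S \<le> \<epsilon> ^ n" using Sn by simp
        also have "\<epsilon> ^ n \<le> \<epsilon> ^ 1" using \<epsilon> n1 by (intro power_decreasing) auto
        finally have 1: "integral\<^sup>L (lebesgue_on annulus) (\<lambda>x. g x ^ n) \<le> \<epsilon>" by simp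
        have "S / \<epsilon> ^ (n - 1) \<le> \<epsilon> ^ n / \<epsilon> ^ (n - 1)" using Sn \<epsilon> by (intro divide_right_mono) auto
        also have "\<dots> = \<epsilon>" using \<epsilon> n1 by (cases n) auto
        finally have 2: "S / \<epsilon> ^ (n - 1) \<le> \<epsilon>" .
        show ?thesis using 1 2 C0 by (intro mult_left_mono) auto
      qed
      also have "\<dots> = C * (2 * A + 2) * \<epsilon>" by (simp add: algebra_simps)
      finally show False using \<epsilon>c by simp
    qed
  qed
qed

end

theorem theorem1p12:
  fixes n :: nat
  assumes "n \<ge> 2" and "DIM('a::euclidean_space) = Suc n"
  shows "\<exists>Z :: 'a set. compact Z \<and> lip_pi0_trivial Z \<and> (\<forall>k\<ge>1. lip_pik_trivial k Z) \<and>
     (\<exists>u. sphere_sobolev_into (real n) Z u \<and>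
        (\<exists>\<epsilon>>0. \<forall>v. (\<exists>L. L-lipschitz_on (sphere 0 1) v) \<and> v ` sphere 0 1 \<subseteq> Z \<longrightarrow>
           sphere_sobolev_dist (real n) u v \<ge> \<epsilon>))"
proof -
  obtain e :: 'a where "e \<in> Basis" using nonempty_Basis by blast
  then interpret whiskered e by unfold_locales
  show ?thesis
    using compact_Z pi0_Z pik_Z crimp_sobolev[OF assms(2,1)] sobolev_distance_bounded_below[OF assms(2,1)] by blast
qed

end
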